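(* Let $X$ be a linear diffusion on $I=(\ell,+\infty[$ as described in the context, and let $f:[0,+\infty[\to[\ell,+\infty[$ be a continuous function, of class $\mathcal{C}^1$ on $]0,+\infty[$, with $\zeta(f):=\inf\{t\ge 0: f(t)=\ell\}\in\,]0,+\infty]$. If $\zeta(f)=+\infty$, suppose that for all $x\in I$, $\mathbb{P}_x\left(\lim_{t\to\zeta(f)}(X_t-f(t))>0\right)=1$. Let $H$ be the function $H(t,y)=\mathbb{P}_y(T_{f\circ\theta_t}=+\infty)$. Assume that $H$ is of class $\mathcal{C}^{1,2}$ on $]0,\zeta(f)[\times]\ell,+\infty[$ and is such that, for every $x\in\,]\ell,+\infty[$ and $t>0$, $$\lim_{y\to+\infty}\frac{1}{s'(y)}\frac{\partial H(t,y)}{\partial y}\,q(t,x,y)=0.$$ Then the density of the random variable $G_f$ under $\mathbb{P}_x$ is given by $$\mathbb{P}_x(G_f\in dt)=\frac{q(t,x,f(t))}{s'(f(t))}\,\frac{\partial H(t,y)}{\partial y}\Big|_{y=f(t)}\,dt\qquad(0<t<\zeta(f)).$$ For $x>f(0)$, this density is defective.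
   Context: Setting: $\ell\in[-\infty,+\infty[$, and $(X_t,t\ge 0)$ is a linear regular conservative (infinite life-time) diffusion with values in $I=(\ell,+\infty[$ (no assumption is made on the nature of the boundary point $\ell$), with $+\infty$ a natural boundary, defined on canonical path space; $\mathbb{P}_x$ is its law started from $x$. Its speed measure is $m(dx)=\rho(x)dx$ (absolutely continuous), its scale function $s$ is of class $\mathcal{C}^2$, and its generator is $\mathcal{G}=\frac{1}{\rho(x)}\frac{\partial}{\partial x}\left(\frac{1}{s'(x)}\frac{\partial}{\partial x}\right)$. $X$ has a transition density $q(t,x,y)$ with respect to $m$, jointly continuous, symmetric in $(x,y)$, assumed of class $\mathcal{C}^{1,2,2}$ on $]0,+\infty[\times I\times I$; in particular, $\mathcal{G}q=\partial q/\partial t$ in the variables $(t,x)$ on $]0,+\infty[\times]\ell,+\infty[$. Last passage time: $G_f:=\sup\{0\le t\le\zeta(f): X_t=f(t)\}$, with $G_f=0$ if this set is empty. First passage time: for a function $g$, $T_g:=\inf\{t\ge 0: X_t=g(t)\}$, with $T_g=+\infty$ if this set is empty. Shift: $(f\circ\theta_t)(u)=f(t+u)$ for $u\ge 0$.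
   Formalization: In H, the first passage time of f∘θ_t counts only meetings up to the lifetime of the shifted curve, as in G_f; with meetings after ζ(f) counted the claim fails (3-dim. Bessel, ℓ=0, f(t)=(1−t)²). Nothing changes if ζ(f)=+∞ or f stays at ℓ after ζ(f). *)

theory Defs
  imports "HOL-Probability.Probability"
begin

section \<open>Smoothness classes\<close>

definition C1_on :: "real set \<Rightarrow> (real \<Rightarrow> real) \<Rightarrow> bool" where
  "C1_on D g \<longleftrightarrow> (\<forall>x\<in>D. g field_differentiable at x) \<and> continuous_on D (deriv g)"

definition C2_on :: "real set \<Rightarrow> (real \<Rightarrow> real) \<Rightarrow> bool" where
  "C2_on D g \<longleftrightarrow> (\<forall>x\<in>D. g field_differentiable at x) \<and> C1_on D (deriv g)"

text \<open>
  Derivatives are taken along the sections of \<open>D\<close>. For open \<open>D\<close> this is the usual class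
  \<open>C\<^sup>1\<^sup>,\<^sup>2\<close>; if \<open>D\<close> contains part of its boundary, the derivatives there are one-sided and
  extend the interior ones continuously.
\<close>
definition C12_on :: "(real \<times> real) set \<Rightarrow> (real \<Rightarrow> real \<Rightarrow> real) \<Rightarrow> bool" where
  "C12_on D h \<longleftrightarrow> (\<exists>ht hy hyy.
     continuous_on D (\<lambda>(t, y). h t y) \<and>
     continuous_on D (\<lambda>(t, y). ht t y) \<and>
     continuous_on D (\<lambda>(t, y). hy t y) \<and>
     continuous_on D (\<lambda>(t, y). hyy t y) \<and>
     (\<forall>(t, y)\<in>D.
        ((\<lambda>r. h r y) has_real_derivative ht t y) (at t within {r. (r, y) \<in> D}) \<and>
        ((\<lambda>z. h t z) has_real_derivative hy t y) (at y within {z. (t, z) \<in> D}) \<and>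
        ((\<lambda>z. hy t z) has_real_derivative hyy t y) (at y within {z. (t, z) \<in> D})))"

lemma C12_on_subset:
  assumes "C12_on D h" and "D' \<subseteq> D"
  shows "C12_on D' h"
proof -
  from assms(1) obtain ht hy hyy where
    c: "continuous_on D (\<lambda>(t, y). h t y)" "continuous_on D (\<lambda>(t, y). ht t y)"
       "continuous_on D (\<lambda>(t, y). hy t y)" "continuous_on D (\<lambda>(t, y). hyy t y)"
    and d: "\<And>t y. (t, y) \<in> D \<Longrightarrow>
        ((\<lambda>r. h r y) has_real_derivative ht t y) (at t within {r. (r, y) \<in> D}) \<and>
        ((\<lambda>z. h t z) has_real_derivative hy t y) (at y within {z. (t, z) \<in> D}) \<and>
        ((\<lambda>z. hy t z) has_real_derivative hyy t y) (at y within {z. (t, z) \<in> D})"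
    unfolding C12_on_def by blast
  have s: "{r. (r, y) \<in> D'} \<subseteq> {r. (r, y) \<in> D}" "{z. (t, z) \<in> D'} \<subseteq> {z. (t, z) \<in> D}" for t y
    using assms(2) by auto
  have d': "((\<lambda>r. h r y) has_real_derivative ht t y) (at t within {r. (r, y) \<in> D'}) \<and>
        ((\<lambda>z. h t z) has_real_derivative hy t y) (at y within {z. (t, z) \<in> D'}) \<and>
        ((\<lambda>z. hy t z) has_real_derivative hyy t y) (at y within {z. (t, z) \<in> D'})"
    if "(t, y) \<in> D'" for t y
    using d[of t y] that assms(2) s by (blast intro: DERIV_subset)
  show ?thesis
    unfolding C12_on_def
    using c[THEN continuous_on_subset, OF assms(2)] d' by blast
qed

text \<open>Only the pure partial derivatives are required; mixed ones are not.\<close>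
definition C122_on :: "real set \<Rightarrow> real set \<Rightarrow> (real \<Rightarrow> real \<Rightarrow> real \<Rightarrow> real) \<Rightarrow> bool" where
  "C122_on T I q \<longleftrightarrow>
     (\<forall>t\<in>T. \<forall>x\<in>I. \<forall>y\<in>I.
        (\<lambda>r. q r x y) field_differentiable at t \<and>
        (\<lambda>z. q t z y) field_differentiable at x \<and>
        deriv (\<lambda>z. q t z y) field_differentiable at x \<and>
        (\<lambda>z. q t x z) field_differentiable at y \<and>
        deriv (\<lambda>z. q t x z) field_differentiable at y) \<and>
     continuous_on (T \<times> I \<times> I) (\<lambda>(t, x, y). q t x y) \<and>
     continuous_on (T \<times> I \<times> I) (\<lambda>(t, x, y). deriv (\<lambda>r. q r x y) t) \<and>
     continuous_on (T \<times> I \<times> I) (\<lambda>(t, x, y). deriv (\<lambda>z. q t z y) x) \<and>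
     continuous_on (T \<times> I \<times> I) (\<lambda>(t, x, y). deriv (deriv (\<lambda>z. q t z y)) x) \<and>
     continuous_on (T \<times> I \<times> I) (\<lambda>(t, x, y). deriv (\<lambda>z. q t x z) y) \<and>
     continuous_on (T \<times> I \<times> I) (\<lambda>(t, x, y). deriv (deriv (\<lambda>z. q t x z)) y)"

section \<open>Canonical path space and passage times\<close>

definition path_space :: "real set \<Rightarrow> (real \<Rightarrow> real) measure" where
  "path_space E = restrict_space (\<Pi>\<^sub>M t\<in>{0..}. borel)
     {\<omega>. continuous_on {0..} \<omega> \<and> (\<forall>t\<ge>0. \<omega> t \<in> E)}"

definition path_filtration :: "real set \<Rightarrow> real \<Rightarrow> (real \<Rightarrow> real) measure" where
  "path_filtration E t = sigma (space (path_space E))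
     {{\<omega> \<in> space (path_space E). \<omega> u \<in> B} | u B. 0 \<le> u \<and> u \<le> t \<and> B \<in> sets borel}"

definition path_shift :: "real \<Rightarrow> (real \<Rightarrow> real) \<Rightarrow> (real \<Rightarrow> real)" where
  "path_shift t \<omega> = restrict (\<lambda>u. \<omega> (t + u)) {0..}"

text \<open>
  Random times take values in \<open>ennreal\<close>, where \<open>Inf {} = \<infinity>\<close> and \<open>Sup {} = 0\<close>.
\<close>
definition hitting_time :: "real \<Rightarrow> (real \<Rightarrow> real) \<Rightarrow> ennreal" where
  "hitting_time y \<omega> = Inf (ennreal ` {t. 0 \<le> t \<and> \<omega> t = y})"

definition curve_lifetime :: "ereal \<Rightarrow> (real \<Rightarrow> ereal) \<Rightarrow> ennreal" where
  "curve_lifetime l f = Inf (ennreal ` {t. 0 \<le> t \<and> f t = l})"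

text \<open>
  A curve is only followed up to its lifetime, in \<open>first_passage\<close> as well as in
  \<open>last_passage\<close>. For curves of infinite lifetime, and for paths that avoid \<open>l\<close> and curves
  that stay at \<open>l\<close> once they have reached it, \<open>first_passage\<close> is the infimum over all \<open>t \<ge> 0\<close>.
  In general, without this restriction \<open>first_passage\<close> would depend on values of the curve
  after its lifetime, which \<open>last_passage\<close> ignores.
\<close>
definition first_passage :: "ereal \<Rightarrow> (real \<Rightarrow> ereal) \<Rightarrow> (real \<Rightarrow> real) \<Rightarrow> ennreal" where
  "first_passage l g \<omega> =
     Inf (ennreal ` {t. 0 \<le> t \<and> ennreal t \<le> curve_lifetime l g \<and> ereal (\<omega> t) = g t})"

definition last_passage :: "ereal \<Rightarrow> (real \<Rightarrow> ereal) \<Rightarrow> (real \<Rightarrow> real) \<Rightarrow> ennreal" where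
  "last_passage l f \<omega> =
     Sup (ennreal ` {t. 0 \<le> t \<and> ennreal t \<le> curve_lifetime l f \<and> ereal (\<omega> t) = f t})"

definition curve_shift :: "real \<Rightarrow> (real \<Rightarrow> ereal) \<Rightarrow> (real \<Rightarrow> ereal)" where
  "curve_shift t f = (\<lambda>u. f (t + u))"

lemma first_passage_infinite_lifetime:
  assumes "\<forall>t\<ge>0. g t \<noteq> l"
  shows "first_passage l g \<omega> = Inf (ennreal ` {t. 0 \<le> t \<and> ereal (\<omega> t) = g t})"
proof -
  have "{t. 0 \<le> t \<and> g t = l} = {}" using assms by auto
  then have "curve_lifetime l g = top" by (simp only: curve_lifetime_def image_empty Inf_empty)
  then show ?thesis by (simp add: first_passage_def)
qed

section \<open>Linear diffusions\<close>

text \<open>\<open>1/\<rho> d/dx (1/s' du/dx)\<close>\<close>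
definition diffusion_generator ::
  "(real \<Rightarrow> real) \<Rightarrow> (real \<Rightarrow> real) \<Rightarrow> (real \<Rightarrow> real) \<Rightarrow> real \<Rightarrow> real" where
  "diffusion_generator s \<rho> u x = deriv (\<lambda>z. deriv u z / deriv s z) x / \<rho> x"

text \<open>
  Green function of \<open>]a,b[\<close> with respect to the speed measure, normalised so that the generator
  is \<open>d/dm d/ds\<close> without factor \<open>1/2\<close> (Brownian motion: \<open>s(x) = x\<close>, \<open>m(dx) = 2 dx\<close>).
\<close>
definition green_function :: "(real \<Rightarrow> real) \<Rightarrow> real \<Rightarrow> real \<Rightarrow> real \<Rightarrow> real \<Rightarrow> real" where
  "green_function s a b x y =
     (s (min x y) - s a) * (s b - s (max x y)) / (s b - s a)"

text \<open>
  The state space \<open>E\<close> is \<open>I = ]l,\<infinity>[\<close>, possibly with the left end point \<open>l\<close> added, so that \<open>l\<close> may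
  be inaccessible or, for instance, a reflecting boundary. Infinite lifetime is built into the path
  space. The stopping times in the strong Markov property are those of the right-continuous
  filtration, characterised by the events \<open>{\<tau> < t}\<close>.
\<close>
locale linear_diffusion =
  fixes l :: ereal
    and E :: "real set"
    and P :: "real \<Rightarrow> (real \<Rightarrow> real) measure"
    and s \<rho> :: "real \<Rightarrow> real"
    and q :: "real \<Rightarrow> real \<Rightarrow> real \<Rightarrow> real"
  assumes left_end: "l < \<infinity>"
    and state_space: "{x. l < ereal x} \<subseteq> E" "E \<subseteq> {x. l \<le> ereal x}"
    and kernel: "P \<in> restrict_space borel E \<rightarrow>\<^sub>M prob_algebra (path_space E)"
    and start: "x \<in> E \<Longrightarrow> AE \<omega> in P x. \<omega> 0 = x"
    and strong_markov:
      "\<lbrakk>x \<in> E;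
        \<tau> \<in> borel_measurable (path_space E);
        \<And>t. 0 \<le> t \<Longrightarrow> {\<omega> \<in> space (path_space E). \<tau> \<omega> < ennreal t} \<in> sets (path_filtration E t);
        A \<in> sets (path_space E);
        \<And>t. 0 \<le> t \<Longrightarrow> {\<omega> \<in> A. \<tau> \<omega> < ennreal t} \<in> sets (path_filtration E t);
        B \<in> sets (path_space E)\<rbrakk> \<Longrightarrow>
       emeasure (P x) {\<omega> \<in> A. \<tau> \<omega> < \<infinity> \<and> path_shift (enn2real (\<tau> \<omega>)) \<omega> \<in> B} =
       (\<integral>\<^sup>+\<omega>\<in>{\<omega> \<in> A. \<tau> \<omega> < \<infinity>}. emeasure (P (\<omega> (enn2real (\<tau> \<omega>)))) B \<partial>P x)"
    and regular:
      "\<lbrakk>l < ereal x; l < ereal y\<rbrakk> \<Longrightarrow>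
       0 < emeasure (P x) {\<omega> \<in> space (P x). hitting_time y \<omega> < \<infinity>}"
    and scale_C2: "C2_on {x. l < ereal x} s"
    and scale_deriv_pos: "l < ereal x \<Longrightarrow> 0 < deriv s x"
    and scale:
      "\<lbrakk>l < ereal a; a < x; x < b\<rbrakk> \<Longrightarrow>
       measure (P x) {\<omega> \<in> space (P x). hitting_time b \<omega> < hitting_time a \<omega>} =
       (s x - s a) / (s b - s a)"
    and speed_density_pos: "l < ereal x \<Longrightarrow> 0 < \<rho> x"
    and speed_density_integrable: "l < ereal a \<Longrightarrow> set_integrable lborel {a..b} \<rho>"
    and speed:
      "\<lbrakk>l < ereal a; a < x; x < b\<rbrakk> \<Longrightarrow>
       (\<integral>\<^sup>+\<omega>. min (hitting_time a \<omega>) (hitting_time b \<omega>) \<partial>P x) =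
       (\<integral>\<^sup>+y\<in>{a<..<b}. ennreal (green_function s a b x y * \<rho> y) \<partial>lborel)"
    and right_end_not_exit:
      "l < ereal c \<Longrightarrow>
       (\<integral>\<^sup>+z\<in>{c..}. (\<integral>\<^sup>+y\<in>{c..z}. ennreal (\<rho> y) \<partial>lborel) * ennreal (deriv s z) \<partial>lborel) = \<infinity>"
    and right_end_not_entrance:
      "l < ereal c \<Longrightarrow> (\<integral>\<^sup>+z\<in>{c..}. ennreal ((s z - s c) * \<rho> z) \<partial>lborel) = \<infinity>"
    and transition_density:
      "\<lbrakk>l < ereal x; 0 < t\<rbrakk> \<Longrightarrow>
       distr (P x) borel (\<lambda>\<omega>. \<omega> t) =
       density lborel (\<lambda>y. ennreal (if l < ereal y then q t x y * \<rho> y else 0))"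
    and transition_density_nonneg: "\<lbrakk>0 < t; l < ereal x; l < ereal y\<rbrakk> \<Longrightarrow> 0 \<le> q t x y"
    and transition_density_symmetric:
      "\<lbrakk>0 < t; l < ereal x; l < ereal y\<rbrakk> \<Longrightarrow> q t x y = q t y x"
    and transition_density_C122: "C122_on {0<..} {x. l < ereal x} q"
    and kolmogorov_backward:
      "\<lbrakk>0 < t; l < ereal x; l < ereal y\<rbrakk> \<Longrightarrow>
       diffusion_generator s \<rho> (\<lambda>z. q t z y) x = deriv (\<lambda>r. q r x y) t"

definition no_hit_prob ::
  "ereal \<Rightarrow> (real \<Rightarrow> (real \<Rightarrow> real) measure) \<Rightarrow> (real \<Rightarrow> ereal) \<Rightarrow> real \<Rightarrow> real \<Rightarrow> real" where
  "no_hit_prob l P f t y =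
     measure (P y) {\<omega> \<in> space (P y). first_passage l (curve_shift t f) \<omega> = \<infinity>}"

text \<open>
  The region on and above the curve. A path started from \<open>y < f t\<close> has to cross the curve, so
  \<open>no_hit_prob l P f t\<close> vanishes below \<open>f t\<close> and has in general a kink at \<open>f t\<close>: its smoothness,
  and its derivative at \<open>f t\<close>, are meant from above.
\<close>
definition above_curve :: "ereal \<Rightarrow> (real \<Rightarrow> ereal) \<Rightarrow> (real \<times> real) set" where
  "above_curve l f =
     {(t, y). 0 < t \<and> ennreal t < curve_lifetime l f \<and> l < ereal y \<and> f t \<le> ereal y}"

definition right_deriv :: "(real \<Rightarrow> real) \<Rightarrow> real \<Rightarrow> real" where
  "right_deriv g y = vector_derivative g (at_right y)"

lemma right_deriv_eq_deriv:
  fixes g :: "real \<Rightarrow> real"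
  assumes "g field_differentiable at y"
  shows "right_deriv g y = deriv g y"
proof -
  have "(g has_vector_derivative deriv g y) (at y)"
    using assms DERIV_deriv_iff_field_differentiable has_real_derivative_iff_has_vector_derivative
    by blast
  then have "(g has_vector_derivative deriv g y) (at_right y)"
    by (rule has_vector_derivative_at_within)
  then show ?thesis
    unfolding right_deriv_def
    by (intro vector_derivative_within) auto
qed

definition last_passage_density ::
  "ereal \<Rightarrow> (real \<Rightarrow> (real \<Rightarrow> real) measure) \<Rightarrow> (real \<Rightarrow> real) \<Rightarrow> (real \<Rightarrow> real \<Rightarrow> real \<Rightarrow> real) \<Rightarrow>
   (real \<Rightarrow> ereal) \<Rightarrow> real \<Rightarrow> real \<Rightarrow> real" where
  "last_passage_density l P s q f x t =
     (let y = real_of_ereal (f t) in q t x y / deriv s y * right_deriv (no_hit_prob l P f t) y)"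

end

theory Submission
  imports Defs
begin

text \<open>
  For \<open>t < \<zeta>(f)\<close> the event \<open>{G\<^sub>f < t}\<close> says that the path avoids the curve from time \<open>t\<close> on, so
  \<open>P\<^sub>x(G\<^sub>f < t) = E\<^sub>x H(t, X\<^sub>t)\<close> by the Markov property, and the right-hand side has to be differentiated.
  The diffusion leaves a neighbourhood of its position before time \<open>h\<close> with probability \<open>O(h\<^sup>2)\<close>. This
  localises the generator; in particular \<open>\<partial>H/\<partial>t + GH = 0\<close> above the curve.

  Split the expectation by a smooth cutoff between two levels \<open>K\<close> and \<open>K + 1\<close> above the curve. The part
  below the cutoff is an integral against \<open>q\<close>; integration by parts shows that its derivative is the
  claimed density minus a flux through \<open>[K, K + 1]\<close>. As \<open>H\<close> has a kink on the curve, this is done for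
  \<open>\<chi>(H)\<close> with \<open>C\<^sup>1\<close> functions \<open>\<chi>\<close> that vanish near \<open>0\<close> and tend to the identity. The part above the
  cutoff changes exactly at the rate of the flux, by the local generator estimate, which is uniform in
  the starting point.

  If the density had total mass \<open>1\<close>, then \<open>H(0, x) = 0\<close>. The diffusion leaves \<open>]y - \<eta>, y + \<eta>[\<close> through
  either end before a time \<open>C\<eta>\<^sup>2\<close> with positive probability, so zeros of \<open>H\<close> above the curve spread
  vertically and forward in time. Then \<open>P\<^sub>x(G\<^sub>f < t) = 0\<close> for all \<open>t < \<zeta>(f)\<close>, a contradiction.
\<close>

section \<open>Path space and the Markov property\<close>

text \<open>The available data are scale, speed and a transition density that is smooth on compact
  sets; there is no semigroup domain, no stochastic integral and no bound on \<open>q\<close> or on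
  the derivatives of \<open>H\<close> near infinity. This is why the mass far above the curve is not
  treated as an integral against \<open>q\<close>. Its change over a time step \<open>h\<close> is
  estimated path by path, with an error of at most \<open>\<epsilon> * h\<close> for all starting
  points at once, so that the estimate can be averaged over the law at time \<open>t\<close>, and
  the \<open>(b - a) / h\<close> errors add up to at most \<open>\<epsilon> * (b - a)\<close>. An
  event of probability \<open>O(h\<^sup>2)\<close> disappears in such a sum. The boundary point
  \<open>l\<close> never enters an integral: along almost every path \<open>H\<close> is zero below
  the curve, so a level \<open>L\<close> strictly between \<open>l\<close> and the curve can serve
  as lower limit. The flux is computed from both sides of the cutoff and cancels. What remains is
  the boundary term of an integration by parts at the curve, where \<open>H\<close> is zero but its
  derivative from above need not be.\<close>

lemma zero_iff_small_on_rationals: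
  fixes w :: "real \<Rightarrow> real"
  assumes "continuous_on {a..b} w" "a \<le> b"
  shows "(\<exists>u\<in>{a..b}. w u = 0) \<longleftrightarrow>
    (\<forall>n::nat. \<exists>r\<in>(\<lambda>r. a + (b - a) * r) ` (\<rat> \<inter> {0..1}). \<bar>w r\<bar> < 1 / Suc n)"
proof
  assume "\<exists>u\<in>{a..b}. w u = 0"
  then obtain u where u: "a \<le> u" "u \<le> b" "w u = 0" by auto
  show "\<forall>n::nat. \<exists>r\<in>(\<lambda>r. a + (b - a) * r) ` (\<rat> \<inter> {0..1}). \<bar>w r\<bar> < 1 / Suc n"
  proof
    fix n :: nat
    show "\<exists>r\<in>(\<lambda>r. a + (b - a) * r) ` (\<rat> \<inter> {0..1}). \<bar>w r\<bar> < 1 / Suc n"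
    proof (cases "a = b")
      case True
      then show ?thesis using u by (intro bexI[of _ a] image_eqI[of _ _ 0]) auto
    next
      case False
      with assms have ab: "a < b" by simp
      obtain d where d: "d > 0" "\<And>v. v \<in> {a..b} \<Longrightarrow> dist v u < d \<Longrightarrow> dist (w v) (w u) < 1 / Suc n"
        using assms(1)[unfolded continuous_on_iff] u
        by (metis atLeastAtMost_iff of_nat_0_less_iff zero_less_Suc zero_less_divide_1_iff)
      \<comment> \<open>The grid is the affine image of the rationals of \<open>[0, 1]\<close>, so
        the rational is sought in the rescaled part of the \<open>d\<close>-neighbourhood of
        \<open>u\<close> that lies in \<open>[a, b]\<close>.\<close>
      define lo where "lo = max a (u - d)"
      define hi where "hi = min b (u + d)"
      have "lo < hi" using ab u d by (auto simp: lo_def hi_def)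
      then have "(lo - a) / (b - a) < (hi - a) / (b - a)" using ab by (simp add: divide_strict_right_mono)
      then obtain r where r: "r \<in> \<rat>" "(lo - a) / (b - a) < r" "r < (hi - a) / (b - a)"
        using Rats_dense_in_real by blast
      have "lo - a < r * (b - a)" "r * (b - a) < hi - a"
        using pos_divide_less_eq[THEN iffD1, OF _ r(2)] pos_less_divide_eq[THEN iffD1, OF _ r(3)] ab by auto
      then have *: "lo < a + (b - a) * r" "a + (b - a) * r < hi"
        unfolding mult.commute[of r] by linarith+
      define v where "v = a + (b - a) * r"
      have v: "v \<in> {a..b}" "dist v u < d"
        using * unfolding lo_def hi_def dist_real_def v_def[symmetric] by (simp_all add: abs_less_iff)
      have "0 \<le> (lo - a) / (b - a)" "(hi - a) / (b - a) \<le> 1"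
        using ab unfolding lo_def hi_def by simp_all
      then have "r \<in> {0..1}" using r(2,3) by simp
      then have "v \<in> (\<lambda>r. a + (b - a) * r) ` (\<rat> \<inter> {0..1})" using r(1) unfolding v_def by blast
      moreover have "\<bar>w v\<bar> < 1 / Suc n" using d(2)[OF v] u(3) by (simp add: dist_real_def)
      ultimately show ?thesis by blast
    qed
  qed
next
  assume *: "\<forall>n::nat. \<exists>r\<in>(\<lambda>r. a + (b - a) * r) ` (\<rat> \<inter> {0..1}). \<bar>w r\<bar> < 1 / Suc n"
  \<comment> \<open>Compactness provides a minimum point of \<open>\<bar>w\<bar>\<close>; its value
    is below every \<open>1 / Suc n\<close>.\<close>
  have "continuous_on {a..b} (\<lambda>u. \<bar>w u\<bar>)" using assms(1) by (intro continuous_intros)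
  then obtain u where u: "u \<in> {a..b}" "\<And>v. v \<in> {a..b} \<Longrightarrow> \<bar>w u\<bar> \<le> \<bar>w v\<bar>"
    using continuous_attains_inf[of "{a..b}" "\<lambda>u. \<bar>w u\<bar>"] assms(2) by fastforce
  have "\<bar>w u\<bar> < 1 / Suc n" for n
  proof -
    obtain r where r: "r \<in> \<rat>" "0 \<le> r" "r \<le> 1" "\<bar>w (a + (b - a) * r)\<bar> < 1 / Suc n"
      using *[rule_format, of n] by (elim bexE imageE IntE) auto
    have "(b - a) * r \<le> (b - a) * 1" using r assms(2) by (intro mult_left_mono) auto
    then have "a + (b - a) * r \<in> {a..b}" using r assms(2) by auto
    then show ?thesis using u(2)[of "a + (b - a) * r"] r(4) by linarith
  qed
  then have "\<not> 0 < \<bar>w u\<bar>"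
    by (meson less_asym nat_approx_posE)
  then show "\<exists>u\<in>{a..b}. w u = 0" using u by auto
qed

section \<open>Coordinates, filtration and shifts on path space\<close>

lemma path_spaceD:
  assumes "\<omega> \<in> space (path_space E)"
  shows "continuous_on {0..} \<omega>" "\<And>t. 0 \<le> t \<Longrightarrow> \<omega> t \<in> E" "\<omega> \<in> extensional {0..}"
  using assms by (auto simp: path_space_def space_restrict_space space_PiM PiE_def)

lemma path_spaceI:
  assumes "continuous_on {0..} \<omega>" "\<And>t. 0 \<le> t \<Longrightarrow> \<omega> t \<in> E" "\<omega> \<in> extensional {0..}"
  shows "\<omega> \<in> space (path_space E)"
  using assms by (auto simp: path_space_def space_restrict_space space_PiM PiE_def)

lemma measurable_coordinate [measurable]:
  "0 \<le> t \<Longrightarrow> (\<lambda>\<omega>. \<omega> t) \<in> borel_measurable (path_space E)"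
  unfolding path_space_def by (intro measurable_restrict_space1) auto

lemma space_path_filtration [simp]: "space (path_filtration E t) = space (path_space E)"
  unfolding path_filtration_def by (rule space_measure_of) auto

lemma coordinate_in_filtration:
  assumes "0 \<le> u" "u \<le> t" "B \<in> sets borel"
  shows "{\<omega> \<in> space (path_space E). \<omega> u \<in> B} \<in> sets (path_filtration E t)"
  unfolding path_filtration_def using assms by (subst sets_measure_of) auto

lemma measurable_coordinate_filtration:
  assumes "0 \<le> u" "u \<le> t"
  shows "(\<lambda>\<omega>. \<omega> u) \<in> borel_measurable (path_filtration E t)"
  using coordinate_in_filtration[OF assms, of _ E]
  by (intro measurableI) (auto simp: vimage_def Int_def conj_commute)

lemma path_filtration_subset: "sets (path_filtration E t) \<subseteq> sets (path_space E)"
proof -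
  have "{\<omega> \<in> space (path_space E). \<omega> u \<in> B} \<in> sets (path_space E)" if "0 \<le> u" "B \<in> sets borel" for u B
    using measurable_sets[OF measurable_coordinate[OF that(1), of E] that(2)]
    by (simp add: vimage_def Int_def conj_commute)
  then show ?thesis
    unfolding path_filtration_def by (subst sets_measure_of) (auto intro!: sets.sigma_sets_subset)
qed

lemma path_filtration_mono:
  assumes "t \<le> t'"
  shows "sets (path_filtration E t) \<subseteq> sets (path_filtration E t')"
proof -
  have "sets (path_filtration E t) = sigma_sets (space (path_space E)) {{\<omega> \<in> space (path_space E). \<omega> u \<in> B} | u B. 0 \<le> u \<and> u \<le> t \<and> B \<in> sets borel}"
    unfolding path_filtration_def by (rule sets_measure_of) auto
  also have "\<dots> \<subseteq> sets (path_filtration E t')"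
  proof -
    have "{{\<omega> \<in> space (path_space E). \<omega> u \<in> B} | u B. 0 \<le> u \<and> u \<le> t \<and> B \<in> sets borel} \<subseteq> sets (path_filtration E t')"
      using assms by (auto intro!: coordinate_in_filtration)
    from sets.sigma_sets_subset[OF this] show ?thesis by simp
  qed
  finally show ?thesis .
qed

text \<open>By continuity, meeting the curve within a compact time interval is a condition on
  countably many coordinates with times at most \<open>b\<close>. The other events about passage
  times are built from such events.\<close>

lemma curve_hit_in_filtration:
  assumes "0 \<le> a" "b \<le> t" "continuous_on {a..b} g"
  shows "{\<omega> \<in> space (path_space E). \<exists>u\<in>{a..b}. \<omega> u = g u} \<in> sets (path_filtration E t)"
proof (cases "a \<le> b")
  case True
  define Q where "Q = (\<lambda>r. a + (b - a) * r) ` (\<rat> \<inter> {0..1})"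
  have Q: "countable Q" unfolding Q_def by (intro countable_image countable_Int1 countable_rat)
  have Qb: "0 \<le> r \<and> r \<le> t" if "r \<in> Q" for r
  proof -
    from that obtain v where v: "0 \<le> v" "v \<le> 1" "r = a + (b - a) * v" by (auto simp: Q_def)
    have "(b - a) * v \<le> (b - a) * 1" using v True by (intro mult_left_mono) auto
    then show ?thesis using v True assms by auto
  qed
  have eq: "{\<omega> \<in> space (path_space E). \<exists>u\<in>{a..b}. \<omega> u = g u} =
    {\<omega> \<in> space (path_filtration E t). \<forall>n::nat. \<exists>r\<in>Q. \<bar>\<omega> r - g r\<bar> < 1 / Suc n}"
    unfolding space_path_filtration
  proof (intro Collect_cong conj_cong refl)
    fix \<omega> assume w: "\<omega> \<in> space (path_space E)"
    have "continuous_on {a..b} (\<lambda>u. \<omega> u - g u)"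
      using continuous_on_subset[OF path_spaceD(1)[OF w], of "{a..b}"] assms by (intro continuous_intros) auto
    from zero_iff_small_on_rationals[OF this True]
    show "(\<exists>u\<in>{a..b}. \<omega> u = g u) = (\<forall>n::nat. \<exists>r\<in>Q. \<bar>\<omega> r - g r\<bar> < 1 / Suc n)"
      unfolding Q_def by simp
  qed
  have meas: "(\<lambda>\<omega>. \<omega> r) \<in> borel_measurable (path_filtration E t)" if "r \<in> Q" for r
    using Qb[OF that] by (intro measurable_coordinate_filtration) auto
  have "{\<omega> \<in> space (path_filtration E t). \<bar>\<omega> r - g r\<bar> < c} \<in> sets (path_filtration E t)" if "r \<in> Q" for r c
    using meas[OF that] by measurable
  then have "(\<Inter>n::nat. \<Union>r\<in>Q. {\<omega> \<in> space (path_filtration E t). \<bar>\<omega> r - g r\<bar> < 1 / Suc n}) \<in> sets (path_filtration E t)"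
    by (intro sets.countable_INT' countableI_type sets.countable_UN'[OF Q] image_subsetI) auto
  also have "(\<Inter>n::nat. \<Union>r\<in>Q. {\<omega> \<in> space (path_filtration E t). \<bar>\<omega> r - g r\<bar> < 1 / Suc n}) =
    {\<omega> \<in> space (path_filtration E t). \<forall>n::nat. \<exists>r\<in>Q. \<bar>\<omega> r - g r\<bar> < 1 / Suc n}"
    by auto
  finally show ?thesis unfolding eq .
qed auto

lemma path_shift_in_space:
  assumes "\<omega> \<in> space (path_space E)" "0 \<le> t"
  shows "path_shift t \<omega> \<in> space (path_space E)"
proof (rule path_spaceI)
  have "continuous_on {0..} (\<lambda>u. \<omega> (t + u))"
    by (rule continuous_on_compose2[OF path_spaceD(1)[OF assms(1)]]) (use assms(2) in \<open>auto intro!: continuous_on_add continuous_on_const continuous_on_id\<close>)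
  then show "continuous_on {0..} (path_shift t \<omega>)"
    unfolding path_shift_def by (rule continuous_on_eq) auto
qed (use assms path_spaceD(2)[OF assms(1)] in \<open>auto simp: path_shift_def\<close>)

lemma measurable_path_shift [measurable]:
  assumes "0 \<le> t"
  shows "path_shift t \<in> path_space E \<rightarrow>\<^sub>M path_space E"
proof -
  have "path_shift t \<in> path_space E \<rightarrow>\<^sub>M (\<Pi>\<^sub>M t\<in>{0..}. borel)"
    unfolding path_shift_def using assms by (intro measurable_restrict) auto
  moreover have "path_shift t \<in> space (path_space E) \<rightarrow> {\<omega>. continuous_on {0..} \<omega> \<and> (\<forall>t\<ge>0. \<omega> t \<in> E)}"
    using path_spaceD[OF path_shift_in_space[OF _ assms]] by auto
  ultimately show ?thesis
    by (subst (2) path_space_def) (rule measurable_restrict_space2)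
qed

lemma path_shift_apply: "0 \<le> u \<Longrightarrow> path_shift t \<omega> u = \<omega> (t + u)"
  by (simp add: path_shift_def)

section \<open>Hitting times of levels\<close>

lemma Inf_ennreal_less_iff:
  assumes "0 \<le> t"
  shows "Inf (ennreal ` {u. 0 \<le> u \<and> Q u}) < ennreal t \<longleftrightarrow> (\<exists>u. 0 \<le> u \<and> u < t \<and> Q u)"
  unfolding Inf_less_iff using assms by (auto simp: ennreal_less_iff)

lemma hitting_time_less_iff:
  "0 \<le> t \<Longrightarrow> hitting_time c \<omega> < ennreal t \<longleftrightarrow> (\<exists>u. 0 \<le> u \<and> u < t \<and> \<omega> u = c)"
  unfolding hitting_time_def by (rule Inf_ennreal_less_iff)

lemma hitting_time_finite_iff: "hitting_time c \<omega> < \<infinity> \<longleftrightarrow> (\<exists>u\<ge>0. \<omega> u = c)"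
  unfolding hitting_time_def infinity_ennreal_def Inf_less_iff by auto

text \<open>A hit before \<open>t\<close> is a hit within \<open>[0, t - 1 / Suc n]\<close> for some
  \<open>n\<close>. The strict inequality is the one by which the strong Markov property recognises
  stopping times.\<close>

lemma hitting_time_stopping:
  assumes "0 \<le> t"
  shows "{\<omega> \<in> space (path_space E). hitting_time c \<omega> < ennreal t} \<in> sets (path_filtration E t)"
proof -
  have "{\<omega> \<in> space (path_space E). hitting_time c \<omega> < ennreal t} =
    (\<Union>n::nat. {\<omega> \<in> space (path_space E). \<exists>u\<in>{0..t - 1 / Suc n}. \<omega> u = c})"
    unfolding hitting_time_less_iff[OF assms]
  proof safe
    fix \<omega> u assume "\<omega> \<in> space (path_space E)" "0 \<le> u" "u < t" "c = \<omega> u"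
    then obtain n :: nat where "1 / Suc n < t - u" using nat_approx_posE[of "t - u"] by auto
    then show "\<omega> \<in> (\<Union>n::nat. {\<omega>' \<in> space (path_space E). \<exists>u'\<in>{0..t - 1 / Suc n}. \<omega>' u' = \<omega> u})"
      using \<open>0 \<le> u\<close> \<open>\<omega> \<in> _\<close> by (auto intro!: exI[of _ n] bexI[of _ u])
  next
    fix \<omega> u and n :: nat assume "u \<in> {0..t - 1 / Suc n}"
    moreover have "0 < 1 / (1 + real n)" by simp
    ultimately have "0 \<le> u" "u < t" by (simp_all, linarith)
    then show "\<exists>u'\<ge>0. u' < t \<and> \<omega> u' = \<omega> u" by auto
  qed
  also have "\<dots> \<in> sets (path_filtration E t)"
    by (intro sets.countable_UN) (auto intro!: curve_hit_in_filtration continuous_on_const)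
  finally show ?thesis .
qed

lemma measurable_hitting_time [measurable]:
  "hitting_time c \<in> borel_measurable (path_space E)"
proof (rule borel_measurableI_less)
  fix y :: ennreal
  show "{\<omega> \<in> space (path_space E). hitting_time c \<omega> < y} \<in> sets (path_space E)"
  proof (cases y)
    case (real r)
    then show ?thesis using hitting_time_stopping[of r E c] path_filtration_subset by auto
  next
    case top
    have "{\<omega> \<in> space (path_space E). hitting_time c \<omega> < y} =
      (\<Union>n::nat. {\<omega> \<in> space (path_space E). hitting_time c \<omega> < ennreal (real n)})"
    proof safe
      fix \<omega> assume "\<omega> \<in> space (path_space E)" "hitting_time c \<omega> < y"
      then obtain r where "hitting_time c \<omega> = ennreal r" "0 \<le> r" unfolding top by (cases "hitting_time c \<omega>") auto
      moreover obtain n :: nat where "r < n" using reals_Archimedean2 by blast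
      ultimately show "\<omega> \<in> (\<Union>n::nat. {\<omega> \<in> space (path_space E). hitting_time c \<omega> < ennreal (real n)})"
        using \<open>\<omega> \<in> space _\<close> by (auto simp: ennreal_less_iff)
    qed (auto simp: top intro: less_trans[OF _ ennreal_less_top])
    also have "\<dots> \<in> sets (path_space E)"
      by (intro sets.countable_UN image_subsetI subsetD[OF path_filtration_subset hitting_time_stopping]) auto
    finally show ?thesis .
  qed
qed

text \<open>The infimum is formed in \<open>ennreal\<close> but taken over the image of a closed set
  of reals. Both the hitting times of continuous paths and the lifetime of the curve are of this
  kind, so they are attained when finite.\<close>

lemma Inf_ennreal_attained:
  assumes "closed S" "S \<noteq> {}" "\<And>t. t \<in> S \<Longrightarrow> 0 \<le> t"
  shows "\<exists>t\<in>S. Inf (ennreal ` S) = ennreal t"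
proof -
  have bb: "bdd_below S" using assms(3) by (rule bdd_belowI)
  have m: "Inf S \<in> S" using closed_contains_Inf[OF assms(2) bb assms(1)] .
  have "Inf (ennreal ` S) = ennreal (Inf S)"
  proof (rule antisym)
    show "Inf (ennreal ` S) \<le> ennreal (Inf S)" using m by (intro Inf_lower imageI)
    show "ennreal (Inf S) \<le> Inf (ennreal ` S)"
      using cInf_lower[OF _ bb] by (intro Inf_greatest) (auto intro!: ennreal_leI)
  qed
  then show ?thesis using m by blast
qed

lemma hitting_time_attained:
  assumes w: "\<omega> \<in> space (path_space E)" and fin: "hitting_time c \<omega> < \<infinity>"
  shows "\<omega> (enn2real (hitting_time c \<omega>)) = c" "hitting_time c \<omega> = ennreal (enn2real (hitting_time c \<omega>))"
    "\<And>u. 0 \<le> u \<Longrightarrow> u < enn2real (hitting_time c \<omega>) \<Longrightarrow> \<omega> u \<noteq> c"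
proof -
  define S where "S = {t. 0 \<le> t \<and> \<omega> t = c}"
  have "closed S"
  proof -
    have "closedin (top_of_set {0..}) ({0..} \<inter> \<omega> -` {c})"
      using path_spaceD(1)[OF w] by (intro continuous_closedin_preimage) auto
    moreover have "{0..} \<inter> \<omega> -` {c} = S" by (auto simp: S_def)
    ultimately show ?thesis by (metis closedin_closed_eq closed_atLeast)
  qed
  moreover have "S \<noteq> {}" using fin hitting_time_finite_iff unfolding S_def by blast
  ultimately have "\<exists>m\<in>S. Inf (ennreal ` S) = ennreal m" by (rule Inf_ennreal_attained) (simp add: S_def)
  then obtain m where m: "m \<in> S" "Inf (ennreal ` S) = ennreal m" by blast
  have h: "hitting_time c \<omega> = ennreal m" unfolding hitting_time_def S_def[symmetric] by (rule m(2))
  then have e: "enn2real (hitting_time c \<omega>) = m" using m(1) by (simp add: S_def)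
  show "\<omega> (enn2real (hitting_time c \<omega>)) = c" unfolding e using m(1) by (simp add: S_def)
  show "hitting_time c \<omega> = ennreal (enn2real (hitting_time c \<omega>))" unfolding e by (rule h)
  show "\<omega> u \<noteq> c" if u: "0 \<le> u" "u < enn2real (hitting_time c \<omega>)" for u
  proof
    assume "\<omega> u = c"
    then have "ennreal m \<le> ennreal u" unfolding m(2)[symmetric] using u by (intro Inf_lower) (simp add: S_def)
    then show False using u unfolding e by simp
  qed
qed

section \<open>Markov and strong Markov properties\<close>

context linear_diffusion
begin

lemma P_prob_space: "x \<in> E \<Longrightarrow> prob_space (P x)"
  and sets_P: "x \<in> E \<Longrightarrow> sets (P x) = sets (path_space E)"
  using measurable_space[OF kernel, of x] by (auto simp: space_prob_algebra space_restrict_space)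

lemma space_P: "x \<in> E \<Longrightarrow> space (P x) = space (path_space E)"
  using sets_P by (rule sets_eq_imp_space_eq)

lemma in_E: "l < ereal x \<Longrightarrow> x \<in> E"
  using state_space by auto

lemma measurable_P_iff: "x \<in> E \<Longrightarrow> f \<in> measurable (P x) N \<longleftrightarrow> f \<in> measurable (path_space E) N"
  using measurable_cong_sets[OF sets_P refl] by blast

lemma measurable_emeasure_P:
  "B \<in> sets (path_space E) \<Longrightarrow> (\<lambda>y. emeasure (P y) B) \<in> borel_measurable (restrict_space borel E)"
  using measurable_emeasure_kernel[OF measurable_prob_algebraD[OF kernel]] .

lemma measurable_measure_P:
  "B \<in> sets (path_space E) \<Longrightarrow> (\<lambda>y. measure (P y) B) \<in> borel_measurable (restrict_space borel E)"
  unfolding measure_def by (intro borel_measurable_enn2real measurable_emeasure_P)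

lemma measurable_coordinate_E:
  "0 \<le> t \<Longrightarrow> (\<lambda>\<omega>. \<omega> t) \<in> path_space E \<rightarrow>\<^sub>M restrict_space borel E"
  by (rule measurable_restrict_space2) (auto dest: path_spaceD(2))

text \<open>A constant \<open>t\<close> is a stopping time: \<open>{t < t'}\<close> is everything or
  nothing, and in the first case an event known at time \<open>t\<close> is known at time
  \<open>t'\<close> as well.\<close>

lemma markov_fixed:
  assumes x: "x \<in> E" and t: "0 \<le> t" and A: "A \<in> sets (path_filtration E t)" and B: "B \<in> sets (path_space E)"
  shows "emeasure (P x) {\<omega> \<in> A. path_shift t \<omega> \<in> B} = (\<integral>\<^sup>+\<omega>\<in>A. emeasure (P (\<omega> t)) B \<partial>P x)"
proof -
  have As: "A \<in> sets (path_space E)" using A path_filtration_subset by auto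
  have "emeasure (P x) {\<omega> \<in> A. ennreal t < \<infinity> \<and> path_shift (enn2real (ennreal t)) \<omega> \<in> B} =
     (\<integral>\<^sup>+\<omega>\<in>{\<omega> \<in> A. ennreal t < \<infinity>}. emeasure (P (\<omega> (enn2real (ennreal t)))) B \<partial>P x)"
  proof (rule strong_markov[OF x, of "\<lambda>_. ennreal t"])
    show "{\<omega> \<in> space (path_space E). ennreal t < ennreal t'} \<in> sets (path_filtration E t')" if "0 \<le> t'" for t'
      using sets.top[of "path_filtration E t'"] by (cases "ennreal t < ennreal t'") auto
    show "{\<omega> \<in> A. ennreal t < ennreal t'} \<in> sets (path_filtration E t')" if "0 \<le> t'" for t'
    proof (cases "t < t'")
      case True
      then show ?thesis using path_filtration_mono[of t t' E] A t by (auto simp: ennreal_less_iff)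
    qed (use t that in \<open>auto simp: ennreal_less_iff\<close>)
  qed (use As B in auto)
  moreover have "ennreal t < \<infinity>" by (simp add: infinity_ennreal_def)
  ultimately show ?thesis using t by simp
qed

text \<open>Monotone class induction from events to nonnegative functionals of the future, such as
  the exit time of an interval.\<close>

lemma markov_fixed_nn:
  assumes x: "x \<in> E" and t: "0 \<le> t" and A: "A \<in> sets (path_filtration E t)"
    and f: "f \<in> borel_measurable (path_space E)"
  shows "(\<integral>\<^sup>+\<omega>\<in>A. f (path_shift t \<omega>) \<partial>P x) = (\<integral>\<^sup>+\<omega>\<in>A. (\<integral>\<^sup>+\<omega>'. f \<omega>' \<partial>P (\<omega> t)) \<partial>P x)"
proof -
  have As: "A \<in> sets (path_space E)" using A path_filtration_subset by auto
  let ?K = "restrict_space borel E"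
  have mK: "(\<lambda>y. \<integral>\<^sup>+\<omega>'. g \<omega>' \<partial>P y) \<in> borel_measurable ?K" if "g \<in> borel_measurable (path_space E)" for g
    using measurable_compose[OF measurable_prob_algebraD[OF kernel] nn_integral_measurable_subprob_algebra[OF that]] .
  have mA[measurable]: "A \<in> sets (P x)" using As sets_P[OF x] by simp
  have ms: "path_shift t \<in> P x \<rightarrow>\<^sub>M path_space E" using measurable_path_shift[OF t] measurable_P_iff[OF x] by blast
  have mc: "(\<lambda>\<omega>. \<omega> t) \<in> P x \<rightarrow>\<^sub>M ?K" using measurable_coordinate_E[OF t] measurable_P_iff[OF x] by blast
  note mKx = measurable_compose[OF mc mK]
  from f show ?thesis
  proof (induction rule: borel_measurable_induct)
    case (cong f g)
    have "(\<integral>\<^sup>+\<omega>\<in>A. f (path_shift t \<omega>) \<partial>P x) = (\<integral>\<^sup>+\<omega>\<in>A. g (path_shift t \<omega>) \<partial>P x)"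
      using cong(3) measurable_space[OF ms] by (intro nn_integral_cong) auto
    moreover have "(\<integral>\<^sup>+\<omega>'. f \<omega>' \<partial>P (\<omega> t)) = (\<integral>\<^sup>+\<omega>'. g \<omega>' \<partial>P (\<omega> t))" if "\<omega> \<in> space (P x)" for \<omega>
      using that path_spaceD(2)[OF _ t, of \<omega> E] cong(3) space_P[of "\<omega> t"] space_P[OF x] by (intro nn_integral_cong) auto
    then have "(\<integral>\<^sup>+\<omega>\<in>A. (\<integral>\<^sup>+\<omega>'. f \<omega>' \<partial>P (\<omega> t)) \<partial>P x) = (\<integral>\<^sup>+\<omega>\<in>A. (\<integral>\<^sup>+\<omega>'. g \<omega>' \<partial>P (\<omega> t)) \<partial>P x)"
      by (intro nn_integral_cong) auto
    ultimately show ?case using cong by simp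
  next
    case (set B)
    have "(\<integral>\<^sup>+\<omega>\<in>A. indicator B (path_shift t \<omega>) \<partial>P x) = (\<integral>\<^sup>+\<omega>. indicator {\<omega> \<in> A. path_shift t \<omega> \<in> B} \<omega> \<partial>P x)"
      by (intro nn_integral_cong) (auto simp: indicator_def)
    also have "\<dots> = emeasure (P x) {\<omega> \<in> A. path_shift t \<omega> \<in> B}"
    proof (rule nn_integral_indicator)
      have "{\<omega> \<in> A. path_shift t \<omega> \<in> B} = A \<inter> (path_shift t -` B \<inter> space (P x))"
        using sets.sets_into_space[OF mA] by auto
      also have "\<dots> \<in> sets (P x)" using measurable_sets[OF ms set] mA by (rule sets.Int[rotated])
      finally show "{\<omega> \<in> A. path_shift t \<omega> \<in> B} \<in> sets (P x)" .
    qed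
    also have "\<dots> = (\<integral>\<^sup>+\<omega>\<in>A. emeasure (P (\<omega> t)) B \<partial>P x)" by (rule markov_fixed[OF x t A set])
    also have "\<dots> = (\<integral>\<^sup>+\<omega>\<in>A. (\<integral>\<^sup>+\<omega>'. indicator B \<omega>' \<partial>P (\<omega> t)) \<partial>P x)"
    proof (rule nn_integral_cong)
      fix \<omega> assume "\<omega> \<in> space (P x)"
      then have "\<omega> t \<in> E" using path_spaceD(2)[OF _ t, of \<omega> E] space_P[OF x] by auto
      then show "emeasure (P (\<omega> t)) B * indicator A \<omega> = (\<integral>\<^sup>+\<omega>'. indicator B \<omega>' \<partial>P (\<omega> t)) * indicator A \<omega>"
        using set sets_P by (subst nn_integral_indicator) auto
    qed
    finally show ?case .
  next
    case (mult u c)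
    have "(\<integral>\<^sup>+\<omega>\<in>A. c * u (path_shift t \<omega>) \<partial>P x) = c * (\<integral>\<^sup>+\<omega>\<in>A. u (path_shift t \<omega>) \<partial>P x)"
      using measurable_compose[OF ms mult(2)] by (subst nn_integral_cmult[symmetric]) (auto simp: mult.assoc)
    also have "\<dots> = (\<integral>\<^sup>+\<omega>\<in>A. c * (\<integral>\<^sup>+\<omega>'. u \<omega>' \<partial>P (\<omega> t)) \<partial>P x)"
      using mKx[OF mult(2)] unfolding mult(4) by (subst nn_integral_cmult[symmetric]) (auto simp: mult.assoc)
    also have "\<dots> = (\<integral>\<^sup>+\<omega>\<in>A. (\<integral>\<^sup>+\<omega>'. c * u \<omega>' \<partial>P (\<omega> t)) \<partial>P x)"
    proof (rule nn_integral_cong)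
      fix \<omega> assume "\<omega> \<in> space (P x)"
      then have "\<omega> t \<in> E" using path_spaceD(2)[OF _ t, of \<omega> E] space_P[OF x] by auto
      then have "u \<in> borel_measurable (P (\<omega> t))" using mult(2) measurable_P_iff by blast
      then show "c * (\<integral>\<^sup>+\<omega>'. u \<omega>' \<partial>P (\<omega> t)) * indicator A \<omega> = (\<integral>\<^sup>+\<omega>'. c * u \<omega>' \<partial>P (\<omega> t)) * indicator A \<omega>"
        by (simp add: nn_integral_cmult)
    qed
    finally show ?case .
  next
    case (add u v)
    have "(\<integral>\<^sup>+\<omega>\<in>A. (v (path_shift t \<omega>) + u (path_shift t \<omega>)) \<partial>P x) = (\<integral>\<^sup>+\<omega>\<in>A. v (path_shift t \<omega>) \<partial>P x) + (\<integral>\<^sup>+\<omega>\<in>A. u (path_shift t \<omega>) \<partial>P x)"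
      using measurable_compose[OF ms add.hyps(1)] measurable_compose[OF ms add.hyps(3)]
      by (subst nn_integral_add[symmetric]) (auto simp: distrib_right)
    also have "\<dots> = (\<integral>\<^sup>+\<omega>\<in>A. ((\<integral>\<^sup>+\<omega>'. v \<omega>' \<partial>P (\<omega> t)) + (\<integral>\<^sup>+\<omega>'. u \<omega>' \<partial>P (\<omega> t))) \<partial>P x)"
      using mKx[OF add.hyps(1)] mKx[OF add.hyps(3)] unfolding add.IH
      by (subst nn_integral_add[symmetric]) (auto simp: distrib_right)
    also have "\<dots> = (\<integral>\<^sup>+\<omega>\<in>A. (\<integral>\<^sup>+\<omega>'. v \<omega>' + u \<omega>' \<partial>P (\<omega> t)) \<partial>P x)"
    proof (rule nn_integral_cong)
      fix \<omega> assume "\<omega> \<in> space (P x)"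
      then have "\<omega> t \<in> E" using path_spaceD(2)[OF _ t, of \<omega> E] space_P[OF x] by auto
      then have "u \<in> borel_measurable (P (\<omega> t))" "v \<in> borel_measurable (P (\<omega> t))" using add.hyps(1,3) measurable_P_iff by blast+
      then show "((\<integral>\<^sup>+\<omega>'. v \<omega>' \<partial>P (\<omega> t)) + (\<integral>\<^sup>+\<omega>'. u \<omega>' \<partial>P (\<omega> t))) * indicator A \<omega> = (\<integral>\<^sup>+\<omega>'. v \<omega>' + u \<omega>' \<partial>P (\<omega> t)) * indicator A \<omega>"
        by (simp add: nn_integral_add)
    qed
    finally show ?case by simp
  next
    case (seq U)
    have Um: "U i \<in> borel_measurable (path_space E)" for i using seq by auto
    have inc: "incseq (\<lambda>i \<omega>. U i (path_shift t \<omega>) * indicator A \<omega>)"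
      using \<open>incseq U\<close> by (auto simp: incseq_def le_fun_def indicator_def)
    have inc2: "incseq (\<lambda>i \<omega>. (\<integral>\<^sup>+\<omega>'. U i \<omega>' \<partial>P (\<omega> t)) * indicator A \<omega>)"
      using \<open>incseq U\<close> by (auto simp: incseq_def le_fun_def indicator_def intro!: nn_integral_mono)
    have "(\<integral>\<^sup>+\<omega>\<in>A. (SUP i. U i) (path_shift t \<omega>) \<partial>P x) = (\<integral>\<^sup>+\<omega>. (SUP i. U i (path_shift t \<omega>) * indicator A \<omega>) \<partial>P x)"
      by (intro nn_integral_cong) (auto simp: indicator_def image_comp)
    also have "\<dots> = (SUP i. (\<integral>\<^sup>+\<omega>\<in>A. U i (path_shift t \<omega>) \<partial>P x))"
      using measurable_compose[OF ms Um] by (intro nn_integral_monotone_convergence_SUP inc) auto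
    also have "\<dots> = (SUP i. (\<integral>\<^sup>+\<omega>\<in>A. (\<integral>\<^sup>+\<omega>'. U i \<omega>' \<partial>P (\<omega> t)) \<partial>P x))"
      using seq by simp
    also have "\<dots> = (\<integral>\<^sup>+\<omega>. (SUP i. (\<integral>\<^sup>+\<omega>'. U i \<omega>' \<partial>P (\<omega> t)) * indicator A \<omega>) \<partial>P x)"
      using mKx[OF Um] by (intro nn_integral_monotone_convergence_SUP[symmetric] inc2) auto
    also have "\<dots> = (\<integral>\<^sup>+\<omega>\<in>A. (\<integral>\<^sup>+\<omega>'. (SUP i. U i) \<omega>' \<partial>P (\<omega> t)) \<partial>P x)"
    proof (rule nn_integral_cong)
      fix \<omega> assume "\<omega> \<in> space (P x)"
      then have "\<omega> t \<in> E" using path_spaceD(2)[OF _ t, of \<omega> E] space_P[OF x] by auto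
      then have "U i \<in> borel_measurable (P (\<omega> t))" for i using Um measurable_P_iff by blast
      from nn_integral_monotone_convergence_SUP[OF \<open>incseq U\<close> this]
      show "(SUP i. (\<integral>\<^sup>+\<omega>'. U i \<omega>' \<partial>P (\<omega> t)) * indicator A \<omega>) = (\<integral>\<^sup>+\<omega>'. (SUP i. U i) \<omega>' \<partial>P (\<omega> t)) * indicator A \<omega>"
        by (auto simp: indicator_def image_comp)
    qed
    finally show ?case by (simp add: image_comp)
  qed
qed

text \<open>At its hitting time the path is at \<open>c\<close>, so the law of the future is the
  constant \<open>P c\<close> on the whole event and the integral factorises.\<close>

lemma strong_markov_hitting:
  assumes x: "x \<in> E" and h: "0 \<le> h" and B: "B \<in> sets (path_space E)"
  shows "emeasure (P x) {\<omega> \<in> space (path_space E). hitting_time c \<omega> < ennreal h \<and>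
      path_shift (enn2real (hitting_time c \<omega>)) \<omega> \<in> B} =
    emeasure (P x) {\<omega> \<in> space (path_space E). hitting_time c \<omega> < ennreal h} * emeasure (P c) B"
proof -
  define A where "A = {\<omega> \<in> space (path_space E). hitting_time c \<omega> < ennreal h}"
  have A: "A \<in> sets (path_space E)" unfolding A_def by measurable
  have lt: "hitting_time c \<omega> < \<infinity>" if "\<omega> \<in> A" for \<omega>
    using that unfolding A_def by (auto simp: infinity_ennreal_def intro: less_trans[OF _ ennreal_less_top])
  have "emeasure (P x) {\<omega> \<in> A. hitting_time c \<omega> < \<infinity> \<and> path_shift (enn2real (hitting_time c \<omega>)) \<omega> \<in> B} =
     (\<integral>\<^sup>+\<omega>\<in>{\<omega> \<in> A. hitting_time c \<omega> < \<infinity>}. emeasure (P (\<omega> (enn2real (hitting_time c \<omega>)))) B \<partial>P x)"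
  proof (rule strong_markov[OF x _ _ A _ B])
    show "{\<omega> \<in> A. hitting_time c \<omega> < ennreal t} \<in> sets (path_filtration E t)" if "0 \<le> t" for t
    proof -
      \<comment> \<open>The two constraints merge into a hit before \<open>min h t\<close>, an event
        known at that time and hence at time \<open>t\<close>.\<close>
      have "{\<omega> \<in> A. hitting_time c \<omega> < ennreal t} = {\<omega> \<in> space (path_space E). hitting_time c \<omega> < ennreal (min h t)}"
        using h that unfolding A_def by (cases "h \<le> t") (auto simp: min_def ennreal_leI intro: less_le_trans)
      also have "\<dots> \<in> sets (path_filtration E (min h t))" using h that by (intro hitting_time_stopping) auto
      finally show ?thesis using path_filtration_mono[of "min h t" t E] by auto
    qed
  qed (auto intro: hitting_time_stopping)
  moreover have "{\<omega> \<in> A. hitting_time c \<omega> < \<infinity>} = A" using lt by auto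
  moreover have "{\<omega> \<in> A. hitting_time c \<omega> < \<infinity> \<and> path_shift (enn2real (hitting_time c \<omega>)) \<omega> \<in> B} =
    {\<omega> \<in> A. path_shift (enn2real (hitting_time c \<omega>)) \<omega> \<in> B}" using lt by auto
  moreover have "(\<integral>\<^sup>+\<omega>\<in>A. emeasure (P (\<omega> (enn2real (hitting_time c \<omega>)))) B \<partial>P x) = (\<integral>\<^sup>+\<omega>\<in>A. emeasure (P c) B \<partial>P x)"
  proof (intro nn_integral_cong)
    fix \<omega>
    show "emeasure (P (\<omega> (enn2real (hitting_time c \<omega>)))) B * indicator A \<omega> = emeasure (P c) B * indicator A \<omega>"
    proof (cases "\<omega> \<in> A")
      case True
      then have "\<omega> (enn2real (hitting_time c \<omega>)) = c"
        using lt by (intro hitting_time_attained(1)[of _ E]) (auto simp: A_def)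
      then show ?thesis by simp
    qed simp
  qed
  moreover have "(\<integral>\<^sup>+\<omega>\<in>A. emeasure (P c) B \<partial>P x) = emeasure (P x) A * emeasure (P c) B"
    using A sets_P[OF x] by (subst nn_integral_cmult_indicator) (auto simp: mult.commute)
  moreover have "{\<omega> \<in> space (path_space E). hitting_time c \<omega> < ennreal h \<and>
      path_shift (enn2real (hitting_time c \<omega>)) \<omega> \<in> B} = {\<omega> \<in> A. path_shift (enn2real (hitting_time c \<omega>)) \<omega> \<in> B}"
    by (auto simp: A_def)
  ultimately show ?thesis unfolding A_def[symmetric] by simp
qed

end

section \<open>Exit estimates\<close>

lemma path_ivt:
  assumes w: "\<omega> \<in> space (path_space E)" and u: "0 \<le> u" "u \<le> v"
    and c: "(\<omega> u \<le> c \<and> c \<le> \<omega> v) \<or> (\<omega> v \<le> c \<and> c \<le> \<omega> u)"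
  shows "\<exists>r. u \<le> r \<and> r \<le> v \<and> \<omega> r = c"
proof -
  have "continuous_on {u..v} \<omega>" using path_spaceD(1)[OF w] by (rule continuous_on_subset) (use u in auto)
  then show ?thesis using IVT'[of \<omega> u c v] IVT2'[of \<omega> v c u] c u by blast
qed

text \<open>The path is arbitrary here, so the infimum behind the right-hand side may not be
  attained; a hit within an extra time \<open>e\<close> takes its place.\<close>

lemma hitting_time_shift:
  assumes "0 \<le> h"
  shows "hitting_time c \<omega> \<le> ennreal h + hitting_time c (path_shift h \<omega>)"
proof (cases "hitting_time c (path_shift h \<omega>)")
  case (real r)
  show ?thesis
  proof (rule ennreal_le_epsilon)
    fix e :: real assume "0 < e"
    have "hitting_time c (path_shift h \<omega>) < ennreal (r + e)" unfolding real using real \<open>0 < e\<close> by (simp add: ennreal_less_iff)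
    then obtain u where u: "0 \<le> u" "u < r + e" "path_shift h \<omega> u = c"
      using hitting_time_less_iff[of "r + e" c "path_shift h \<omega>"] real \<open>0 < e\<close> by auto
    then have "\<omega> (h + u) = c" by (simp add: path_shift_apply)
    note u = u(1,2) this
    then have "hitting_time c \<omega> \<le> ennreal (h + u)"
      unfolding hitting_time_def using assms by (intro Inf_lower imageI) simp
    also have "\<dots> \<le> ennreal (h + (r + e))" using u by (intro ennreal_leI) auto
    also have "\<dots> = ennreal h + hitting_time c (path_shift h \<omega>) + ennreal e"
      unfolding real using assms real \<open>0 < e\<close> by (simp add: ennreal_plus[symmetric] del: ennreal_plus)
    finally show "hitting_time c \<omega> \<le> ennreal h + hitting_time c (path_shift h \<omega>) + ennreal e" .
  qed
qed auto

lemma hitting_time_start: "\<omega> 0 = c \<Longrightarrow> hitting_time c \<omega> = 0"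
  unfolding hitting_time_def using Inf_lower[of 0 "ennreal ` {t. 0 \<le> t \<and> \<omega> t = c}"]
  by (metis (mono_tags, lifting) ennreal_0 image_eqI le_zero_eq mem_Collect_eq order_refl)

text \<open>A continuous path is determined by its values at the times \<open>k / Suc n\<close>.
  This is used to evaluate paths at random times, and to recover a path that is known on this
  grid.\<close>

lemma floor_grid_tendsto:
  fixes v :: real
  assumes v: "0 \<le> v"
  shows "(\<lambda>n. real (nat \<lfloor>real (Suc n) * v\<rfloor>) / Suc n) \<longlonglongrightarrow> v"
proof -
  have b: "v - 1 / Suc n \<le> real (nat \<lfloor>real (Suc n) * v\<rfloor>) / Suc n \<and> real (nat \<lfloor>real (Suc n) * v\<rfloor>) / Suc n \<le> v" for n
  proof -
    have "real (nat \<lfloor>real (Suc n) * v\<rfloor>) \<le> real (Suc n) * v" "real (Suc n) * v - 1 \<le> real (nat \<lfloor>real (Suc n) * v\<rfloor>)"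
      using v of_nat_floor[of "real (Suc n) * v"] real_of_int_floor_add_one_ge[of "real (Suc n) * v"]
      by (auto simp: of_nat_nat)
    then have "real (nat \<lfloor>real (Suc n) * v\<rfloor>) / Suc n \<le> real (Suc n) * v / Suc n"
      "(real (Suc n) * v - 1) / Suc n \<le> real (nat \<lfloor>real (Suc n) * v\<rfloor>) / Suc n"
      by (intro divide_right_mono; simp)+
    moreover have "(real (Suc n) * v - 1) / Suc n = v - 1 / Suc n" "real (Suc n) * v / Suc n = v"
      by (simp_all add: diff_divide_distrib)
    ultimately show ?thesis by simp
  qed
  show "(\<lambda>n. real (nat \<lfloor>real (Suc n) * v\<rfloor>) / Suc n) \<longlonglongrightarrow> v"
  proof (rule real_tendsto_sandwich)
    have "(\<lambda>n. v - 1 / Suc n) \<longlonglongrightarrow> v - 0" by (intro tendsto_diff tendsto_const LIMSEQ_Suc[OF lim_1_over_n])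
    then show "(\<lambda>n. v - 1 / Suc n) \<longlonglongrightarrow> v" by simp
    show "(\<lambda>n. v) \<longlonglongrightarrow> v" by simp
  qed (use b in \<open>auto intro!: always_eventually\<close>)
qed

text \<open>The value of a continuous path at a random time is the limit of its values at grid
  times, and on each grid the random time selects one of countably many coordinates.\<close>

lemma measurable_path_shift_random:
  assumes m: "\<tau> \<in> borel_measurable (path_space E)" and nn: "\<And>\<omega>. 0 \<le> \<tau> \<omega>"
  shows "(\<lambda>\<omega>. path_shift (\<tau> \<omega>) \<omega>) \<in> path_space E \<rightarrow>\<^sub>M path_space E"
proof -
  have coord: "(\<lambda>\<omega>. \<omega> (\<tau> \<omega> + u)) \<in> borel_measurable (path_space E)" if u: "0 \<le> u" for u
  proof (rule borel_measurable_LIMSEQ_real)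
    fix n :: nat
    have g: "(\<lambda>\<omega>. nat \<lfloor>real (Suc n) * (\<tau> \<omega> + u)\<rfloor>) \<in> measurable (path_space E) (count_space UNIV)"
      using m by measurable
    have "(\<lambda>\<omega>. \<omega> (real k / Suc n)) \<in> borel_measurable (path_space E)" for k :: nat
      by (rule measurable_coordinate) auto
    from measurable_compose_countable[OF this g]
    show "(\<lambda>\<omega>. \<omega> (real (nat \<lfloor>real (Suc n) * (\<tau> \<omega> + u)\<rfloor>) / Suc n)) \<in> borel_measurable (path_space E)" .
  next
    fix \<omega> assume w: "\<omega> \<in> space (path_space E)"
    define v where "v = \<tau> \<omega> + u"
    have v: "0 \<le> v" using nn u by (simp add: v_def)
    show "(\<lambda>n. \<omega> (real (nat \<lfloor>real (Suc n) * (\<tau> \<omega> + u)\<rfloor>) / Suc n)) \<longlonglongrightarrow> \<omega> (\<tau> \<omega> + u)"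
      unfolding v_def[symmetric]
      by (rule continuous_on_tendsto_compose[OF path_spaceD(1)[OF w] floor_grid_tendsto[OF v]]) (use v in auto)
  qed
  have "(\<lambda>\<omega>. path_shift (\<tau> \<omega>) \<omega>) \<in> path_space E \<rightarrow>\<^sub>M (\<Pi>\<^sub>M t\<in>{0..}. borel)"
    unfolding path_shift_def by (rule measurable_restrict) (rule coord, simp)
  moreover have "(\<lambda>\<omega>. path_shift (\<tau> \<omega>) \<omega>) \<in> space (path_space E) \<rightarrow> {\<omega>. continuous_on {0..} \<omega> \<and> (\<forall>t\<ge>0. \<omega> t \<in> E)}"
    using path_spaceD[OF path_shift_in_space[OF _ nn]] by blast
  ultimately show ?thesis
    by (subst (2) path_space_def) (rule measurable_restrict_space2)
qed

context linear_diffusion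
begin

abbreviation "hit_prob z c h \<equiv> emeasure (P z) {\<omega> \<in> space (path_space E). hitting_time c \<omega> < ennreal h}"

lemma AE_P: "x \<in> E \<Longrightarrow> (AE \<omega> in P x. Q \<omega>) \<Longrightarrow> AE \<omega> in P x. \<omega> \<in> space (path_space E) \<and> Q \<omega>"
  using space_P[of x] by (auto intro: AE_mp AE_I2)

lemma start_AE: "x \<in> E \<Longrightarrow> AE \<omega> in P x. \<omega> \<in> space (path_space E) \<and> \<omega> 0 = x"
  by (intro AE_P start)

text \<open>A path from \<open>z\<close> to \<open>b\<close> passes through \<open>c\<close>. Both
  the time to reach \<open>c\<close> and the time left from there to \<open>b\<close> are shorter
  than \<open>h\<close>, and the strong Markov property at \<open>c\<close> makes the two bounds
  multiply.\<close>

lemma hit_prob_chain: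
  assumes z: "z \<in> E" and h: "0 \<le> h" and c: "(z \<le> c \<and> c \<le> b) \<or> (b \<le> c \<and> c \<le> z)"
  shows "hit_prob z b h \<le> hit_prob z c h * hit_prob c b h"
proof -
  define B where "B = {\<omega> \<in> space (path_space E). hitting_time b \<omega> < ennreal h}"
  have B: "B \<in> sets (path_space E)" unfolding B_def by measurable
  define D where "D = {\<omega> \<in> space (path_space E). hitting_time c \<omega> < ennreal h \<and>
      path_shift (enn2real (hitting_time c \<omega>)) \<omega> \<in> B}"
  have eq: "emeasure (P z) D = hit_prob z c h * emeasure (P c) B"
    unfolding D_def by (rule strong_markov_hitting[OF z h B])
  have True: "D \<in> sets (P z)"
  proof -
    define \<tau> where "\<tau> = (\<lambda>\<omega>. enn2real (hitting_time c \<omega>))"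
    have "(\<lambda>\<omega>. path_shift (\<tau> \<omega>) \<omega>) \<in> path_space E \<rightarrow>\<^sub>M path_space E"
      by (rule measurable_path_shift_random) (auto simp: \<tau>_def)
    from measurable_sets[OF this B]
    have "((\<lambda>\<omega>. path_shift (\<tau> \<omega>) \<omega>) -` B \<inter> space (path_space E)) \<inter>
       {\<omega> \<in> space (path_space E). hitting_time c \<omega> < ennreal h} \<in> sets (path_space E)" by (rule sets.Int) measurable
    also have "((\<lambda>\<omega>. path_shift (\<tau> \<omega>) \<omega>) -` B \<inter> space (path_space E)) \<inter>
       {\<omega> \<in> space (path_space E). hitting_time c \<omega> < ennreal h} = D"
      by (auto simp: D_def \<tau>_def)
    finally show ?thesis using sets_P[OF z] by simp
  qed
  show ?thesis
  proof -
    have "hit_prob z b h \<le> emeasure (P z) D"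
    proof (rule emeasure_mono_AE[OF _ True])
      show "AE \<omega> in P z. \<omega> \<in> {\<omega> \<in> space (path_space E). hitting_time b \<omega> < ennreal h} \<longrightarrow> \<omega> \<in> D"
        using start_AE[OF z]
      proof (eventually_elim, intro impI)
        fix \<omega> assume w: "\<omega> \<in> space (path_space E) \<and> \<omega> 0 = z" and "\<omega> \<in> {\<omega> \<in> space (path_space E). hitting_time b \<omega> < ennreal h}"
        then obtain u where u: "0 \<le> u" "u < h" "\<omega> u = b" using hitting_time_less_iff[OF h] by auto
        obtain r where r: "0 \<le> r" "r \<le> u" "\<omega> r = c" using path_ivt[of \<omega> E 0 u c] w u c by auto
        have lt: "hitting_time c \<omega> < ennreal h" using r u hitting_time_less_iff[OF h] by force
        then have fin: "hitting_time c \<omega> < \<infinity>" using hitting_time_finite_iff r by auto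
        define T where "T = enn2real (hitting_time c \<omega>)"
        note att = hitting_time_attained[OF conjunct1[OF w] fin, folded T_def]
        have T0: "0 \<le> T" by (simp add: T_def)
        have "T \<le> u" using att(3)[OF r(1)] r by force
        then have "hitting_time b (path_shift T \<omega>) < ennreal h"
          unfolding hitting_time_less_iff[OF h] using u T0 by (intro exI[of _ "u - T"]) (auto simp: path_shift_apply)
        then show "\<omega> \<in> D" using w lt path_shift_in_space[OF conjunct1[OF w] T0] by (auto simp: D_def B_def T_def)
      qed
    qed
    then show ?thesis using eq by (simp add: B_def)
  qed
qed

lemma hit_prob_le_1: "z \<in> E \<Longrightarrow> hit_prob z c h \<le> 1"
  using prob_space.emeasure_le_1[OF P_prob_space] .

lemma hit_prob_closer:
  assumes z: "z \<in> E" and cE: "c \<in> E" and h: "0 \<le> h" and c: "(z \<le> c \<and> c \<le> b) \<or> (b \<le> c \<and> c \<le> z)"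
  shows "hit_prob z b h \<le> hit_prob c b h"
proof -
  have "hit_prob z b h \<le> hit_prob z c h * hit_prob c b h" by (rule hit_prob_chain[OF z h c])
  also have "\<dots> \<le> 1 * hit_prob c b h" by (intro mult_right_mono hit_prob_le_1 z) auto
  finally show ?thesis by simp
qed

section \<open>Scale function, Green kernel and mean exit times\<close>

lemma scale_differentiable: "l < ereal x \<Longrightarrow> (s has_real_derivative deriv s x) (at x)"
  using scale_C2 unfolding C2_on_def by (auto simp: DERIV_deriv_iff_field_differentiable)

lemma scale_deriv_differentiable: "l < ereal x \<Longrightarrow> (deriv s has_real_derivative deriv (deriv s) x) (at x)"
  using scale_C2 unfolding C2_on_def C1_on_def by (auto simp: DERIV_deriv_iff_field_differentiable)

lemma scale_deriv2_continuous: "continuous_on {x. l < ereal x} (deriv (deriv s))"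
  using scale_C2 unfolding C2_on_def C1_on_def by auto

lemma scale_deriv_continuous: "continuous_on {x. l < ereal x} (deriv s)"
  using scale_deriv_differentiable by (intro continuous_at_imp_continuous_on) (auto intro: DERIV_isCont)

lemma scale_continuous: "continuous_on {x. l < ereal x} s"
  using scale_differentiable by (intro continuous_at_imp_continuous_on) (auto intro: DERIV_isCont)

lemma l_less_trans: "l < ereal a \<Longrightarrow> a \<le> b \<Longrightarrow> l < ereal b"
  by (meson ereal_less_eq(3) less_le_trans)

lemma scale_less: "l < ereal a \<Longrightarrow> a < b \<Longrightarrow> s a < s b"
  by (rule DERIV_pos_imp_increasing) (auto intro!: exI scale_differentiable scale_deriv_pos intro: l_less_trans)

lemma scale_le: "l < ereal a \<Longrightarrow> a \<le> b \<Longrightarrow> s a \<le> s b"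
  using scale_less[of a b] by (cases "a = b") auto

text \<open>The Green function in scale coordinates: as a function of \<open>p\<close> it is
  piecewise linear with slopes \<open>(\<beta> - w) / (\<beta> - \<alpha>)\<close> and
  \<open>- (w - \<alpha>) / (\<beta> - \<alpha>)\<close>, both at most 1 in absolute value. If the
  kink \<open>w\<close> separates the two points, the estimate is chained through
  \<open>w\<close>.\<close>

lemma green_kernel_lipschitz:
  fixes \<alpha> \<beta> p p' w :: real
  assumes "\<alpha> < \<beta>" "\<alpha> \<le> p" "p \<le> p'" "p' \<le> \<beta>" "\<alpha> \<le> w" "w \<le> \<beta>"
  shows "\<bar>(min p w - \<alpha>) * (\<beta> - max p w) / (\<beta> - \<alpha>) - (min p' w - \<alpha>) * (\<beta> - max p' w) / (\<beta> - \<alpha>)\<bar> \<le> p' - p"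
proof -
  have 1: "\<bar>(min p w - \<alpha>) * (\<beta> - max p w) - (min p' w - \<alpha>) * (\<beta> - max p' w)\<bar> \<le> (p' - p) * (\<beta> - \<alpha>)"
    if "\<alpha> \<le> p" "p \<le> p'" "p' \<le> \<beta>" "p' \<le> w \<or> w \<le> p" for p p'
    using that(4)
  proof
    assume "p' \<le> w"
    then have "(min p w - \<alpha>) * (\<beta> - max p w) - (min p' w - \<alpha>) * (\<beta> - max p' w) = - ((p' - p) * (\<beta> - w))"
      using that by (simp add: algebra_simps)
    moreover have "0 \<le> (p' - p) * (\<beta> - w)" using that assms by simp
    moreover have "(p' - p) * (\<beta> - w) \<le> (p' - p) * (\<beta> - \<alpha>)" using that assms by (intro mult_left_mono) auto
    ultimately show ?thesis by linarith
  next
    assume "w \<le> p"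
    then have "(min p w - \<alpha>) * (\<beta> - max p w) - (min p' w - \<alpha>) * (\<beta> - max p' w) = (p' - p) * (w - \<alpha>)"
      using that by (simp add: algebra_simps)
    moreover have "0 \<le> (p' - p) * (w - \<alpha>)" using that assms by simp
    moreover have "(p' - p) * (w - \<alpha>) \<le> (p' - p) * (\<beta> - \<alpha>)" using that assms by (intro mult_left_mono) auto
    ultimately show ?thesis by linarith
  qed
  have "\<bar>(min p w - \<alpha>) * (\<beta> - max p w) - (min p' w - \<alpha>) * (\<beta> - max p' w)\<bar> \<le> (p' - p) * (\<beta> - \<alpha>)"
  proof (cases "p' \<le> w \<or> w \<le> p")
    case True
    then show ?thesis using 1 assms by auto
  next
    case False
    have "\<bar>(min p w - \<alpha>) * (\<beta> - max p w) - (min w w - \<alpha>) * (\<beta> - max w w)\<bar> \<le> (w - p) * (\<beta> - \<alpha>)"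
      "\<bar>(min w w - \<alpha>) * (\<beta> - max w w) - (min p' w - \<alpha>) * (\<beta> - max p' w)\<bar> \<le> (p' - w) * (\<beta> - \<alpha>)"
      using 1[of p w] 1[of w p'] assms False by auto
    moreover have "(w - p) * (\<beta> - \<alpha>) + (p' - w) * (\<beta> - \<alpha>) = (p' - p) * (\<beta> - \<alpha>)" by algebra
    ultimately show ?thesis by linarith
  qed
  then have "\<bar>(min p w - \<alpha>) * (\<beta> - max p w) - (min p' w - \<alpha>) * (\<beta> - max p' w)\<bar> / (\<beta> - \<alpha>) \<le> p' - p"
    using assms by (simp add: pos_divide_le_eq)
  then show ?thesis using assms by (simp add: diff_divide_distrib[symmetric] abs_divide)
qed

lemma green_eq:
  assumes "l < ereal a" "a \<le> z" "a \<le> y"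
  shows "green_function s a b z y = (min (s z) (s y) - s a) * (s b - max (s z) (s y)) / (s b - s a)"
proof -
  have "l < ereal z" "l < ereal y" using assms l_less_trans by blast+
  then have "s (min z y) = min (s z) (s y)" "s (max z y) = max (s z) (s y)"
    using scale_le[of z y] scale_le[of y z] by (auto simp: min_def max_def intro: antisym)
  then show ?thesis by (simp add: green_function_def)
qed

lemma green_bounds:
  assumes "l < ereal a" "a < b" "a \<le> z" "a \<le> y" "z \<le> b" "y \<le> b"
  shows "0 \<le> green_function s a b z y" "green_function s a b z y \<le> s b - s a"
proof -
  have lz: "l < ereal z" "l < ereal y" using assms l_less_trans by blast+
  have m: "s a \<le> s z" "s a \<le> s y" "s z \<le> s b" "s y \<le> s b" "s a < s b"
    using scale_le[OF assms(1)] scale_le[OF lz(1)] scale_le[OF lz(2)] scale_less[OF assms(1)] assms by auto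
  have e: "green_function s a b z y = (min (s z) (s y) - s a) * (s b - max (s z) (s y)) / (s b - s a)"
    using green_eq assms by blast
  show "0 \<le> green_function s a b z y" unfolding e using m by (intro divide_nonneg_pos mult_nonneg_nonneg) auto
  have "(min (s z) (s y) - s a) * (s b - max (s z) (s y)) \<le> (s b - s a) * (s b - s a)"
    using m by (intro mult_mono) auto
  then show "green_function s a b z y \<le> s b - s a" unfolding e using m by (simp add: pos_divide_le_eq)
qed

lemma green_integrable:
  assumes ab: "l < ereal a" "a < b" and z: "a \<le> z" "z \<le> b"
  shows "set_integrable lborel {a<..<b} (\<lambda>y. green_function s a b z y * \<rho> y)"
proof -
  have r: "set_integrable lborel {a<..<b} \<rho>"
    by (rule set_integrable_subset[OF speed_density_integrable[OF ab(1), of b]]) auto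
  have "continuous_on {a<..<b} (\<lambda>y. s (min z y))" "continuous_on {a<..<b} (\<lambda>y. s (max z y))"
    by (rule continuous_on_compose2[OF scale_continuous continuous_on_min[OF continuous_on_const continuous_on_id]],
        use ab z l_less_trans[OF ab(1)] in \<open>auto simp: min_def\<close>)
      (rule continuous_on_compose2[OF scale_continuous continuous_on_max[OF continuous_on_const continuous_on_id]],
        use ab z l_less_trans[OF ab(1)] in \<open>auto simp: max_def\<close>)
  then have "continuous_on {a<..<b} (\<lambda>y. green_function s a b z y)"
    unfolding green_function_def using scale_less[OF ab] by (intro continuous_intros) auto
  then have gm: "(\<lambda>y. indicator {a<..<b} y *\<^sub>R green_function s a b z y) \<in> borel_measurable lborel"
    using borel_measurable_continuous_on_indicator[of "{a<..<b}" "green_function s a b z"] by simp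
  have "integrable lborel (\<lambda>y. (indicator {a<..<b} y *\<^sub>R green_function s a b z y) * (indicator {a<..<b} y *\<^sub>R \<rho> y))"
  proof (rule Bochner_Integration.integrable_bound[where f = "\<lambda>y. (s b - s a) * (indicator {a<..<b} y *\<^sub>R \<rho> y)"])
    show "integrable lborel (\<lambda>y. (s b - s a) * (indicator {a<..<b} y *\<^sub>R \<rho> y))"
      using r unfolding set_integrable_def by (rule integrable_mult_right)
    show "(\<lambda>y. indicator {a<..<b} y *\<^sub>R green_function s a b z y * (indicator {a<..<b} y *\<^sub>R \<rho> y)) \<in> borel_measurable lborel"
      using gm r unfolding set_integrable_def by (intro borel_measurable_times) auto
    show "AE y in lborel. norm (indicator {a<..<b} y *\<^sub>R green_function s a b z y * (indicator {a<..<b} y *\<^sub>R \<rho> y))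
        \<le> norm ((s b - s a) * (indicator {a<..<b} y *\<^sub>R \<rho> y))"
      using green_bounds[OF ab z(1) _ z(2)] scale_less[OF ab]
      by (intro AE_I2) (auto simp: indicator_def abs_mult intro!: mult_right_mono)
  qed
  then show ?thesis unfolding set_integrable_def
    by (rule Bochner_Integration.integrable_cong[THEN iffD1, rotated 2]) (auto simp: indicator_def)
qed

text \<open>Defined from the Green function rather than as an expectation, so that it is also given,
  and equal to 0, at the end points \<open>a\<close> and \<open>b\<close>, and its continuity can be
  read off the kernel.\<close>

definition mean_exit :: "real \<Rightarrow> real \<Rightarrow> real \<Rightarrow> real" where
  "mean_exit a b z = (LINT y:{a<..<b}|lborel. green_function s a b z y * \<rho> y)"

lemma mean_exit_speed:
  assumes "l < ereal a" "a < z" "z < b"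
  shows "(\<integral>\<^sup>+\<omega>. min (hitting_time a \<omega>) (hitting_time b \<omega>) \<partial>P z) = ennreal (mean_exit a b z)"
proof -
  have nn: "0 \<le> green_function s a b z y * \<rho> y" if "y \<in> {a<..<b}" for y
    using that assms green_bounds(1)[of a b z y] speed_density_pos[of y] l_less_trans[of a y] by auto
  have "(\<integral>\<^sup>+y\<in>{a<..<b}. ennreal (green_function s a b z y * \<rho> y) \<partial>lborel) =
    (\<integral>\<^sup>+y. ennreal (indicator {a<..<b} y *\<^sub>R (green_function s a b z y * \<rho> y)) \<partial>lborel)"
    by (intro nn_integral_cong) (auto simp: indicator_def)
  also have "\<dots> = ennreal (mean_exit a b z)"
    unfolding mean_exit_def set_lebesgue_integral_def
    using green_integrable[of a b z] assms nn unfolding set_integrable_def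
    by (intro nn_integral_eq_integral) (auto simp: indicator_def)
  finally show ?thesis using speed[OF assms] by simp
qed

text \<open>The kernel is Lipschitz in the scale with constant 1, so the integral is Lipschitz in
  the scale with the speed mass of the interval as constant.\<close>

lemma mean_exit_lipschitz:
  assumes ab: "l < ereal a" "a < b" and z: "a \<le> z" "z \<le> z'" "z' \<le> b"
  shows "\<bar>mean_exit a b z - mean_exit a b z'\<bar> \<le> (s z' - s z) * (LINT y:{a<..<b}|lborel. \<rho> y)"
proof -
  have r: "set_integrable lborel {a<..<b} \<rho>"
    by (rule set_integrable_subset[OF speed_density_integrable[OF ab(1), of b]]) auto
  have i: "set_integrable lborel {a<..<b} (\<lambda>y. green_function s a b z y * \<rho> y)"
    "set_integrable lborel {a<..<b} (\<lambda>y. green_function s a b z' y * \<rho> y)"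
    using green_integrable[OF ab, of z] green_integrable[OF ab, of z'] z by auto
  have b: "\<bar>green_function s a b z y * \<rho> y - green_function s a b z' y * \<rho> y\<bar> \<le> (s z' - s z) * \<rho> y" if y: "y \<in> {a<..<b}" for y
  proof -
    have ly: "l < ereal y" "l < ereal z" "l < ereal z'" using l_less_trans[OF ab(1)] y z by auto
    have "s a < s b" "s a \<le> s z" "s z \<le> s z'" "s z' \<le> s b" "s a \<le> s y" "s y \<le> s b"
      using scale_less[OF ab] scale_le[OF ab(1), of z] scale_le[OF ab(1), of y] scale_le[OF ly(1), of b]
        scale_le[OF ly(2), of z'] scale_le[OF ly(3), of b] y z by auto
    from green_kernel_lipschitz[OF this]
    have "\<bar>green_function s a b z y - green_function s a b z' y\<bar> \<le> s z' - s z"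
      using green_eq[OF ab(1), of z y b] green_eq[OF ab(1), of z' y b] y z by auto
    then have "\<bar>green_function s a b z y - green_function s a b z' y\<bar> * \<rho> y \<le> (s z' - s z) * \<rho> y"
      using speed_density_pos[OF ly(1)] by (intro mult_right_mono) auto
    moreover have "\<bar>green_function s a b z y * \<rho> y - green_function s a b z' y * \<rho> y\<bar> = \<bar>green_function s a b z y - green_function s a b z' y\<bar> * \<rho> y"
      using speed_density_pos[OF ly(1)] by (simp add: left_diff_distrib[symmetric] abs_mult)
    ultimately show ?thesis by simp
  qed
  have "mean_exit a b z - mean_exit a b z' = (LINT y:{a<..<b}|lborel. green_function s a b z y * \<rho> y - green_function s a b z' y * \<rho> y)"
    unfolding mean_exit_def using set_integral_diff(2)[OF i] by simp
  then have "\<bar>mean_exit a b z - mean_exit a b z'\<bar> \<le> (LINT y:{a<..<b}|lborel. \<bar>green_function s a b z y * \<rho> y - green_function s a b z' y * \<rho> y\<bar>)"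
    using set_integral_norm_bound[OF set_integral_diff(1)[OF i]] unfolding real_norm_def by simp
  also have "\<dots> \<le> (LINT y:{a<..<b}|lborel. (s z' - s z) * \<rho> y)"
  proof (rule set_integral_mono)
    show "set_integrable lborel {a<..<b} (\<lambda>y. \<bar>green_function s a b z y * \<rho> y - green_function s a b z' y * \<rho> y\<bar>)"
      using set_integrable_abs[OF set_integral_diff(1)[OF i]] .
    show "set_integrable lborel {a<..<b} (\<lambda>y. (s z' - s z) * \<rho> y)"
      using r by (rule set_integrable_mult_right)
  qed (rule b)
  finally show ?thesis by (simp only: set_integral_mult_right)
qed

text \<open>A continuous function on \<open>[a, b]\<close> that is zero at the ends and positive at
  the midpoint attains its maximum inside.\<close>

lemma mean_exit_max:
  assumes ab: "l < ereal a" "a < b"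
  shows "\<exists>c. a < c \<and> c < b \<and> 0 < mean_exit a b c \<and> (\<forall>z. a \<le> z \<and> z \<le> b \<longrightarrow> mean_exit a b z \<le> mean_exit a b c)"
proof -
  define M where "M = (LINT y:{a<..<b}|lborel. \<rho> y)"
  have "continuous_on {a..b} (mean_exit a b)"
  unfolding continuous_on_def
  proof
    fix z assume z: "z \<in> {a..b}"
    have sc: "(s \<longlongrightarrow> s z) (at z within {a..b})"
    proof -
      have "{a..b} \<subseteq> {x. l < ereal x}" using l_less_trans[OF ab(1)] by auto
      from continuous_on_subset[OF scale_continuous this] z show ?thesis unfolding continuous_on_def by blast
    qed
    have "((\<lambda>w. mean_exit a b w - mean_exit a b z) \<longlongrightarrow> 0) (at z within {a..b})"
    proof (rule Lim_null_comparison)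
      show "\<forall>\<^sub>F w in at z within {a..b}. norm (mean_exit a b w - mean_exit a b z) \<le> \<bar>s w - s z\<bar> * M"
        unfolding eventually_at_filter
      proof (intro always_eventually allI impI)
        fix w assume w: "w \<in> {a..b}"
        have "l < ereal w" "l < ereal z" using w z l_less_trans[OF ab(1)] by auto
        then have sw: "w \<le> z \<Longrightarrow> s w \<le> s z" "z \<le> w \<Longrightarrow> s z \<le> s w" using scale_le by auto
        show "norm (mean_exit a b w - mean_exit a b z) \<le> \<bar>s w - s z\<bar> * M"
        proof (cases "w \<le> z")
          case True
          then show ?thesis using mean_exit_lipschitz[OF ab, of w z] w z sw by (simp add: M_def abs_minus_commute)
        next
          case False
          then show ?thesis using mean_exit_lipschitz[OF ab, of z w] w z sw by (simp add: M_def abs_minus_commute)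
        qed
      qed
      have "((\<lambda>w. \<bar>s w - s z\<bar> * M) \<longlongrightarrow> \<bar>s z - s z\<bar> * M) (at z within {a..b})"
        by (intro tendsto_intros sc)
      then show "((\<lambda>w. \<bar>s w - s z\<bar> * M) \<longlongrightarrow> 0) (at z within {a..b})" by simp
    qed
    then show "(mean_exit a b \<longlongrightarrow> mean_exit a b z) (at z within {a..b})" by (rule LIM_zero_cancel)
  qed
  then obtain c where c: "a \<le> c" "c \<le> b" "\<And>z. a \<le> z \<Longrightarrow> z \<le> b \<Longrightarrow> mean_exit a b z \<le> mean_exit a b c"
    using continuous_attains_sup[of "{a..b}" "mean_exit a b"] ab by (metis atLeastAtMost_iff compact_Icc empty_iff less_imp_le order_refl)
  have ends: "mean_exit a b a = 0" "mean_exit a b b = 0"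
  proof -
    have "green_function s a b a y * \<rho> y = 0" "green_function s a b b y * \<rho> y = 0" if "y \<in> {a<..<b}" for y
      using that by (auto simp: green_function_def min_def max_def)
    then show "mean_exit a b a = 0" "mean_exit a b b = 0"
      unfolding mean_exit_def set_lebesgue_integral_def by (intro integral_eq_zero_AE AE_I2; simp add: indicator_def)+
  qed
  \<comment> \<open>If the mean were zero, almost every path from the midpoint would be at
    \<open>a\<close> or \<open>b\<close> at time 0.\<close>
  have pos: "0 < mean_exit a b ((a + b) / 2)"
  proof -
    define z where "z = (a + b) / 2"
    have z: "a < z" "z < b" using ab by (auto simp: z_def)
    have zE: "z \<in> E" using in_E l_less_trans[OF ab(1)] z by auto
    have "(\<integral>\<^sup>+\<omega>. min (hitting_time a \<omega>) (hitting_time b \<omega>) \<partial>P z) \<noteq> 0"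
    proof
      assume "(\<integral>\<^sup>+\<omega>. min (hitting_time a \<omega>) (hitting_time b \<omega>) \<partial>P z) = 0"
      then have "AE \<omega> in P z. min (hitting_time a \<omega>) (hitting_time b \<omega>) = 0"
        by (rule nn_integral_0_iff_AE[THEN iffD1, rotated]) (unfold measurable_P_iff[OF zE], measurable)
      then have "AE \<omega> in P z. False" using start_AE[OF zE]
      proof eventually_elim
        fix \<omega> assume m: "min (hitting_time a \<omega>) (hitting_time b \<omega>) = 0" and w: "\<omega> \<in> space (path_space E) \<and> \<omega> 0 = z"
        show False
        proof (cases "hitting_time a \<omega> = 0")
          case True
          then show ?thesis using hitting_time_attained(1)[OF conjunct1[OF w], of a] w z by simp
        next
          case False
          then have "hitting_time b \<omega> = 0" using m by (auto simp: min_def split: if_splits)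
          then show ?thesis using hitting_time_attained(1)[OF conjunct1[OF w], of b] w z by simp
        qed
      qed
      then show False using prob_space.AE_False[OF P_prob_space[OF zE]] by simp
    qed
    then have "ennreal (mean_exit a b z) \<noteq> 0" using mean_exit_speed[OF ab(1) z] by simp
    then show ?thesis unfolding z_def by (simp add: ennreal_eq_0_iff)
  qed
  moreover have "mean_exit a b ((a + b) / 2) \<le> mean_exit a b c" using c(3) ab by simp
  ultimately have "0 < mean_exit a b c" by simp
  moreover from this have "a \<noteq> c" "c \<noteq> b" using ends by auto
  ultimately show ?thesis using c by (intro exI[of _ c]) auto
qed

text \<open>At a maximum point \<open>c\<close> of the mean exit time \<open>v\<close>, the Markov property at time \<open>h\<close> gives
  \<open>v c \<le> h + v c * P\<^sub>c(no exit before h)\<close>.\<close>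

lemma exit_small:
  assumes ab: "l < ereal a" "a < b"
  shows "\<exists>c C. a < c \<and> c < b \<and> 0 \<le> C \<and> (\<forall>h>0. hit_prob c a h \<le> ennreal (C * h) \<and> hit_prob c b h \<le> ennreal (C * h))"
proof -
  obtain c where c: "a < c" "c < b" "0 < mean_exit a b c" "\<And>z. a \<le> z \<Longrightarrow> z \<le> b \<Longrightarrow> mean_exit a b z \<le> mean_exit a b c"
    using mean_exit_max[OF ab] by auto
  define V where "V = mean_exit a b c"
  have cE: "c \<in> E" and aE: "a \<in> E" and bE: "b \<in> E" using in_E l_less_trans[OF ab(1)] c ab by auto
  interpret prob_space "P c" by (rule P_prob_space[OF cE])
  let ?T = "\<lambda>\<omega>. min (hitting_time a \<omega>) (hitting_time b \<omega>)"
  have T: "?T \<in> borel_measurable (path_space E)" by measurable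
  have "hit_prob c a h \<le> ennreal (1 / V * h) \<and> hit_prob c b h \<le> ennreal (1 / V * h)" if h: "0 < h" for h
  proof -
    define N where "N = {\<omega> \<in> space (path_space E). ?T \<omega> < ennreal h}"
    define A where "A = space (path_space E) - N"
    have "N = {\<omega> \<in> space (path_space E). hitting_time a \<omega> < ennreal h} \<union> {\<omega> \<in> space (path_space E). hitting_time b \<omega> < ennreal h}"
      by (auto simp: N_def min_less_iff_disj)
    then have NF: "N \<in> sets (path_filtration E h)" using hitting_time_stopping[of h E] h by auto
    then have AF: "A \<in> sets (path_filtration E h)" unfolding A_def using sets.compl_sets[OF NF] by simp
    have Ns: "N \<in> sets (P c)" using NF path_filtration_subset sets_P[OF cE] by auto
    have As: "A \<in> sets (P c)" using AF path_filtration_subset sets_P[OF cE] by auto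
    have "ennreal V = (\<integral>\<^sup>+\<omega>. ?T \<omega> \<partial>P c)" unfolding V_def using mean_exit_speed[OF ab(1) c(1,2)] by simp
    \<comment> \<open>An exit before \<open>h\<close> costs less than \<open>h\<close>; otherwise
      the exit time is at most \<open>h\<close> plus the exit time of the shifted path.\<close>
    also have "\<dots> \<le> (\<integral>\<^sup>+\<omega>. (ennreal h + ?T (path_shift h \<omega>) * indicator A \<omega>) \<partial>P c)"
    proof (rule nn_integral_mono)
      fix \<omega> assume "\<omega> \<in> space (P c)"
      then have w: "\<omega> \<in> space (path_space E)" using space_P[OF cE] by simp
      show "?T \<omega> \<le> ennreal h + ?T (path_shift h \<omega>) * indicator A \<omega>"
      proof (cases "\<omega> \<in> A")
        case True
        have "hitting_time a \<omega> \<le> ennreal h + hitting_time a (path_shift h \<omega>)" "hitting_time b \<omega> \<le> ennreal h + hitting_time b (path_shift h \<omega>)"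
          using hitting_time_shift h by auto
        then show ?thesis using True by (auto simp: min_def intro: order_trans)
      next
        case False
        then have "?T \<omega> < ennreal h" using w by (auto simp: A_def N_def)
        then show ?thesis using False by simp
      qed
    qed
    also have "\<dots> = ennreal h + (\<integral>\<^sup>+\<omega>\<in>A. ?T (path_shift h \<omega>) \<partial>P c)"
    proof (subst nn_integral_add)
      have "(\<lambda>\<omega>. ?T (path_shift h \<omega>)) \<in> borel_measurable (P c)"
        unfolding measurable_P_iff[OF cE] using measurable_compose[OF measurable_path_shift T, of h] h by simp
      then show "(\<lambda>\<omega>. ?T (path_shift h \<omega>) * indicator A \<omega>) \<in> borel_measurable (P c)" using As by measurable
    qed (simp_all add: emeasure_space_1)
    also have "(\<integral>\<^sup>+\<omega>\<in>A. ?T (path_shift h \<omega>) \<partial>P c) = (\<integral>\<^sup>+\<omega>\<in>A. (\<integral>\<^sup>+\<omega>'. ?T \<omega>' \<partial>P (\<omega> h)) \<partial>P c)"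
      using markov_fixed_nn[OF cE _ AF T] h by simp
    \<comment> \<open>Without an exit before \<open>h\<close> the path is in \<open>[a, b]\<close>
      at time \<open>h\<close>, and from there the mean exit time is at most its maximum
      \<open>V\<close>.\<close>
    also have "\<dots> \<le> (\<integral>\<^sup>+\<omega>. ennreal V * indicator A \<omega> \<partial>P c)"
    proof (rule nn_integral_mono_AE)
      show "AE \<omega> in P c. (\<integral>\<^sup>+\<omega>'. ?T \<omega>' \<partial>P (\<omega> h)) * indicator A \<omega> \<le> ennreal V * indicator A \<omega>"
        using start_AE[OF cE]
      proof eventually_elim
        fix \<omega> assume w: "\<omega> \<in> space (path_space E) \<and> \<omega> 0 = c"
        have *: "(\<integral>\<^sup>+\<omega>'. ?T \<omega>' \<partial>P (\<omega> h)) \<le> ennreal V" if "\<omega> \<in> A"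
        proof -
          have nh: "\<omega> u \<noteq> a \<and> \<omega> u \<noteq> b" if "0 \<le> u" "u < h" for u
          proof -
            have "\<not> hitting_time a \<omega> < ennreal h" "\<not> hitting_time b \<omega> < ennreal h"
              using \<open>\<omega> \<in> A\<close> by (auto simp: A_def N_def min_less_iff_disj)
            then show ?thesis using hitting_time_less_iff[of h] h that by auto
          qed
          have "a \<le> \<omega> h"
          proof (rule ccontr)
            assume "\<not> a \<le> \<omega> h"
            then obtain r where "0 \<le> r" "r \<le> h" "\<omega> r = a" using path_ivt[OF conjunct1[OF w], of 0 h a] h w c by auto
            then show False using nh[of r] \<open>\<not> a \<le> \<omega> h\<close> by (cases "r = h") auto
          qed
          moreover have "\<omega> h \<le> b"
          proof (rule ccontr)
            assume "\<not> \<omega> h \<le> b"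
            then obtain r where "0 \<le> r" "r \<le> h" "\<omega> r = b" using path_ivt[OF conjunct1[OF w], of 0 h b] h w c by auto
            then show False using nh[of r] \<open>\<not> \<omega> h \<le> b\<close> by (cases "r = h") auto
          qed
          \<comment> \<open>Excluding hits strictly before \<open>h\<close> leaves the possibility
            of being at an end point exactly at time \<open>h\<close>; the remaining exit time is
            then 0.\<close>
          ultimately consider "a < \<omega> h" "\<omega> h < b" | "\<omega> h = a" | "\<omega> h = b" by linarith
          then show ?thesis
          proof cases
            case 1
            then show ?thesis using mean_exit_speed[OF ab(1) 1] c(4)[of "\<omega> h"] by (simp add: V_def ennreal_leI)
          next
            case 2
            have "(\<integral>\<^sup>+\<omega>'. ?T \<omega>' \<partial>P a) = (\<integral>\<^sup>+\<omega>'. 0 \<partial>P a)"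
              by (rule nn_integral_cong_AE) (use start[OF aE] in eventually_elim, simp add: hitting_time_start)
            then show ?thesis using 2 by simp
          next
            case 3
            have "(\<integral>\<^sup>+\<omega>'. ?T \<omega>' \<partial>P b) = (\<integral>\<^sup>+\<omega>'. 0 \<partial>P b)"
              by (rule nn_integral_cong_AE) (use start[OF bE] in eventually_elim, simp add: hitting_time_start)
            then show ?thesis using 3 by simp
          qed
        qed
        then show "(\<integral>\<^sup>+\<omega>'. ?T \<omega>' \<partial>P (\<omega> h)) * indicator A \<omega> \<le> ennreal V * indicator A \<omega>"
          by (auto simp: indicator_def)
      qed
    qed
    also have "\<dots> = ennreal V * emeasure (P c) A" using As by (rule nn_integral_cmult_indicator)
    finally have "ennreal V \<le> ennreal h + ennreal V * emeasure (P c) A" by (auto intro: add_left_mono)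
    then have "ennreal V \<le> ennreal (h + V * measure (P c) A)"
      using c(3) h by (simp add: emeasure_eq_measure ennreal_mult[symmetric] ennreal_plus[symmetric] V_def del: ennreal_plus)
    then have "V \<le> h + V * measure (P c) A" using c(3) h by (subst (asm) ennreal_le_iff) (auto simp: V_def)
    moreover have "measure (P c) A = 1 - measure (P c) N"
      unfolding A_def using prob_compl[OF Ns] space_P[OF cE] by simp
    ultimately have "V * measure (P c) N \<le> h" by (simp add: algebra_simps)
    then have "measure (P c) N \<le> 1 / V * h" using c(3) by (simp add: V_def field_simps)
    then have Nle: "emeasure (P c) N \<le> ennreal (1 / V * h)" by (simp add: emeasure_eq_measure ennreal_leI)
    have "hit_prob c a h \<le> emeasure (P c) N" "hit_prob c b h \<le> emeasure (P c) N"
      using Ns by (auto intro!: emeasure_mono simp: N_def min_less_iff_disj)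
    then show ?thesis using Nle by (auto intro: order_trans)
  qed
  then show ?thesis using c by (intro exI[of _ c] exI[of _ "1 / V"]) (auto simp: V_def)
qed

text \<open>Two disjoint intervals have to be crossed one after the other, each at the cost of a factor \<open>O(h)\<close>.\<close>

lemma crossing_small:
  assumes ab: "l < ereal a" "a < b"
  shows "\<exists>C\<ge>0. \<forall>h>0. \<forall>z\<in>E. (z \<le> a \<longrightarrow> hit_prob z b h \<le> ennreal (C * h\<^sup>2)) \<and> (b \<le> z \<longrightarrow> hit_prob z a h \<le> ennreal (C * h\<^sup>2))"
proof -
  define m where "m = (a + b) / 2"
  have m: "a < m" "m < b" "l < ereal m" using ab l_less_trans[OF ab(1), of "(a + b) / 2"] by (auto simp: m_def)
  obtain c1 C1 where 1: "a < c1" "c1 < m" "0 \<le> C1"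
      "\<And>h. 0 < h \<Longrightarrow> hit_prob c1 a h \<le> ennreal (C1 * h)" "\<And>h. 0 < h \<Longrightarrow> hit_prob c1 m h \<le> ennreal (C1 * h)"
    using exit_small[OF ab(1) m(1)] by blast
  obtain c2 C2 where 2: "m < c2" "c2 < b" "0 \<le> C2"
      "\<And>h. 0 < h \<Longrightarrow> hit_prob c2 m h \<le> ennreal (C2 * h)" "\<And>h. 0 < h \<Longrightarrow> hit_prob c2 b h \<le> ennreal (C2 * h)"
    using exit_small[OF m(3,2)] by blast
  have E: "c1 \<in> E" "c2 \<in> E" "m \<in> E" using in_E l_less_trans[OF ab(1)] 1 2 m by auto
  have sq: "ennreal (C1 * h) * ennreal (C2 * h) = ennreal (C1 * C2 * h\<^sup>2)" if "0 < h" for h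
    using 1 2 that by (simp add: ennreal_mult[symmetric] power2_eq_square mult_ac)
  have "(z \<le> a \<longrightarrow> hit_prob z b h \<le> ennreal (C1 * C2 * h\<^sup>2)) \<and> (b \<le> z \<longrightarrow> hit_prob z a h \<le> ennreal (C1 * C2 * h\<^sup>2))"
    if h: "0 < h" and z: "z \<in> E" for h z
  proof (intro conjI impI)
    assume za: "z \<le> a"
    \<comment> \<open>The way to \<open>m\<close> leads through \<open>c1\<close> and the way from
      \<open>m\<close> to \<open>b\<close> leads through \<open>c2\<close>; starting closer to the
      target only raises the probability, so the bounds at \<open>c1\<close> and \<open>c2\<close>
      apply.\<close>
    have "hit_prob z b h \<le> hit_prob z m h * hit_prob m b h" using h z za m by (intro hit_prob_chain) auto
    also have "\<dots> \<le> hit_prob c1 m h * hit_prob c2 b h" using h z za m 1 2 E by (intro mult_mono hit_prob_closer) auto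
    also have "\<dots> \<le> ennreal (C1 * h) * ennreal (C2 * h)" using 1 2 h by (intro mult_mono) auto
    finally show "hit_prob z b h \<le> ennreal (C1 * C2 * h\<^sup>2)" using sq[OF h] by simp
  next
    assume zb: "b \<le> z"
    have "hit_prob z a h \<le> hit_prob z m h * hit_prob m a h" using h z zb m by (intro hit_prob_chain) auto
    also have "\<dots> \<le> hit_prob c2 m h * hit_prob c1 a h" using h z zb m 1 2 E by (intro mult_mono hit_prob_closer) auto
    also have "\<dots> \<le> ennreal (C2 * h) * ennreal (C1 * h)" using 1 2 h by (intro mult_mono) auto
    finally show "hit_prob z a h \<le> ennreal (C1 * C2 * h\<^sup>2)" using sq[OF h] by (simp add: mult.commute)
  qed
  then show ?thesis using 1 2 by (intro exI[of _ "C1 * C2"]) auto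
qed

section \<open>Transition density and generator\<close>

lemma open_I: "open {x. l < ereal x}"
  by (rule open_Collect_less) (auto intro: continuous_intros)

text \<open>Throughout, the first space variable \<open>y\<close> is differentiated and
  \<open>z\<close> is the starting point, kept last. Symmetry of \<open>q\<close> turns the density
  at \<open>y\<close> of paths started from \<open>z\<close> into this form.\<close>

definition q_t where "q_t t y z = deriv (\<lambda>r. q r y z) t"
definition q_y where "q_y t y z = deriv (\<lambda>w. q t w z) y"
definition q_yy where "q_yy t y z = deriv (deriv (\<lambda>w. q t w z)) y"

lemma q_derivs:
  assumes "0 < t" "l < ereal y" "l < ereal z"
  shows "((\<lambda>r. q r y z) has_real_derivative q_t t y z) (at t)"
    "((\<lambda>w. q t w z) has_real_derivative q_y t y z) (at y)"
    "((\<lambda>w. q_y t w z) has_real_derivative q_yy t y z) (at y)"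
  using transition_density_C122 assms unfolding C122_on_def q_t_def q_y_def q_yy_def
  by (simp_all add: DERIV_deriv_iff_field_differentiable)

lemma q_continuous:
  assumes z: "l < ereal z"
  shows "continuous_on ({0<..} \<times> {x. l < ereal x}) (\<lambda>(t, y). q t y z)"
    "continuous_on ({0<..} \<times> {x. l < ereal x}) (\<lambda>(t, y). q_t t y z)"
    "continuous_on ({0<..} \<times> {x. l < ereal x}) (\<lambda>(t, y). q_y t y z)"
    "continuous_on ({0<..} \<times> {x. l < ereal x}) (\<lambda>(t, y). q_yy t y z)"
proof -
  have m: "continuous_on ({0<..} \<times> {x. l < ereal x}) (\<lambda>(t, y). (t, y, z))"
    unfolding case_prod_beta by (intro continuous_intros)
  have s: "(\<lambda>(t, y). (t, y, z)) ` ({0<..} \<times> {x. l < ereal x}) \<subseteq> {0<..} \<times> {x. l < ereal x} \<times> {x. l < ereal x}"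
    using z by auto
  note c = transition_density_C122[unfolded C122_on_def, THEN conjunct2]
  have 1: "continuous_on ({0<..} \<times> {x. l < ereal x} \<times> {x. l < ereal x}) (\<lambda>(t, x, y). q t x y)"
    and 2: "continuous_on ({0<..} \<times> {x. l < ereal x} \<times> {x. l < ereal x}) (\<lambda>(t, x, y). q_t t x y)"
    and 3: "continuous_on ({0<..} \<times> {x. l < ereal x} \<times> {x. l < ereal x}) (\<lambda>(t, x, y). q_y t x y)"
    and 4: "continuous_on ({0<..} \<times> {x. l < ereal x} \<times> {x. l < ereal x}) (\<lambda>(t, x, y). q_yy t x y)"
    using c unfolding q_t_def q_y_def q_yy_def by blast+
  show "continuous_on ({0<..} \<times> {x. l < ereal x}) (\<lambda>(t, y). q t y z)"
    using continuous_on_compose2[OF 1 m s] by (simp add: case_prod_beta)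
  show "continuous_on ({0<..} \<times> {x. l < ereal x}) (\<lambda>(t, y). q_t t y z)"
    using continuous_on_compose2[OF 2 m s] by (simp add: case_prod_beta)
  show "continuous_on ({0<..} \<times> {x. l < ereal x}) (\<lambda>(t, y). q_y t y z)"
    using continuous_on_compose2[OF 3 m s] by (simp add: case_prod_beta)
  show "continuous_on ({0<..} \<times> {x. l < ereal x}) (\<lambda>(t, y). q_yy t y z)"
    using continuous_on_compose2[OF 4 m s] by (simp add: case_prod_beta)
qed

lemma q_continuous_space:
  assumes "l < ereal z" "0 < t"
  shows "continuous_on {x. l < ereal x} (\<lambda>y. q t y z)" "continuous_on {x. l < ereal x} (\<lambda>y. q_t t y z)"
    "continuous_on {x. l < ereal x} (\<lambda>y. q_y t y z)" "continuous_on {x. l < ereal x} (\<lambda>y. q_yy t y z)"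
proof -
  have m: "continuous_on {x. l < ereal x} (\<lambda>y. (t, y))" by (intro continuous_intros)
  have s: "(\<lambda>y. (t, y)) ` {x. l < ereal x} \<subseteq> {0<..} \<times> {x. l < ereal x}" using assms by auto
  show "continuous_on {x. l < ereal x} (\<lambda>y. q t y z)" using continuous_on_compose2[OF q_continuous(1)[OF assms(1)] m s] by simp
  show "continuous_on {x. l < ereal x} (\<lambda>y. q_t t y z)" using continuous_on_compose2[OF q_continuous(2)[OF assms(1)] m s] by simp
  show "continuous_on {x. l < ereal x} (\<lambda>y. q_y t y z)" using continuous_on_compose2[OF q_continuous(3)[OF assms(1)] m s] by simp
  show "continuous_on {x. l < ereal x} (\<lambda>y. q_yy t y z)" using continuous_on_compose2[OF q_continuous(4)[OF assms(1)] m s] by simp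
qed

lemma q_quotient_derivative:
  assumes "0 < t" "l < ereal y" "l < ereal z"
  shows "((\<lambda>w. q_y t w z / deriv s w) has_real_derivative (q_yy t y z * deriv s y - q_y t y z * deriv (deriv s) y) / (deriv s y * deriv s y)) (at y)"
  using DERIV_divide[OF q_derivs(3)[OF assms] scale_deriv_differentiable[OF assms(2)]] scale_deriv_pos[OF assms(2)] by simp

lemma kolmogorov_y:
  assumes "0 < t" "l < ereal y" "l < ereal z"
  shows "(q_yy t y z * deriv s y - q_y t y z * deriv (deriv s) y) / (deriv s y * deriv s y) = \<rho> y * q_t t y z"
proof -
  have "deriv (\<lambda>w. deriv (\<lambda>w. q t w z) w / deriv s w) y = (q_yy t y z * deriv s y - q_y t y z * deriv (deriv s) y) / (deriv s y * deriv s y)"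
    using DERIV_imp_deriv[OF q_quotient_derivative[OF assms]] unfolding q_y_def .
  moreover have "deriv (\<lambda>w. deriv (\<lambda>w. q t w z) w / deriv s w) y / \<rho> y = q_t t y z"
    using kolmogorov_backward[OF assms] unfolding diffusion_generator_def q_t_def .
  ultimately show ?thesis using speed_density_pos[OF assms(2)] by (metis less_irrefl nonzero_mult_div_cancel_left times_divide_eq_right)
qed

text \<open>The backward equation in divergence form: \<open>q_y / s'\<close> is an antiderivative
  of \<open>\<rho> * q_t\<close>. It converts time derivatives of expectations into boundary terms
  and first space derivatives.\<close>

lemma flux_derivative:
  assumes "0 < t" "l < ereal y" "l < ereal z"
  shows "((\<lambda>w. q_y t w z / deriv s w) has_real_derivative \<rho> y * q_t t y z) (at y)"
  using q_quotient_derivative[OF assms] unfolding kolmogorov_y[OF assms] .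

section \<open>Continuity of the speed density\<close>

lemma path_tendsto_start:
  assumes "\<omega> \<in> space (path_space E)" "v \<longlonglongrightarrow> 0" "\<And>n. 0 \<le> v n"
  shows "(\<lambda>n. \<omega> (v n)) \<longlonglongrightarrow> \<omega> 0"
  using continuous_on_tendsto_compose[OF path_spaceD(1)[OF assms(1)] assms(2)] assms(3) by simp

lemma measurable_coordinate_P: "z \<in> E \<Longrightarrow> 0 \<le> t \<Longrightarrow> (\<lambda>\<omega>. \<omega> t) \<in> borel_measurable (P z)"
  using measurable_coordinate measurable_P_iff by blast

text \<open>If \<open>q\<close> did not depend on time, then, letting \<open>t \<rightarrow> 0\<close>, the path would stay at its starting point.\<close>

lemma q_t_nonzero:
  assumes y: "l < ereal y"
  shows "\<exists>t>0. \<exists>z. l < ereal z \<and> q_t t y z \<noteq> 0"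
proof (rule ccontr)
  assume "\<not> ?thesis"
  then have z0: "\<And>t z. 0 < t \<Longrightarrow> l < ereal z \<Longrightarrow> q_t t y z = 0" by blast
  have const: "q t y z = q 1 y z" if "0 < t" "l < ereal z" for t z
  proof -
    have "((\<lambda>r. q r y z) has_field_derivative 0) (at r within {0<..})" if "r \<in> {0<..}" for r
      using q_derivs(1)[of r y z] z0[of r z] that \<open>l < ereal z\<close> y
      by (auto intro: has_field_derivative_at_within)
    then obtain c where "\<forall>r\<in>{0<..}. q r y z = c"
      using has_field_derivative_zero_constant[of "{0<..}" "\<lambda>r. q r y z"] convex_real_interval by auto
    then show ?thesis using that by simp
  qed
  have yE: "y \<in> E" using in_E y by auto
  interpret prob_space "P y" by (rule P_prob_space[OF yE])
  have mc: "(\<lambda>\<omega>. \<omega> t) \<in> borel_measurable (P y)" if "0 \<le> t" for t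
    using measurable_coordinate[OF that] measurable_P_iff[OF yE] by blast
  have d: "distr (P y) borel (\<lambda>\<omega>. \<omega> t) = distr (P y) borel (\<lambda>\<omega>. \<omega> 1)" if "0 < t" for t
  proof -
    have "(\<lambda>w. ennreal (if l < ereal w then q t y w * \<rho> w else 0)) = (\<lambda>w. ennreal (if l < ereal w then q 1 y w * \<rho> w else 0))"
      using const[OF that] by (intro ext) (auto intro!: arg_cong[where f = ennreal])
    then show ?thesis using transition_density[OF y that] transition_density[OF y, of 1] by simp
  qed
  \<comment> \<open>A bounded distance from \<open>y\<close>, so that its expectation follows the
    continuous path to time 0 by dominated convergence. As the law does not change with time, this
    limit is also the value at every positive time.\<close>
  define g where "g w = min \<bar>w - y\<bar> 1" for w :: real
  have gm: "g \<in> borel_measurable borel" unfolding g_def by measurable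
  have e: "(\<integral>\<omega>. g (\<omega> t) \<partial>P y) = (\<integral>\<omega>. g (\<omega> 1) \<partial>P y)" if "0 < t" for t
    using integral_distr[OF mc[of t] gm] integral_distr[OF mc[of 1] gm] d[OF that] that by simp
  have "(\<lambda>n. \<integral>\<omega>. g (\<omega> (1 / Suc n)) \<partial>P y) \<longlonglongrightarrow> (\<integral>\<omega>. 0 \<partial>P y)"
  proof (rule integral_dominated_convergence[where w = "\<lambda>_. 1"])
    show "(\<lambda>\<omega>. g (\<omega> (1 / Suc n))) \<in> borel_measurable (P y)" for n
      using measurable_compose[OF mc gm] by simp
    show "AE \<omega> in P y. (\<lambda>n. g (\<omega> (1 / Suc n))) \<longlonglongrightarrow> 0"
      using start_AE[OF yE]
    proof eventually_elim
      fix \<omega> assume w: "\<omega> \<in> space (path_space E) \<and> \<omega> 0 = y"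
      have "(\<lambda>n. \<omega> (1 / Suc n)) \<longlonglongrightarrow> \<omega> 0"
        using path_tendsto_start[OF conjunct1[OF w] LIMSEQ_Suc[OF lim_1_over_n]] by simp
      then have "(\<lambda>n. g (\<omega> (1 / Suc n))) \<longlonglongrightarrow> min \<bar>\<omega> 0 - y\<bar> 1"
        unfolding g_def by (intro tendsto_intros)
      then show "(\<lambda>n. g (\<omega> (1 / Suc n))) \<longlonglongrightarrow> 0" using w by simp
    qed
  qed (auto simp: g_def)
  moreover have "(\<integral>\<omega>. g (\<omega> (1 / Suc n)) \<partial>P y) = (\<integral>\<omega>. g (\<omega> 1) \<partial>P y)" for n by (rule e) simp
  ultimately have "(\<lambda>n::nat. (\<integral>\<omega>. g (\<omega> 1) \<partial>P y)) \<longlonglongrightarrow> 0" by simp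
  then have e0: "(\<integral>\<omega>. g (\<omega> 1) \<partial>P y) = 0" by (simp only: LIMSEQ_const_iff)
  have ae: "AE \<omega> in P y. \<omega> t = y" if t: "0 < t" for t
  proof -
    have gi: "integrable (P y) (\<lambda>\<omega>. g (\<omega> t))"
      using measurable_compose[OF mc[of t] gm] t by (intro integrable_const_bound[of _ 1]) (auto simp: g_def)
    have "AE \<omega> in P y. g (\<omega> t) = 0"
      using integral_nonneg_eq_0_iff_AE[OF gi] unfolding e[OF t] e0 by (simp add: g_def)
    then show ?thesis by eventually_elim (auto simp: g_def min_def split: if_splits)
  qed
  \<comment> \<open>The grid of times \<open>k / Suc n\<close> determines the path;
    \<open>k = 0\<close> is covered by the starting point.\<close>
  have all: "AE \<omega> in P y. \<forall>k n :: nat. \<omega> (real k / Suc n) = y"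
    unfolding AE_all_countable
  proof (intro allI)
    fix k n :: nat
    show "AE \<omega> in P y. \<omega> (real k / Suc n) = y"
    proof (cases "k = 0")
      case True
      then show ?thesis using start[OF yE] by simp
    next
      case False
      then show ?thesis by (intro ae) (auto intro: divide_pos_pos)
    qed
  qed
  have "AE \<omega> in P y. \<not> hitting_time (y + 1) \<omega> < \<infinity>"
    using all start_AE[OF yE]
  proof eventually_elim
    fix \<omega> assume k: "\<forall>k n :: nat. \<omega> (real k / Suc n) = y" and w: "\<omega> \<in> space (path_space E) \<and> \<omega> 0 = y"
    show "\<not> hitting_time (y + 1) \<omega> < \<infinity>"
      unfolding hitting_time_finite_iff
    proof
      assume "\<exists>u\<ge>0. \<omega> u = y + 1"
      then obtain u where u: "0 \<le> u" "\<omega> u = y + 1" by blast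
      have "(\<lambda>n. \<omega> (real (nat \<lfloor>real (Suc n) * u\<rfloor>) / Suc n)) \<longlonglongrightarrow> \<omega> u"
        by (rule continuous_on_tendsto_compose[OF path_spaceD(1)[OF conjunct1[OF w]] floor_grid_tendsto[OF u(1)]]) (use u in auto)
      then have "(\<lambda>n::nat. y) \<longlonglongrightarrow> \<omega> u" using k by simp
      then show False using u by (simp add: LIMSEQ_const_iff)
    qed
  qed
  \<comment> \<open>A path that never moves contradicts regularity, by which the level
    \<open>y + 1\<close> is reached with positive probability.\<close>
  then have "emeasure (P y) {\<omega> \<in> space (P y). hitting_time (y + 1) \<omega> < \<infinity>} = 0"
    by (subst (asm) AE_iff_measurable[OF _ refl]) (auto simp: sets_P[OF yE] space_P[OF yE])
  then show False using regular[OF y, of "y + 1"] l_less_trans[OF y, of "y + 1"] by simp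
qed

text \<open>The Kolmogorov equation \<open>\<rho> q\<^sub>t = (q\<^sub>y/s')\<^sub>y\<close> exhibits \<open>\<rho>\<close> as a quotient of continuous functions.\<close>

lemma speed_density_continuous: "continuous_on {x. l < ereal x} \<rho>"
proof (rule continuous_at_imp_continuous_on, intro ballI)
  fix y assume "y \<in> {x. l < ereal x}"
  then have y: "l < ereal y" by simp
  obtain t z where tz: "0 < t" "l < ereal z" "q_t t y z \<noteq> 0" using q_t_nonzero[OF y] by blast
  define N where "N w = (q_yy t w z * deriv s w - q_y t w z * deriv (deriv s) w) / (deriv s w * deriv s w)" for w
  have ev: "\<forall>\<^sub>F w in nhds y. l < ereal w" using eventually_nhds open_I y by blast
  have cq: "isCont (\<lambda>w. q_t t w z) y" "isCont (\<lambda>w. q_y t w z) y" "isCont (\<lambda>w. q_yy t w z) y"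
    "isCont (deriv s) y" "isCont (deriv (deriv s)) y"
    using q_continuous_space[OF tz(2,1)] scale_deriv_continuous scale_deriv2_continuous y open_I
    by (auto simp: continuous_on_eq_continuous_at)
  have "\<forall>\<^sub>F w in nhds y. q_t t w z \<noteq> 0"
  proof -
    have "(\<lambda>w. q_t t w z) \<midarrow>y\<rightarrow> q_t t y z" using cq(1) by (simp add: isCont_def)
    from tendsto_imp_eventually_ne[OF this tz(3)] show ?thesis
      using tz(3) by (auto simp: eventually_at_filter elim!: eventually_mono)
  qed
  with ev have "\<forall>\<^sub>F w in nhds y. \<rho> w = N w / q_t t w z"
  proof eventually_elim
    case (elim w)
    then show ?case unfolding N_def kolmogorov_y[OF tz(1) elim(1) tz(2)] by simp
  qed
  then have "isCont \<rho> y \<longleftrightarrow> isCont (\<lambda>w. N w / q_t t w z) y" by (rule isCont_cong)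
  moreover have "isCont (\<lambda>w. N w / q_t t w z) y"
    unfolding N_def using cq tz(3) scale_deriv_pos[OF y] by (intro continuous_intros) auto
  ultimately show "isCont \<rho> y" by simp
qed

text \<open>The law at a positive time has a density that is zero outside \<open>I\<close>, so even
  a boundary point that belongs to \<open>E\<close> is not charged at a fixed time.\<close>

lemma AE_in_I:
  assumes "l < ereal z" "0 < t"
  shows "AE \<omega> in P z. l < ereal (\<omega> t)"
proof -
  have zE: "z \<in> E" using in_E assms by auto
  have mc: "(\<lambda>\<omega>. \<omega> t) \<in> borel_measurable (P z)"
    using assms by (intro measurable_coordinate_P zE) simp
  have dm: "(\<lambda>y. ennreal (if l < ereal y then q t z y * \<rho> y else 0)) \<in> borel_measurable lborel"
  proof -
    have "continuous_on {x. l < ereal x} (\<lambda>y. q t y z * \<rho> y)"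
      using q_continuous_space(1)[OF assms] speed_density_continuous by (intro continuous_intros)
    from borel_measurable_continuous_on_indicator[OF _ this]
    have "(\<lambda>y. indicator {x. l < ereal x} y *\<^sub>R (q t y z * \<rho> y)) \<in> borel_measurable borel" using open_I by auto
    also have "(\<lambda>y. indicator {x. l < ereal x} y *\<^sub>R (q t y z * \<rho> y)) = (\<lambda>y. if l < ereal y then q t z y * \<rho> y else 0)"
      using transition_density_symmetric[OF assms(2,1)] by (intro ext) (auto simp: indicator_def)
    finally have "(\<lambda>y. if l < ereal y then q t z y * \<rho> y else 0) \<in> borel_measurable borel" .
    from measurable_compose[OF this measurable_ennreal] show ?thesis by simp
  qed
  have "AE y in density lborel (\<lambda>y. ennreal (if l < ereal y then q t z y * \<rho> y else 0)). l < ereal y"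
    using dm by (subst AE_density) auto
  then have "AE y in distr (P z) borel (\<lambda>\<omega>. \<omega> t). l < ereal y" unfolding transition_density[OF assms] .
  then show ?thesis using mc by (subst (asm) AE_distr_iff) (auto intro: borel_open open_I)
qed

text \<open>Expresses an expectation as an integral over a compact interval away from
  \<open>l\<close>, where \<open>q\<close> and \<open>\<rho>\<close> are continuous and the rules of
  calculus apply.\<close>

lemma expectation_density:
  assumes z: "l < ereal z" and t: "0 < t" and L: "l < ereal L"
    and c: "continuous_on {L..R} \<phi>" and out: "\<And>y. y \<notin> {L..R} \<Longrightarrow> \<phi> y = 0"
  shows "(\<integral>\<omega>. \<phi> (\<omega> t) \<partial>P z) = integral {L..R} (\<lambda>y. \<phi> y * q t y z * \<rho> y)"
proof -
  have zE: "z \<in> E" using in_E z by auto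
  have mc: "(\<lambda>\<omega>. \<omega> t) \<in> borel_measurable (P z)"
    using t by (intro measurable_coordinate_P zE) simp
  have sub: "{L..R} \<subseteq> {x. l < ereal x}" using L l_less_trans by auto
  have cq: "continuous_on {L..R} (\<lambda>y. \<phi> y * q t y z * \<rho> y)"
    using continuous_on_subset[OF q_continuous_space(1)[OF z t] sub] continuous_on_subset[OF speed_density_continuous sub] c
    by (intro continuous_intros)
  have phi: "(\<lambda>y. indicator {L..R} y *\<^sub>R \<phi> y) = \<phi>" using out by (intro ext) (auto simp: indicator_def)
  have pm: "\<phi> \<in> borel_measurable borel"
    using borel_measurable_continuous_on_indicator[OF _ c] unfolding phi by auto
  define d where "d y = (if l < ereal y then q t z y * \<rho> y else 0)" for y
  have dI: "d = (\<lambda>y. indicator {x. l < ereal x} y *\<^sub>R (q t y z * \<rho> y))"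
    using transition_density_symmetric[OF t z] by (intro ext) (auto simp: indicator_def d_def)
  have dm: "d \<in> borel_measurable borel"
  proof -
    have "continuous_on {x. l < ereal x} (\<lambda>y. q t y z * \<rho> y)"
      using q_continuous_space(1)[OF z t] speed_density_continuous by (intro continuous_intros)
    from borel_measurable_continuous_on_indicator[OF _ this] show ?thesis unfolding dI using open_I by auto
  qed
  have dn: "0 \<le> d y" for y
    using transition_density_nonneg[OF t z, of y] speed_density_pos[of y] by (auto simp: d_def)
  have "(\<integral>\<omega>. \<phi> (\<omega> t) \<partial>P z) = integral\<^sup>L (distr (P z) borel (\<lambda>\<omega>. \<omega> t)) \<phi>"
    using integral_distr[OF mc pm] by simp
  also have "\<dots> = integral\<^sup>L (density lborel (\<lambda>y. ennreal (d y))) \<phi>"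
    unfolding transition_density[OF z t] d_def ..
  also have "\<dots> = (\<integral>y. d y * \<phi> y \<partial>lborel)"
    using dm pm dn by (subst integral_real_density) auto
  also have "\<dots> = (LINT y:{L..R}|lborel. \<phi> y * q t y z * \<rho> y)"
    unfolding set_lebesgue_integral_def
  proof (rule Bochner_Integration.integral_cong[OF refl])
    fix y
    show "d y * \<phi> y = indicat_real {L..R} y *\<^sub>R (\<phi> y * q t y z * \<rho> y)"
      using out[of y] sub unfolding dI by (cases "y \<in> {L..R}") (auto simp: indicator_def)
  qed
  also have "\<dots> = integral {L..R} (\<lambda>y. \<phi> y * q t y z * \<rho> y)"
    by (rule set_borel_integral_eq_integral(2)[OF borel_integrable_atLeastAtMost']) (rule cq)
  finally show ?thesis .
qed

text \<open>The grid has mesh \<open>\<delta> / 3\<close> and covers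
  \<open>[A - \<delta>, B + \<delta>]\<close>. Starting from the end of the displacement that lies
  in \<open>[A, B]\<close>, the nearest complete cell in its direction ends within distance
  \<open>2 * \<delta> / 3\<close> and has therefore been crossed.\<close>

lemma grid_cell_exists:
  fixes A B \<delta> z w :: real
  assumes d: "0 < \<delta>" and zw: "\<delta> \<le> \<bar>w - z\<bar>" and or: "z \<in> {A..B} \<or> w \<in> {A..B}" and n: "B + \<delta> \<le> A - \<delta> + real n * (\<delta> / 3)"
  shows "\<exists>i<n. (z \<le> A - \<delta> + real i * (\<delta> / 3) \<and> A - \<delta> + real (Suc i) * (\<delta> / 3) \<le> w) \<or>
     (w \<le> A - \<delta> + real i * (\<delta> / 3) \<and> A - \<delta> + real (Suc i) * (\<delta> / 3) \<le> z)"
proof -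
  define p where "p i = A - \<delta> + real i * (\<delta> / 3)" for i
  have up: "\<exists>i<n. e \<le> p i \<and> p (Suc i) \<le> x" if e: "e \<in> {A..B}" and x: "e + \<delta> \<le> x" for e x
  proof -
    define k where "k = nat \<lceil>(e - (A - \<delta>)) / (\<delta> / 3)\<rceil>"
    have nn: "0 \<le> (e - (A - \<delta>)) / (\<delta> / 3)" using e d by auto
    have k: "(e - (A - \<delta>)) / (\<delta> / 3) \<le> real k" "real k < (e - (A - \<delta>)) / (\<delta> / 3) + 1"
      unfolding k_def using nn by linarith+
    then have "(e - (A - \<delta>)) \<le> real k * (\<delta> / 3)" "(real k - 1) * (\<delta> / 3) < e - (A - \<delta>)"
      using d by (simp_all add: field_simps)
    moreover have "(real k - 1) * (\<delta> / 3) = real k * (\<delta> / 3) - \<delta> / 3" "p (Suc k) = p k + \<delta> / 3"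
      by (simp_all add: p_def left_diff_distrib distrib_right add_divide_distrib)
    ultimately have 1: "e \<le> p k" "p (Suc k) < e + 2 * (\<delta> / 3)" unfolding p_def[of k] by linarith+
    have "p (Suc k) < p n" using 1 n e d unfolding p_def[of n] by auto
    then have "real (Suc k) < real n" using d unfolding p_def by (simp add: mult_less_cancel_right)
    then show ?thesis using 1 x d by (intro exI[of _ k]) auto
  qed
  have dn: "\<exists>i<n. x \<le> p i \<and> p (Suc i) \<le> e" if e: "e \<in> {A..B}" and x: "x \<le> e - \<delta>" for e x
  proof -
    define k where "k = nat \<lfloor>(e - (A - \<delta>)) / (\<delta> / 3)\<rfloor>"
    have nn: "1 \<le> (e - (A - \<delta>)) / (\<delta> / 3)" using e d by (auto simp: field_simps)
    then have k: "real k \<le> (e - (A - \<delta>)) / (\<delta> / 3)" "(e - (A - \<delta>)) / (\<delta> / 3) < real k + 1" "1 \<le> k"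
      unfolding k_def by linarith+
    then have "real k * (\<delta> / 3) \<le> (e - (A - \<delta>))" "e - (A - \<delta>) < (real k + 1) * (\<delta> / 3)"
      using d by (simp_all add: field_simps)
    moreover have "(real k + 1) * (\<delta> / 3) = real k * (\<delta> / 3) + \<delta> / 3" by (simp add: algebra_simps)
    ultimately have 1: "p k \<le> e" "e < p k + \<delta> / 3" unfolding p_def by linarith+
    obtain i where i: "k = Suc i" using k(3) by (cases k) auto
    have "p (Suc i) = p i + \<delta> / 3" unfolding p_def by (simp add: algebra_simps)
    then have 2: "p (Suc i) \<le> e" "x \<le> p i" using 1 x d unfolding i by auto
    have "p k < p n" using 1 n e d unfolding p_def[of n] by auto
    then have "real k < real n" using d unfolding p_def by (simp add: mult_less_cancel_right)
    then show ?thesis using 2 i by (intro exI[of _ i]) auto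
  qed
  consider "z + \<delta> \<le> w" | "w + \<delta> \<le> z" using zw by linarith
  then have "\<exists>i<n. (z \<le> p i \<and> p (Suc i) \<le> w) \<or> (w \<le> p i \<and> p (Suc i) \<le> z)"
  proof cases
    case 1
    then show ?thesis using or up[of z w] dn[of w z] by auto
  next
    case 2
    then show ?thesis using or up[of w z] dn[of z w] by auto
  qed
  then show ?thesis unfolding p_def .
qed

text \<open>A displacement by \<open>\<delta>\<close> crosses one of finitely many grid cells, each
  at a cost \<open>O(v\<^sup>2)\<close>. Since either end of the displacement may be the one in
  \<open>[A, B]\<close>, the bound also covers jumps into \<open>[A, B]\<close> from arbitrarily far
  away, uniformly in \<open>z\<close>.\<close>

lemma displacement_small:
  assumes d: "0 < \<delta>" and A: "l < ereal (A - \<delta>)" and AB: "A \<le> B"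
  shows "\<exists>C\<ge>0. \<forall>v>0. \<forall>z\<in>E. emeasure (P z) {\<omega> \<in> space (path_space E). \<delta> \<le> \<bar>\<omega> v - z\<bar> \<and> (z \<in> {A..B} \<or> \<omega> v \<in> {A..B})} \<le> ennreal (C * v\<^sup>2)"
proof -
  define p where "p i = A - \<delta> + real i * (\<delta> / 3)" for i
  obtain n :: nat where n: "(B + \<delta> - (A - \<delta>)) / (\<delta> / 3) \<le> real n" using real_arch_simple by blast
  then have n': "B + \<delta> \<le> A - \<delta> + real n * (\<delta> / 3)" using d by (simp add: field_simps)
  have lp: "l < ereal (p i)" for i using l_less_trans[OF A, of "p i"] d by (simp add: p_def)
  have pp: "p i < p (Suc i)" for i using d by (simp add: p_def algebra_simps)
  have "\<forall>i. \<exists>C\<ge>0. \<forall>h>0. \<forall>z\<in>E. (z \<le> p i \<longrightarrow> hit_prob z (p (Suc i)) h \<le> ennreal (C * h\<^sup>2)) \<and> (p (Suc i) \<le> z \<longrightarrow> hit_prob z (p i) h \<le> ennreal (C * h\<^sup>2))"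
    using crossing_small[OF lp pp] by blast
  from choice[OF this] obtain C where "\<forall>i. 0 \<le> C i \<and> (\<forall>h>0. \<forall>z\<in>E. (z \<le> p i \<longrightarrow> hit_prob z (p (Suc i)) h \<le> ennreal (C i * h\<^sup>2)) \<and> (p (Suc i) \<le> z \<longrightarrow> hit_prob z (p i) h \<le> ennreal (C i * h\<^sup>2)))" ..
  then have C: "\<And>i. 0 \<le> C i" "\<And>i h z. 0 < h \<Longrightarrow> z \<in> E \<Longrightarrow> z \<le> p i \<Longrightarrow> hit_prob z (p (Suc i)) h \<le> ennreal (C i * h\<^sup>2)"
    "\<And>i h z. 0 < h \<Longrightarrow> z \<in> E \<Longrightarrow> p (Suc i) \<le> z \<Longrightarrow> hit_prob z (p i) h \<le> ennreal (C i * h\<^sup>2)"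
    by simp_all
  have "emeasure (P z) {\<omega> \<in> space (path_space E). \<delta> \<le> \<bar>\<omega> v - z\<bar> \<and> (z \<in> {A..B} \<or> \<omega> v \<in> {A..B})} \<le> ennreal (4 * (\<Sum>i<n. C i) * v\<^sup>2)"
    if v: "0 < v" and z: "z \<in> E" for v z
  proof -
    \<comment> \<open>The horizon is \<open>2 * v\<close> because the level may be reached only at
      time \<open>v\<close> itself, while the crossing bounds concern hits strictly before the
      horizon. The factor 4 of the constant comes from \<open>(2 * v)\<^sup>2\<close>.\<close>
    define N where "N i = {\<omega> \<in> space (path_space E). (z \<le> p i \<and> hitting_time (p (Suc i)) \<omega> < ennreal (2 * v)) \<or> (p (Suc i) \<le> z \<and> hitting_time (p i) \<omega> < ennreal (2 * v))}" for i
    have Nm: "N i \<in> sets (P z)" for i unfolding sets_P[OF z] N_def by measurable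
    have Nb: "emeasure (P z) (N i) \<le> ennreal (C i * (2 * v)\<^sup>2)" for i
    proof -
      consider "z \<le> p i" | "p (Suc i) \<le> z" | "\<not> z \<le> p i" "\<not> p (Suc i) \<le> z" by blast
      then show ?thesis
      proof cases
        case 1
        then have "\<not> p (Suc i) \<le> z" using pp[of i] by auto
        then show ?thesis using C(2)[of "2 * v" z i] 1 v z by (simp add: N_def)
      next
        case 2
        then have "\<not> z \<le> p i" using pp[of i] by auto
        then show ?thesis using C(3)[of "2 * v" z i] 2 v z by (simp add: N_def)
      qed (simp add: N_def)
    qed
    have "emeasure (P z) {\<omega> \<in> space (path_space E). \<delta> \<le> \<bar>\<omega> v - z\<bar> \<and> (z \<in> {A..B} \<or> \<omega> v \<in> {A..B})} \<le> emeasure (P z) (\<Union>i<n. N i)"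
    proof (rule emeasure_mono_AE)
      show "AE \<omega> in P z. \<omega> \<in> {\<omega> \<in> space (path_space E). \<delta> \<le> \<bar>\<omega> v - z\<bar> \<and> (z \<in> {A..B} \<or> \<omega> v \<in> {A..B})} \<longrightarrow> \<omega> \<in> (\<Union>i<n. N i)"
        using start_AE[OF z]
      proof (eventually_elim, intro impI)
        fix \<omega> assume w: "\<omega> \<in> space (path_space E) \<and> \<omega> 0 = z"
          and "\<omega> \<in> {\<omega> \<in> space (path_space E). \<delta> \<le> \<bar>\<omega> v - z\<bar> \<and> (z \<in> {A..B} \<or> \<omega> v \<in> {A..B})}"
        then obtain i where i: "i < n" "(z \<le> p i \<and> p (Suc i) \<le> \<omega> v) \<or> (\<omega> v \<le> p i \<and> p (Suc i) \<le> z)"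
          using grid_cell_exists[OF d _ _ n', of "\<omega> v" z] unfolding p_def by auto
        from i(2) have "\<omega> \<in> N i"
        proof
          assume a: "z \<le> p i \<and> p (Suc i) \<le> \<omega> v"
          then obtain r where "0 \<le> r" "r \<le> v" "\<omega> r = p (Suc i)" using path_ivt[OF conjunct1[OF w], of 0 v "p (Suc i)"] w v pp[of i] by auto
          then have "hitting_time (p (Suc i)) \<omega> < ennreal (2 * v)" using v by (subst hitting_time_less_iff) auto
          then show ?thesis using a w by (simp add: N_def)
        next
          assume a: "\<omega> v \<le> p i \<and> p (Suc i) \<le> z"
          then obtain r where "0 \<le> r" "r \<le> v" "\<omega> r = p i" using path_ivt[OF conjunct1[OF w], of 0 v "p i"] w v pp[of i] by auto
          then have "hitting_time (p i) \<omega> < ennreal (2 * v)" using v by (subst hitting_time_less_iff) auto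
          then show ?thesis using a w by (simp add: N_def)
        qed
        then show "\<omega> \<in> (\<Union>i<n. N i)" using i(1) by blast
      qed
    qed (use Nm in auto)
    also have "\<dots> \<le> (\<Sum>i<n. emeasure (P z) (N i))" using Nm by (intro emeasure_subadditive_finite) auto
    also have "\<dots> \<le> (\<Sum>i<n. ennreal (C i * (2 * v)\<^sup>2))" by (intro sum_mono Nb)
    also have "\<dots> = ennreal (\<Sum>i<n. C i * (2 * v)\<^sup>2)" using C(1) by (intro sum_ennreal) auto
    also have "(\<Sum>i<n. C i * (2 * v)\<^sup>2) = 4 * (\<Sum>i<n. C i) * v\<^sup>2" by (simp add: sum_distrib_right power_mult_distrib mult_ac sum_distrib_left)
    finally show ?thesis .
  qed
  then show ?thesis using C(1) by (intro exI[of _ "4 * (\<Sum>i<n. C i)"]) (auto intro: sum_nonneg)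
qed

end

section \<open>Dynkin's formula and the local generator\<close>

lemma continuous_on_section:
  assumes "continuous_on (U \<times> Y) (\<lambda>(v, y). f v y)" "v \<in> U"
  shows "continuous_on Y (f v)"
proof -
  have "continuous_on Y (\<lambda>y. (v, y))" by (intro continuous_intros)
  from continuous_on_compose2[OF assms(1) this] show ?thesis using assms(2) by auto
qed

lemma continuous_on_snd_only:
  assumes "continuous_on Y f"
  shows "continuous_on (U \<times> Y) (\<lambda>(v, y). f y)"
proof -
  have "continuous_on (U \<times> Y) (\<lambda>p. f (snd p))"
    by (rule continuous_on_compose2[OF assms]) (auto intro: continuous_intros)
  then show ?thesis by (simp add: case_prod_beta)
qed

text \<open>The support keeps a positive distance from the ends of \<open>[L, R]\<close>. Two close
  points with at least one in \<open>[L', R']\<close> both lie in the compact box, and otherwise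
  both values are 0; so uniform continuity on the box holds for all real \<open>y\<close>.\<close>

lemma uniformly_continuous_zero_outside:
  fixes f :: "real \<Rightarrow> real \<Rightarrow> real"
  assumes c: "continuous_on ({t1..t2} \<times> {L..R}) (\<lambda>(t, y). f t y)" and LR: "L < L'" "R' < R"
    and out: "\<And>t y. t \<in> {t1..t2} \<Longrightarrow> y \<notin> {L'..R'} \<Longrightarrow> f t y = 0" and e: "0 < \<epsilon>"
  shows "\<exists>\<delta>>0. \<forall>t\<in>{t1..t2}. \<forall>t'\<in>{t1..t2}. \<forall>y y'. \<bar>t - t'\<bar> < \<delta> \<longrightarrow> \<bar>y - y'\<bar> < \<delta> \<longrightarrow> \<bar>f t y - f t' y'\<bar> < \<epsilon>"
proof -
  have "compact ({t1..t2} \<times> {L..R})" by (intro compact_Times) auto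
  from compact_uniformly_continuous[OF c this, unfolded uniformly_continuous_on_def, rule_format, OF e]
  obtain d where d: "0 < d" "\<forall>p\<in>{t1..t2} \<times> {L..R}. \<forall>p'\<in>{t1..t2} \<times> {L..R}. dist p' p < d \<longrightarrow>
      dist ((\<lambda>(t, y). f t y) p') ((\<lambda>(t, y). f t y) p) < \<epsilon>"
    by (elim exE conjE)
  define \<delta> where "\<delta> = min (d / 2) (min (L' - L) (R - R'))"
  have dpos: "0 < \<delta>" using d LR by (auto simp: \<delta>_def)
  have "\<bar>f t y - f t' y'\<bar> < \<epsilon>" if t: "t \<in> {t1..t2}" "t' \<in> {t1..t2}" and *: "\<bar>t - t'\<bar> < \<delta>" "\<bar>y - y'\<bar> < \<delta>" for t t' y y'
  proof (cases "y \<in> {L'..R'} \<or> y' \<in> {L'..R'}")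
    case True
    then have "y \<in> {L..R}" "y' \<in> {L..R}" using * LR unfolding \<delta>_def by (auto simp: abs_less_iff)
    moreover have "dist (t, y) (t', y') \<le> \<bar>t - t'\<bar> + \<bar>y - y'\<bar>"
      unfolding dist_Pair_Pair dist_real_def using sqrt_sum_squares_le_sum_abs[of "t - t'" "y - y'"] by simp
    then have "dist (t, y) (t', y') < d" using * unfolding \<delta>_def by linarith
    ultimately show ?thesis using d(2)[THEN bspec, of "(t', y')", THEN bspec, of "(t, y)"] t by (simp add: dist_real_def)
  next
    case False
    then show ?thesis using out t e by auto
  qed
  then show ?thesis using dpos by blast
qed

lemma bounded_zero_outside:
  fixes f :: "real \<Rightarrow> real \<Rightarrow> real"
  assumes c: "continuous_on ({t1..t2} \<times> {L..R}) (\<lambda>(t, y). f t y)"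
    and out: "\<And>t y. t \<in> {t1..t2} \<Longrightarrow> y \<notin> {L..R} \<Longrightarrow> f t y = 0"
  shows "\<exists>M>0. \<forall>t\<in>{t1..t2}. \<forall>y. \<bar>f t y\<bar> \<le> M"
proof -
  have "compact ({t1..t2} \<times> {L..R})" by (intro compact_Times) auto
  from compact_imp_bounded[OF compact_continuous_image[OF c this]]
  obtain M where M: "0 < M" "\<And>p. p \<in> {t1..t2} \<times> {L..R} \<Longrightarrow> norm ((\<lambda>(t, y). f t y) p) \<le> M"
    unfolding bounded_pos by auto
  have "\<bar>f t y\<bar> \<le> M" if "t \<in> {t1..t2}" for t y
    using M(2)[of "(t, y)"] out[OF that, of y] M(1) that by (cases "y \<in> {L..R}") auto
  then show ?thesis using M(1) by blast
qed

lemma borel_measurable_zero_outside: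
  fixes \<phi> :: "real \<Rightarrow> real"
  assumes "continuous_on {L..R} \<phi>" "\<And>y. y \<notin> {L..R} \<Longrightarrow> \<phi> y = 0"
  shows "\<phi> \<in> borel_measurable borel"
proof -
  have "(\<lambda>y. indicator {L..R} y *\<^sub>R \<phi> y) = \<phi>" using assms(2) by (intro ext) (auto simp: indicator_def)
  then show ?thesis using borel_measurable_continuous_on_indicator[OF _ assms(1)] by auto
qed

context linear_diffusion
begin

lemma I_interval: "l < ereal L \<Longrightarrow> {L..R} \<subseteq> {x. l < ereal x}"
  using l_less_trans by auto

lemma interval_continuity:
  assumes "l < ereal L"
  shows "continuous_on {L..R} \<rho>" "continuous_on {L..R} (deriv s)" "continuous_on {L..R} (deriv (deriv s))"
    "\<And>y. y \<in> {L..R} \<Longrightarrow> deriv s y \<noteq> 0" "\<And>y. y \<in> {L..R} \<Longrightarrow> \<rho> y \<noteq> 0"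
  using continuous_on_subset[OF speed_density_continuous I_interval[OF assms]]
    continuous_on_subset[OF scale_deriv_continuous I_interval[OF assms]]
    continuous_on_subset[OF scale_deriv2_continuous I_interval[OF assms]]
    scale_deriv_pos speed_density_pos l_less_trans[OF assms] by (auto simp: less_imp_neq[symmetric])

lemma q_continuous_box:
  assumes "l < ereal L" "l < ereal z" "U \<subseteq> {0<..}"
  shows "continuous_on (U \<times> {L..R}) (\<lambda>(t, y). q t y z)" "continuous_on (U \<times> {L..R}) (\<lambda>(t, y). q_t t y z)"
    "continuous_on (U \<times> {L..R}) (\<lambda>(t, y). q_y t y z)"
proof -
  have "U \<times> {L..R} \<subseteq> {0<..} \<times> {x. l < ereal x}" using assms(3) I_interval[OF assms(1)] by auto
  then show "continuous_on (U \<times> {L..R}) (\<lambda>(t, y). q t y z)" "continuous_on (U \<times> {L..R}) (\<lambda>(t, y). q_t t y z)"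
    "continuous_on (U \<times> {L..R}) (\<lambda>(t, y). q_y t y z)"
    using q_continuous[OF assms(2)] continuous_on_subset by blast+
qed

lemma integral_parts_q:
  assumes t: "0 < t" and z: "l < ereal z" and L: "l < ereal L" "L \<le> R"
    and A: "\<And>y. y \<in> {L..R} \<Longrightarrow> (A has_real_derivative A' y) (at y within {L..R})"
    and A': "continuous_on {L..R} A'"
  shows "integral {L..R} (\<lambda>y. A' y * q t y z) = A R * q t R z - A L * q t L z - integral {L..R} (\<lambda>y. A y * q_y t y z)"
proof -
  have Ac: "continuous_on {L..R} A" using A by (meson DERIV_continuous continuous_on_eq_continuous_within)
  have qc: "continuous_on {L..R} (\<lambda>y. q t y z)" "continuous_on {L..R} (\<lambda>y. q_y t y z)"
    using continuous_on_section[OF q_continuous_box(1)[OF L(1) z, of "{t}"]] continuous_on_section[OF q_continuous_box(3)[OF L(1) z, of "{t}"]] t by auto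
  have "((\<lambda>y. A' y * q t y z + A y * q_y t y z) has_integral A R * q t R z - A L * q t L z) {L..R}"
  proof (rule fundamental_theorem_of_calculus[OF L(2)])
    fix y assume y: "y \<in> {L..R}"
    have "((\<lambda>y. q t y z) has_real_derivative q_y t y z) (at y within {L..R})"
      using has_field_derivative_at_within[OF q_derivs(2)[OF t _ z]] l_less_trans[OF L(1), of y] y by simp
    from DERIV_mult[OF A[OF y] this]
    show "((\<lambda>y. A y * q t y z) has_vector_derivative A' y * q t y z + A y * q_y t y z) (at y within {L..R})"
      unfolding has_real_derivative_iff_has_vector_derivative[symmetric] by (simp add: mult.commute)
  qed
  then have "integral {L..R} (\<lambda>y. A' y * q t y z + A y * q_y t y z) = A R * q t R z - A L * q t L z" by (rule integral_unique)
  moreover have "integral {L..R} (\<lambda>y. A' y * q t y z + A y * q_y t y z) = integral {L..R} (\<lambda>y. A' y * q t y z) + integral {L..R} (\<lambda>y. A y * q_y t y z)"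
    using A' Ac qc by (intro Henstock_Kurzweil_Integration.integral_add integrable_continuous_interval continuous_intros)
  ultimately show ?thesis by simp
qed

text \<open>The derivative under the integral contains \<open>g * \<rho> * q_t\<close>. By the
  divergence form of the backward equation this is \<open>g\<close> times the derivative of
  \<open>q_y / s'\<close>, and an integration by parts moves that derivative to \<open>g\<close>.
  Only first derivatives of \<open>g\<close> occur in the result, which makes it applicable to the
  \<open>C\<^sup>1\<close> regularisation of \<open>H\<close> at the curve.\<close>

lemma dynkin_derivative:
  assumes z: "l < ereal z" and U: "convex U" "U \<subseteq> {0<..}" and L: "l < ereal L" "L \<le> R"
    and dt: "\<And>v y. v \<in> U \<Longrightarrow> y \<in> {L..R} \<Longrightarrow> ((\<lambda>v. g v y) has_real_derivative gt v y) (at v within U)"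
    and dy: "\<And>v y. v \<in> U \<Longrightarrow> y \<in> {L..R} \<Longrightarrow> (g v has_real_derivative gy v y) (at y within {L..R})"
    and c: "continuous_on (U \<times> {L..R}) (\<lambda>(v, y). g v y)" "continuous_on (U \<times> {L..R}) (\<lambda>(v, y). gt v y)"
      "continuous_on (U \<times> {L..R}) (\<lambda>(v, y). gy v y)"
    and ends: "\<And>v. v \<in> U \<Longrightarrow> g v L = 0" "\<And>v. v \<in> U \<Longrightarrow> g v R = 0"
    and v: "v \<in> U"
  shows "((\<lambda>v. integral {L..R} (\<lambda>y. g v y * q v y z * \<rho> y)) has_real_derivative
    integral {L..R} (\<lambda>y. gt v y * q v y z * \<rho> y - gy v y * (q_y v y z / deriv s y))) (at v within U)"
proof -
  note ic = interval_continuity[OF L(1), where R = R]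
  note qc = q_continuous_box[OF L(1) z U(2), where R = R]
  have rc: "continuous_on (U \<times> {L..R}) (\<lambda>(v, y). \<rho> y)" using continuous_on_snd_only[OF ic(1)] .
  have v0: "0 < v" using U v by auto
  have D: "((\<lambda>v. integral (cbox L R) (\<lambda>y. g v y * q v y z * \<rho> y)) has_field_derivative
    integral (cbox L R) (\<lambda>y. (gt v y * q v y z + g v y * q_t v y z) * \<rho> y)) (at v within U)"
  proof (rule leibniz_rule_field_derivative[OF _ _ _ v U(1)])
    fix w y assume w: "w \<in> U" and y: "y \<in> cbox L R"
    have y': "y \<in> {L..R}" using y by simp
    have wy: "0 < w" "l < ereal y" using U(2) w y' l_less_trans[OF L(1), of y] by auto
    have "((\<lambda>w. q w y z) has_real_derivative q_t w y z) (at w within U)"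
      by (rule has_field_derivative_at_within[OF q_derivs(1)[OF wy z]])
    from DERIV_cmult_right[OF DERIV_mult[OF dt[OF w y'] this], of "\<rho> y"]
    have "((\<lambda>v. g v y * q v y z * \<rho> y) has_real_derivative (gt w y * q w y z + q_t w y z * g w y) * \<rho> y) (at w within U)" .
    moreover have "gt w y * q w y z + q_t w y z * g w y = gt w y * q w y z + g w y * q_t w y z" by simp
    ultimately show "((\<lambda>v. g v y * q v y z * \<rho> y) has_real_derivative (gt w y * q w y z + g w y * q_t w y z) * \<rho> y) (at w within U)"
      by (simp only:)
  next
    fix w assume w: "w \<in> U"
    show "(\<lambda>y. g w y * q w y z * \<rho> y) integrable_on cbox L R"
      unfolding cbox_interval
      using continuous_on_section[OF c(1) w] continuous_on_section[OF qc(1) w] ic(1)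
      by (intro integrable_continuous_interval continuous_intros)
  next
    show "continuous_on (U \<times> cbox L R) (\<lambda>(v, y). (gt v y * q v y z + g v y * q_t v y z) * \<rho> y)"
      using c qc rc unfolding case_prod_beta cbox_interval by (intro continuous_intros)
  qed
  have sc: "continuous_on {L..R} (g v)" "continuous_on {L..R} (gt v)" "continuous_on {L..R} (gy v)"
    "continuous_on {L..R} (\<lambda>y. q v y z)" "continuous_on {L..R} (\<lambda>y. q_t v y z)" "continuous_on {L..R} (\<lambda>y. q_y v y z)"
    using continuous_on_section[OF _ v] c qc by auto
  have "((\<lambda>y. gy v y * (q_y v y z / deriv s y) + g v y * (\<rho> y * q_t v y z)) has_integral g v R * (q_y v R z / deriv s R) - g v L * (q_y v L z / deriv s L)) {L..R}"
  proof (rule fundamental_theorem_of_calculus[OF L(2)])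
    fix y assume y: "y \<in> {L..R}"
    have "((\<lambda>y. q_y v y z / deriv s y) has_real_derivative \<rho> y * q_t v y z) (at y within {L..R})"
      using has_field_derivative_at_within[OF flux_derivative[OF v0 _ z]] l_less_trans[OF L(1), of y] y by simp
    from DERIV_mult[OF dy[OF v y] this]
    show "((\<lambda>y. g v y * (q_y v y z / deriv s y)) has_vector_derivative gy v y * (q_y v y z / deriv s y) + g v y * (\<rho> y * q_t v y z)) (at y within {L..R})"
      unfolding has_real_derivative_iff_has_vector_derivative[symmetric] by (simp add: mult.commute)
  qed
  then have "integral {L..R} (\<lambda>y. gy v y * (q_y v y z / deriv s y) + g v y * (\<rho> y * q_t v y z)) = 0"
    using ends[OF v] by (simp add: integral_unique)
  moreover have "integral {L..R} (\<lambda>y. gy v y * (q_y v y z / deriv s y) + g v y * (\<rho> y * q_t v y z)) =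
     integral {L..R} (\<lambda>y. gy v y * (q_y v y z / deriv s y)) + integral {L..R} (\<lambda>y. g v y * (\<rho> y * q_t v y z))"
    using sc ic by (intro Henstock_Kurzweil_Integration.integral_add integrable_continuous_interval continuous_intros) auto
  moreover have "integral {L..R} (\<lambda>y. (gt v y * q v y z + g v y * q_t v y z) * \<rho> y) =
     integral {L..R} (\<lambda>y. gt v y * q v y z * \<rho> y) + integral {L..R} (\<lambda>y. g v y * (\<rho> y * q_t v y z))"
  proof (subst Henstock_Kurzweil_Integration.integral_add[symmetric])
    show "(\<lambda>y. gt v y * q v y z * \<rho> y) integrable_on {L..R}" "(\<lambda>y. g v y * (\<rho> y * q_t v y z)) integrable_on {L..R}"
      by (intro integrable_continuous_interval continuous_intros sc ic(1))+
  qed (simp add: algebra_simps)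
  moreover have "integral {L..R} (\<lambda>y. gt v y * q v y z * \<rho> y - gy v y * (q_y v y z / deriv s y)) =
     integral {L..R} (\<lambda>y. gt v y * q v y z * \<rho> y) - integral {L..R} (\<lambda>y. gy v y * (q_y v y z / deriv s y))"
    using sc ic by (intro Henstock_Kurzweil_Integration.integral_diff integrable_continuous_interval continuous_intros) auto
  ultimately have "integral {L..R} (\<lambda>y. (gt v y * q v y z + g v y * q_t v y z) * \<rho> y) =
     integral {L..R} (\<lambda>y. gt v y * q v y z * \<rho> y - gy v y * (q_y v y z / deriv s y))" by linarith
  then show ?thesis using D by (simp only: cbox_interval)
qed

text \<open>The generator applied to a function with first and second derivative \<open>u1\<close> and \<open>u2\<close> at \<open>y\<close>.\<close>

definition space_generator :: "real \<Rightarrow> real \<Rightarrow> real \<Rightarrow> real" where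
  "space_generator y u1 u2 = (u2 * deriv s y - u1 * deriv (deriv s) y) / (deriv s y * deriv s y * \<rho> y)"

lemma space_generator_zero [simp]: "space_generator y 0 0 = 0"
  by (simp add: space_generator_def)

text \<open>Symmetry of the generator with respect to the speed measure, stopped halfway: one
  derivative goes from \<open>u1 / s'\<close> to \<open>q\<close>, and the boundary terms vanish
  with \<open>u1\<close>.\<close>

lemma generator_by_parts:
  assumes z: "l < ereal z" and t: "0 < t" and L: "l < ereal L" "L \<le> R"
    and dy: "\<And>y. y \<in> {L..R} \<Longrightarrow> (u1 has_real_derivative u2 y) (at y within {L..R})"
    and c: "continuous_on {L..R} u2" and ends: "u1 L = 0" "u1 R = 0"
  shows "integral {L..R} (\<lambda>y. space_generator y (u1 y) (u2 y) * q t y z * \<rho> y) = - integral {L..R} (\<lambda>y. u1 y * (q_y t y z / deriv s y))"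
proof -
  note ic = interval_continuity[OF L(1), where R = R]
  have u1c: "continuous_on {L..R} u1" using dy by (meson DERIV_continuous continuous_on_eq_continuous_within)
  have "integral {L..R} (\<lambda>y. space_generator y (u1 y) (u2 y) * q t y z * \<rho> y) =
    integral {L..R} (\<lambda>y. (u2 y * deriv s y - u1 y * deriv (deriv s) y) / (deriv s y * deriv s y) * q t y z)"
  proof (rule Henstock_Kurzweil_Integration.integral_cong)
    fix y assume "y \<in> {L..R}"
    then have "\<rho> y \<noteq> 0" "deriv s y \<noteq> 0" using ic(4,5) by auto
    then show "space_generator y (u1 y) (u2 y) * q t y z * \<rho> y = (u2 y * deriv s y - u1 y * deriv (deriv s) y) / (deriv s y * deriv s y) * q t y z"
      unfolding space_generator_def by (simp add: field_simps)
  qed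
  also have "\<dots> = (u1 R / deriv s R) * q t R z - (u1 L / deriv s L) * q t L z - integral {L..R} (\<lambda>y. (u1 y / deriv s y) * q_y t y z)"
  proof (rule integral_parts_q[OF t z L])
    fix y assume y: "y \<in> {L..R}"
    have "(deriv s has_real_derivative deriv (deriv s) y) (at y within {L..R})"
      using has_field_derivative_at_within[OF scale_deriv_differentiable] l_less_trans[OF L(1), of y] y by simp
    from DERIV_divide[OF dy[OF y] this ic(4)[OF y]]
    show "((\<lambda>y. u1 y / deriv s y) has_real_derivative (u2 y * deriv s y - u1 y * deriv (deriv s) y) / (deriv s y * deriv s y)) (at y within {L..R})"
      by simp
  next
    show "continuous_on {L..R} (\<lambda>y. (u2 y * deriv s y - u1 y * deriv (deriv s) y) / (deriv s y * deriv s y))"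
      using ic c u1c by (intro continuous_intros) auto
  qed
  finally show ?thesis using ends by simp
qed

text \<open>Dominated convergence along continuous paths. The function may change with
  \<open>n\<close>, since in its use both time and position converge.\<close>

lemma expectation_tendsto_start:
  fixes f :: "nat \<Rightarrow> real \<Rightarrow> real"
  assumes z: "z \<in> E" and m: "\<And>n. f n \<in> borel_measurable borel" and b: "\<And>n y. \<bar>f n y\<bar> \<le> M"
    and a: "a \<longlonglongrightarrow> 0" "\<And>n. 0 \<le> a n"
    and lim: "\<And>w. w \<longlonglongrightarrow> z \<Longrightarrow> (\<lambda>n. f n (w n)) \<longlonglongrightarrow> c"
  shows "(\<lambda>n. \<integral>\<omega>. f n (\<omega> (a n)) \<partial>P z) \<longlonglongrightarrow> c"
proof -
  interpret prob_space "P z" by (rule P_prob_space[OF z])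
  have "(\<lambda>n. \<integral>\<omega>. f n (\<omega> (a n)) \<partial>P z) \<longlonglongrightarrow> (\<integral>\<omega>. c \<partial>P z)"
  proof (rule integral_dominated_convergence[where w = "\<lambda>_. M"])
    show "(\<lambda>\<omega>. f n (\<omega> (a n))) \<in> borel_measurable (P z)" for n
      using measurable_compose[OF measurable_coordinate_P[OF z a(2)] m] .
    show "AE \<omega> in P z. (\<lambda>n. f n (\<omega> (a n))) \<longlonglongrightarrow> c"
      using start_AE[OF z]
    proof eventually_elim
      fix \<omega> assume w: "\<omega> \<in> space (path_space E) \<and> \<omega> 0 = z"
      then show "(\<lambda>n. f n (\<omega> (a n))) \<longlonglongrightarrow> c"
        using lim[of "\<lambda>n. \<omega> (a n)"] path_tendsto_start[of \<omega> a] a by auto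
    qed
  qed (use b in auto)
  then show ?thesis by (simp add: prob_space)
qed

text \<open>With \<open>K\<close> the space-time generator applied to \<open>g\<close>, Dynkin's
  formula gives the expectation of \<open>K\<close> at time \<open>t + v\<close> as derivative of
  the expectation of \<open>g\<close>. This is within \<open>\<epsilon>\<close> of
  \<open>K t z\<close>: a path that moves by less than \<open>\<delta>\<close> changes
  \<open>K\<close> by less than \<open>\<epsilon> / 2\<close>, and one that moves further either
  starts or ends in the support, with probability \<open>O(v\<^sup>2)\<close>, or sees
  \<open>K = 0\<close> at both ends. No step depends on where \<open>z\<close> lies, hence the
  uniformity.\<close>

lemma local_generator:
  fixes g gt gy gyy :: "real \<Rightarrow> real \<Rightarrow> real"
  assumes L: "l < ereal L" "L < L'" "L' \<le> R'" "R' < R"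
    and dt: "\<And>t y. t \<in> {t1..t2} \<Longrightarrow> y \<in> {L..R} \<Longrightarrow> ((\<lambda>t. g t y) has_real_derivative gt t y) (at t within {t1..t2})"
    and dy: "\<And>t y. t \<in> {t1..t2} \<Longrightarrow> y \<in> {L..R} \<Longrightarrow> (g t has_real_derivative gy t y) (at y within {L..R})"
    and dyy: "\<And>t y. t \<in> {t1..t2} \<Longrightarrow> y \<in> {L..R} \<Longrightarrow> (gy t has_real_derivative gyy t y) (at y within {L..R})"
    and c: "continuous_on ({t1..t2} \<times> {L..R}) (\<lambda>(t, y). g t y)" "continuous_on ({t1..t2} \<times> {L..R}) (\<lambda>(t, y). gt t y)"
      "continuous_on ({t1..t2} \<times> {L..R}) (\<lambda>(t, y). gy t y)" "continuous_on ({t1..t2} \<times> {L..R}) (\<lambda>(t, y). gyy t y)"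
    and out: "\<And>t y. t \<in> {t1..t2} \<Longrightarrow> y \<notin> {L'..R'} \<Longrightarrow> g t y = 0 \<and> gt t y = 0 \<and> gy t y = 0 \<and> gyy t y = 0"
    and e: "0 < \<epsilon>"
  shows "\<exists>h0>0. \<forall>h t z. 0 < h \<longrightarrow> h \<le> h0 \<longrightarrow> t1 \<le> t \<longrightarrow> t + h \<le> t2 \<longrightarrow> l < ereal z \<longrightarrow>
    \<bar>(\<integral>\<omega>. g (t + h) (\<omega> h) \<partial>P z) - g t z - h * (gt t z + space_generator z (gy t z) (gyy t z))\<bar> \<le> \<epsilon> * h"
proof -
  define K where "K t y = gt t y + space_generator y (gy t y) (gyy t y)" for t y
  note ic = interval_continuity[OF L(1), where R = R]
  have LR: "L \<le> R" using L by simp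
  have Kc: "continuous_on ({t1..t2} \<times> {L..R}) (\<lambda>(t, y). K t y)"
    unfolding K_def space_generator_def case_prod_beta
    using c ic(4,5) continuous_on_snd_only[OF ic(1), of "{t1..t2}"] continuous_on_snd_only[OF ic(2), of "{t1..t2}"] continuous_on_snd_only[OF ic(3), of "{t1..t2}"]
    unfolding case_prod_beta by (intro continuous_intros) auto
  have Ko: "K t y = 0" if "t \<in> {t1..t2}" "y \<notin> {L'..R'}" for t y using out[OF that] by (simp add: K_def)
  have Ko': "K t y = 0" if "t \<in> {t1..t2}" "y \<notin> {L..R}" for t y using Ko[of t y] that L by auto
  have go': "g t y = 0" if "t \<in> {t1..t2}" "y \<notin> {L..R}" for t y using out[of t y] that L by auto
  obtain \<delta>0 where d0: "0 < \<delta>0" "\<And>t t' y y'. t \<in> {t1..t2} \<Longrightarrow> t' \<in> {t1..t2} \<Longrightarrow> \<bar>t - t'\<bar> < \<delta>0 \<Longrightarrow> \<bar>y - y'\<bar> < \<delta>0 \<Longrightarrow> \<bar>K t y - K t' y'\<bar> < \<epsilon> / 2"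
    using uniformly_continuous_zero_outside[OF Kc L(2,4) Ko, of "\<epsilon> / 2"] e by (auto 0 3)
  define \<delta> where "\<delta> = min \<delta>0 (L' - L)"
  have d: "0 < \<delta>" "\<delta> \<le> \<delta>0" using d0 L by (auto simp: \<delta>_def)
  have "l < ereal (L' - \<delta>)" using l_less_trans[OF L(1), of "L' - \<delta>"] by (auto simp: \<delta>_def)
  from displacement_small[OF d(1) this L(3)]
  obtain C where C: "0 \<le> C" "\<And>v z. 0 < v \<Longrightarrow> z \<in> E \<Longrightarrow>
      emeasure (P z) {\<omega> \<in> space (path_space E). \<delta> \<le> \<bar>\<omega> v - z\<bar> \<and> (z \<in> {L'..R'} \<or> \<omega> v \<in> {L'..R'})} \<le> ennreal (C * v\<^sup>2)"
    by blast
  obtain M where M: "0 < M" "\<And>t y. t \<in> {t1..t2} \<Longrightarrow> \<bar>K t y\<bar> \<le> M"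
    using bounded_zero_outside[OF Kc Ko'] by blast
  obtain Mg where Mg: "0 < Mg" "\<And>t y. t \<in> {t1..t2} \<Longrightarrow> \<bar>g t y\<bar> \<le> Mg"
    using bounded_zero_outside[OF c(1) go'] by blast
  \<comment> \<open>Chosen to make the contribution \<open>2 * M * (C * v\<^sup>2)\<close> of large
    displacements at most \<open>\<epsilon> / 2\<close>: \<open>h0 \<le> 1\<close> gives
    \<open>v\<^sup>2 \<le> v\<close>, and \<open>C + 1\<close> avoids a division by zero. The bound
    \<open>\<delta> / 2\<close> is for the modulus of continuity in time.\<close>
  define h0 where "h0 = min (\<delta> / 2) (min 1 (\<epsilon> / (4 * M * (C + 1))))"
  have h0: "0 < h0" "h0 < \<delta>" "h0 \<le> 1" "h0 \<le> \<epsilon> / (4 * M * (C + 1))"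
    using d M C e by (auto simp: h0_def intro!: divide_pos_pos mult_pos_pos)
  have "\<bar>(\<integral>\<omega>. g (t + h) (\<omega> h) \<partial>P z) - g t z - h * K t z\<bar> \<le> \<epsilon> * h"
    if h: "0 < h" "h \<le> h0" and t: "t1 \<le> t" "t + h \<le> t2" and z: "l < ereal z" for h t z
  proof -
    have zE: "z \<in> E" using in_E z by auto
    interpret prob_space "P z" by (rule P_prob_space[OF zE])
    have tv: "t + v \<in> {t1..t2}" if "v \<in> {0..h}" for v using that t by auto
    have tt: "t \<in> {t1..t2}" using tv[of 0] h by simp
    have gb: "g (t + v) \<in> borel_measurable borel" "K (t + v) \<in> borel_measurable borel" if "v \<in> {0..h}" for v
      using borel_measurable_zero_outside[OF continuous_on_section[OF c(1) tv[OF that]] go'[OF tv[OF that]]]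
        borel_measurable_zero_outside[OF continuous_on_section[OF Kc tv[OF that]] Ko'[OF tv[OF that]]] by auto
    define F where "F v = integral {L..R} (\<lambda>y. g (t + v) y * q v y z * \<rho> y)" for v
    define k where "k v = integral {L..R} (\<lambda>y. K (t + v) y * q v y z * \<rho> y)" for v
    have FE: "F v = (\<integral>\<omega>. g (t + v) (\<omega> v) \<partial>P z)" and kE: "k v = (\<integral>\<omega>. K (t + v) (\<omega> v) \<partial>P z)" if "v \<in> {0<..h}" for v
      using expectation_density[OF z _ L(1) continuous_on_section[OF c(1) tv[of v]] go'[OF tv[of v]]]
        expectation_density[OF z _ L(1) continuous_on_section[OF Kc tv[of v]] Ko'[OF tv[of v]]] that
      by (auto simp: F_def k_def)
    have "\<bar>k v - K t z\<bar> \<le> \<epsilon>" if v: "v \<in> {0<..h}" for v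
    proof -
      define G where "G = {\<omega> \<in> space (path_space E). \<delta> \<le> \<bar>\<omega> v - z\<bar> \<and> (z \<in> {L'..R'} \<or> \<omega> v \<in> {L'..R'})}"
      have cm: "(\<lambda>\<omega>. \<omega> v) \<in> borel_measurable (P z)" using v by (intro measurable_coordinate_P zE) auto
      have Gm: "G \<in> events"
      proof -
        have "G = {\<omega> \<in> space (P z). \<delta> \<le> \<bar>\<omega> v - z\<bar> \<and> (z \<in> {L'..R'} \<or> (L' \<le> \<omega> v \<and> \<omega> v \<le> R'))}"
          unfolding G_def space_P[OF zE] by auto
        also have "\<dots> \<in> events" using cm by measurable
        finally show ?thesis .
      qed
      have "emeasure (P z) G \<le> ennreal (C * v\<^sup>2)" unfolding G_def using C(2) v zE by auto
      then have GC: "prob G \<le> C * v\<^sup>2" using C(1) by (simp add: emeasure_eq_measure)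
      have Ki: "integrable (P z) (\<lambda>\<omega>. K (t + v) (\<omega> v))"
        using measurable_compose[OF cm gb(2)] M(2)[OF tv[of v]] v by (intro integrable_const_bound[of _ M]) auto
      have "k v - K t z = (\<integral>\<omega>. K (t + v) (\<omega> v) - K t z \<partial>P z)"
        unfolding kE[OF v] using Ki by (simp add: prob_space)
      then have "\<bar>k v - K t z\<bar> \<le> (\<integral>\<omega>. \<bar>K (t + v) (\<omega> v) - K t z\<bar> \<partial>P z)" using integral_abs_bound by simp
      also have "\<dots> \<le> (\<integral>\<omega>. \<epsilon> / 2 + 2 * M * indicator G \<omega> \<partial>P z)"
      proof (rule integral_mono)
        show "integrable (P z) (\<lambda>\<omega>. \<bar>K (t + v) (\<omega> v) - K t z\<bar>)" using Ki by auto
        show "integrable (P z) (\<lambda>\<omega>. \<epsilon> / 2 + 2 * M * indicator G \<omega>)" using Gm by (auto simp: less_top[symmetric])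
        fix \<omega> assume "\<omega> \<in> space (P z)"
        then have w: "\<omega> \<in> space (path_space E)" using space_P[OF zE] by simp
        show "\<bar>K (t + v) (\<omega> v) - K t z\<bar> \<le> \<epsilon> / 2 + 2 * M * indicator G \<omega>"
        proof (cases "\<omega> \<in> G")
          case True
          have "\<bar>K (t + v) (\<omega> v) - K t z\<bar> \<le> M + M"
            using M(2)[OF tv[of v], of "\<omega> v"] M(2)[OF tt, of z] v by auto
          then show ?thesis using True e by simp
        next
          case False
          show ?thesis
          proof (cases "\<bar>\<omega> v - z\<bar> < \<delta>")
            case True
            have "\<bar>K (t + v) (\<omega> v) - K t z\<bar> < \<epsilon> / 2"
              using v h h0 d True by (intro d0(2) tt tv) auto
            then show ?thesis using False by simp
          next
            \<comment> \<open>A large displacement outside \<open>G\<close> has both ends outside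
              the support, where \<open>K\<close> is zero.\<close>
            case f: False
            then have "z \<notin> {L'..R'}" "\<omega> v \<notin> {L'..R'}" using False w by (auto simp: G_def)
            then have "K (t + v) (\<omega> v) = 0" "K t z = 0" using Ko[OF tv[of v]] Ko[OF tt] v by auto
            then show ?thesis using e M by (simp add: indicator_def)
          qed
        qed
      qed
      also have "\<dots> = \<epsilon> / 2 + 2 * M * prob G" using Gm by (simp add: prob_space less_top[symmetric])
      also have "\<dots> \<le> \<epsilon> / 2 + 2 * M * (C * v\<^sup>2)" using GC M by (intro add_left_mono mult_left_mono) auto
      also have "2 * M * (C * v\<^sup>2) \<le> \<epsilon> / 2"
      proof -
        have "v\<^sup>2 \<le> v" using v h h0 by (simp add: power2_eq_square mult_left_le)
        also have "v \<le> \<epsilon> / (4 * M * (C + 1))" using v h h0 by auto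
        finally have "C * v\<^sup>2 \<le> (C + 1) * (\<epsilon> / (4 * M * (C + 1)))" using C by (intro mult_mono) auto
        also have "(C + 1) * (\<epsilon> / (4 * M * (C + 1))) = \<epsilon> / (4 * M)"
        proof -
          have "D * (\<epsilon> / (4 * M * D)) = \<epsilon> / (4 * M)" if "D \<noteq> 0" for D using that M by (simp add: field_simps)
          then show ?thesis using C(1) by auto
        qed
        finally have "2 * M * (C * v\<^sup>2) \<le> 2 * M * (\<epsilon> / (4 * M))" using M by (intro mult_left_mono) auto
        then show ?thesis using M by simp
      qed
      finally show ?thesis by simp
    qed
    note kb = this
    have Fd: "(F has_real_derivative k v) (at v within {0<..h})" if v: "v \<in> {0<..h}" for v
    proof -
      have sh: "continuous_on ({0<..h} \<times> {L..R}) (\<lambda>(v, y). f (t + v) y)" if "continuous_on ({t1..t2} \<times> {L..R}) (\<lambda>(t, y). f t y)" for f :: "real \<Rightarrow> real \<Rightarrow> real"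
      proof -
        have c1: "continuous_on ({0<..h} \<times> {L..R}) (\<lambda>(v, y). (t + v, y))" unfolding case_prod_beta by (intro continuous_intros)
        have c2: "(\<lambda>(v, y). (t + v, y)) ` ({0<..h} \<times> {L..R}) \<subseteq> {t1..t2} \<times> {L..R}" using t by auto
        show ?thesis using continuous_on_compose2[OF that c1 c2] by (simp add: case_prod_beta)
      qed
      have "(F has_real_derivative integral {L..R} (\<lambda>y. gt (t + v) y * q v y z * \<rho> y - gy (t + v) y * (q_y v y z / deriv s y))) (at v within {0<..h})"
        unfolding F_def
      proof (rule dynkin_derivative[where g = "\<lambda>v. g (t + v)" and gt = "\<lambda>v. gt (t + v)" and gy = "\<lambda>v. gy (t + v)", OF z _ _ L(1) LR _ _ sh[OF c(1)] sh[OF c(2)] sh[OF c(3)] _ _ v])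
        fix w y assume w: "w \<in> {0<..h}" and y: "y \<in> {L..R}"
        have tw: "t + w \<in> {t1..t2}" using w tv by auto
        have "((\<lambda>r. g r y) has_real_derivative gt (t + w) y) (at (t + w) within (\<lambda>r. t + r) ` {0<..h})"
          by (rule DERIV_subset[OF dt[OF tw y]]) (use t in auto)
        moreover have "((\<lambda>r. t + r) has_real_derivative 1) (at w within {0<..h})"
          by (auto intro!: derivative_eq_intros)
        ultimately have "((\<lambda>r. g r y) \<circ> (\<lambda>r. t + r) has_real_derivative gt (t + w) y * 1) (at w within {0<..h})"
          by (rule DERIV_image_chain)
        then show "((\<lambda>r. g (t + r) y) has_real_derivative gt (t + w) y) (at w within {0<..h})" by (simp add: o_def)
        show "(g (t + w) has_real_derivative gy (t + w) y) (at y within {L..R})" using dy[OF tw y] .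
      next
        fix w assume w: "w \<in> {0<..h}"
        then show "g (t + w) L = 0" "g (t + w) R = 0" using out[OF tv, of w] L by auto
      qed (auto simp: convex_real_interval)
      also have "integral {L..R} (\<lambda>y. gt (t + v) y * q v y z * \<rho> y - gy (t + v) y * (q_y v y z / deriv s y)) = k v"
      proof -
        have tw: "t + v \<in> {t1..t2}" using v tv by auto
        have v0: "0 < v" using v by simp
        have qs: "continuous_on {L..R} (\<lambda>y. q v y z)" "continuous_on {L..R} (\<lambda>y. q_y v y z)"
          using continuous_on_section[OF q_continuous_box(1)[OF L(1) z, of "{v}"]] continuous_on_section[OF q_continuous_box(3)[OF L(1) z, of "{v}"]] v0 by auto
        have gs: "continuous_on {L..R} (gt (t + v))" "continuous_on {L..R} (gy (t + v))" "continuous_on {L..R} (gyy (t + v))"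
          using continuous_on_section[OF _ tw] c by auto
        have gen: "integral {L..R} (\<lambda>y. space_generator y (gy (t + v) y) (gyy (t + v) y) * q v y z * \<rho> y) = - integral {L..R} (\<lambda>y. gy (t + v) y * (q_y v y z / deriv s y))"
          using out[OF tw] L by (intro generator_by_parts[OF z v0 L(1) LR dyy[OF tw] gs(3)]) auto
        have sgc: "continuous_on {L..R} (\<lambda>y. space_generator y (gy (t + v) y) (gyy (t + v) y))"
          unfolding space_generator_def using gs ic by (intro continuous_intros) auto
        have "k v = integral {L..R} (\<lambda>y. gt (t + v) y * q v y z * \<rho> y + space_generator y (gy (t + v) y) (gyy (t + v) y) * q v y z * \<rho> y)"
          unfolding k_def K_def by (simp add: algebra_simps)
        also have "\<dots> = integral {L..R} (\<lambda>y. gt (t + v) y * q v y z * \<rho> y) - integral {L..R} (\<lambda>y. gy (t + v) y * (q_y v y z / deriv s y))"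
          using gs qs ic sgc gen by (subst Henstock_Kurzweil_Integration.integral_add) (auto intro!: integrable_continuous_interval continuous_intros)
        also have "\<dots> = integral {L..R} (\<lambda>y. gt (t + v) y * q v y z * \<rho> y - gy (t + v) y * (q_y v y z / deriv s y))"
          using gs qs ic by (subst Henstock_Kurzweil_Integration.integral_diff) (auto intro!: integrable_continuous_interval continuous_intros)
        finally show ?thesis by simp
      qed
      finally show ?thesis .
    qed
    have inc: "\<bar>(F h - h * K t z) - (F a - a * K t z)\<bar> \<le> \<epsilon> * (h - a)" if a: "a \<in> {0<..h}" for a
    proof -
      have "norm ((F h - h * K t z) - (F a - a * K t z)) \<le> \<epsilon> * norm (h - a)"
      proof (rule field_differentiable_bound[where S = "{0<..h}" and f = "\<lambda>v. F v - v * K t z" and f' = "\<lambda>v. k v - K t z"])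
        fix v assume "v \<in> {0<..h}"
        then show "((\<lambda>v. F v - v * K t z) has_real_derivative k v - K t z) (at v within {0<..h})"
          by (auto intro!: derivative_eq_intros Fd)
      qed (use kb a h in \<open>auto simp: convex_real_interval\<close>)
      then show ?thesis using a by simp
    qed
    \<comment> \<open>The density exists at positive times only. The increment is therefore bounded
      from \<open>a n\<close> to \<open>h\<close>, and \<open>a n\<close> tends to 0, where
      continuity of the paths supplies the value \<open>g t z\<close>.\<close>
    define a where "a n = h / Suc n" for n
    have a: "a n \<in> {0<..h}" "a n \<in> {0..h}" for n using h by (auto simp: a_def field_simps)
    have alim: "a \<longlonglongrightarrow> 0" unfolding a_def using LIMSEQ_Suc[OF lim_const_over_n[of h]] by simp
    have "(\<lambda>n. \<integral>\<omega>. g (t + a n) (\<omega> (a n)) \<partial>P z) \<longlonglongrightarrow> g t z"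
    proof (rule expectation_tendsto_start[OF zE])
      show "g (t + a n) \<in> borel_measurable borel" for n using gb(1)[OF a(2)] .
      show "\<bar>g (t + a n) y\<bar> \<le> Mg" for n y using Mg(2)[OF tv[OF a(2)]] .
      show "0 \<le> a n" for n using a(2)[of n] by simp
      fix w assume w: "w \<longlonglongrightarrow> z"
      show "(\<lambda>n. g (t + a n) (w n)) \<longlonglongrightarrow> g t z"
      proof (rule LIMSEQ_I)
        fix r :: real assume r: "0 < r"
        obtain d1 where d1: "0 < d1" "\<And>t t' y y'. t \<in> {t1..t2} \<Longrightarrow> t' \<in> {t1..t2} \<Longrightarrow> \<bar>t - t'\<bar> < d1 \<Longrightarrow> \<bar>y - y'\<bar> < d1 \<Longrightarrow> \<bar>g t y - g t' y'\<bar> < r"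
          using uniformly_continuous_zero_outside[OF c(1) L(2,4), of r] out r by (auto 0 3)
        obtain N1 where N1: "\<And>n. N1 \<le> n \<Longrightarrow> norm (w n - z) < d1" using LIMSEQ_D[OF w d1(1)] by blast
        obtain N2 where N2: "\<And>n. N2 \<le> n \<Longrightarrow> norm (a n - 0) < d1" using LIMSEQ_D[OF alim d1(1)] by blast
        have "norm (g (t + a n) (w n) - g t z) < r" if "max N1 N2 \<le> n" for n
          using N1[of n] N2[of n] that d1(2)[OF tv[OF a(2)] tt, of n "w n" z] by simp
        then show "\<exists>no. \<forall>n\<ge>no. norm (g (t + a n) (w n) - g t z) < r" by blast
      qed
    qed (rule alim)
    then have Fl: "(\<lambda>n. F (a n)) \<longlonglongrightarrow> g t z" using FE[OF a(1)] by simp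
    have "\<bar>(F h - h * K t z) - (g t z - 0 * K t z)\<bar> \<le> \<epsilon> * (h - 0)"
    proof (rule LIMSEQ_le)
      show "(\<lambda>n. \<bar>(F h - h * K t z) - (F (a n) - a n * K t z)\<bar>) \<longlonglongrightarrow> \<bar>(F h - h * K t z) - (g t z - 0 * K t z)\<bar>"
        by (intro tendsto_intros Fl alim)
      show "(\<lambda>n. \<epsilon> * (h - a n)) \<longlonglongrightarrow> \<epsilon> * (h - 0)" by (intro tendsto_intros alim)
    qed (use inc a in blast)
    then show ?thesis using FE[of h] h by (simp add: algebra_simps)
  qed
  then show ?thesis using h0(1) unfolding K_def by blast
qed

end

section \<open>Cutoff functions\<close>

definition clip :: "real \<Rightarrow> real" where "clip v = max 0 (min 1 v)"

lemma clip_dist: "\<bar>clip w - clip v\<bar> \<le> \<bar>w - v\<bar>"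
  unfolding clip_def by (auto simp: max_def min_def abs_if)

lemma clip_range: "0 \<le> clip v" "clip v \<le> 1"
  by (auto simp: clip_def)

lemma continuous_clip: "continuous_on A clip"
  unfolding clip_def by (intro continuous_intros)

text \<open>The inner function need not be differentiable: where \<open>g\<close> has derivative 0,
  a nonexpansive change of its argument keeps the increment \<open>o(h)\<close>. This takes care of
  the kinks of \<open>clip\<close> and of \<open>max \<epsilon>\<close>.\<close>

lemma derivative_zero_comp_nonexpansive:
  fixes g c :: "real \<Rightarrow> real"
  assumes g: "(g has_real_derivative 0) (at (c v))" and c: "\<And>w. \<bar>c w - c v\<bar> \<le> \<bar>w - v\<bar>"
  shows "((\<lambda>w. g (c w)) has_real_derivative 0) (at v)"
proof -
  have lim: "(\<lambda>h. (g (c v + h) - g (c v)) / h) \<midarrow>0\<rightarrow> 0"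
    using g unfolding DERIV_def .
  have "(\<lambda>h. (g (c (v + h)) - g (c v)) / h) \<midarrow>0\<rightarrow> 0"
  proof (rule LIM_I)
    fix e :: real assume e: "0 < e"
    obtain d where d: "0 < d" "\<And>h. h \<noteq> 0 \<Longrightarrow> \<bar>h\<bar> < d \<Longrightarrow> \<bar>(g (c v + h) - g (c v)) / h\<bar> < e"
      using LIM_D[OF lim e] by auto
    have "\<bar>(g (c (v + h)) - g (c v)) / h\<bar> < e" if h: "h \<noteq> 0" "\<bar>h\<bar> < d" for h
    proof -
      define k where "k = c (v + h) - c v"
      have k: "\<bar>k\<bar> \<le> \<bar>h\<bar>" using c[of "v + h"] by (simp add: k_def)
      show ?thesis
      proof (cases "k = 0")
        case True
        then show ?thesis using e by (simp add: k_def)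
      next
        case False
        then have "\<bar>(g (c v + k) - g (c v)) / k\<bar> < e" using d(2)[of k] k h by simp
        then have "\<bar>g (c v + k) - g (c v)\<bar> < e * \<bar>k\<bar>" using False by (simp add: abs_divide pos_divide_less_eq)
        also have "\<dots> \<le> e * \<bar>h\<bar>" using k e by simp
        finally show ?thesis using h by (simp add: abs_divide pos_divide_less_eq k_def)
      qed
    qed
    then show "\<exists>d>0. \<forall>x. x \<noteq> 0 \<and> norm (x - 0) < d \<longrightarrow> norm ((g (c (v + x)) - g (c v)) / x - 0) < e"
      using d(1) by auto
  qed
  then show ?thesis unfolding DERIV_def .
qed

lemma clip_derivative:
  fixes g g' :: "real \<Rightarrow> real"
  assumes g: "\<And>v. (g has_real_derivative g' v) (at v)" and 0: "g' 0 = 0" "g' 1 = 0"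
  shows "((\<lambda>v. g (clip v)) has_real_derivative g' (clip v)) (at v)"
proof (cases "0 < v \<and> v < 1")
  case True
  then have "\<forall>\<^sub>F w in nhds v. w \<in> {0<..<1}" by (intro eventually_nhds_in_open) auto
  then have "\<forall>\<^sub>F w in nhds v. g (clip w) = g w" by eventually_elim (auto simp: clip_def)
  moreover have "clip v = v" using True by (simp add: clip_def)
  ultimately show ?thesis using g[of v] by (subst DERIV_cong_ev[OF refl _ refl]) auto
next
  case False
  then have "clip v = 0 \<or> clip v = 1" by (auto simp: clip_def)
  then have "g' (clip v) = 0" using 0 by auto
  then show ?thesis using derivative_zero_comp_nonexpansive[of g clip v] g[of "clip v"] clip_dist by simp
qed

text \<open>A quintic whose first two derivatives vanish at \<open>0\<close> and \<open>1\<close>, so that \<open>step\<close> is \<open>C\<^sup>2\<close>.\<close>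

definition step :: "real \<Rightarrow> real" where
  "step v = 6 * clip v ^ 5 - 15 * clip v ^ 4 + 10 * clip v ^ 3"
definition step1 :: "real \<Rightarrow> real" where
  "step1 v = 30 * clip v ^ 2 - 60 * clip v ^ 3 + 30 * clip v ^ 4"
definition step2 :: "real \<Rightarrow> real" where
  "step2 v = 60 * clip v - 180 * clip v ^ 2 + 120 * clip v ^ 3"

lemma step_derivative: "(step has_real_derivative step1 v) (at v)"
  unfolding step_def[abs_def] step1_def
  by (rule clip_derivative[where g = "\<lambda>c. 6 * c ^ 5 - 15 * c ^ 4 + 10 * c ^ 3" and g' = "\<lambda>c. 30 * c ^ 2 - 60 * c ^ 3 + 30 * c ^ 4"])
    (auto intro!: derivative_eq_intros)

lemma step1_derivative: "(step1 has_real_derivative step2 v) (at v)"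
  unfolding step1_def[abs_def] step2_def
  by (rule clip_derivative[where g = "\<lambda>c. 30 * c ^ 2 - 60 * c ^ 3 + 30 * c ^ 4" and g' = "\<lambda>c. 60 * c - 180 * c ^ 2 + 120 * c ^ 3"])
    (auto intro!: derivative_eq_intros)

lemma continuous_step2: "continuous_on A step2"
  unfolding step2_def[abs_def] by (intro continuous_intros continuous_clip)

lemma continuous_step1: "continuous_on A step1"
  using step1_derivative by (meson DERIV_isCont continuous_at_imp_continuous_on)

lemma continuous_step: "continuous_on A step"
  using step_derivative by (meson DERIV_isCont continuous_at_imp_continuous_on)

lemma step_eq:
  "v \<le> 0 \<Longrightarrow> step v = 0" "v \<le> 0 \<Longrightarrow> step1 v = 0" "v \<le> 0 \<Longrightarrow> step2 v = 0"
  "1 \<le> v \<Longrightarrow> step v = 1" "1 \<le> v \<Longrightarrow> step1 v = 0" "1 \<le> v \<Longrightarrow> step2 v = 0"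
  by (auto simp: step_def step1_def step2_def clip_def)

lemma step_range: "0 \<le> step v" "step v \<le> 1"
proof -
  have p: "0 \<le> 6 * c ^ 5 - 15 * c ^ 4 + 10 * c ^ 3" if "0 \<le> c" for c :: real
  proof -
    \<comment> \<open>Completed square of \<open>6 * c\<^sup>2 - 15 * c + 10\<close>, the cofactor
      of \<open>c ^ 3\<close> in the quintic.\<close>
    have "0 \<le> 6 * (c - 5/4)\<^sup>2 + 5/8" by simp
    then have "0 \<le> c ^ 3 * (6 * (c - 5/4)\<^sup>2 + 5/8)" using that by (intro mult_nonneg_nonneg) auto
    then show ?thesis by (simp add: power2_eq_square algebra_simps power_numeral_reduce)
  qed
  \<comment> \<open>The quintic is symmetric about \<open>1/2\<close>, which reduces the upper bound
    to the lower one.\<close>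
  have sym: "1 - (6 * c ^ 5 - 15 * c ^ 4 + 10 * c ^ 3) = 6 * (1 - c) ^ 5 - 15 * (1 - c) ^ 4 + 10 * (1 - c) ^ 3" for c :: real
    by (simp add: algebra_simps power_numeral_reduce)
  show "0 \<le> step v" unfolding step_def using p clip_range by blast
  show "step v \<le> 1" using p[of "1 - clip v"] clip_range[of v] unfolding step_def sym[symmetric] by simp
qed

lemma le_Inf_ennreal_iff:
  "0 \<le> u \<Longrightarrow> ennreal u \<le> Inf (ennreal ` {t. 0 \<le> t \<and> Q t}) \<longleftrightarrow> (\<forall>t. 0 \<le> t \<longrightarrow> Q t \<longrightarrow> u \<le> t)"
  by (auto simp: le_Inf_iff)

text \<open>Telescoping over equal steps of length at most \<open>h0\<close>: the total increment is
  at most \<open>\<epsilon> * (b - a)\<close>, and \<open>\<epsilon>\<close> is chosen to make this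
  half of a supposed nonzero increment.\<close>

lemma increments_constant:
  fixes M :: "real \<Rightarrow> real"
  assumes ab: "a \<le> b"
    and inc: "\<And>\<epsilon>. 0 < \<epsilon> \<Longrightarrow> \<exists>h0>0. \<forall>h t. 0 < h \<longrightarrow> h \<le> h0 \<longrightarrow> a \<le> t \<longrightarrow> t + h \<le> b \<longrightarrow> \<bar>M (t + h) - M t\<bar> \<le> \<epsilon> * h"
  shows "M a = M b"
proof (rule ccontr)
  assume ne: "M a \<noteq> M b"
  then have ab': "a < b" using ab by (cases "a = b") auto
  define \<epsilon> where "\<epsilon> = \<bar>M b - M a\<bar> / (2 * (b - a))"
  have e: "0 < \<epsilon>" using ne ab' by (simp add: \<epsilon>_def)
  obtain h0 where h0: "0 < h0" "\<And>h t. 0 < h \<Longrightarrow> h \<le> h0 \<Longrightarrow> a \<le> t \<Longrightarrow> t + h \<le> b \<Longrightarrow> \<bar>M (t + h) - M t\<bar> \<le> \<epsilon> * h"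
    using inc[OF e] by blast
  obtain n :: nat where n: "(b - a) / h0 < real n" using reals_Archimedean2 by blast
  have n0: "0 < real n" using n h0 ab' by (smt (verit) divide_pos_pos)
  define h where "h = (b - a) / n"
  have hp: "0 < h" and hh: "h \<le> h0" using n n0 h0 ab' by (auto simp: h_def field_simps)
  have nh: "real n * h = b - a" using n0 by (simp add: h_def)
  have "\<bar>M (a + real k * h) - M a\<bar> \<le> \<epsilon> * (real k * h)" if "k \<le> n" for k
    using that
  proof (induction k)
    case (Suc k)
    have "real (Suc k) * h \<le> real n * h" using Suc.prems hp by (intro mult_right_mono) auto
    moreover have eq: "a + real (Suc k) * h = (a + real k * h) + h" by (simp add: algebra_simps)
    moreover have "0 \<le> real k * h" using hp by simp
    ultimately have "a \<le> a + real k * h" "a + real k * h + h \<le> b" using nh by linarith+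
    then have "\<bar>M (a + real (Suc k) * h) - M (a + real k * h)\<bar> \<le> \<epsilon> * h"
      unfolding eq by (intro h0(2) hp hh)
    moreover have "\<epsilon> * (real (Suc k) * h) = \<epsilon> * (real k * h) + \<epsilon> * h" by (simp add: algebra_simps)
    moreover have "\<bar>M (a + real k * h) - M a\<bar> \<le> \<epsilon> * (real k * h)" using Suc by simp
    ultimately show ?case by linarith
  qed simp
  from this[of n] have "\<bar>M b - M a\<bar> \<le> \<epsilon> * (b - a)" unfolding nh by simp
  also have "\<epsilon> * (b - a) = \<bar>M b - M a\<bar> / 2"
  proof -
    have *: "X / (2 * D) * D = X / 2" if "D \<noteq> 0" for X D :: real using that by simp
    show ?thesis unfolding \<epsilon>_def by (rule *) (use ab' in simp)
  qed
  finally show False using ne by simp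
qed

section \<open>Avoiding a curve\<close>

text \<open>Fixes one choice of the derivatives whose existence \<open>C12_on\<close> asserts, so
  that all lemmas speak of the same continuous functions \<open>ht\<close>, \<open>hy\<close>,
  \<open>hyy\<close> up to the curve.\<close>

locale curve_diffusion = linear_diffusion l E P s \<rho> q
  for l E P s \<rho> q +
  fixes f :: "real \<Rightarrow> ereal" and ht hy hyy :: "real \<Rightarrow> real \<Rightarrow> real"
  assumes f_range: "\<And>t. 0 \<le> t \<Longrightarrow> l \<le> f t \<and> f t < \<infinity>"
    and f_cont: "continuous_on {0..} f"
    and lifetime_pos: "0 < curve_lifetime l f"
    and eventually_above: "\<And>z. curve_lifetime l f = \<infinity> \<Longrightarrow> l < ereal z \<Longrightarrow>
        AE \<omega> in P z. \<exists>L>0. ((\<lambda>t. ereal (\<omega> t) - f t) \<longlongrightarrow> L) at_top"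
    and H_continuous: "continuous_on (above_curve l f) (\<lambda>(t, y). no_hit_prob l P f t y)"
      "continuous_on (above_curve l f) (\<lambda>(t, y). ht t y)"
      "continuous_on (above_curve l f) (\<lambda>(t, y). hy t y)"
      "continuous_on (above_curve l f) (\<lambda>(t, y). hyy t y)"
    and H_derivs: "\<And>t y. (t, y) \<in> above_curve l f \<Longrightarrow>
        ((\<lambda>r. no_hit_prob l P f r y) has_real_derivative ht t y) (at t within {r. (r, y) \<in> above_curve l f}) \<and>
        ((\<lambda>z. no_hit_prob l P f t z) has_real_derivative hy t y) (at y within {z. (t, z) \<in> above_curve l f}) \<and>
        ((\<lambda>z. hy t z) has_real_derivative hyy t y) (at y within {z. (t, z) \<in> above_curve l f})"
begin

abbreviation "\<zeta> \<equiv> curve_lifetime l f"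
abbreviation "H \<equiv> no_hit_prob l P f"
definition alive :: "real \<Rightarrow> bool" where "alive t \<longleftrightarrow> 0 \<le> t \<and> ennreal t < \<zeta>"
definition F :: "real \<Rightarrow> real" where "F t = real_of_ereal (f t)"

lemma alive_nonneg: "alive t \<Longrightarrow> 0 \<le> t" by (simp add: alive_def)

lemma alive_zero: "alive 0" using lifetime_pos by (simp add: alive_def)

lemma alive_le: "alive t \<Longrightarrow> 0 \<le> r \<Longrightarrow> r \<le> t \<Longrightarrow> alive r"
  unfolding alive_def by (meson ennreal_leI le_less_trans)

lemma alive_f:
  assumes "alive t"
  shows "f t = ereal (F t)" "l < ereal (F t)"
proof -
  have "f t \<noteq> l"
  proof
    assume "f t = l"
    then have "\<zeta> \<le> ennreal t" unfolding curve_lifetime_def using assms by (intro Inf_lower imageI) (simp add: alive_def)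
    then show False using assms by (simp add: alive_def not_le[symmetric])
  qed
  then have "l < f t" "f t < \<infinity>" using f_range[OF alive_nonneg[OF assms]] by auto
  then show "f t = ereal (F t)" unfolding F_def by (cases "f t") auto
  then show "l < ereal (F t)" using \<open>l < f t\<close> by simp
qed

lemma F_continuous: "continuous_on {t. alive t} F"
proof -
  have "continuous_on {t. alive t} f" using f_cont by (rule continuous_on_subset) (auto simp: alive_def)
  then have "continuous_on {t. alive t} (real_of_ereal \<circ> f)"
    using alive_f(1) by (subst (asm) continuous_on_iff_real) auto
  then show ?thesis by (simp add: o_def F_def[abs_def])
qed

lemma alive_extend:
  assumes "alive t"
  shows "\<exists>d>0. alive (t + d)"
proof (cases \<zeta>)
  case (real r)
  then have "t < r" using assms by (auto simp: alive_def ennreal_less_iff)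
  then show ?thesis using assms real by (intro exI[of _ "(r - t) / 2"]) (auto simp: alive_def ennreal_less_iff field_simps)
next
  case top
  then show ?thesis using assms by (intro exI[of _ 1]) (auto simp: alive_def)
qed

lemma alive_not_le: "0 \<le> t \<Longrightarrow> \<not> alive t \<Longrightarrow> ennreal t \<le> \<zeta> \<Longrightarrow> \<zeta> = ennreal t"
  by (auto simp: alive_def)

lemma lifetime_value:
  assumes "\<zeta> = ennreal r" "0 \<le> r"
  shows "f r = l"
proof -
  define S where "S = {t. 0 \<le> t \<and> f t = l}"
  have "closedin (top_of_set {0..}) ({0..} \<inter> f -` {l})"
    using f_cont by (intro continuous_closedin_preimage) auto
  moreover have "{0..} \<inter> f -` {l} = S" by (auto simp: S_def)
  ultimately have cl: "closed S" by (metis closedin_closed_eq closed_atLeast)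
  have "S \<noteq> {}" using assms(1) unfolding curve_lifetime_def S_def[symmetric] by (auto simp: Inf_empty)
  from Inf_ennreal_attained[OF cl this] obtain t where t: "t \<in> S" "Inf (ennreal ` S) = ennreal t" by (auto simp: S_def)
  then have "ennreal r = ennreal t" using assms(1) unfolding curve_lifetime_def S_def by simp
  then show ?thesis using t assms(2) by (auto simp: S_def)
qed

text \<open>The event behind \<open>H t\<close>, with the clock of the path started at time
  \<open>t\<close>. The lifetime itself is included: being at \<open>l\<close> at that moment counts
  as meeting the curve.\<close>

definition avoiding :: "real \<Rightarrow> (real \<Rightarrow> real) set" where
  "avoiding t = {\<omega> \<in> space (path_space E). \<forall>u\<ge>0. ennreal (t + u) \<le> \<zeta> \<longrightarrow> ereal (\<omega> u) \<noteq> f (t + u)}"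

text \<open>The curve is not at \<open>l\<close> up to time \<open>t\<close>, so shifting it by
  \<open>t\<close> shortens its lifetime by exactly \<open>t\<close>.\<close>

lemma lifetime_shift:
  assumes "alive t" "0 \<le> u"
  shows "ennreal u \<le> curve_lifetime l (curve_shift t f) \<longleftrightarrow> ennreal (t + u) \<le> \<zeta>"
proof -
  have t: "0 \<le> t" using assms by (simp add: alive_def)
  have *: "t < t'" if "0 \<le> t'" "f t' = l" for t'
  proof (rule ccontr)
    assume "\<not> t < t'"
    then have "alive t'" using alive_le assms(1) that by auto
    then show False using alive_f[of t'] that by simp
  qed
  have "(\<forall>u'. 0 \<le> u' \<longrightarrow> f (t + u') = l \<longrightarrow> u \<le> u') \<longleftrightarrow> (\<forall>t'. 0 \<le> t' \<longrightarrow> f t' = l \<longrightarrow> t + u \<le> t')"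
  proof (intro iffI allI impI)
    fix t' assume a: "\<forall>u'. 0 \<le> u' \<longrightarrow> f (t + u') = l \<longrightarrow> u \<le> u'" and t': "0 \<le> t'" "f t' = l"
    have "u \<le> t' - t" using a[rule_format, of "t' - t"] *[OF t'] t' by simp
    then show "t + u \<le> t'" by simp
  next
    fix u' assume a: "\<forall>t'. 0 \<le> t' \<longrightarrow> f t' = l \<longrightarrow> t + u \<le> t'" and "0 \<le> u'" "f (t + u') = l"
    then show "u \<le> u'" using a[rule_format, of "t + u'"] t by simp
  qed
  then show ?thesis unfolding curve_lifetime_def curve_shift_def using assms t by (simp add: le_Inf_ennreal_iff del: ennreal_plus)
qed

lemma first_passage_infinite_iff:
  assumes "alive t"
  shows "first_passage l (curve_shift t f) \<omega> = \<infinity> \<longleftrightarrow> (\<forall>u\<ge>0. ennreal (t + u) \<le> \<zeta> \<longrightarrow> ereal (\<omega> u) \<noteq> f (t + u))"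
proof -
  have "first_passage l (curve_shift t f) \<omega> = \<infinity> \<longleftrightarrow>
    {u. 0 \<le> u \<and> ennreal u \<le> curve_lifetime l (curve_shift t f) \<and> ereal (\<omega> u) = curve_shift t f u} = {}"
    unfolding first_passage_def infinity_ennreal_def Inf_top_conv(1) by auto
  then show ?thesis using lifetime_shift[OF assms] by (auto simp: curve_shift_def)
qed

text \<open>Meetings before the lifetime are covered by countably many compact time intervals on
  which the curve is real and continuous; a meeting at the lifetime is a condition on one
  coordinate.\<close>

lemma avoiding_sets:
  assumes t: "alive t"
  shows "avoiding t \<in> sets (path_space E)"
proof -
  define D where "D = {d \<in> \<rat>. 0 \<le> d \<and> alive (t + d)}"
  have cD: "countable D" unfolding D_def using countable_rat by (rule countable_subset[rotated]) auto
  define N1 where "N1 = (\<Union>d\<in>D. {\<omega> \<in> space (path_space E). \<exists>u\<in>{0..d}. \<omega> u = F (t + u)})"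
  define N2 where "N2 = {\<omega> \<in> space (path_space E). \<exists>u\<ge>0. \<zeta> = ennreal (t + u) \<and> ereal (\<omega> u) = f (t + u)}"
  have "{\<omega> \<in> space (path_space E). \<exists>u\<in>{0..d}. \<omega> u = F (t + u)} \<in> sets (path_space E)" if "d \<in> D" for d
  proof -
    have "continuous_on {0..d} (\<lambda>u. F (t + u))"
    proof (rule continuous_on_compose2[OF F_continuous])
      show "continuous_on {0..d} (\<lambda>u. t + u)" by (intro continuous_intros)
      show "(\<lambda>u. t + u) ` {0..d} \<subseteq> {t. alive t}" using that t alive_le[of "t + d"] alive_nonneg[OF t] by (auto simp: D_def)
    qed
    from curve_hit_in_filtration[OF order_refl order_refl this] show ?thesis using path_filtration_subset by blast
  qed
  then have m1: "N1 \<in> sets (path_space E)" unfolding N1_def by (intro sets.countable_UN' cD) auto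
  have m2: "N2 \<in> sets (path_space E)"
  proof (cases "\<exists>r\<ge>0. \<zeta> = ennreal (t + r)")
    case True
    then obtain r where r: "0 \<le> r" "\<zeta> = ennreal (t + r)" by blast
    have "N2 = {\<omega> \<in> space (path_space E). ereal (\<omega> r) = f (t + r)}"
      unfolding N2_def using r alive_nonneg[OF t] by (auto simp: ennreal_inj)
    also have "\<dots> = (\<lambda>\<omega>. \<omega> r) -` {y. ereal y = f (t + r)} \<inter> space (path_space E)" by auto
    also have "\<dots> \<in> sets (path_space E)"
    proof (rule measurable_sets[OF measurable_coordinate[OF r(1)]])
      have "{y. ereal y = f (t + r)} \<subseteq> {real_of_ereal (f (t + r))}" by (auto dest: sym)
      then have "finite {y. ereal y = f (t + r)}" by (rule finite_subset) simp
      then show "{y. ereal y = f (t + r)} \<in> sets borel" by (intro borel_closed finite_imp_closed)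
    qed
    finally show ?thesis .
  next
    case False
    then have "N2 = {}" by (auto simp: N2_def)
    then show ?thesis by simp
  qed
  have "avoiding t = space (path_space E) - (N1 \<union> N2)"
  proof (intro set_eqI iffI)
    fix \<omega> assume w: "\<omega> \<in> avoiding t"
    have "\<omega> \<notin> N1"
    proof
      assume "\<omega> \<in> N1"
      then obtain d u where "d \<in> D" "0 \<le> u" "u \<le> d" "\<omega> u = F (t + u)" by (auto simp: N1_def)
      moreover from this have "alive (t + u)" using alive_le[of "t + d" "t + u"] alive_nonneg[OF t] by (auto simp: D_def)
      ultimately show False using w alive_f(1)[of "t + u"] unfolding avoiding_def alive_def by auto
    qed
    moreover have "\<omega> \<notin> N2" using w unfolding avoiding_def N2_def by auto
    ultimately show "\<omega> \<in> space (path_space E) - (N1 \<union> N2)" using w by (auto simp: avoiding_def)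
  next
    fix \<omega> assume w: "\<omega> \<in> space (path_space E) - (N1 \<union> N2)"
    have "ereal (\<omega> u) \<noteq> f (t + u)" if u: "0 \<le> u" "ennreal (t + u) \<le> \<zeta>" for u
    proof (cases "alive (t + u)")
      case True
      obtain d where d: "0 < d" "alive (t + u + d)" using alive_extend[OF True] by blast
      obtain r where r: "r \<in> \<rat>" "u < r" "r < u + d" using Rats_dense_in_real[of u "u + d"] d by auto
      have "alive (t + r)" using alive_le[OF d(2), of "t + r"] r u alive_nonneg[OF t] by auto
      then have "r \<in> D" using r u by (auto simp: D_def)
      then have "\<omega> u \<noteq> F (t + u)" using w u r unfolding N1_def by auto
      then show ?thesis using alive_f(1)[OF True] by simp
    next
      case False
      then have "\<zeta> = ennreal (t + u)" using alive_not_le[of "t + u"] u alive_nonneg[OF t] by (simp del: ennreal_plus)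
      then show ?thesis using w u unfolding N2_def by auto
    qed
    then show "\<omega> \<in> avoiding t" using w by (auto simp: avoiding_def)
  qed
  then show ?thesis using m1 m2 by auto
qed

lemma H_eq: "alive t \<Longrightarrow> y \<in> E \<Longrightarrow> H t y = measure (P y) (avoiding t)"
  unfolding no_hit_prob_def avoiding_def using first_passage_infinite_iff[of t] by (simp add: space_P)

lemma H_range: "alive t \<Longrightarrow> y \<in> E \<Longrightarrow> 0 \<le> H t y" "alive t \<Longrightarrow> y \<in> E \<Longrightarrow> H t y \<le> 1"
  using prob_space.prob_le_1[OF P_prob_space, of y "avoiding t"] by (auto simp: H_eq)

lemma H_measurable:
  assumes "alive t" "z \<in> E" "0 \<le> u"
  shows "(\<lambda>\<omega>. H t (\<omega> u)) \<in> borel_measurable (P z)"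
proof -
  have "(\<lambda>\<omega>. \<omega> u) \<in> P z \<rightarrow>\<^sub>M restrict_space borel E"
    using measurable_coordinate_E[OF assms(3)] measurable_P_iff[OF assms(2)] by blast
  from measurable_compose[OF this measurable_measure_P[OF avoiding_sets[OF assms(1)]]]
  have "(\<lambda>\<omega>. measure (P (\<omega> u)) (avoiding t)) \<in> borel_measurable (P z)" .
  then show ?thesis
    by (rule measurable_cong[THEN iffD1, rotated])
      (use path_spaceD(2)[OF _ assms(3)] space_P[OF assms(2)] H_eq[OF assms(1)] in auto)
qed

lemma shift_avoiding_event:
  assumes "alive t" "0 \<le> h"
  shows "{\<omega> \<in> space (path_space E). path_shift h \<omega> \<in> avoiding t} \<in> sets (path_space E)"
  using measurable_sets[OF measurable_path_shift[OF assms(2)] avoiding_sets[OF assms(1)]]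
  by (simp add: vimage_def Int_def conj_commute)

text \<open>The event \<open>A\<close> of the past allows the identity to be localised, for instance
  to paths that are below the curve at time \<open>h\<close>, or to paths that have kept away from
  it so far.\<close>

lemma expectation_H:
  assumes z: "z \<in> E" and h: "0 \<le> h" and t: "alive t" and A: "A \<in> sets (path_filtration E h)"
  shows "emeasure (P z) {\<omega> \<in> A. path_shift h \<omega> \<in> avoiding t} = (\<integral>\<^sup>+\<omega>\<in>A. ennreal (H t (\<omega> h)) \<partial>P z)"
proof -
  have "emeasure (P z) {\<omega> \<in> A. path_shift h \<omega> \<in> avoiding t} = (\<integral>\<^sup>+\<omega>\<in>A. emeasure (P (\<omega> h)) (avoiding t) \<partial>P z)"
    by (rule markov_fixed[OF z h A avoiding_sets[OF t]])
  also have "\<dots> = (\<integral>\<^sup>+\<omega>\<in>A. ennreal (H t (\<omega> h)) \<partial>P z)"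
  proof (rule nn_integral_cong)
    fix \<omega> assume "\<omega> \<in> space (P z)"
    then have e: "\<omega> h \<in> E" using path_spaceD(2)[OF _ h, of \<omega>] space_P[OF z] by auto
    then interpret prob_space "P (\<omega> h)" by (rule P_prob_space)
    show "emeasure (P (\<omega> h)) (avoiding t) * indicator A \<omega> = ennreal (H t (\<omega> h)) * indicator A \<omega>"
      unfolding H_eq[OF t e] by (simp add: emeasure_eq_measure)
  qed
  finally show ?thesis .
qed

lemma H_integrable:
  assumes "alive t" "z \<in> E" "0 \<le> h"
  shows "integrable (P z) (\<lambda>\<omega>. H t (\<omega> h))"
proof -
  interpret prob_space "P z" by (rule P_prob_space[OF assms(2)])
  show ?thesis
  proof (rule integrable_const_bound[of _ 1])
    show "AE \<omega> in P z. norm (H t (\<omega> h)) \<le> 1"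
      using H_range[OF assms(1) path_spaceD(2)[OF _ assms(3)]] space_P[OF assms(2)] by (intro AE_I2) auto
  qed (rule H_measurable[OF assms])
qed

lemma expectation_H_real:
  assumes z: "z \<in> E" and h: "0 \<le> h" and t: "alive t"
  shows "(\<integral>\<omega>. H t (\<omega> h) \<partial>P z) = measure (P z) {\<omega> \<in> space (path_space E). path_shift h \<omega> \<in> avoiding t}"
proof -
  have "emeasure (P z) {\<omega> \<in> space (path_space E). path_shift h \<omega> \<in> avoiding t} = (\<integral>\<^sup>+\<omega>\<in>space (path_space E). ennreal (H t (\<omega> h)) \<partial>P z)"
    using expectation_H[OF z h t, of "space (path_space E)"] sets.top[of "path_filtration E h"] by simp
  also have "\<dots> = (\<integral>\<^sup>+\<omega>. ennreal (H t (\<omega> h)) \<partial>P z)"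
    using space_P[OF z] by (intro nn_integral_cong) auto
  also have "\<dots> = ennreal (\<integral>\<omega>. H t (\<omega> h) \<partial>P z)"
    using H_range(1)[OF t path_spaceD(2)[OF _ h]] space_P[OF z]
    by (intro nn_integral_eq_integral H_integrable t z h AE_I2) auto
  finally have "emeasure (P z) {\<omega> \<in> space (path_space E). path_shift h \<omega> \<in> avoiding t} = ennreal (\<integral>\<omega>. H t (\<omega> h) \<partial>P z)" .
  moreover have "0 \<le> (\<integral>\<omega>. H t (\<omega> h) \<partial>P z)"
    using H_range(1)[OF t path_spaceD(2)[OF _ h]] space_P[OF z] by (intro integral_nonneg_AE AE_I2) auto
  ultimately show ?thesis unfolding measure_def by simp
qed

lemma avoiding_split:
  assumes t: "alive t" "0 \<le> h" "alive (t + h)" and w: "\<omega> \<in> space (path_space E)"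
  shows "\<omega> \<in> avoiding t \<longleftrightarrow> (\<forall>u. 0 \<le> u \<longrightarrow> u < h \<longrightarrow> \<omega> u \<noteq> F (t + u)) \<and> path_shift h \<omega> \<in> avoiding (t + h)"
proof -
  have "(\<forall>u\<ge>0. ennreal (t + u) \<le> \<zeta> \<longrightarrow> ereal (\<omega> u) \<noteq> f (t + u)) \<longleftrightarrow>
    (\<forall>u. 0 \<le> u \<longrightarrow> u < h \<longrightarrow> \<omega> u \<noteq> F (t + u)) \<and> (\<forall>u\<ge>0. ennreal (t + h + u) \<le> \<zeta> \<longrightarrow> ereal (\<omega> (h + u)) \<noteq> f (t + h + u))"
  proof (intro iffI conjI allI impI)
    fix u assume a: "\<forall>u\<ge>0. ennreal (t + u) \<le> \<zeta> \<longrightarrow> ereal (\<omega> u) \<noteq> f (t + u)" and u: "0 \<le> u" "u < h"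
    have "alive (t + u)" using alive_le[OF t(3), of "t + u"] u alive_nonneg[OF t(1)] by auto
    then show "\<omega> u \<noteq> F (t + u)" using a[rule_format, OF u(1)] alive_f(1)[of "t + u"] unfolding alive_def by (auto simp: less_imp_le)
  next
    fix u assume a: "\<forall>u\<ge>0. ennreal (t + u) \<le> \<zeta> \<longrightarrow> ereal (\<omega> u) \<noteq> f (t + u)" and u: "0 \<le> u" "ennreal (t + h + u) \<le> \<zeta>"
    then show "ereal (\<omega> (h + u)) \<noteq> f (t + h + u)" using a[rule_format, of "h + u"] t by (simp add: add.assoc)
  next
    fix u assume a: "(\<forall>u. 0 \<le> u \<longrightarrow> u < h \<longrightarrow> \<omega> u \<noteq> F (t + u)) \<and> (\<forall>u\<ge>0. ennreal (t + h + u) \<le> \<zeta> \<longrightarrow> ereal (\<omega> (h + u)) \<noteq> f (t + h + u))"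
      and u: "0 \<le> u" "ennreal (t + u) \<le> \<zeta>"
    show "ereal (\<omega> u) \<noteq> f (t + u)"
    proof (cases "u < h")
      case True
      have "alive (t + u)" using alive_le[OF t(3), of "t + u"] u True alive_nonneg[OF t(1)] by auto
      then show ?thesis using a True u alive_f(1)[of "t + u"] by auto
    next
      case False
      then show ?thesis using a[THEN conjunct2, rule_format, of "u - h"] u by simp
    qed
  qed
  then show ?thesis unfolding avoiding_def using w path_shift_in_space[OF w t(2)] by (auto simp: path_shift_apply add.assoc)
qed

text \<open>By the Markov property the expectation is the probability of avoiding the curve from
  \<open>t + h\<close> on. It exceeds \<open>H t z\<close> by the probability of meeting the curve
  before \<open>t + h\<close> and avoiding it later, and a path from \<open>z\<close> has to come
  down to \<open>c\<close> for that. Hence \<open>H\<close> is a martingale along the path up to the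
  cost of one crossing.\<close>

lemma H_increment:
  assumes t: "alive t" "0 < h" "alive (t + h)" and z: "z \<in> E" "c \<in> E" and c: "c \<le> z" "\<And>u. 0 \<le> u \<Longrightarrow> u \<le> h \<Longrightarrow> F (t + u) < c"
  shows "H t z \<le> (\<integral>\<omega>. H (t + h) (\<omega> h) \<partial>P z)"
    "ennreal ((\<integral>\<omega>. H (t + h) (\<omega> h) \<partial>P z) - H t z) \<le> hit_prob z c (2 * h)"
proof -
  interpret prob_space "P z" by (rule P_prob_space[OF z(1)])
  let ?S = "{\<omega> \<in> space (path_space E). path_shift h \<omega> \<in> avoiding (t + h)}"
  let ?Q = "{\<omega> \<in> space (path_space E). hitting_time c \<omega> < ennreal (2 * h)}"
  have S: "?S \<in> events" using shift_avoiding_event[OF t(3)] t(2) sets_P[OF z(1)] by auto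
  have N: "avoiding t \<in> events" using avoiding_sets[OF t(1)] sets_P[OF z(1)] by auto
  have Q: "?Q \<in> events" using sets_P[OF z(1)] by auto
  have e: "(\<integral>\<omega>. H (t + h) (\<omega> h) \<partial>P z) = prob ?S" using expectation_H_real[OF z(1) _ t(3)] t(2) by simp
  have sub: "avoiding t \<subseteq> ?S" using avoiding_split[OF t(1) _ t(3)] t(2) by (auto simp: avoiding_def)
  have H: "H t z = prob (avoiding t)" using H_eq[OF t(1) z(1)] .
  show "H t z \<le> (\<integral>\<omega>. H (t + h) (\<omega> h) \<partial>P z)" unfolding e H using sub S by (intro finite_measure_mono) auto
  have "prob ?S - prob (avoiding t) = prob (?S - avoiding t)" using finite_measure_Diff[OF S N sub] by simp
  moreover have "emeasure (P z) (?S - avoiding t) \<le> emeasure (P z) ?Q"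
  proof (rule emeasure_mono_AE[OF _ Q])
    show "AE \<omega> in P z. \<omega> \<in> ?S - avoiding t \<longrightarrow> \<omega> \<in> ?Q"
      using start_AE[OF z(1)]
    proof (eventually_elim, intro impI)
      fix \<omega> assume w: "\<omega> \<in> space (path_space E) \<and> \<omega> 0 = z" and "\<omega> \<in> ?S - avoiding t"
      then obtain u where u: "0 \<le> u" "u < h" "\<omega> u = F (t + u)" using avoiding_split[OF t(1) _ t(3), of \<omega>] t(2) by auto
      then have "\<omega> u < c" using c(2)[of u] by simp
      then obtain r where "0 \<le> r" "r \<le> u" "\<omega> r = c" using path_ivt[OF conjunct1[OF w], of 0 u c] w u c(1) by auto
      then show "\<omega> \<in> ?Q" using w u t(2) by (subst mem_Collect_eq, subst hitting_time_less_iff) auto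
    qed
  qed
  ultimately show "ennreal ((\<integral>\<omega>. H (t + h) (\<omega> h) \<partial>P z) - H t z) \<le> hit_prob z c (2 * h)"
    unfolding e H by (simp add: emeasure_eq_measure)
qed

text \<open>The curve may be at \<open>l\<close> at time \<open>d\<close>, possibly at minus
  infinity, so the intermediate value theorem cannot be applied to a difference. Instead, the times
  with the path on or below the curve and those with the path on or above it are closed sets that
  cover a connected interval.\<close>

lemma curve_crossing:
  assumes w: "\<omega> \<in> space (path_space E)" and t: "0 \<le> t" "t \<le> d"
    and le: "ereal (\<omega> t) \<le> f t" "f d \<le> ereal (\<omega> d)"
  shows "\<exists>u\<in>{t..d}. ereal (\<omega> u) = f u"
proof (rule ccontr)
  assume no: "\<not> ?thesis"
  have cw: "continuous_on {t..d} (\<lambda>u. ereal (\<omega> u))"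
    using continuous_on_subset[OF path_spaceD(1)[OF w], of "{t..d}"] t by (intro continuous_on_ereal) auto
  have cf: "continuous_on {t..d} f" using continuous_on_subset[OF f_cont, of "{t..d}"] t by auto
  have closed_le: "closed {u \<in> {t..d}. g u \<le> g' u}" if "continuous_on {t..d} g" "continuous_on {t..d} g'" for g g' :: "real \<Rightarrow> ereal"
  proof -
    have "closed {p :: ereal \<times> ereal. fst p \<le> snd p}" by (intro closed_Collect_le continuous_intros)
    then have "closed ({t..d} \<inter> (\<lambda>u. (g u, g' u)) -` {p. fst p \<le> snd p})"
      using that by (intro continuous_closed_preimage continuous_on_Pair) auto
    also have "{t..d} \<inter> (\<lambda>u. (g u, g' u)) -` {p. fst p \<le> snd p} = {u \<in> {t..d}. g u \<le> g' u}" by auto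
    finally show ?thesis .
  qed
  define A where "A = {u \<in> {t..d}. ereal (\<omega> u) \<le> f u}"
  define B where "B = {u \<in> {t..d}. f u \<le> ereal (\<omega> u)}"
  have "closed A" "closed B" unfolding A_def B_def
    using closed_le[OF cw cf] closed_le[OF cf cw] by auto
  moreover have "{t..d} \<subseteq> A \<union> B" by (auto simp: A_def B_def)
  moreover have "A \<inter> B \<inter> {t..d} = {}" using no by (auto simp: A_def B_def)
  moreover have "A \<inter> {t..d} \<noteq> {}" "B \<inter> {t..d} \<noteq> {}" using t le by (auto simp: A_def B_def)
  ultimately show False using connected_Icc[of t d] unfolding connected_closed by blast
qed

text \<open>If all meeting times are less than \<open>t\<close>, their supremum is less than
  \<open>t\<close> as well, because they form a compact subset of \<open>[0, t]\<close> and the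
  supremum is attained.\<close>

lemma last_passage_less_iff:
  assumes t: "alive t" "0 < t" and w: "\<omega> \<in> space (path_space E)"
  shows "last_passage l f \<omega> < ennreal t \<longleftrightarrow> path_shift t \<omega> \<in> avoiding t"
proof -
  define S where "S = {r. 0 \<le> r \<and> ennreal r \<le> \<zeta> \<and> ereal (\<omega> r) = f r}"
  have lp: "last_passage l f \<omega> = Sup (ennreal ` S)" by (simp add: last_passage_def S_def)
  have iff: "path_shift t \<omega> \<in> avoiding t \<longleftrightarrow> (\<forall>r\<in>S. r < t)"
  proof -
    have "(\<forall>u\<ge>0. ennreal (t + u) \<le> \<zeta> \<longrightarrow> ereal (\<omega> (t + u)) \<noteq> f (t + u)) \<longleftrightarrow> (\<forall>r\<in>S. r < t)"
    proof (intro iffI ballI allI impI)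
      fix r assume a: "\<forall>u\<ge>0. ennreal (t + u) \<le> \<zeta> \<longrightarrow> ereal (\<omega> (t + u)) \<noteq> f (t + u)" and r: "r \<in> S"
      show "r < t" using a[rule_format, of "r - t"] r by (force simp: S_def)
    next
      fix u assume a: "\<forall>r\<in>S. r < t" and u: "0 \<le> u" "ennreal (t + u) \<le> \<zeta>"
      show "ereal (\<omega> (t + u)) \<noteq> f (t + u)" using bspec[OF a, of "t + u"] u t by (force simp: S_def)
    qed
    then show ?thesis unfolding avoiding_def using path_shift_in_space[OF w alive_nonneg[OF t(1)]] by (auto simp: path_shift_apply)
  qed
  show ?thesis
  proof
    assume a: "last_passage l f \<omega> < ennreal t"
    have "r < t" if r: "r \<in> S" for r
    proof -
      have "ennreal r \<le> last_passage l f \<omega>" unfolding lp using r by (intro Sup_upper imageI)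
      then have "ennreal r < ennreal t" using a by (rule le_less_trans)
      then show ?thesis using r by (simp add: S_def ennreal_less_iff)
    qed
    then show "path_shift t \<omega> \<in> avoiding t" using iff by blast
  next
    assume "path_shift t \<omega> \<in> avoiding t"
    then have lt: "r < t" if "r \<in> S" for r using that iff by blast
    show "last_passage l f \<omega> < ennreal t"
    proof (cases "S = {}")
      case True
      then show ?thesis unfolding lp using t(2) by (simp add: bot_ennreal)
    next
      case False
      have cw: "continuous_on {0..t} (\<lambda>u. \<omega> u - F u)"
      proof -
        have "{0..t} \<subseteq> {t. alive t}" "{0..t} \<subseteq> {0..}" using alive_le[OF t(1)] by auto
        then show ?thesis
          by (intro continuous_on_diff continuous_on_subset[OF path_spaceD(1)[OF w]] continuous_on_subset[OF F_continuous])
      qed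
      have "S = {u \<in> {0..t}. \<omega> u - F u = 0}"
      proof (intro set_eqI iffI)
        fix r assume r: "r \<in> S"
        then have "alive r" using lt[OF r] alive_le[OF t(1), of r] by (auto simp: S_def)
        then show "r \<in> {u \<in> {0..t}. \<omega> u - F u = 0}" using r lt[OF r] alive_f(1)[of r] by (auto simp: S_def)
      next
        fix r assume r: "r \<in> {u \<in> {0..t}. \<omega> u - F u = 0}"
        then have "alive r" using alive_le[OF t(1), of r] by auto
        then show "r \<in> S" using r alive_f(1)[of r] by (auto simp: S_def alive_def)
      qed
      then have "compact S" using continuous_closed_preimage_constant[OF cw, of 0] by (auto simp: compact_eq_bounded_closed intro: bounded_subset[of "{0..t}"])
      then obtain m where m: "m \<in> S" "\<And>r. r \<in> S \<Longrightarrow> r \<le> m" using compact_attains_sup[OF _ False] by blast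
      have "last_passage l f \<omega> \<le> ennreal m" unfolding lp using m(2) by (intro Sup_least) (auto intro: ennreal_leI)
      also have "\<dots> < ennreal t" using lt[OF m(1)] m(1) by (simp add: S_def ennreal_less_iff)
      finally show ?thesis .
    qed
  qed
qed

text \<open>The function \<open>H t\<close> vanishes below the curve only up to a null set of starting points, because
  the behaviour at infinity is only assumed for paths started at time \<open>0\<close>.\<close>

definition Hb :: "real \<Rightarrow> real \<Rightarrow> real" where "Hb t y = (if F t < y then H t y else 0)"

lemma H_on_curve:
  assumes "alive t" shows "H t (F t) = 0"
proof -
  have e: "F t \<in> E" using in_E alive_f(2)[OF assms] .
  interpret prob_space "P (F t)" by (rule P_prob_space[OF e])
  have "AE \<omega> in P (F t). \<omega> \<notin> avoiding t"
    using start[OF e]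
  proof eventually_elim
    fix \<omega> :: "real \<Rightarrow> real" assume "\<omega> 0 = F t"
    then have "ereal (\<omega> 0) = f (t + 0)" using alive_f(1)[OF assms] by simp
    then show "\<omega> \<notin> avoiding t" using assms unfolding avoiding_def alive_def by (auto intro!: exI[of _ 0])
  qed
  then have "prob (avoiding t) = 0" using avoiding_sets[OF assms] sets_P[OF e] by (subst prob_eq_0) auto
  then show ?thesis using H_eq[OF assms e] by simp
qed

text \<open>A path that is below the curve at time \<open>t\<close> and not below it later has met
  it. With finite lifetime the curve ends at \<open>l\<close>, and no path is below
  \<open>l\<close>; with infinite lifetime the assumption on the limit provides the later time for
  almost every path from \<open>x\<close>. So being below at \<open>t\<close> and avoiding the curve
  from then on is a null event, and \<open>expectation_H\<close> turns this into
  \<open>H = 0\<close> at almost every position below the curve.\<close>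

lemma H_below_AE:
  assumes x: "l < ereal x" and t: "alive t" "0 < t"
  shows "AE \<omega> in P x. H t (\<omega> t) = Hb t (\<omega> t)"
proof -
  have xE: "x \<in> E" using in_E x .
  have t0: "0 \<le> t" using t by simp
  define A where "A = {\<omega> \<in> space (path_space E). \<omega> t \<in> {..<F t}}"
  have A: "A \<in> sets (path_filtration E t)" unfolding A_def using t by (intro coordinate_in_filtration) auto
  have As: "A \<in> sets (P x)" using A path_filtration_subset sets_P[OF xE] by auto
  have "AE \<omega> in P x. \<omega> \<notin> {\<omega> \<in> A. path_shift t \<omega> \<in> avoiding t}"
  proof -
    have cross: "\<omega> \<notin> {\<omega> \<in> A. path_shift t \<omega> \<in> avoiding t}"
      if w: "\<omega> \<in> space (path_space E)" and d: "t \<le> d" "ennreal d \<le> \<zeta>" "f d \<le> ereal (\<omega> d)" for \<omega> d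
    proof
      assume a: "\<omega> \<in> {\<omega> \<in> A. path_shift t \<omega> \<in> avoiding t}"
      then have "ereal (\<omega> t) \<le> f t" using alive_f(1)[OF t(1)] by (auto simp: A_def)
      then obtain u where u: "t \<le> u" "u \<le> d" "ereal (\<omega> u) = f u" using curve_crossing[OF w t0 d(1) _ d(3)] by auto
      have "ennreal u \<le> \<zeta>" using u d by (meson ennreal_leI order_trans)
      then show False using a u unfolding avoiding_def by (auto simp: path_shift_apply dest!: spec[of _ "u - t"])
    qed
    show ?thesis
    proof (cases \<zeta>)
      case (real r)
      have tr: "t \<le> r" using t real by (auto simp: alive_def ennreal_less_iff)
      have "\<omega> \<notin> {\<omega> \<in> A. path_shift t \<omega> \<in> avoiding t}" if w: "\<omega> \<in> space (path_space E)" for \<omega>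
      proof (rule cross[OF w tr])
        have "\<omega> r \<in> E" using path_spaceD(2)[OF w] tr t by auto
        then show "f r \<le> ereal (\<omega> r)" using state_space(2) lifetime_value[OF real(2,1)] by auto
      qed (use real in auto)
      then show ?thesis using space_P[OF xE] by (intro AE_I2) auto
    next
      case top
      have "AE \<omega> in P x. \<omega> \<in> space (path_space E) \<and> (\<exists>L>0. ((\<lambda>t. ereal (\<omega> t) - f t) \<longlongrightarrow> L) at_top)"
        using AE_P[OF xE eventually_above[OF _ x]] top by (simp add: infinity_ennreal_def)
      then show ?thesis
      proof eventually_elim
        fix \<omega> assume w: "\<omega> \<in> space (path_space E) \<and> (\<exists>L>0. ((\<lambda>t. ereal (\<omega> t) - f t) \<longlongrightarrow> L) at_top)"
        then obtain L where L: "0 < L" "((\<lambda>t. ereal (\<omega> t) - f t) \<longlongrightarrow> L) at_top" by blast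
        from order_tendstoD(1)[OF L(2,1)] obtain d where d: "\<And>r. d \<le> r \<Longrightarrow> 0 < ereal (\<omega> r) - f r"
          by (auto simp: eventually_at_top_linorder)
        define d' where "d' = max d t"
        have al: "alive d'" using t0 top by (auto simp: alive_def d'_def)
        have "0 < ereal (\<omega> d') - ereal (F d')" using d[of d'] alive_f(1)[OF al] by (simp add: d'_def)
        then have "f d' \<le> ereal (\<omega> d')" using alive_f(1)[OF al] by simp
        then show "\<omega> \<notin> {\<omega> \<in> A. path_shift t \<omega> \<in> avoiding t}"
          using w top by (intro cross[of _ d']) (auto simp: d'_def)
      qed
    qed
  qed
  then have "emeasure (P x) {\<omega> \<in> space (P x). \<omega> \<in> {\<omega> \<in> A. path_shift t \<omega> \<in> avoiding t}} = 0"
    by (rule emeasure_eq_0_AE)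
  moreover have "{\<omega> \<in> space (P x). \<omega> \<in> {\<omega> \<in> A. path_shift t \<omega> \<in> avoiding t}} = {\<omega> \<in> A. path_shift t \<omega> \<in> avoiding t}"
    using sets.sets_into_space[OF As] by auto
  ultimately have "emeasure (P x) {\<omega> \<in> A. path_shift t \<omega> \<in> avoiding t} = 0" by simp
  then have "(\<integral>\<^sup>+\<omega>\<in>A. ennreal (H t (\<omega> t)) \<partial>P x) = 0" using expectation_H[OF xE t0 t(1) A] by simp
  then have "AE \<omega> in P x. ennreal (H t (\<omega> t)) * indicator A \<omega> = 0"
    using H_measurable[OF t(1) xE t0] As by (subst (asm) nn_integral_0_iff_AE) auto
  then show ?thesis using AE_space
  proof eventually_elim
    fix \<omega> assume a: "ennreal (H t (\<omega> t)) * indicator A \<omega> = 0" and "\<omega> \<in> space (P x)"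
    then have w: "\<omega> \<in> space (path_space E)" using space_P[OF xE] by simp
    have r: "0 \<le> H t (\<omega> t)" using H_range(1)[OF t(1) path_spaceD(2)[OF w t0]] .
    consider "\<omega> t < F t" | "\<omega> t = F t" | "F t < \<omega> t" by linarith
    then show "H t (\<omega> t) = Hb t (\<omega> t)"
    proof cases
      case 1
      then have "\<omega> \<in> A" using w by (simp add: A_def)
      then show ?thesis using a r 1 by (simp add: Hb_def ennreal_eq_0_iff)
    next
      case 2
      then show ?thesis using H_on_curve[OF t(1)] by (simp add: Hb_def)
    qed (simp add: Hb_def)
  qed
qed

lemma last_passage_distribution:
  assumes x: "l < ereal x" and t: "alive t" "0 < t"
  shows "measure (P x) {\<omega> \<in> space (P x). last_passage l f \<omega> < ennreal t} = (\<integral>\<omega>. H t (\<omega> t) \<partial>P x)"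
proof -
  have xE: "x \<in> E" using in_E x .
  have "{\<omega> \<in> space (P x). last_passage l f \<omega> < ennreal t} = {\<omega> \<in> space (path_space E). path_shift t \<omega> \<in> avoiding t}"
    using last_passage_less_iff[OF t] space_P[OF xE] by auto
  then show ?thesis using expectation_H_real[OF xE _ t(1)] t(2) by simp
qed

end

section \<open>Increments, bump functions and the backward equation\<close>

lemma integral_from_increments:
  fixes D k :: "real \<Rightarrow> real"
  assumes ab: "a \<le> b" and k: "continuous_on {a..b} k"
    and inc: "\<And>\<epsilon>. 0 < \<epsilon> \<Longrightarrow> \<exists>h0>0. \<forall>h t. 0 < h \<longrightarrow> h \<le> h0 \<longrightarrow> a \<le> t \<longrightarrow> t + h \<le> b \<longrightarrow> \<bar>D (t + h) - D t - h * k t\<bar> \<le> \<epsilon> * h"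
  shows "D b - D a = integral {a..b} k"
proof -
  \<comment> \<open>\<open>D\<close> is not known to be differentiable; after subtraction of the
    integral the increments over steps of length \<open>h\<close> are uniformly \<open>o(h)\<close>,
    which already forces a constant.\<close>
  define M where "M t = D t - integral {a..t} k" for t
  have "M a = M b"
  proof (rule increments_constant[OF ab])
    fix \<epsilon> :: real assume e: "0 < \<epsilon>"
    then have e2: "0 < \<epsilon> / 2" by simp
    obtain h0 where h0: "0 < h0" "\<And>h t. 0 < h \<Longrightarrow> h \<le> h0 \<Longrightarrow> a \<le> t \<Longrightarrow> t + h \<le> b \<Longrightarrow> \<bar>D (t + h) - D t - h * k t\<bar> \<le> \<epsilon> / 2 * h"
      using inc[OF e2] by blast
    have "uniformly_continuous_on {a..b} k" using compact_uniformly_continuous[OF k] by simp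
    from this[unfolded uniformly_continuous_on_def, rule_format, OF e2]
    obtain d where d: "0 < d" "\<forall>u\<in>{a..b}. \<forall>v\<in>{a..b}. dist v u < d \<longrightarrow> dist (k v) (k u) < \<epsilon> / 2" by (elim exE conjE)
    have "\<bar>M (t + h) - M t\<bar> \<le> \<epsilon> * h" if h: "0 < h" "h \<le> min h0 (d / 2)" and t: "a \<le> t" "t + h \<le> b" for h t
    proof -
      have ii: "k integrable_on {a..t + h}" "k integrable_on {t..t + h}"
        using t h by (auto intro!: integrable_continuous_interval continuous_on_subset[OF k])
      have "integral {a..t + h} k = integral {a..t} k + integral {t..t + h} k"
        using Henstock_Kurzweil_Integration.integral_combine[OF t(1) _ ii(1)] h by simp
      moreover have "integral {t..t + h} (\<lambda>u. k u - k t) = integral {t..t + h} k - h * k t"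
        using ii(2) h by (subst Henstock_Kurzweil_Integration.integral_diff) auto
      moreover have "norm (integral {t..t + h} (\<lambda>u. k u - k t)) \<le> \<epsilon> / 2 * (t + h - t)"
      proof (rule integral_bound)
        show "continuous_on {t..t + h} (\<lambda>u. k u - k t)"
          using t by (intro continuous_intros continuous_on_subset[OF k]) auto
        fix u assume u: "u \<in> {t..t + h}"
        have "dist (k u) (k t) < \<epsilon> / 2" using d(2)[THEN bspec, of t, THEN bspec, of u] u t h d(1) by (simp add: dist_real_def)
        then show "norm (k u - k t) \<le> \<epsilon> / 2" by (simp add: dist_real_def)
      qed (use h in simp)
      moreover have "\<bar>D (t + h) - D t - h * k t\<bar> \<le> \<epsilon> / 2 * h" using h t by (intro h0(2)) auto
      moreover have "\<epsilon> / 2 * (t + h - t) = \<epsilon> / 2 * h" "\<epsilon> * h = \<epsilon> / 2 * h + \<epsilon> / 2 * h" by (simp_all add: field_simps)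
      ultimately show ?thesis unfolding M_def real_norm_def by linarith
    qed
    then show "\<exists>h0>0. \<forall>h t. 0 < h \<longrightarrow> h \<le> h0 \<longrightarrow> a \<le> t \<longrightarrow> t + h \<le> b \<longrightarrow> \<bar>M (t + h) - M t\<bar> \<le> \<epsilon> * h"
      using h0(1) d(1) by (intro exI[of _ "min h0 (d / 2)"]) simp
  qed
  then show ?thesis by (simp add: M_def)
qed

text \<open>A \<open>C\<^sup>2\<close> function that is 1 on \<open>[A, B]\<close> and 0 outside
  \<open>[A - r, B + r]\<close>; \<open>bump1\<close> and \<open>bump2\<close> are its
  derivatives.\<close>

definition bump :: "real \<Rightarrow> real \<Rightarrow> real \<Rightarrow> real \<Rightarrow> real" where
  "bump A B r w = step ((w - (A - r)) / r) * step ((B + r - w) / r)"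
definition bump1 :: "real \<Rightarrow> real \<Rightarrow> real \<Rightarrow> real \<Rightarrow> real" where
  "bump1 A B r w = step1 ((w - (A - r)) / r) / r * step ((B + r - w) / r) - step ((w - (A - r)) / r) * (step1 ((B + r - w) / r) / r)"
definition bump2 :: "real \<Rightarrow> real \<Rightarrow> real \<Rightarrow> real \<Rightarrow> real" where
  "bump2 A B r w = step2 ((w - (A - r)) / r) / r / r * step ((B + r - w) / r)
    - 2 * (step1 ((w - (A - r)) / r) / r) * (step1 ((B + r - w) / r) / r)
    + step ((w - (A - r)) / r) * (step2 ((B + r - w) / r) / r / r)"

lemma up_derivative:
  assumes "r \<noteq> 0" "\<And>v. (S has_real_derivative S' v) (at v)"
  shows "((\<lambda>w. S ((w - c) / r)) has_real_derivative S' ((w - c) / r) / r) (at w)"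
    "((\<lambda>w. S ((c - w) / r)) has_real_derivative - (S' ((c - w) / r) / r)) (at w)"
proof -
  have "((\<lambda>w. (w - c) / r) has_real_derivative 1 / r) (at w)" "((\<lambda>w. (c - w) / r) has_real_derivative - (1 / r)) (at w)"
    using assms(1) by (auto intro!: derivative_eq_intros)
  from DERIV_chain'[OF this(1) assms(2)] DERIV_chain'[OF this(2) assms(2)]
  show "((\<lambda>w. S ((w - c) / r)) has_real_derivative S' ((w - c) / r) / r) (at w)"
    "((\<lambda>w. S ((c - w) / r)) has_real_derivative - (S' ((c - w) / r) / r)) (at w)" by simp_all
qed

lemma bump_derivative:
  assumes r: "0 < r"
  shows "(bump A B r has_real_derivative bump1 A B r w) (at w)"
proof -
  have r0: "r \<noteq> 0" using r by simp
  have "((\<lambda>w. step ((w - (A - r)) / r) * step ((B + r - w) / r)) has_real_derivative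
     step1 ((w - (A - r)) / r) / r * step ((B + r - w) / r) + - (step1 ((B + r - w) / r) / r) * step ((w - (A - r)) / r)) (at w)"
    by (rule DERIV_mult[OF up_derivative(1)[OF r0 step_derivative] up_derivative(2)[OF r0 step_derivative]])
  then show ?thesis unfolding bump_def[abs_def] bump1_def by (simp add: mult.commute)
qed

lemma bump1_derivative:
  assumes r: "0 < r"
  shows "(bump1 A B r has_real_derivative bump2 A B r w) (at w)"
proof -
  have r0: "r \<noteq> 0" using r by simp
  note d = up_derivative(1)[OF r0 step_derivative, of "A - r" w] up_derivative(2)[OF r0 step_derivative, of "B + r" w]
    DERIV_cdivide[OF up_derivative(1)[OF r0 step1_derivative, of "A - r" w], of r] DERIV_cdivide[OF up_derivative(2)[OF r0 step1_derivative, of "B + r" w], of r]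
  have "((\<lambda>w. step1 ((w - (A - r)) / r) / r * step ((B + r - w) / r) - step ((w - (A - r)) / r) * (step1 ((B + r - w) / r) / r)) has_real_derivative
     (step2 ((w - (A - r)) / r) / r / r * step ((B + r - w) / r) + - (step1 ((B + r - w) / r) / r) * (step1 ((w - (A - r)) / r) / r))
     - (step1 ((w - (A - r)) / r) / r * (step1 ((B + r - w) / r) / r) + - (step2 ((B + r - w) / r) / r) / r * step ((w - (A - r)) / r))) (at w)"
    by (rule DERIV_diff[OF DERIV_mult[OF d(3) d(2)] DERIV_mult[OF d(1) d(4)]])
  then show ?thesis unfolding bump1_def[abs_def]
    by (rule DERIV_cong) (simp add: bump2_def algebra_simps)
qed

lemma continuous_bump2:
  assumes "0 < r"
  shows "continuous_on S (bump2 A B r)"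
proof -
  have c: "continuous_on S (\<lambda>w. g ((w - c) / r))" "continuous_on S (\<lambda>w. g ((c - w) / r))"
    if "continuous_on UNIV g" for g :: "real \<Rightarrow> real" and c
    using assms by (auto intro!: continuous_on_compose2[OF that] continuous_intros)
  show ?thesis unfolding bump2_def[abs_def] using assms
    by (intro continuous_on_add continuous_on_diff continuous_on_mult continuous_on_divide continuous_on_const
        c continuous_step continuous_step1 continuous_step2) auto
qed

lemma bump_inside: "0 < r \<Longrightarrow> w \<in> {A..B} \<Longrightarrow> bump A B r w = 1 \<and> bump1 A B r w = 0 \<and> bump2 A B r w = 0"
  by (simp add: bump_def bump1_def bump2_def step_eq)

lemma bump_outside: "0 < r \<Longrightarrow> w \<notin> {A - r..B + r} \<Longrightarrow> bump A B r w = 0 \<and> bump1 A B r w = 0 \<and> bump2 A B r w = 0"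
proof -
  assume r: "0 < r" and w: "w \<notin> {A - r..B + r}"
  then consider "(w - (A - r)) / r \<le> 0" | "(B + r - w) / r \<le> 0" by (force simp: divide_le_0_iff)
  then show ?thesis by cases (simp_all add: bump_def bump1_def bump2_def step_eq)
qed

lemma bump_range: "0 \<le> bump A B r w" "bump A B r w \<le> 1"
  unfolding bump_def using step_range by (auto intro: mult_le_one)

context linear_diffusion
begin

lemma space_generator_linear:
  "space_generator y (a * u1 + v1) (a * u2 + v2) = a * space_generator y u1 u2 + space_generator y v1 v2"
  unfolding space_generator_def by (simp add: algebra_simps add_divide_distrib[symmetric] diff_divide_distrib[symmetric])

text \<open>Boundedness makes all integrals finite, so the identity can be used in differences of
  real expectations.\<close>

lemma markov_integral:
  assumes x: "x \<in> E" and t: "0 \<le> t" and g: "g \<in> borel_measurable (path_space E)"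
    and b: "\<And>\<omega>. \<omega> \<in> space (path_space E) \<Longrightarrow> 0 \<le> g \<omega> \<and> g \<omega> \<le> (1::real)"
  shows "integrable (P x) (\<lambda>\<omega>. \<integral>\<omega>'. g \<omega>' \<partial>P (\<omega> t))"
    "(\<integral>\<omega>. g (path_shift t \<omega>) \<partial>P x) = (\<integral>\<omega>. (\<integral>\<omega>'. g \<omega>' \<partial>P (\<omega> t)) \<partial>P x)"
proof -
  interpret prob_space "P x" by (rule P_prob_space[OF x])
  let ?K = "restrict_space borel E"
  have e: "\<omega> t \<in> E" "\<omega> \<in> space (path_space E)" if "\<omega> \<in> space (P x)" for \<omega>
    using that path_spaceD(2)[OF _ t, of \<omega> E] space_P[OF x] by auto
  have gi: "integrable (P z) g" if z: "z \<in> E" for z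
  proof -
    interpret z: prob_space "P z" by (rule P_prob_space[OF z])
    show ?thesis
    proof (rule z.integrable_const_bound[of _ 1])
      show "AE \<omega> in P z. norm (g \<omega>) \<le> 1" using b space_P[OF z] by (intro AE_I2) auto
      show "g \<in> borel_measurable (P z)" using g measurable_P_iff[OF z] by blast
    qed
  qed
  have nn: "(\<integral>\<^sup>+\<omega>'. ennreal (g \<omega>') \<partial>P z) = ennreal (\<integral>\<omega>'. g \<omega>' \<partial>P z)" if z: "z \<in> E" for z
    using b space_P[OF z] by (intro nn_integral_eq_integral gi z AE_I2) auto
  have ge0: "0 \<le> (\<integral>\<omega>'. g \<omega>' \<partial>P z)" if z: "z \<in> E" for z
    using b space_P[OF z] by (intro integral_nonneg_AE AE_I2) auto
  have le1: "(\<integral>\<omega>'. g \<omega>' \<partial>P z) \<le> 1" if z: "z \<in> E" for z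
  proof -
    interpret z: prob_space "P z" by (rule P_prob_space[OF z])
    have "(\<integral>\<omega>'. g \<omega>' \<partial>P z) \<le> (\<integral>\<omega>'. 1 \<partial>P z)" using b space_P[OF z] by (intro integral_mono gi z) auto
    then show ?thesis by (simp add: z.prob_space)
  qed
  have gm: "(\<lambda>\<omega>. ennreal (g \<omega>)) \<in> borel_measurable (path_space E)" using g by simp
  have mK: "(\<lambda>y. \<integral>\<^sup>+\<omega>'. ennreal (g \<omega>') \<partial>P y) \<in> borel_measurable ?K"
    using measurable_compose[OF measurable_prob_algebraD[OF kernel] nn_integral_measurable_subprob_algebra[OF gm]] .
  have mc: "(\<lambda>\<omega>. \<omega> t) \<in> P x \<rightarrow>\<^sub>M ?K" using measurable_coordinate_E[OF t] measurable_P_iff[OF x] by blast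
  have "(\<lambda>\<omega>. enn2real (\<integral>\<^sup>+\<omega>'. ennreal (g \<omega>') \<partial>P (\<omega> t))) \<in> borel_measurable (P x)"
    using measurable_compose[OF mc mK] by simp
  then have mG: "(\<lambda>\<omega>. \<integral>\<omega>'. g \<omega>' \<partial>P (\<omega> t)) \<in> borel_measurable (P x)"
    by (rule measurable_cong[THEN iffD1, rotated]) (use e nn ge0 in simp)
  show iG: "integrable (P x) (\<lambda>\<omega>. \<integral>\<omega>'. g \<omega>' \<partial>P (\<omega> t))"
  proof (rule integrable_const_bound[of _ 1])
    show "AE \<omega> in P x. norm (\<integral>\<omega>'. g \<omega>' \<partial>P (\<omega> t)) \<le> 1" using e ge0 le1 by (intro AE_I2) auto
  qed (rule mG)
  have ms: "(\<lambda>\<omega>. g (path_shift t \<omega>)) \<in> borel_measurable (P x)"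
    using measurable_compose[OF measurable_path_shift[OF t] g] measurable_P_iff[OF x] by blast
  have si: "integrable (P x) (\<lambda>\<omega>. g (path_shift t \<omega>))"
  proof (rule integrable_const_bound[of _ 1])
    show "AE \<omega> in P x. norm (g (path_shift t \<omega>)) \<le> 1" using e b[OF path_shift_in_space[OF _ t]] by (intro AE_I2) auto
  qed (rule ms)
  have "ennreal (\<integral>\<omega>. g (path_shift t \<omega>) \<partial>P x) = (\<integral>\<^sup>+\<omega>. ennreal (g (path_shift t \<omega>)) \<partial>P x)"
    using e b[OF path_shift_in_space[OF _ t]] by (intro nn_integral_eq_integral[symmetric] si AE_I2) auto
  also have "\<dots> = (\<integral>\<^sup>+\<omega>\<in>space (path_space E). ennreal (g (path_shift t \<omega>)) \<partial>P x)"
    using space_P[OF x] by (intro nn_integral_cong) auto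
  also have "\<dots> = (\<integral>\<^sup>+\<omega>\<in>space (path_space E). (\<integral>\<^sup>+\<omega>'. ennreal (g \<omega>') \<partial>P (\<omega> t)) \<partial>P x)"
    using markov_fixed_nn[OF x t _ gm, of "space (path_space E)"] sets.top[of "path_filtration E t"] by simp
  also have "\<dots> = (\<integral>\<^sup>+\<omega>. ennreal (\<integral>\<omega>'. g \<omega>' \<partial>P (\<omega> t)) \<partial>P x)"
    using space_P[OF x] e nn by (intro nn_integral_cong) auto
  also have "\<dots> = ennreal (\<integral>\<omega>. (\<integral>\<omega>'. g \<omega>' \<partial>P (\<omega> t)) \<partial>P x)"
    using e ge0 by (intro nn_integral_eq_integral iG AE_I2) auto
  finally have "ennreal (\<integral>\<omega>. g (path_shift t \<omega>) \<partial>P x) = ennreal (\<integral>\<omega>. (\<integral>\<omega>'. g \<omega>' \<partial>P (\<omega> t)) \<partial>P x)" .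
  moreover have "0 \<le> (\<integral>\<omega>. g (path_shift t \<omega>) \<partial>P x)"
    using e b[OF path_shift_in_space[OF _ t]] by (intro integral_nonneg_AE AE_I2) auto
  moreover have "0 \<le> (\<integral>\<omega>. (\<integral>\<omega>'. g \<omega>' \<partial>P (\<omega> t)) \<partial>P x)"
    by (rule integral_nonneg_AE, rule AE_I2, rule ge0[OF e(1)])
  ultimately show "(\<integral>\<omega>. g (path_shift t \<omega>) \<partial>P x) = (\<integral>\<omega>. (\<integral>\<omega>'. g \<omega>' \<partial>P (\<omega> t)) \<partial>P x)" by simp
qed

end

context curve_diffusion
begin

lemma above_iff: "(t, y) \<in> above_curve l f \<longleftrightarrow> alive t \<and> 0 < t \<and> F t \<le> y"
proof
  assume "(t, y) \<in> above_curve l f"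
  then have "0 < t" "alive t" "f t \<le> ereal y" by (auto simp: above_curve_def alive_def)
  then show "alive t \<and> 0 < t \<and> F t \<le> y" using alive_f(1)[of t] by simp
next
  assume "alive t \<and> 0 < t \<and> F t \<le> y"
  then show "(t, y) \<in> above_curve l f"
    using alive_f[of t] l_less_trans[of "F t" y] by (auto simp: above_curve_def alive_def)
qed

lemma box_above:
  assumes "0 < t1" "alive t2" "\<And>t. t \<in> {t1..t2} \<Longrightarrow> F t \<le> L"
  shows "{t1..t2} \<times> {L..R} \<subseteq> above_curve l f"
  using assms alive_le[OF assms(2)] by (force simp: above_iff)

lemma box_derivs:
  assumes b: "{t1..t2} \<times> {L..R} \<subseteq> above_curve l f" and ty: "t \<in> {t1..t2}" "y \<in> {L..R}"
  shows "((\<lambda>r. H r y) has_real_derivative ht t y) (at t within {t1..t2})"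
    "(H t has_real_derivative hy t y) (at y within {L..R})"
    "(hy t has_real_derivative hyy t y) (at y within {L..R})"
proof -
  have i: "(t, y) \<in> above_curve l f" using b ty by auto
  have s: "{t1..t2} \<subseteq> {r. (r, y) \<in> above_curve l f}" "{L..R} \<subseteq> {z. (t, z) \<in> above_curve l f}" using b ty by auto
  show "((\<lambda>r. H r y) has_real_derivative ht t y) (at t within {t1..t2})"
    "(H t has_real_derivative hy t y) (at y within {L..R})"
    "(hy t has_real_derivative hyy t y) (at y within {L..R})"
    using H_derivs[OF i] DERIV_subset s by blast+
qed

lemma box_continuous:
  assumes "{t1..t2} \<times> {L..R} \<subseteq> above_curve l f"
  shows "continuous_on ({t1..t2} \<times> {L..R}) (\<lambda>(t, y). H t y)" "continuous_on ({t1..t2} \<times> {L..R}) (\<lambda>(t, y). ht t y)"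
    "continuous_on ({t1..t2} \<times> {L..R}) (\<lambda>(t, y). hy t y)" "continuous_on ({t1..t2} \<times> {L..R}) (\<lambda>(t, y). hyy t y)"
  using H_continuous[THEN continuous_on_subset, OF assms] by auto

text \<open>\<open>H\<close> has no compact support and a kink at the curve. Multiplied by a bump
  with support inside a box above the curve it satisfies the requirements of the local estimate; the
  generator term is the product rule written out.\<close>

lemma cutoff_generator:
  assumes b: "{t1..t2} \<times> {L..R} \<subseteq> above_curve l f" and L: "l < ereal L" "L < A - r" "A \<le> B" "0 < r" "B + r < R"
    and e: "0 < \<epsilon>"
  shows "\<exists>h0>0. \<forall>h t z. 0 < h \<longrightarrow> h \<le> h0 \<longrightarrow> t1 \<le> t \<longrightarrow> t + h \<le> t2 \<longrightarrow> l < ereal z \<longrightarrow>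
    \<bar>(\<integral>\<omega>. bump A B r (\<omega> h) * H (t + h) (\<omega> h) \<partial>P z) - bump A B r z * H t z
      - h * (bump A B r z * ht t z + space_generator z (bump1 A B r z * H t z + bump A B r z * hy t z)
          (bump2 A B r z * H t z + 2 * bump1 A B r z * hy t z + bump A B r z * hyy t z))\<bar> \<le> \<epsilon> * h"
proof (rule local_generator[where g = "\<lambda>t y. bump A B r y * H t y" and gt = "\<lambda>t y. bump A B r y * ht t y"
      and gy = "\<lambda>t y. bump1 A B r y * H t y + bump A B r y * hy t y"
      and gyy = "\<lambda>t y. bump2 A B r y * H t y + 2 * bump1 A B r y * hy t y + bump A B r y * hyy t y"
      and L = L and R = R and L' = "A - r" and R' = "B + r"])
  note bd = has_field_derivative_at_within[OF bump_derivative[OF L(4)]]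
  note bd1 = has_field_derivative_at_within[OF bump1_derivative[OF L(4)]]
  show "A - r \<le> B + r" using L by simp
  fix t y assume t: "t \<in> {t1..t2}"
  show "bump A B r y * H t y = 0 \<and> bump A B r y * ht t y = 0 \<and> bump1 A B r y * H t y + bump A B r y * hy t y = 0 \<and>
        bump2 A B r y * H t y + 2 * bump1 A B r y * hy t y + bump A B r y * hyy t y = 0" if "y \<notin> {A - r..B + r}"
    using bump_outside[OF L(4) that] by simp
  assume y: "y \<in> {L..R}"
  note d = box_derivs[OF b t y]
  show "((\<lambda>t. bump A B r y * H t y) has_real_derivative bump A B r y * ht t y) (at t within {t1..t2})"
    by (rule DERIV_cmult[OF d(1)])
  show "((\<lambda>y. bump A B r y * H t y) has_real_derivative bump1 A B r y * H t y + bump A B r y * hy t y) (at y within {L..R})"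
    by (rule DERIV_cong[OF DERIV_mult[OF bd d(2)]]) simp
  show "((\<lambda>y. bump1 A B r y * H t y + bump A B r y * hy t y) has_real_derivative bump2 A B r y * H t y + 2 * bump1 A B r y * hy t y + bump A B r y * hyy t y) (at y within {L..R})"
    by (rule DERIV_cong[OF DERIV_add[OF DERIV_mult[OF bd1 d(2)] DERIV_mult[OF bd d(3)]]]) simp
next
  have cb: "continuous_on {L..R} (bump A B r)" "continuous_on {L..R} (bump1 A B r)" "continuous_on {L..R} (bump2 A B r)"
    using bump_derivative[OF L(4)] bump1_derivative[OF L(4)] continuous_bump2[OF L(4)]
    by (meson DERIV_isCont continuous_at_imp_continuous_on)+
  note c = box_continuous[OF b] cb[THEN continuous_on_snd_only, of "{t1..t2}"]
  show "continuous_on ({t1..t2} \<times> {L..R}) (\<lambda>(t, y). bump A B r y * H t y)"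
    "continuous_on ({t1..t2} \<times> {L..R}) (\<lambda>(t, y). bump A B r y * ht t y)"
    "continuous_on ({t1..t2} \<times> {L..R}) (\<lambda>(t, y). bump1 A B r y * H t y + bump A B r y * hy t y)"
    "continuous_on ({t1..t2} \<times> {L..R}) (\<lambda>(t, y). bump2 A B r y * H t y + 2 * bump1 A B r y * hy t y + bump A B r y * hyy t y)"
    unfolding case_prod_beta by (intro continuous_on_add continuous_on_mult continuous_on_const c[unfolded case_prod_beta])+
qed (use L e in auto)

text \<open>All factors lie in \<open>[0, 1]\<close>. The last claim serves to discard parts of an
  expectation: if the weight is nonzero only for paths that have covered a distance, the expectation
  is at most the probability of that event.\<close>

lemma weighted_H:
  assumes z: "z \<in> E" and t: "alive t" and h: "0 \<le> h" and c: "c \<in> borel_measurable borel" "\<And>w. 0 \<le> c w \<and> c w \<le> (1::real)"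
  shows "integrable (P z) (\<lambda>\<omega>. c (\<omega> h) * H t (\<omega> h))"
    "0 \<le> (\<integral>\<omega>. c (\<omega> h) * H t (\<omega> h) \<partial>P z)"
    "\<And>S. S \<in> sets (path_space E) \<Longrightarrow> (AE \<omega> in P z. \<omega> \<in> space (path_space E) \<longrightarrow> c (\<omega> h) \<noteq> 0 \<longrightarrow> \<omega> \<in> S) \<Longrightarrow> (\<integral>\<omega>. c (\<omega> h) * H t (\<omega> h) \<partial>P z) \<le> measure (P z) S"
proof -
  interpret prob_space "P z" by (rule P_prob_space[OF z])
  have r: "0 \<le> c (\<omega> h) * H t (\<omega> h)" "c (\<omega> h) * H t (\<omega> h) \<le> 1" if "\<omega> \<in> space (P z)" for \<omega>
    using H_range[OF t path_spaceD(2)[OF _ h]] that space_P[OF z] c(2) by (auto intro: mult_le_one)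
  have m: "(\<lambda>\<omega>. c (\<omega> h) * H t (\<omega> h)) \<in> borel_measurable (P z)"
    using measurable_compose[OF measurable_coordinate_P[OF z h] c(1)] H_measurable[OF t z h] by (rule borel_measurable_times)
  show i: "integrable (P z) (\<lambda>\<omega>. c (\<omega> h) * H t (\<omega> h))"
    by (rule integrable_const_bound[of _ 1, OF _ m]) (use r in \<open>auto intro!: AE_I2\<close>)
  show "0 \<le> (\<integral>\<omega>. c (\<omega> h) * H t (\<omega> h) \<partial>P z)" using r(1) by (intro integral_nonneg_AE AE_I2)
  fix S assume S: "S \<in> sets (path_space E)" and ae: "AE \<omega> in P z. \<omega> \<in> space (path_space E) \<longrightarrow> c (\<omega> h) \<noteq> 0 \<longrightarrow> \<omega> \<in> S"
  have S': "S \<in> events" using S sets_P[OF z] by simp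
  have "(\<integral>\<omega>. c (\<omega> h) * H t (\<omega> h) \<partial>P z) \<le> (\<integral>\<omega>. indicator S \<omega> \<partial>P z)"
  proof (rule integral_mono_AE[OF i])
    show "AE \<omega> in P z. c (\<omega> h) * H t (\<omega> h) \<le> indicator S \<omega>"
      using ae AE_space
    proof eventually_elim
      fix \<omega> assume a: "\<omega> \<in> space (path_space E) \<longrightarrow> c (\<omega> h) \<noteq> 0 \<longrightarrow> \<omega> \<in> S" and w: "\<omega> \<in> space (P z)"
      show "c (\<omega> h) * H t (\<omega> h) \<le> indicator S \<omega>"
        using a r(2)[OF w] w space_P[OF z] by (cases "c (\<omega> h) = 0") auto
    qed
  qed (use S' in \<open>auto simp: less_top[symmetric]\<close>)
  then show "(\<integral>\<omega>. c (\<omega> h) * H t (\<omega> h) \<partial>P z) \<le> measure (P z) S" using S' by simp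
qed

lemma curve_below_near:
  assumes t: "alive t" and y: "F t < y"
  shows "\<exists>d>0. alive (t + d) \<and> (\<forall>u\<in>{t..t + d}. F u < y)"
proof -
  obtain d1 where d1: "0 < d1" "alive (t + d1)" using alive_extend[OF t] by blast
  have "\<exists>d>0. \<forall>u\<in>{t. alive t}. dist u t < d \<longrightarrow> dist (F u) (F t) < y - F t"
    using F_continuous[unfolded continuous_on_iff, THEN bspec, of t] t y by simp
  then obtain d2 where d2: "0 < d2" "\<forall>u\<in>{t. alive t}. dist u t < d2 \<longrightarrow> dist (F u) (F t) < y - F t" by blast
  define d where "d = min d1 (d2 / 2)"
  have d: "0 < d" "d \<le> d1" "d < d2" using d1 d2 by (auto simp: d_def)
  have al: "alive u" if "u \<in> {t..t + d}" for u using that alive_le[OF d1(2), of u] d alive_nonneg[OF t] by auto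
  have "F u < y" if u: "u \<in> {t..t + d}" for u
  proof -
    have "dist (F u) (F t) < y - F t" using d2(2)[THEN bspec, of u] al[OF u] u d by (auto simp: dist_real_def)
    then show ?thesis by (auto simp: dist_real_def)
  qed
  then show ?thesis using d al[of "t + d"] by (intro exI[of _ d]) auto
qed

text \<open>Let \<open>\<kappa>\<close> be the left-hand side. The expectation of
  \<open>H (t + h)\<close> at time \<open>h\<close> differs from \<open>H t y\<close> only by the
  probability \<open>O(h\<^sup>2)\<close> of coming down to the curve. With a bump around
  \<open>y\<close> inserted it changes by another \<open>O(h\<^sup>2)\<close>, but then equals
  \<open>H t y + h * \<kappa>\<close> up to \<open>\<bar>\<kappa>\<bar> / 4 * h\<close>. For small
  \<open>h\<close> this leaves only \<open>\<kappa> = 0\<close>.\<close>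

lemma backward_equation:
  assumes t: "alive t" "0 < t" and y: "F t < y"
  shows "ht t y + space_generator y (hy t y) (hyy t y) = 0"
proof (rule ccontr)
  define \<kappa> where "\<kappa> = ht t y + space_generator y (hy t y) (hyy t y)"
  assume "\<not> ?thesis"
  then have k: "0 < \<bar>\<kappa>\<bar>" by (simp add: \<kappa>_def)
  \<comment> \<open>\<open>L = y - 3 * r\<close> is then halfway between the curve and
    \<open>y\<close>, and the bump with plateau \<open>[y - r, y + r]\<close> vanishes outside
    \<open>[y - 2 * r, y + 2 * r]\<close>, inside \<open>[L, y + 3 * r]\<close>.\<close>
  define r where "r = (y - F t) / 6"
  have r: "0 < r" using y by (simp add: r_def)
  define L where "L = y - 3 * r"
  have FL: "F t < L" using y unfolding L_def r_def by (simp add: field_simps)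
  obtain d where d: "0 < d" "alive (t + d)" "\<And>u. u \<in> {t..t + d} \<Longrightarrow> F u < L"
    using curve_below_near[OF t(1) FL] by blast
  have lL: "l < ereal L" using l_less_trans[OF alive_f(2)[OF t(1)], of L] FL by simp
  have b: "{t..t + d} \<times> {L..y + 3 * r} \<subseteq> above_curve l f"
    using box_above[OF t(2) d(2), of L] d(3) less_imp_le by blast
  have yl: "l < ereal y" using l_less_trans[OF lL, of y] r by (simp add: L_def)
  have yE: "y \<in> E" using in_E yl .
  interpret prob_space "P y" by (rule P_prob_space[OF yE])
  obtain h0 where h0: "0 < h0" "\<And>h t' z. 0 < h \<Longrightarrow> h \<le> h0 \<Longrightarrow> t \<le> t' \<Longrightarrow> t' + h \<le> t + d \<Longrightarrow> l < ereal z \<Longrightarrow>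
    \<bar>(\<integral>\<omega>. bump (y - r) (y + r) r (\<omega> h) * H (t' + h) (\<omega> h) \<partial>P z) - bump (y - r) (y + r) r z * H t' z
      - h * (bump (y - r) (y + r) r z * ht t' z + space_generator z (bump1 (y - r) (y + r) r z * H t' z + bump (y - r) (y + r) r z * hy t' z)
          (bump2 (y - r) (y + r) r z * H t' z + 2 * bump1 (y - r) (y + r) r z * hy t' z + bump (y - r) (y + r) r z * hyy t' z))\<bar> \<le> \<bar>\<kappa>\<bar> / 4 * h"
    using cutoff_generator[OF b lL, of "y - r" r "y + r" "\<bar>\<kappa>\<bar> / 4"] r k unfolding L_def by auto
  have lr: "l < ereal (y - r)" using l_less_trans[OF lL, of "y - r"] r by (simp add: L_def)
  obtain C1 where C1: "0 \<le> C1" "\<And>v. 0 < v \<Longrightarrow> emeasure (P y) {\<omega> \<in> space (path_space E). r \<le> \<bar>\<omega> v - y\<bar> \<and> (y \<in> {y..y} \<or> \<omega> v \<in> {y..y})} \<le> ennreal (C1 * v\<^sup>2)"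
    using displacement_small[OF r lr order_refl] yE by blast
  obtain C2 where C2: "0 \<le> C2" "\<And>h. 0 < h \<Longrightarrow> hit_prob y (y - r) h \<le> ennreal (C2 * h\<^sup>2)"
    using crossing_small[OF lr, of y] r yE by auto
  \<comment> \<open>Small enough for
    \<open>(C1 + 4 * C2) * h\<^sup>2 \<le> \<bar>\<kappa>\<bar> / 4 * h\<close>; the 4 stems from
    the horizon \<open>2 * h\<close> in the descent to the curve, and the 1 avoids a division by
    zero.\<close>
  define h where "h = min (min h0 d) (\<bar>\<kappa>\<bar> / (4 * (C1 + 4 * C2 + 1)))"
  have h: "0 < h" "h \<le> h0" "h \<le> d" "h \<le> \<bar>\<kappa>\<bar> / (4 * (C1 + 4 * C2 + 1))"
    using h0 d k C1 C2 by (auto simp: h_def intro!: divide_pos_pos add_nonneg_pos)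
  have tha: "alive (t + h)" using alive_le[OF d(2), of "t + h"] h t by auto
  define X where "X = (\<integral>\<omega>. bump (y - r) (y + r) r (\<omega> h) * H (t + h) (\<omega> h) \<partial>P y)"
  define Y where "Y = (\<integral>\<omega>. H (t + h) (\<omega> h) \<partial>P y)"
  have 1: "\<bar>X - H t y - h * \<kappa>\<bar> \<le> \<bar>\<kappa>\<bar> / 4 * h"
    using h0(2)[OF h(1,2), of t y] h yl bump_inside[OF r, of y "y - r" "y + r"] r unfolding X_def \<kappa>_def by simp
  have h': "0 \<le> h" using h by simp
  have bm: "bump (y - r) (y + r) r \<in> borel_measurable borel" "(\<lambda>w. 1 - bump (y - r) (y + r) r w) \<in> borel_measurable borel"
    using bump_derivative[OF r] by (intro borel_measurable_continuous_onI borel_measurable_diff borel_measurable_const; meson DERIV_isCont continuous_at_imp_continuous_on)+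
  note w1 = weighted_H[OF yE tha h' bm(1)]
  note w2 = weighted_H[OF yE tha h' bm(2)]
  have rng: "0 \<le> bump (y - r) (y + r) r w \<and> bump (y - r) (y + r) r w \<le> 1" for w using bump_range by auto
  have YX: "Y - X = (\<integral>\<omega>. (1 - bump (y - r) (y + r) r (\<omega> h)) * H (t + h) (\<omega> h) \<partial>P y)"
    unfolding X_def Y_def using H_integrable[OF tha yE h'] w1(1) rng by (simp add: left_diff_distrib)
  have 2: "0 \<le> Y - X" unfolding YX using w2(2) rng by simp
  have 3: "Y - X \<le> C1 * h\<^sup>2"
  proof -
    let ?S = "{\<omega> \<in> space (path_space E). r \<le> \<bar>\<omega> h - y\<bar> \<and> (y \<in> {y..y} \<or> \<omega> h \<in> {y..y})}"
    have S: "?S \<in> sets (path_space E)"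
    proof -
      have "(\<lambda>\<omega>. \<omega> h) \<in> borel_measurable (path_space E)" using h' by (rule measurable_coordinate)
      then have "{\<omega> \<in> space (path_space E). r \<le> \<bar>\<omega> h - y\<bar>} \<in> sets (path_space E)" by measurable
      then show ?thesis by simp
    qed
    have "Y - X \<le> prob ?S" unfolding YX
    proof (rule w2(3)[OF _ S])
      show "AE \<omega> in P y. \<omega> \<in> space (path_space E) \<longrightarrow> 1 - bump (y - r) (y + r) r (\<omega> h) \<noteq> 0 \<longrightarrow> \<omega> \<in> ?S"
      proof (intro AE_I2 impI)
        fix \<omega> assume "\<omega> \<in> space (path_space E)" "1 - bump (y - r) (y + r) r (\<omega> h) \<noteq> 0"
        then have "\<omega> h \<notin> {y - r..y + r}" using bump_inside[OF r, of "\<omega> h" "y - r" "y + r"] by auto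
        then show "\<omega> \<in> ?S" using \<open>\<omega> \<in> space (path_space E)\<close> by (auto simp: abs_if)
      qed
    qed (use rng in auto)
    also have "prob ?S \<le> C1 * h\<^sup>2" using C1(2)[OF h(1)] C1(1) by (simp add: emeasure_eq_measure)
    finally show ?thesis .
  qed
  have rE: "y - r \<in> E" using in_E lr .
  have Fc: "F (t + u) < y - r" if "0 \<le> u" "u \<le> h" for u using d(3)[of "t + u"] that h r by (simp add: L_def)
  have 4: "0 \<le> Y - H t y" using H_increment(1)[OF t(1) h(1) tha yE rE _ Fc] r unfolding Y_def by simp
  have "ennreal (Y - H t y) \<le> ennreal (C2 * (2 * h)\<^sup>2)"
    using H_increment(2)[OF t(1) h(1) tha yE rE _ Fc] C2(2)[of "2 * h"] r h unfolding Y_def by (auto intro: order_trans)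
  then have 5: "Y - H t y \<le> 4 * C2 * h\<^sup>2" using C2 by (subst (asm) ennreal_le_iff) (auto simp: power_mult_distrib)
  have "h * \<bar>\<kappa>\<bar> \<le> \<bar>\<kappa>\<bar> / 4 * h + (C1 + 4 * C2) * h\<^sup>2"
  proof -
    have "\<bar>h * \<kappa>\<bar> \<le> \<bar>X - H t y - h * \<kappa>\<bar> + \<bar>X - H t y\<bar>" by linarith
    moreover have "\<bar>X - H t y\<bar> \<le> C1 * h\<^sup>2 + 4 * C2 * h\<^sup>2" using 2 3 4 5 by linarith
    moreover have "\<bar>h * \<kappa>\<bar> = h * \<bar>\<kappa>\<bar>" using h by (simp add: abs_mult)
    ultimately show ?thesis using 1 by (simp add: distrib_right)
  qed
  also have "(C1 + 4 * C2) * h\<^sup>2 \<le> \<bar>\<kappa>\<bar> / 4 * h"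
  proof -
    define D where "D = C1 + 4 * C2 + 1"
    have D: "0 < D" using C1 C2 by (simp add: D_def add_nonneg_pos)
    have "D * h \<le> D * (\<bar>\<kappa>\<bar> / (4 * D))" using h(4) D unfolding D_def[symmetric] by (intro mult_left_mono) auto
    then have "D * h \<le> \<bar>\<kappa>\<bar> / 4" using D by simp
    then have "D * h * h \<le> \<bar>\<kappa>\<bar> / 4 * h" using h by (intro mult_right_mono) auto
    moreover have "(C1 + 4 * C2) * h\<^sup>2 \<le> D * h * h" using h by (simp add: D_def power2_eq_square mult_right_mono algebra_simps)
    ultimately show ?thesis by linarith
  qed
  finally have "h * \<bar>\<kappa>\<bar> \<le> h * (\<bar>\<kappa>\<bar> / 2)" by simp
  then have "\<bar>\<kappa>\<bar> \<le> \<bar>\<kappa>\<bar> / 2" using h by (simp only: mult_le_cancel_left_pos)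
  then show False using k by simp
qed

section \<open>The mass far above the curve\<close>

lemma bump_eq_step:
  assumes "w \<le> K + 3"
  shows "bump (K + 1) (K + 3) 1 w = step (w - K)" "bump1 (K + 1) (K + 3) 1 w = step1 (w - K)" "bump2 (K + 1) (K + 3) 1 w = step2 (w - K)"
  \<comment> \<open>The falling flank of this bump occupies \<open>[K + 3, K + 4]\<close>, so up to
    \<open>K + 3\<close> the second factor is constantly 1.\<close>
  using assms step_eq(4-6)[of "K + 4 - w"] by (simp_all add: bump_def bump1_def bump2_def add.commute)

text \<open>The generator applied to \<open>step (z - K) * H t z\<close>, without the terms cancelled by the backward equation.\<close>

definition far_generator_term :: "real \<Rightarrow> real \<Rightarrow> real \<Rightarrow> real" where
  "far_generator_term K t z = space_generator z (step1 (z - K) * H t z) (step2 (z - K) * H t z + 2 * step1 (z - K) * hy t z)"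

lemma far_generator_term_eq_0: "z \<notin> {K..K + 1} \<Longrightarrow> far_generator_term K t z = 0"
  using step_eq(2,3)[of "z - K"] step_eq(5,6)[of "z - K"] by (auto simp: far_generator_term_def)

lemma AE_hit_before:
  assumes z: "z \<in> E" and h: "0 < h" and c: "AE \<omega> in P z. \<omega> \<in> space (path_space E) \<longrightarrow> Q \<omega> \<longrightarrow> (z \<le> c \<and> c \<le> \<omega> h) \<or> (\<omega> h \<le> c \<and> c \<le> z)"
  shows "AE \<omega> in P z. \<omega> \<in> space (path_space E) \<longrightarrow> Q \<omega> \<longrightarrow> \<omega> \<in> {\<omega> \<in> space (path_space E). hitting_time c \<omega> < ennreal (2 * h)}"
  using start_AE[OF z] c
proof (eventually_elim, intro impI)
  fix \<omega> assume w: "\<omega> \<in> space (path_space E) \<and> \<omega> 0 = z" and a: "\<omega> \<in> space (path_space E) \<longrightarrow> Q \<omega> \<longrightarrow> (z \<le> c \<and> c \<le> \<omega> h) \<or> (\<omega> h \<le> c \<and> c \<le> z)" and "Q \<omega>"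
  then have "(\<omega> 0 \<le> c \<and> c \<le> \<omega> h) \<or> (\<omega> h \<le> c \<and> c \<le> \<omega> 0)" by auto
  from path_ivt[OF conjunct1[OF w] order_refl less_imp_le[OF h] this]
  obtain r where "0 \<le> r" "r \<le> h" "\<omega> r = c" by blast
  then show "\<omega> \<in> {\<omega> \<in> space (path_space E). hitting_time c \<omega> < ennreal (2 * h)}"
    using w h by (subst mem_Collect_eq, subst hitting_time_less_iff) auto
qed

lemma measurable_step: "(\<lambda>w. step (w - K)) \<in> borel_measurable borel"
  by (intro borel_measurable_continuous_onI continuous_on_compose2[OF continuous_step, of UNIV] continuous_intros) auto

text \<open>For \<open>z \<le> K + 2\<close> the step may be replaced by a compactly supported bump:
  they differ only above \<open>K + 3\<close>, which costs a crossing of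
  \<open>[K + 2, K + 3]\<close>. For larger \<open>z\<close> the generator term is 0 and the step is
  1 near \<open>z\<close>: both the change of \<open>H\<close> and the loss by the cutoff require a
  descent to \<open>K + 1\<close>. The crossing bounds do not depend on \<open>z\<close>, which
  gives a uniform estimate on an unbounded region.\<close>

lemma far_generator:
  assumes t12: "0 < t1" "alive t2" and FK: "\<And>t. t \<in> {t1..t2} \<Longrightarrow> F t \<le> K - 1" and lK: "l < ereal (K - 1)" and e: "0 < \<epsilon>"
  shows "\<exists>h0>0. \<forall>h t z. 0 < h \<longrightarrow> h \<le> h0 \<longrightarrow> t1 \<le> t \<longrightarrow> t + h \<le> t2 \<longrightarrow> l < ereal z \<longrightarrow>
    \<bar>(\<integral>\<omega>. step (\<omega> h - K) * H (t + h) (\<omega> h) \<partial>P z) - step (z - K) * H t z - h * far_generator_term K t z\<bar> \<le> \<epsilon> * h"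
proof -
  have b: "{t1..t2} \<times> {K - 1..K + 5} \<subseteq> above_curve l f" using box_above[OF t12 FK] .
  have lK': "l < ereal (K + 1)" "l < ereal (K + 2)" "l < ereal (K + 3)" using l_less_trans[OF lK] by auto
  obtain h1 where h1: "0 < h1" "\<And>h t z. 0 < h \<Longrightarrow> h \<le> h1 \<Longrightarrow> t1 \<le> t \<Longrightarrow> t + h \<le> t2 \<Longrightarrow> l < ereal z \<Longrightarrow>
    \<bar>(\<integral>\<omega>. bump (K + 1) (K + 3) 1 (\<omega> h) * H (t + h) (\<omega> h) \<partial>P z) - bump (K + 1) (K + 3) 1 z * H t z
      - h * (bump (K + 1) (K + 3) 1 z * ht t z + space_generator z (bump1 (K + 1) (K + 3) 1 z * H t z + bump (K + 1) (K + 3) 1 z * hy t z)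
          (bump2 (K + 1) (K + 3) 1 z * H t z + 2 * bump1 (K + 1) (K + 3) 1 z * hy t z + bump (K + 1) (K + 3) 1 z * hyy t z))\<bar> \<le> \<epsilon> / 2 * h"
    using cutoff_generator[OF b lK, of "K + 1" 1 "K + 3" "\<epsilon> / 2"] e by auto
  obtain C1 where C1: "0 \<le> C1" "\<And>h z. 0 < h \<Longrightarrow> z \<in> E \<Longrightarrow> z \<le> K + 2 \<Longrightarrow> hit_prob z (K + 3) h \<le> ennreal (C1 * h\<^sup>2)"
    using crossing_small[OF lK'(2), of "K + 3"] by auto
  obtain C2 where C2: "0 \<le> C2" "\<And>h z. 0 < h \<Longrightarrow> z \<in> E \<Longrightarrow> K + 2 \<le> z \<Longrightarrow> hit_prob z (K + 1) h \<le> ennreal (C2 * h\<^sup>2)"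
    using crossing_small[OF lK'(1), of "K + 2"] by auto
  \<comment> \<open>One error \<open>4 * C1 * h\<^sup>2\<close> in the first case and two errors
    \<open>4 * C2 * h\<^sup>2\<close> in the second.\<close>
  define D where "D = 4 * C1 + 8 * C2 + 1"
  have D: "0 < D" using C1 C2 by (simp add: D_def add_nonneg_pos)
  define h0 where "h0 = min h1 (\<epsilon> / (2 * D))"
  have h0: "0 < h0" using h1 e D by (simp add: h0_def)
  have main: "\<bar>(\<integral>\<omega>. step (\<omega> h - K) * H (t + h) (\<omega> h) \<partial>P z) - step (z - K) * H t z - h * far_generator_term K t z\<bar> \<le> \<epsilon> * h"
    if h: "0 < h" "h \<le> h0" and t: "t1 \<le> t" "t + h \<le> t2" and z: "l < ereal z" for h t z
  proof -
    have zE: "z \<in> E" using in_E z .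
    interpret prob_space "P z" by (rule P_prob_space[OF zE])
    have h': "0 \<le> h" using h by simp
    have al: "alive t" "alive (t + h)" using alive_le[OF t12(2)] t t12 h by auto
    have tt: "t \<in> {t1..t2}" using t h by auto
    have small: "D * h\<^sup>2 \<le> \<epsilon> / 2 * h"
    proof -
      have "D * h \<le> D * (\<epsilon> / (2 * D))" using h D by (intro mult_left_mono) (auto simp: h0_def)
      also have "\<dots> = \<epsilon> / 2" using D by simp
      finally have "D * h * h \<le> \<epsilon> / 2 * h" using h by (intro mult_right_mono) auto
      then show ?thesis by (simp add: power2_eq_square)
    qed
    note ws = weighted_H[OF zE al(2) h' measurable_step, of K]
    have sr: "0 \<le> step w \<and> step w \<le> 1" for w using step_range by auto
    show ?thesis
    proof (cases "z \<le> K + 2")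
      case True
      have bm: "bump (K + 1) (K + 3) 1 \<in> borel_measurable borel" "(\<lambda>w. step (w - K) - bump (K + 1) (K + 3) 1 w) \<in> borel_measurable borel"
        by (intro borel_measurable_continuous_onI borel_measurable_diff measurable_step; meson DERIV_isCont continuous_at_imp_continuous_on bump_derivative zero_less_one)+
      have br: "0 \<le> bump (K + 1) (K + 3) 1 w \<and> bump (K + 1) (K + 3) 1 w \<le> 1" for w using bump_range by auto
      have dr: "0 \<le> step (w - K) - bump (K + 1) (K + 3) 1 w \<and> step (w - K) - bump (K + 1) (K + 3) 1 w \<le> 1" for w
      proof -
        have "bump (K + 1) (K + 3) 1 w = step (w - K) * step (K + 4 - w)" by (simp add: bump_def add.commute)
        also have "\<dots> \<le> step (w - K) * 1" using sr by (intro mult_left_mono) auto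
        finally show ?thesis using sr[of "w - K"] br[of w] by auto
      qed
      have val: "bump (K + 1) (K + 3) 1 z * ht t z + space_generator z (bump1 (K + 1) (K + 3) 1 z * H t z + bump (K + 1) (K + 3) 1 z * hy t z)
          (bump2 (K + 1) (K + 3) 1 z * H t z + 2 * bump1 (K + 1) (K + 3) 1 z * hy t z + bump (K + 1) (K + 3) 1 z * hyy t z) = far_generator_term K t z"
      proof -
        have "z \<le> K + 3" using True by simp
        note be = bump_eq_step[OF this]
        \<comment> \<open>Below \<open>K\<close> the step is zero, whatever \<open>H\<close> does
          there; above \<open>K\<close> the point lies strictly above the curve and the backward
          equation holds.\<close>
        have "step (z - K) * (ht t z + space_generator z (hy t z) (hyy t z)) = 0"
        proof (cases "z \<le> K")
          case True
          then show ?thesis by (simp add: step_eq)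
        next
          case False
          then show ?thesis using backward_equation[OF al(1), of z] FK[OF tt] t t12 by auto
        qed
        then show ?thesis unfolding be far_generator_term_def
          using space_generator_linear[of z "step (z - K)" "hy t z" "step1 (z - K) * H t z" "hyy t z" "step2 (z - K) * H t z + 2 * step1 (z - K) * hy t z"]
          by (simp add: algebra_simps)
      qed
      have 1: "\<bar>(\<integral>\<omega>. bump (K + 1) (K + 3) 1 (\<omega> h) * H (t + h) (\<omega> h) \<partial>P z) - step (z - K) * H t z - h * far_generator_term K t z\<bar> \<le> \<epsilon> / 2 * h"
        using h1(2)[OF h(1) _ t z] h True unfolding val by (simp add: h0_def bump_eq_step)
      let ?S = "{\<omega> \<in> space (path_space E). hitting_time (K + 3) \<omega> < ennreal (2 * h)}"
      note wd = weighted_H[OF zE al(2) h' bm(2) dr]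
      have eq: "(\<integral>\<omega>. step (\<omega> h - K) * H (t + h) (\<omega> h) \<partial>P z) - (\<integral>\<omega>. bump (K + 1) (K + 3) 1 (\<omega> h) * H (t + h) (\<omega> h) \<partial>P z)
         = (\<integral>\<omega>. (step (\<omega> h - K) - bump (K + 1) (K + 3) 1 (\<omega> h)) * H (t + h) (\<omega> h) \<partial>P z)"
        using ws(1)[OF sr] weighted_H(1)[OF zE al(2) h' bm(1) br] by (simp add: left_diff_distrib)
      have "(\<integral>\<omega>. (step (\<omega> h - K) - bump (K + 1) (K + 3) 1 (\<omega> h)) * H (t + h) (\<omega> h) \<partial>P z) \<le> prob ?S"
      proof (rule wd(3))
        show "AE \<omega> in P z. \<omega> \<in> space (path_space E) \<longrightarrow> step (\<omega> h - K) - bump (K + 1) (K + 3) 1 (\<omega> h) \<noteq> 0 \<longrightarrow> \<omega> \<in> ?S"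
        proof (rule AE_hit_before[OF zE h(1)], intro AE_I2 impI disjI1)
          fix \<omega> assume "step (\<omega> h - K) - bump (K + 1) (K + 3) 1 (\<omega> h) \<noteq> 0"
          then have "\<not> \<omega> h \<le> K + 3" using bump_eq_step(1)[of "\<omega> h" K] by auto
          then show "z \<le> K + 3 \<and> K + 3 \<le> \<omega> h" using True by auto
        qed
      qed measurable
      also have "prob ?S \<le> C1 * (2 * h)\<^sup>2" using C1(2)[of "2 * h" z] True zE h C1(1) by (simp add: emeasure_eq_measure)
      finally have 2: "(\<integral>\<omega>. (step (\<omega> h - K) - bump (K + 1) (K + 3) 1 (\<omega> h)) * H (t + h) (\<omega> h) \<partial>P z) \<le> 4 * C1 * h\<^sup>2" by (simp add: power_mult_distrib)
      have "4 * C1 * h\<^sup>2 \<le> D * h\<^sup>2" using C2 by (intro mult_right_mono) (auto simp: D_def)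
      then show ?thesis using 1 2 wd(2) eq small by linarith
    next
      case False
      then have f0: "far_generator_term K t z = 0" and s1: "step (z - K) = 1" by (auto intro: far_generator_term_eq_0 simp: step_eq)
      let ?S = "{\<omega> \<in> space (path_space E). hitting_time (K + 1) \<omega> < ennreal (2 * h)}"
      have hp: "hit_prob z (K + 1) (2 * h) \<le> ennreal (C2 * (2 * h)\<^sup>2)" using C2(2)[of "2 * h" z] False zE h by simp
      have Sb: "prob ?S \<le> 4 * C2 * h\<^sup>2" using hp C2(1) by (simp add: emeasure_eq_measure power_mult_distrib)
      have cE: "K + 1 \<in> E" using in_E lK' by blast
      have Fc: "F (t + u) < K + 1" if "0 \<le> u" "u \<le> h" for u using FK[of "t + u"] that t by auto
      have zc: "K + 1 \<le> z" using False by simp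
      have i1: "H t z \<le> (\<integral>\<omega>. H (t + h) (\<omega> h) \<partial>P z)" using H_increment(1)[OF al(1) h(1) al(2) zE cE zc Fc] .
      have "ennreal ((\<integral>\<omega>. H (t + h) (\<omega> h) \<partial>P z) - H t z) \<le> ennreal (C2 * (2 * h)\<^sup>2)"
        using H_increment(2)[OF al(1) h(1) al(2) zE cE zc Fc] hp by (rule order_trans)
      then have i2: "(\<integral>\<omega>. H (t + h) (\<omega> h) \<partial>P z) - H t z \<le> 4 * C2 * h\<^sup>2"
        using C2(1) by (subst (asm) ennreal_le_iff) (auto simp: power_mult_distrib)
      have bm: "(\<lambda>w. 1 - step (w - K)) \<in> borel_measurable borel" using measurable_step by simp
      have cr: "0 \<le> 1 - step (w - K) \<and> 1 - step (w - K) \<le> 1" for w using sr by auto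
      note wd = weighted_H[OF zE al(2) h' bm cr]
      have eq: "(\<integral>\<omega>. H (t + h) (\<omega> h) \<partial>P z) - (\<integral>\<omega>. step (\<omega> h - K) * H (t + h) (\<omega> h) \<partial>P z) = (\<integral>\<omega>. (1 - step (\<omega> h - K)) * H (t + h) (\<omega> h) \<partial>P z)"
        using ws(1)[OF sr] H_integrable[OF al(2) zE h'] by (simp add: left_diff_distrib)
      have "(\<integral>\<omega>. (1 - step (\<omega> h - K)) * H (t + h) (\<omega> h) \<partial>P z) \<le> prob ?S"
      proof (rule wd(3))
        show "AE \<omega> in P z. \<omega> \<in> space (path_space E) \<longrightarrow> 1 - step (\<omega> h - K) \<noteq> 0 \<longrightarrow> \<omega> \<in> ?S"
        proof (rule AE_hit_before[OF zE h(1)], intro AE_I2 impI disjI2)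
          fix \<omega> assume "1 - step (\<omega> h - K) \<noteq> 0"
          then have "\<not> K + 1 \<le> \<omega> h" using step_eq(4)[of "\<omega> h - K"] by auto
          then show "\<omega> h \<le> K + 1 \<and> K + 1 \<le> z" using zc by auto
        qed
      qed measurable
      then have "(\<integral>\<omega>. (1 - step (\<omega> h - K)) * H (t + h) (\<omega> h) \<partial>P z) \<le> 4 * C2 * h\<^sup>2" using Sb by simp
      moreover have "8 * C2 * h\<^sup>2 \<le> D * h\<^sup>2" using C1 by (intro mult_right_mono) (auto simp: D_def)
      moreover have "\<epsilon> / 2 * h \<le> \<epsilon> * h" using e h by simp
      ultimately show ?thesis unfolding f0 s1 using i1 i2 eq wd(2) small C2 by simp
    qed
  qed
  then show ?thesis using h0 by blast
qed

text \<open>The integrand is the Wronskian of \<open>H\<close> and \<open>q\<close> with respect to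
  the scale, weighted by the slope of the cutoff: the rate at which mass of \<open>H\<close> enters
  the region above the cutoff.\<close>

definition flux :: "real \<Rightarrow> real \<Rightarrow> real \<Rightarrow> real" where
  "flux K x t = integral {K..K + 1} (\<lambda>y. step1 (y - K) * (hy t y * q t y x - H t y * q_y t y x) / deriv s y)"

lemma step_shift_derivs:
  "((\<lambda>y. step (y - K)) has_real_derivative step1 (y - K)) (at y within S)"
  "((\<lambda>y. step1 (y - K)) has_real_derivative step2 (y - K)) (at y within S)"
proof -
  have d: "((\<lambda>y. y - K) has_real_derivative 1) (at y within S)" by (auto intro!: derivative_eq_intros)
  from DERIV_chain'[OF d step_derivative] DERIV_chain'[OF d step1_derivative]
  show "((\<lambda>y. step (y - K)) has_real_derivative step1 (y - K)) (at y within S)"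
    "((\<lambda>y. step1 (y - K)) has_real_derivative step2 (y - K)) (at y within S)" by simp_all
qed

lemma step_shift_continuous:
  "continuous_on S (\<lambda>y. step (y - K))" "continuous_on S (\<lambda>y. step1 (y - K))" "continuous_on S (\<lambda>y. step2 (y - K))"
proof -
  have c: "continuous_on S (\<lambda>y. g (y - K))" if "continuous_on UNIV g" for g :: "real \<Rightarrow> real"
    by (rule continuous_on_compose2[OF that]) (auto intro: continuous_intros)
  show "continuous_on S (\<lambda>y. step (y - K))" "continuous_on S (\<lambda>y. step1 (y - K))" "continuous_on S (\<lambda>y. step2 (y - K))"
    by (intro c continuous_step continuous_step1 continuous_step2)+
qed

text \<open>The second-order part of the generator term exceeds the derivative of
  \<open>u1 = step1 * H\<close> by one copy of \<open>step1 * hy\<close>. The part with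
  \<open>u1\<close> is integrated by parts and gives the terms with \<open>q_y\<close>; the extra
  copy gives the terms with \<open>hy\<close>.\<close>

lemma far_expectation:
  assumes x: "l < ereal x" and t: "0 < t" "alive t" and K: "F t \<le> K"
  shows "continuous_on {K..K + 1} (far_generator_term K t)" "(\<integral>\<omega>. far_generator_term K t (\<omega> t) \<partial>P x) = flux K x t"
proof -
  have lK: "l < ereal K" using l_less_trans[OF alive_f(2)[OF t(2)] K] .
  have KR: "K \<le> K + 1" by simp
  have b: "{t..t} \<times> {K..K + 1} \<subseteq> above_curve l f" using box_above[OF t, of K] K by auto
  have tt: "t \<in> {t..t}" by simp
  note d = box_derivs[OF b tt]
  note c = continuous_on_section[OF box_continuous(1)[OF b] tt] continuous_on_section[OF box_continuous(3)[OF b] tt]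
  note ic = interval_continuity[OF lK, where R = "K + 1"]
  note sc = step_shift_continuous[of "{K..K + 1}" K]
  have qc: "continuous_on {K..K + 1} (\<lambda>y. q t y x)" "continuous_on {K..K + 1} (\<lambda>y. q_y t y x)"
    using continuous_on_section[OF q_continuous_box(1)[OF lK x, of "{t}"]] continuous_on_section[OF q_continuous_box(3)[OF lK x, of "{t}"]] t by auto
  define u1 where "u1 y = step1 (y - K) * H t y" for y
  define u2 where "u2 y = step2 (y - K) * H t y + step1 (y - K) * hy t y" for y
  have uc: "continuous_on {K..K + 1} u1" "continuous_on {K..K + 1} u2"
    unfolding u1_def[abs_def] u2_def[abs_def] by (intro continuous_on_add continuous_on_mult c sc)+
  have ud: "(u1 has_real_derivative u2 y) (at y within {K..K + 1})" if "y \<in> {K..K + 1}" for y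
    unfolding u1_def[abs_def] u2_def by (rule DERIV_cong[OF DERIV_mult[OF step_shift_derivs(2) d(2)[OF that]]]) simp
  have fe: "far_generator_term K t y = space_generator y (u1 y) (u2 y) + step1 (y - K) * hy t y / (deriv s y * \<rho> y)" if y: "y \<in> {K..K + 1}" for y
  proof -
    have "space_generator y 0 (step1 (y - K) * hy t y) = step1 (y - K) * hy t y / (deriv s y * \<rho> y)"
      using ic(4)[OF y] by (simp add: space_generator_def)
    then show ?thesis unfolding far_generator_term_def u1_def u2_def
      using space_generator_linear[of y 1 "step1 (y - K) * H t y" 0 "step2 (y - K) * H t y + step1 (y - K) * hy t y" "step1 (y - K) * hy t y"] by (simp add: algebra_simps)
  qed
  have sgc: "continuous_on {K..K + 1} (\<lambda>y. space_generator y (u1 y) (u2 y))"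
    unfolding space_generator_def using uc ic by (intro continuous_intros) auto
  have "continuous_on {K..K + 1} (\<lambda>y. space_generator y (u1 y) (u2 y) + step1 (y - K) * hy t y / (deriv s y * \<rho> y))"
    using sgc c sc ic by (intro continuous_intros) auto
  then show fc: "continuous_on {K..K + 1} (far_generator_term K t)" using fe by (subst continuous_on_cong[OF refl]) auto
  have "(\<integral>\<omega>. far_generator_term K t (\<omega> t) \<partial>P x) = integral {K..K + 1} (\<lambda>y. far_generator_term K t y * q t y x * \<rho> y)"
    by (rule expectation_density[OF x t(1) lK fc far_generator_term_eq_0])
  also have "\<dots> = integral {K..K + 1} (\<lambda>y. space_generator y (u1 y) (u2 y) * q t y x * \<rho> y + step1 (y - K) * hy t y * q t y x / deriv s y)"
  proof (rule Henstock_Kurzweil_Integration.integral_cong)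
    fix y assume y: "y \<in> {K..K + 1}"
    have "(p + r / (d * c)) * w * c = p * w * c + r * w / d" if "d \<noteq> 0" "c \<noteq> 0" for p r d c w :: real
      using that by (simp add: field_simps)
    from this[OF ic(4)[OF y] ic(5)[OF y]]
    show "far_generator_term K t y * q t y x * \<rho> y = space_generator y (u1 y) (u2 y) * q t y x * \<rho> y + step1 (y - K) * hy t y * q t y x / deriv s y"
      unfolding fe[OF y] by simp
  qed
  also have "\<dots> = integral {K..K + 1} (\<lambda>y. space_generator y (u1 y) (u2 y) * q t y x * \<rho> y) + integral {K..K + 1} (\<lambda>y. step1 (y - K) * hy t y * q t y x / deriv s y)"
    using sgc c sc ic qc by (intro Henstock_Kurzweil_Integration.integral_add integrable_continuous_interval continuous_intros) auto
  also have "integral {K..K + 1} (\<lambda>y. space_generator y (u1 y) (u2 y) * q t y x * \<rho> y) = - integral {K..K + 1} (\<lambda>y. u1 y * (q_y t y x / deriv s y))"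
    by (rule generator_by_parts[OF x t(1) lK KR ud uc(2)]) (simp_all add: u1_def step_eq)
  also have "- integral {K..K + 1} (\<lambda>y. u1 y * (q_y t y x / deriv s y)) + integral {K..K + 1} (\<lambda>y. step1 (y - K) * hy t y * q t y x / deriv s y) =
    integral {K..K + 1} (\<lambda>y. step1 (y - K) * hy t y * q t y x / deriv s y - u1 y * (q_y t y x / deriv s y))"
    using uc c sc ic qc by (subst Henstock_Kurzweil_Integration.integral_diff) (auto intro!: integrable_continuous_interval continuous_intros)
  also have "\<dots> = flux K x t"
    unfolding flux_def u1_def by (intro Henstock_Kurzweil_Integration.integral_cong) (simp add: right_diff_distrib diff_divide_distrib mult_ac)
  finally show "(\<integral>\<omega>. far_generator_term K t (\<omega> t) \<partial>P x) = flux K x t" .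
qed

lemma flux_continuous:
  assumes x: "l < ereal x" and ab: "0 < a" "alive b" and FK: "\<And>t. t \<in> {a..b} \<Longrightarrow> F t \<le> K" and lK: "l < ereal K"
  shows "continuous_on {a..b} (flux K x)"
proof -
  have b: "{a..b} \<times> {K..K + 1} \<subseteq> above_curve l f" using box_above[OF ab FK] .
  have U: "{a..b} \<subseteq> {0<..}" using ab by auto
  note c = box_continuous[OF b] q_continuous_box[OF lK x U, where R = "K + 1"] step_shift_continuous(2)[THEN continuous_on_snd_only] interval_continuity(2)[OF lK, THEN continuous_on_snd_only]
  have "continuous_on {a..b} (\<lambda>t. integral (cbox K (K + 1)) (\<lambda>y. step1 (y - K) * (hy t y * q t y x - H t y * q_y t y x) / deriv s y))"
  proof (rule integral_continuous_on_param)
    show "continuous_on ({a..b} \<times> cbox K (K + 1)) (\<lambda>(t, y). step1 (y - K) * (hy t y * q t y x - H t y * q_y t y x) / deriv s y)"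
      using interval_continuity(4)[OF lK, where R = "K + 1"] unfolding case_prod_beta cbox_interval
      by (intro continuous_on_divide continuous_on_mult continuous_on_diff c[unfolded case_prod_beta]) auto
  qed
  then show ?thesis unfolding flux_def[abs_def] by (simp add: cbox_interval)
qed

text \<open>The Markov property at time \<open>t\<close> averages the local estimate over the law of
  the position at that time. As its error is uniform in the starting point, it stays at most
  \<open>\<epsilon> * h\<close>, and the increments integrate to the flux.\<close>

lemma far_identity:
  assumes x: "l < ereal x" and ab: "0 < a" "a \<le> b" "alive b" and FK: "\<And>t. t \<in> {a..b} \<Longrightarrow> F t \<le> K - 1"
  shows "(\<integral>\<omega>. step (\<omega> b - K) * H b (\<omega> b) \<partial>P x) - (\<integral>\<omega>. step (\<omega> a - K) * H a (\<omega> a) \<partial>P x) = integral {a..b} (flux K x)"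
proof -
  have xE: "x \<in> E" using in_E x .
  interpret prob_space "P x" by (rule P_prob_space[OF xE])
  have lK1: "l < ereal (K - 1)" using l_less_trans[OF alive_f(2)[OF ab(3)], of "K - 1"] FK[of b] ab by auto
  have lK: "l < ereal K" using l_less_trans[OF lK1] by simp
  have FK': "F t \<le> K" if "t \<in> {a..b}" for t using FK[OF that] by simp
  have sr: "0 \<le> step w \<and> step w \<le> 1" for w using step_range by auto
  define D where "D t = (\<integral>\<omega>. step (\<omega> t - K) * H t (\<omega> t) \<partial>P x)" for t
  have "D b - D a = integral {a..b} (flux K x)"
  proof (rule integral_from_increments[OF ab(2) flux_continuous[OF x ab(1,3) FK' lK]])
    fix \<epsilon> :: real assume e: "0 < \<epsilon>"
    obtain h0 where h0: "0 < h0" "\<And>h t z. 0 < h \<Longrightarrow> h \<le> h0 \<Longrightarrow> a \<le> t \<Longrightarrow> t + h \<le> b \<Longrightarrow> l < ereal z \<Longrightarrow>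
      \<bar>(\<integral>\<omega>. step (\<omega> h - K) * H (t + h) (\<omega> h) \<partial>P z) - step (z - K) * H t z - h * far_generator_term K t z\<bar> \<le> \<epsilon> * h"
      using far_generator[OF ab(1,3) FK lK1 e] by blast
    have "\<bar>D (t + h) - D t - h * flux K x t\<bar> \<le> \<epsilon> * h" if h: "0 < h" "h \<le> h0" and t: "a \<le> t" "t + h \<le> b" for h t
    proof -
      have t0: "0 < t" "0 \<le> t" "0 \<le> h" using t ab h by auto
      have al: "alive t" "alive (t + h)" using alive_le[OF ab(3)] t t0 h by auto
      have Ft: "F t \<le> K" using FK'[of t] t h by auto
      define g where "g \<omega> = step (\<omega> h - K) * H (t + h) (\<omega> h)" for \<omega> :: "real \<Rightarrow> real"
      have gm: "g \<in> borel_measurable (path_space E)"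
      proof -
        have "(\<lambda>\<omega>. H (t + h) (\<omega> h)) \<in> borel_measurable (path_space E)" using H_measurable[OF al(2) xE t0(3)] measurable_P_iff[OF xE] by blast
        then show ?thesis unfolding g_def using measurable_compose[OF measurable_coordinate[OF t0(3)] measurable_step] by (intro borel_measurable_times) auto
      qed
      have gr: "0 \<le> g \<omega> \<and> g \<omega> \<le> 1" if "\<omega> \<in> space (path_space E)" for \<omega>
        using H_range[OF al(2) path_spaceD(2)[OF that t0(3)]] sr[of "\<omega> h - K"] by (auto simp: g_def intro: mult_le_one)
      note mi = markov_integral[OF xE t0(2) gm gr]
      have Dth: "D (t + h) = (\<integral>\<omega>. (\<integral>\<omega>'. g \<omega>' \<partial>P (\<omega> t)) \<partial>P x)"
      proof -
        have "D (t + h) = (\<integral>\<omega>. g (path_shift t \<omega>) \<partial>P x)" by (simp add: D_def g_def path_shift_apply t0)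
        also have "\<dots> = (\<integral>\<omega>. (\<integral>\<omega>'. g \<omega>' \<partial>P (\<omega> t)) \<partial>P x)" by (rule mi(2))
        finally show ?thesis .
      qed
      have i2: "integrable (P x) (\<lambda>\<omega>. step (\<omega> t - K) * H t (\<omega> t))"
        by (rule weighted_H(1)[OF xE al(1) t0(2) measurable_step sr])
      have lKt: "l < ereal K" by (rule lK)
      have fm: "far_generator_term K t \<in> borel_measurable borel"
        by (rule borel_measurable_zero_outside[OF far_expectation(1)[OF x t0(1) al(1) Ft] far_generator_term_eq_0])
      obtain B where "\<forall>v\<in>far_generator_term K t ` {K..K + 1}. norm v \<le> B"
        using compact_imp_bounded[OF compact_continuous_image[OF far_expectation(1)[OF x t0(1) al(1) Ft] compact_Icc]] unfolding bounded_iff by blast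
      then have B: "\<bar>far_generator_term K t y\<bar> \<le> B" if "y \<in> {K..K + 1}" for y using that by simp
      have B': "\<bar>far_generator_term K t y\<bar> \<le> \<bar>B\<bar>" for y using B[of y] far_generator_term_eq_0[of y K t] by (cases "y \<in> {K..K + 1}") auto
      have i3: "integrable (P x) (\<lambda>\<omega>. far_generator_term K t (\<omega> t))"
        using measurable_compose[OF measurable_coordinate_P[OF xE t0(2)] fm] B' by (intro integrable_const_bound[of _ "\<bar>B\<bar>"]) auto
      have "D (t + h) - D t - h * flux K x t = (\<integral>\<omega>. (\<integral>\<omega>'. g \<omega>' \<partial>P (\<omega> t)) - step (\<omega> t - K) * H t (\<omega> t) - h * far_generator_term K t (\<omega> t) \<partial>P x)"
        unfolding Dth far_expectation(2)[OF x t0(1) al(1) Ft, symmetric] using mi(1) i2 i3 by (simp add: D_def)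
      moreover have "\<bar>\<integral>\<omega>. (\<integral>\<omega>'. g \<omega>' \<partial>P (\<omega> t)) - step (\<omega> t - K) * H t (\<omega> t) - h * far_generator_term K t (\<omega> t) \<partial>P x\<bar> \<le> (\<integral>\<omega>. \<epsilon> * h \<partial>P x)"
      proof (rule order_trans[OF integral_abs_bound integral_mono_AE])
        show "integrable (P x) (\<lambda>\<omega>. \<bar>(\<integral>\<omega>'. g \<omega>' \<partial>P (\<omega> t)) - step (\<omega> t - K) * H t (\<omega> t) - h * far_generator_term K t (\<omega> t)\<bar>)"
          using mi(1) i2 i3 by simp
        show "AE \<omega> in P x. \<bar>(\<integral>\<omega>'. g \<omega>' \<partial>P (\<omega> t)) - step (\<omega> t - K) * H t (\<omega> t) - h * far_generator_term K t (\<omega> t)\<bar> \<le> \<epsilon> * h"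
          \<comment> \<open>The local estimate speaks of starting points above \<open>l\<close>
            only, and almost every path is there at a positive time.\<close>
          using AE_in_I[OF x t0(1)]
        proof eventually_elim
          fix \<omega> :: "real \<Rightarrow> real" assume "l < ereal (\<omega> t)"
          from h0(2)[OF h t this] show "\<bar>(\<integral>\<omega>'. g \<omega>' \<partial>P (\<omega> t)) - step (\<omega> t - K) * H t (\<omega> t) - h * far_generator_term K t (\<omega> t)\<bar> \<le> \<epsilon> * h"
            unfolding g_def .
        qed
      qed simp
      ultimately show ?thesis by (simp add: prob_space)
    qed
    then show "\<exists>h0>0. \<forall>h t. 0 < h \<longrightarrow> h \<le> h0 \<longrightarrow> a \<le> t \<longrightarrow> t + h \<le> b \<longrightarrow> \<bar>D (t + h) - D t - h * flux K x t\<bar> \<le> \<epsilon> * h"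
      using h0(1) by blast
  qed
  then show ?thesis unfolding D_def .
qed

end

section \<open>The contribution of the curve\<close>

text \<open>A \<open>C\<^sup>1\<close> approximation of \<open>h \<mapsto> max 0 h\<close>, equal to \<open>(h - \<epsilon>)\<^sup>2 / h\<close> for \<open>h > \<epsilon>\<close>.\<close>

definition chi :: "real \<Rightarrow> real \<Rightarrow> real" where "chi \<epsilon> h = max \<epsilon> h + \<epsilon>\<^sup>2 / max \<epsilon> h - 2 * \<epsilon>"
definition chi1 :: "real \<Rightarrow> real \<Rightarrow> real" where "chi1 \<epsilon> h = 1 - \<epsilon>\<^sup>2 / (max \<epsilon> h)\<^sup>2"

lemma chi_small: "0 < \<epsilon> \<Longrightarrow> h \<le> \<epsilon> \<Longrightarrow> chi \<epsilon> h = 0" "0 < \<epsilon> \<Longrightarrow> h \<le> \<epsilon> \<Longrightarrow> chi1 \<epsilon> h = 0"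
  by (auto simp: chi_def chi1_def max_def power2_eq_square)

lemma chi_derivative:
  assumes e: "0 < \<epsilon>"
  shows "(chi \<epsilon> has_real_derivative chi1 \<epsilon> h) (at h)"
proof -
  \<comment> \<open>The derivative \<open>1 - \<epsilon>\<^sup>2 / m\<^sup>2\<close> vanishes at
    \<open>m = \<epsilon>\<close>, so the kink of \<open>max \<epsilon>\<close> at
    \<open>\<epsilon>\<close> leaves no trace in the composition.\<close>
  define g where "g m = m + \<epsilon>\<^sup>2 / m - 2 * \<epsilon>" for m :: real
  have gd: "(g has_real_derivative 1 - \<epsilon>\<^sup>2 / m\<^sup>2) (at m)" if "0 < m" for m
    unfolding g_def[abs_def] using that by (auto intro!: derivative_eq_intros simp: power2_eq_square field_simps)
  have cg: "chi \<epsilon> = (\<lambda>h. g (max \<epsilon> h))" by (intro ext) (simp add: chi_def g_def)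
  show ?thesis
  proof (cases "\<epsilon> < h")
    case True
    then have "\<forall>\<^sub>F w in nhds h. w \<in> {\<epsilon><..}" by (intro eventually_nhds_in_open) auto
    then have "\<forall>\<^sub>F w in nhds h. chi \<epsilon> w = g w" by eventually_elim (simp add: cg)
    then show ?thesis using gd[of h] e True by (subst DERIV_cong_ev[OF refl _ refl]) (auto simp: chi1_def)
  next
    case False
    then have "max \<epsilon> h = \<epsilon>" by simp
    moreover have "1 - \<epsilon>\<^sup>2 / \<epsilon>\<^sup>2 = 0" using e by simp
    ultimately have "(g has_real_derivative 0) (at (max \<epsilon> h))" "chi1 \<epsilon> h = 0" using gd[OF e] by (simp_all add: chi1_def)
    then show ?thesis unfolding cg using derivative_zero_comp_nonexpansive[of g "max \<epsilon>" h] by (simp add: max_def abs_if)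
  qed
qed

lemma chi_continuous:
  assumes e: "0 < \<epsilon>"
  shows "continuous_on S (chi \<epsilon>)" "continuous_on S (chi1 \<epsilon>)"
proof -
  have "(max \<epsilon> h)\<^sup>2 \<noteq> 0" for h using e by (simp add: max_def)
  then show "continuous_on S (chi1 \<epsilon>)" unfolding chi1_def[abs_def]
    by (intro continuous_on_diff continuous_on_divide continuous_on_power continuous_on_max continuous_on_const continuous_on_id) auto
  show "continuous_on S (chi \<epsilon>)" using chi_derivative[OF e] by (meson DERIV_isCont continuous_at_imp_continuous_on)
qed

lemma chi_bounds:
  assumes e: "0 < \<epsilon>" and h: "0 \<le> h"
  shows "0 \<le> chi \<epsilon> h" "chi \<epsilon> h \<le> h" "0 \<le> chi1 \<epsilon> h" "chi1 \<epsilon> h \<le> 1"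
proof -
  define m where "m = max \<epsilon> h"
  have m: "0 < m" "\<epsilon> \<le> m" using e by (auto simp: m_def)
  have eq: "chi \<epsilon> h = (m - \<epsilon>)\<^sup>2 / m" using m unfolding chi_def m_def[symmetric] by (simp add: power2_eq_square field_simps)
  show "0 \<le> chi \<epsilon> h" unfolding eq using m by simp
  have sq: "\<epsilon>\<^sup>2 \<le> m\<^sup>2" using m e by (intro power_mono) auto
  show "0 \<le> chi1 \<epsilon> h" "chi1 \<epsilon> h \<le> 1" unfolding chi1_def m_def[symmetric] using sq m by (auto simp: divide_le_eq)
  show "chi \<epsilon> h \<le> h"
  proof (cases "h \<le> \<epsilon>")
    case True
    then show ?thesis using chi_small(1)[OF e True] h by simp
  next
    case False
    then have mh: "m = h" by (simp add: m_def)
    have "(m - \<epsilon>)\<^sup>2 \<le> m\<^sup>2" using m e by (intro power_mono) auto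
    then show ?thesis unfolding eq using m mh by (simp add: pos_divide_le_eq power2_eq_square)
  qed
qed

text \<open>The derivatives converge to the indicator of \<open>h > 0\<close>, so the limit of the
  chain rule loses the derivatives of \<open>H\<close> at zeros of \<open>H\<close>. Above the curve
  these derivatives are 0 anyway.\<close>

lemma chi_limit:
  assumes h: "0 \<le> h"
  shows "(\<lambda>n. chi (1 / Suc n) h) \<longlonglongrightarrow> h" "(\<lambda>n. chi1 (1 / Suc n) h) \<longlonglongrightarrow> (if 0 < h then 1 else 0)"
proof -
  have e: "(\<lambda>n. 1 / real (Suc n)) \<longlonglongrightarrow> 0" using LIMSEQ_Suc[OF lim_1_over_n] by simp
  have "(\<lambda>n. chi (1 / Suc n) h) \<longlonglongrightarrow> h \<and> (\<lambda>n. chi1 (1 / Suc n) h) \<longlonglongrightarrow> (if 0 < h then 1 else 0)"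
  proof (cases "0 < h")
    case True
    have m: "(\<lambda>n. max (1 / real (Suc n)) h) \<longlonglongrightarrow> max 0 h" by (intro tendsto_max e tendsto_const)
    have "(\<lambda>n. chi (1 / Suc n) h) \<longlonglongrightarrow> max 0 h + 0\<^sup>2 / max 0 h - 2 * 0"
      unfolding chi_def using True by (intro tendsto_intros e m) auto
    moreover have "(\<lambda>n. chi1 (1 / Suc n) h) \<longlonglongrightarrow> 1 - 0\<^sup>2 / (max 0 h)\<^sup>2"
      unfolding chi1_def using True by (intro tendsto_intros e m) auto
    ultimately show ?thesis using True by simp
  next
    case False
    then have "h = 0" using h by simp
    then have "chi (1 / Suc n) h = 0" "chi1 (1 / Suc n) h = 0" for n using chi_small[of "1 / Suc n" h] by auto
    then show ?thesis using \<open>h = 0\<close> by simp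
  qed
  then show "(\<lambda>n. chi (1 / Suc n) h) \<longlonglongrightarrow> h" "(\<lambda>n. chi1 (1 / Suc n) h) \<longlonglongrightarrow> (if 0 < h then 1 else 0)" by auto
qed

section \<open>Regularisation of \<open>H\<close> across the curve\<close>

context curve_diffusion
begin

lemma interior_derivs:
  assumes t: "alive t" "0 < t" and y: "F t < y"
  shows "((\<lambda>r. H r y) has_real_derivative ht t y) (at t)" "(H t has_real_derivative hy t y) (at y)" "(hy t has_real_derivative hyy t y) (at y)"
proof -
  have i: "(t, y) \<in> above_curve l f" using assms by (simp add: above_iff)
  have "y \<in> interior {z. (t, z) \<in> above_curve l f}"
    by (rule interiorI[of "{F t<..}"]) (use assms in \<open>auto simp: above_iff\<close>)
  then have ay: "at y within {z. (t, z) \<in> above_curve l f} = at y" by (rule at_within_interior)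
  obtain d1 where d1: "0 < d1" "alive (t + d1)" using alive_extend[OF t(1)] by blast
  have "\<exists>d>0. \<forall>u\<in>{t. alive t}. dist u t < d \<longrightarrow> dist (F u) (F t) < y - F t"
    using F_continuous[unfolded continuous_on_iff, THEN bspec, of t] t y by simp
  then obtain d2 where d2: "0 < d2" "\<forall>u\<in>{t. alive t}. dist u t < d2 \<longrightarrow> dist (F u) (F t) < y - F t" by blast
  define d where "d = min (min d1 t) d2"
  have d: "0 < d" "d \<le> d1" "d \<le> t" "d \<le> d2" using d1 d2 t by (auto simp: d_def)
  have "(r, y) \<in> above_curve l f" if r: "r \<in> ball t d" for r
  proof -
    have r': "0 < r" "r < t + d1" "dist r t < d2" using r d by (auto simp: dist_real_def)
    then have al: "alive r" using alive_le[OF d1(2), of r] by auto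
    then have "dist (F r) (F t) < y - F t" using d2(2) r' by auto
    then show ?thesis using al r' by (auto simp: above_iff dist_real_def)
  qed
  then have "t \<in> interior {r. (r, y) \<in> above_curve l f}"
    using d by (intro interiorI[of "ball t d"]) auto
  then have at: "at t within {r. (r, y) \<in> above_curve l f} = at t" by (rule at_within_interior)
  show "((\<lambda>r. H r y) has_real_derivative ht t y) (at t)" "(H t has_real_derivative hy t y) (at y)" "(hy t has_real_derivative hyy t y) (at y)"
    using H_derivs[OF i] unfolding ay at by blast+
qed

text \<open>As \<open>H\<close> is nonnegative, a zero strictly above the curve is a local minimum
  in each variable.\<close>

lemma zero_interior:
  assumes t: "alive t" "0 < t" and y: "F t < y" and 0: "H t y = 0"
  shows "ht t y = 0" "hy t y = 0"
proof -
  have Hn: "0 \<le> H r z" if "alive r" "F r < z" for r z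
    using H_range(1)[OF that(1)] in_E[OF l_less_trans[OF alive_f(2)[OF that(1)], of z]] that by simp
  have "\<forall>z. \<bar>y - z\<bar> < y - F t \<longrightarrow> H t y \<le> H t z" using Hn[OF t(1)] 0 by auto
  then show "hy t y = 0" using DERIV_local_min[OF interior_derivs(2)[OF t y], of "y - F t"] y by simp
  obtain d1 where d1: "0 < d1" "alive (t + d1)" using alive_extend[OF t(1)] by blast
  have "\<exists>d>0. \<forall>u\<in>{t. alive t}. dist u t < d \<longrightarrow> dist (F u) (F t) < y - F t"
    using F_continuous[unfolded continuous_on_iff, THEN bspec, of t] t y by simp
  then obtain d2 where d2: "0 < d2" "\<forall>u\<in>{t. alive t}. dist u t < d2 \<longrightarrow> dist (F u) (F t) < y - F t" by blast
  define d where "d = min (min d1 t) d2"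
  have d: "0 < d" "d \<le> d1" "d \<le> t" "d \<le> d2" using d1 d2 t by (auto simp: d_def)
  have "H t y \<le> H r y" if "\<bar>t - r\<bar> < d" for r
  proof -
    have al: "alive r" using alive_le[OF d1(2), of r] that d by auto
    then have "dist (F r) (F t) < y - F t" using d2(2) that d by (auto simp: dist_real_def)
    then have "F r < y" by (auto simp: dist_real_def)
    then show ?thesis using Hn[OF al] 0 by simp
  qed
  then show "ht t y = 0" using DERIV_local_min[OF interior_derivs(1)[OF t y] d(1)] by simp
qed

lemma Hb_eq_max: "alive t \<Longrightarrow> Hb t y = H t (max (F t) y)"
  using H_on_curve[of t] by (auto simp: Hb_def max_def)

lemma Hb_range: "alive t \<Longrightarrow> 0 \<le> Hb t y" "alive t \<Longrightarrow> Hb t y \<le> 1"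
  using H_range[of t "max (F t) y"] in_E[OF l_less_trans[OF alive_f(2)[of t], of "max (F t) y"]] by (auto simp: Hb_eq_max)

text \<open>The map to \<open>(t, max (F t) y)\<close> is a continuous projection of the strip onto
  the region on and above the curve, where the derivatives of \<open>H\<close> are given.\<close>

lemma maxed_continuous:
  assumes u: "continuous_on (above_curve l f) (\<lambda>(t, y). u t y)" and ab: "0 < a" "alive b"
  shows "continuous_on ({a..b} \<times> Y) (\<lambda>(t, y). u t (max (F t) y) :: real)"
proof -
  have al: "alive t" if "t \<in> {a..b}" for t using alive_le[OF ab(2), of t] that ab by auto
  have Fc: "continuous_on {a..b} F" using al by (intro continuous_on_subset[OF F_continuous]) auto
  have "continuous_on ({a..b} \<times> Y) (\<lambda>p. F (fst p))"
    by (rule continuous_on_compose2[OF Fc]) (auto intro: continuous_intros)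
  then have c: "continuous_on ({a..b} \<times> Y) (\<lambda>p. (fst p, max (F (fst p)) (snd p)))" by (intro continuous_intros)
  have "(\<lambda>p. (fst p, max (F (fst p)) (snd p))) ` ({a..b} \<times> Y) \<subseteq> above_curve l f"
    using al ab by (auto simp: above_iff)
  from continuous_on_compose2[OF u c this] show ?thesis by (simp add: case_prod_beta)
qed

lemma Hb_continuous:
  assumes ab: "0 < a" "alive b"
  shows "continuous_on ({a..b} \<times> Y) (\<lambda>(t, y). Hb t y)"
proof -
  have "alive t" if "t \<in> {a..b}" for t using alive_le[OF ab(2), of t] that ab by auto
  then show ?thesis using maxed_continuous[OF H_continuous(1) ab, of Y]
    by (subst continuous_on_cong[OF refl, of _ _ "\<lambda>(t, y). H t (max (F t) y)"]) (auto simp: Hb_eq_max)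
qed

text \<open>Above the curve this is the chain rule. On and below it \<open>Hb\<close> is 0, hence
  less than \<open>\<epsilon>\<close> nearby by continuity, so the composition is locally zero; the
  factor \<open>chi1\<close> is zero there too, and the values of \<open>ht\<close> and
  \<open>hy\<close> at the projected point do not matter.\<close>

lemma chi_Hb_derivs:
  assumes ab: "0 < a" "alive b" and t: "t \<in> {a..b}" and e: "0 < \<epsilon>"
  shows "((\<lambda>r. chi \<epsilon> (Hb r y)) has_real_derivative chi1 \<epsilon> (Hb t y) * ht t (max (F t) y)) (at t within {a..b})"
    "((\<lambda>z. chi \<epsilon> (Hb t z)) has_real_derivative chi1 \<epsilon> (Hb t y) * hy t (max (F t) y)) (at y within S)"
proof -
  have al: "alive r" if "r \<in> {a..b}" for r using alive_le[OF ab(2), of r] that ab by auto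
  have t0: "0 < t" using t ab by simp
  have Fc: "continuous_on {a..b} F" using al by (intro continuous_on_subset[OF F_continuous]) auto
  note Hc = Hb_continuous[OF ab, of UNIV]
  have c1: "continuous_on {a..b} (\<lambda>r. Hb r y)"
  proof -
    have "continuous_on {a..b} (\<lambda>r. (r, y))" by (intro continuous_intros)
    from continuous_on_compose2[OF Hc this] show ?thesis by auto
  qed
  have c2: "continuous_on UNIV (Hb t)" using continuous_on_section[OF Hc t] .
  show "((\<lambda>r. chi \<epsilon> (Hb r y)) has_real_derivative chi1 \<epsilon> (Hb t y) * ht t (max (F t) y)) (at t within {a..b})"
  proof (cases "F t < y")
    case True
    have "(F \<longlongrightarrow> F t) (at t within {a..b})" using Fc t unfolding continuous_on_def by blast
    then have "\<forall>\<^sub>F r in at t within {a..b}. F r < y" using True by (rule order_tendstoD(2))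
    then have ev: "\<forall>\<^sub>F r in at t within {a..b}. chi \<epsilon> (Hb r y) = chi \<epsilon> (H r y)" by eventually_elim (simp add: Hb_def)
    have "((\<lambda>r. chi \<epsilon> (H r y)) has_real_derivative chi1 \<epsilon> (H t y) * ht t y) (at t within {a..b})"
      by (rule DERIV_chain'[OF has_field_derivative_at_within[OF interior_derivs(1)[OF al[OF t] t0 True]] chi_derivative[OF e]])
    then show ?thesis using True has_field_derivative_cong_eventually[OF ev] by (simp add: Hb_def)
  next
    case False
    then have z: "Hb t y = 0" by (simp add: Hb_def)
    have "((\<lambda>r. Hb r y) \<longlongrightarrow> 0) (at t within {a..b})" using c1 t z unfolding continuous_on_def by force
    then have "\<forall>\<^sub>F r in at t within {a..b}. Hb r y < \<epsilon>" using e by (rule order_tendstoD(2))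
    then have ev: "\<forall>\<^sub>F r in at t within {a..b}. chi \<epsilon> (Hb r y) = 0" by eventually_elim (simp add: chi_small(1)[OF e])
    show ?thesis using has_field_derivative_cong_eventually[OF ev] z chi_small[OF e, of 0] e by simp
  qed
  show "((\<lambda>z. chi \<epsilon> (Hb t z)) has_real_derivative chi1 \<epsilon> (Hb t y) * hy t (max (F t) y)) (at y within S)"
  proof (cases "F t < y")
    case True
    have "\<forall>\<^sub>F z in nhds y. z \<in> {F t<..}" using True by (intro eventually_nhds_in_open) auto
    then have "\<forall>\<^sub>F z in nhds y. chi \<epsilon> (Hb t z) = chi \<epsilon> (H t z)" by eventually_elim (simp add: Hb_def)
    then have ev: "\<forall>\<^sub>F z in at y within S. chi \<epsilon> (Hb t z) = chi \<epsilon> (H t z)"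
      unfolding eventually_at_filter by eventually_elim simp
    have "((\<lambda>z. chi \<epsilon> (H t z)) has_real_derivative chi1 \<epsilon> (H t y) * hy t y) (at y within S)"
      by (rule DERIV_chain'[OF has_field_derivative_at_within[OF interior_derivs(2)[OF al[OF t] t0 True]] chi_derivative[OF e]])
    then show ?thesis using True has_field_derivative_cong_eventually[OF ev] by (simp add: Hb_def)
  next
    case False
    then have z: "Hb t y = 0" by (simp add: Hb_def)
    have "(Hb t \<longlongrightarrow> Hb t y) (at y within S)"
      using continuous_on_subset[OF c2 subset_UNIV, of "insert y S"] unfolding continuous_on_def by (auto intro: tendsto_within_subset)
    then have "\<forall>\<^sub>F r in at y within S. Hb t r < \<epsilon>" using e unfolding z by (rule order_tendstoD(2))
    then have ev: "\<forall>\<^sub>F r in at y within S. chi \<epsilon> (Hb t r) = 0" by eventually_elim (simp add: chi_small(1)[OF e])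
    show ?thesis using has_field_derivative_cong_eventually[OF ev] z chi_small[OF e, of 0] e by simp
  qed
qed

section \<open>The boundary term at the curve and the mass near it\<close>

definition curve_density :: "real \<Rightarrow> real \<Rightarrow> real" where
  "curve_density x t = hy t (F t) * q t (F t) x / deriv s (F t)"

text \<open>Write \<open>\<psi>\<close> for \<open>1 - step (y - K)\<close>. The function
  \<open>A = \<psi> * (hy / s') * q\<close> is zero at \<open>K + 1\<close> and equals the density
  on the curve. Adding its derivative to the integrand cancels every term with
  \<open>\<psi>\<close>, by the backward equation, and leaves minus the integrand of the
  flux.\<close>

lemma curve_boundary_term:
  assumes x: "l < ereal x" and t: "alive t" "0 < t" and L: "l < ereal L" "L < F t" and K: "F t \<le> K"
  shows "integral {L..K + 1} (\<lambda>y. if F t < y then (1 - step (y - K)) * ht t y * q t y x * \<rho> y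
      - (- step1 (y - K) * H t y + (1 - step (y - K)) * hy t y) * (q_y t y x / deriv s y) else 0) = curve_density x t - flux K x t"
proof -
  define J where "J y = (1 - step (y - K)) * ht t y * q t y x * \<rho> y
      - (- step1 (y - K) * H t y + (1 - step (y - K)) * hy t y) * (q_y t y x / deriv s y)" for y
  have lF: "l < ereal (F t)" using alive_f(2)[OF t(1)] .
  have FR: "F t \<le> K + 1" using K by simp
  have b: "{t..t} \<times> {F t..K + 1} \<subseteq> above_curve l f" using box_above[OF t(2,1), of "F t"] by auto
  have tt: "t \<in> {t..t}" by simp
  note c = continuous_on_section[OF box_continuous(1)[OF b] tt] continuous_on_section[OF box_continuous(2)[OF b] tt] continuous_on_section[OF box_continuous(3)[OF b] tt]
  note ic = interval_continuity[OF lF, where R = "K + 1"]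
  note sc = step_shift_continuous[of "{F t..K + 1}" K]
  have qc: "continuous_on {F t..K + 1} (\<lambda>y. q t y x)" "continuous_on {F t..K + 1} (\<lambda>y. q_y t y x)"
    using continuous_on_section[OF q_continuous_box(1)[OF lF x, of "{t}"]] continuous_on_section[OF q_continuous_box(3)[OF lF x, of "{t}"]] t by auto
  note cont = c ic sc qc
  define A where "A y = (1 - step (y - K)) * (hy t y / deriv s y) * q t y x" for y
  define A' where "A' y = - step1 (y - K) * (hy t y / deriv s y) * q t y x - (1 - step (y - K)) * (\<rho> y * ht t y) * q t y x + (1 - step (y - K)) * (hy t y / deriv s y) * q_y t y x" for y
  have "(A' has_integral A (K + 1) - A (F t)) {F t..K + 1}"
  \<comment> \<open>The backward equation is known strictly above the curve; at the curve itself
    continuity of \<open>A\<close> suffices.\<close>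
  proof (rule fundamental_theorem_of_calculus_interior[OF FR])
    show "continuous_on {F t..K + 1} A" unfolding A_def[abs_def] using cont by (intro continuous_intros) auto
    fix y assume "y \<in> {F t<..<K + 1}"
    then have y: "F t < y" "l < ereal y" using l_less_trans[OF lF, of y] by auto
    have sp: "deriv s y \<noteq> 0" "\<rho> y \<noteq> 0" using scale_deriv_pos[OF y(2)] speed_density_pos[OF y(2)] by auto
    \<comment> \<open>The backward equation for \<open>H\<close> in divergence form, with the sign
      opposite to that for \<open>q\<close>.\<close>
    have hd: "((\<lambda>w. hy t w / deriv s w) has_real_derivative - (\<rho> y * ht t y)) (at y)"
    proof (rule DERIV_cong[OF DERIV_divide[OF interior_derivs(3)[OF t y(1)] scale_deriv_differentiable[OF y(2)] sp(1)]])
      have "ht t y = - space_generator y (hy t y) (hyy t y)" using backward_equation[OF t y(1)] by simp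
      then show "(hyy t y * deriv s y - hy t y * deriv (deriv s) y) / (deriv s y * deriv s y) = - (\<rho> y * ht t y)"
        using sp by (simp add: space_generator_def)
    qed
    have "(A has_real_derivative A' y) (at y)"
      unfolding A_def[abs_def]
      by (rule DERIV_cong[OF DERIV_mult[OF DERIV_mult[OF DERIV_diff[OF DERIV_const step_shift_derivs(1)] hd] q_derivs(2)[OF t(2) y(2) x]]])
        (simp add: A'_def algebra_simps)
    then show "(A has_vector_derivative A' y) (at y)" by (simp add: has_real_derivative_iff_has_vector_derivative)
  qed
  then have A': "integral {F t..K + 1} A' = - curve_density x t"
    by (simp add: integral_unique A_def curve_density_def step_eq K)
  have Jc: "J integrable_on {F t..K + 1}" unfolding J_def[abs_def]
    using cont by (intro integrable_continuous_interval continuous_intros) auto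
  have A'c: "A' integrable_on {F t..K + 1}" unfolding A'_def[abs_def]
    using cont by (intro integrable_continuous_interval continuous_intros) auto
  define G where "G y = step1 (y - K) * (hy t y * q t y x - H t y * q_y t y x) / deriv s y" for y
  have Gc: "continuous_on {F t..K + 1} G" unfolding G_def[abs_def] using cont by (intro continuous_intros) auto
  have Gi: "G integrable_on {F t..K + 1}" using Gc by (rule integrable_continuous_interval)
  have "integral {F t..K + 1} (\<lambda>y. J y + A' y) = integral {F t..K + 1} (\<lambda>y. - G y)"
    by (intro Henstock_Kurzweil_Integration.integral_cong) (simp add: J_def A'_def G_def algebra_simps diff_divide_distrib add_divide_distrib)
  then have JG: "integral {F t..K + 1} J = curve_density x t - integral {F t..K + 1} G"
    using A' Henstock_Kurzweil_Integration.integral_add[OF Jc A'c] by simp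
  have "integral {F t..K + 1} G = integral {F t..K} G + integral {K..K + 1} G"
    using Henstock_Kurzweil_Integration.integral_combine[OF K _ Gi] by simp
  also have "integral {F t..K} G = integral {F t..K} (\<lambda>y. 0)"
    by (intro Henstock_Kurzweil_Integration.integral_cong) (simp add: G_def step_eq)
  finally have GF: "integral {F t..K + 1} G = flux K x t" by (simp add: flux_def G_def[abs_def])
  \<comment> \<open>The integrand, extended by zero below the curve, differs from \<open>J\<close>
    on \<open>[F t, K + 1]\<close> at most at the single point \<open>F t\<close>.\<close>
  define Jz where "Jz y = (if F t < y then J y else 0)" for y
  have i1: "(Jz has_integral integral {F t..K + 1} J) {F t..K + 1}"
  proof (rule has_integral_spike[OF negligible_sing[of "F t"]])
    show "Jz y = J y" if "y \<in> {F t..K + 1} - {F t}" for y using that by (simp add: Jz_def)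
  qed (rule integrable_integral[OF Jc])
  have i0: "(Jz has_integral 0) {L..F t}" by (rule has_integral_is_0) (simp add: Jz_def)
  have "(Jz has_integral 0 + integral {F t..K + 1} J) {L..K + 1}"
    by (rule has_integral_combine[OF _ FR i0 i1]) (use L in simp)
  then have "integral {L..K + 1} Jz = curve_density x t - flux K x t" using JG GF by (simp add: integral_unique)
  then show ?thesis unfolding Jz_def J_def .
qed

text \<open>For \<open>chi (e n) (Hb t y)\<close> in place of \<open>Hb t y\<close> the integrands
  are \<open>C\<^sup>1\<close> in each variable on one fixed box, and Dynkin's formula is integrated
  over \<open>[a, b]\<close>. Then \<open>n\<close> tends to infinity by dominated convergence, in
  \<open>y\<close>, in \<open>t\<close> and in the two expectations at the ends; the limit of the
  space integrals is the boundary term at the curve.\<close>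

lemma near_identity:
  assumes x: "l < ereal x" and ab: "0 < a" "a \<le> b" "alive b" and FK: "\<And>t. t \<in> {a..b} \<Longrightarrow> F t \<le> K"
    and L: "l < ereal L" "\<And>t. t \<in> {a..b} \<Longrightarrow> L < F t"
  shows "((\<lambda>t. curve_density x t - flux K x t) has_integral
    (\<integral>\<omega>. (1 - step (\<omega> b - K)) * Hb b (\<omega> b) \<partial>P x) - (\<integral>\<omega>. (1 - step (\<omega> a - K)) * Hb a (\<omega> a) \<partial>P x)) {a..b}"
proof -
  define R where "R = K + 1"
  define \<psi> where "\<psi> y = 1 - step (y - K)" for y
  define e where "e n = 1 / real (Suc n)" for n
  have e: "0 < e n" for n by (simp add: e_def)
  have al: "alive r" if "r \<in> {a..b}" for r using alive_le[OF ab(3), of r] that ab by auto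
  have pos: "0 < r" if "r \<in> {a..b}" for r using that ab by auto
  have LR: "L \<le> R" using L(2)[of b] FK[of b] ab by (simp add: R_def)
  have U: "{a..b} \<subseteq> {0<..}" using ab by auto
  note ic = interval_continuity[OF L(1), where R = R]
  note snd = continuous_on_snd_only[of "{L..R}" _ "{a..b}"]
  have pc: "continuous_on {L..R} \<psi>" unfolding \<psi>_def[abs_def] by (intro continuous_intros step_shift_continuous)
  note cu = Hb_continuous[OF ab(1,3), of "{L..R}"] maxed_continuous[OF H_continuous(2) ab(1,3), of "{L..R}"] maxed_continuous[OF H_continuous(3) ab(1,3), of "{L..R}"]
    snd[OF pc] snd[OF step_shift_continuous(2)] snd[OF ic(1)] snd[OF ic(2)] q_continuous_box[OF L(1) x U, where R = R]
  have chic: "continuous_on ({a..b} \<times> {L..R}) (\<lambda>(t, y). chi (e n) (Hb t y))" "continuous_on ({a..b} \<times> {L..R}) (\<lambda>(t, y). chi1 (e n) (Hb t y))" for n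
    using continuous_on_compose2[OF chi_continuous(1)[OF e, of UNIV n] cu(1)] continuous_on_compose2[OF chi_continuous(2)[OF e, of UNIV n] cu(1)]
    by (auto simp: case_prod_beta)
  define g where "g n t y = \<psi> y * chi (e n) (Hb t y)" for n t y
  define gt where "gt n t y = \<psi> y * (chi1 (e n) (Hb t y) * ht t (max (F t) y))" for n t y
  define gy where "gy n t y = - step1 (y - K) * chi (e n) (Hb t y) + \<psi> y * (chi1 (e n) (Hb t y) * hy t (max (F t) y))" for n t y
  have gc: "continuous_on ({a..b} \<times> {L..R}) (\<lambda>(t, y). g n t y)" "continuous_on ({a..b} \<times> {L..R}) (\<lambda>(t, y). gt n t y)" "continuous_on ({a..b} \<times> {L..R}) (\<lambda>(t, y). gy n t y)" for n
    unfolding g_def gt_def gy_def case_prod_beta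
    by (intro continuous_on_add continuous_on_mult continuous_on_minus cu[unfolded case_prod_beta] chic[unfolded case_prod_beta])+
  define N where "N n t = integral {L..R} (\<lambda>y. g n t y * q t y x * \<rho> y)" for n t
  define W where "W n t y = gt n t y * q t y x * \<rho> y - gy n t y * (q_y t y x / deriv s y)" for n t y
  have Wc: "continuous_on ({a..b} \<times> {L..R}) (\<lambda>(t, y). W n t y)" for n
    unfolding W_def case_prod_beta using ic(4)
    by (intro continuous_on_diff continuous_on_mult continuous_on_divide cu[unfolded case_prod_beta] gc[unfolded case_prod_beta]) auto
  have ND: "(N n has_real_derivative integral {L..R} (W n t)) (at t within {a..b})" if t: "t \<in> {a..b}" for n t
    unfolding N_def[abs_def] W_def[abs_def]
  proof (rule dynkin_derivative[OF x _ U L(1) LR _ _ gc _ _ t])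
    fix v y assume v: "v \<in> {a..b}"
    note d = chi_Hb_derivs[OF ab(1,3) v e[of n]]
    show "((\<lambda>v. g n v y) has_real_derivative gt n v y) (at v within {a..b})"
      unfolding g_def gt_def by (rule DERIV_cmult[OF d(1)])
    have "(\<psi> has_real_derivative - step1 (y - K)) (at y within {L..R})"
      unfolding \<psi>_def[abs_def] by (rule DERIV_cong[OF DERIV_diff[OF DERIV_const step_shift_derivs(1)]]) simp
    then show "(g n v has_real_derivative gy n v y) (at y within {L..R})"
      unfolding g_def[abs_def] gy_def by (rule DERIV_cong[OF DERIV_mult[OF _ d(2)]]) simp
    show "g n v L = 0" using L(2)[OF v] chi_small(1)[OF e, of 0 n] e[of n] by (simp add: g_def Hb_def)
    show "g n v R = 0" by (simp add: g_def \<psi>_def R_def step_eq)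
  qed (rule convex_real_interval)
  have NI: "((\<lambda>t. integral {L..R} (W n t)) has_integral N n b - N n a) {a..b}" for n
    using ND by (intro fundamental_theorem_of_calculus[OF ab(2)]) (simp add: has_real_derivative_iff_has_vector_derivative)
  \<comment> \<open>A majorant that does not depend on \<open>n\<close>: the cutoff,
    \<open>chi\<close> and \<open>chi1\<close> are at most 1 on the range of \<open>Hb\<close>, and
    the remaining factors are continuous on a compact box.\<close>
  define B where "B t y = \<bar>ht t (max (F t) y)\<bar> * \<bar>q t y x\<bar> * \<bar>\<rho> y\<bar> + (\<bar>step1 (y - K)\<bar> + \<bar>hy t (max (F t) y)\<bar>) * \<bar>q_y t y x / deriv s y\<bar>" for t y
  have Bc: "continuous_on ({a..b} \<times> {L..R}) (\<lambda>(t, y). B t y)"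
    unfolding B_def case_prod_beta using ic(4)
    by (intro continuous_on_add continuous_on_mult continuous_on_rabs continuous_on_divide cu[unfolded case_prod_beta]) auto
  have "compact ({a..b} \<times> {L..R})" by (intro compact_Times) auto
  from compact_imp_bounded[OF compact_continuous_image[OF Bc this]]
  obtain M where M: "\<forall>p\<in>(\<lambda>(t, y). B t y) ` ({a..b} \<times> {L..R}). norm p \<le> M" unfolding bounded_iff by blast
  have pr: "0 \<le> \<psi> y" "\<psi> y \<le> 1" for y using step_range[of "y - K"] by (auto simp: \<psi>_def)
  have cb: "\<bar>\<psi> y * chi (e n) (Hb t y)\<bar> \<le> 1" "\<bar>\<psi> y * chi1 (e n) (Hb t y)\<bar> \<le> 1" "\<bar>chi (e n) (Hb t y)\<bar> \<le> 1" if "t \<in> {a..b}" for n t y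
  proof -
    have h: "0 \<le> Hb t y" "Hb t y \<le> 1" using Hb_range al[OF that] by auto
    note b = chi_bounds[OF e[of n] h(1)]
    show "\<bar>chi (e n) (Hb t y)\<bar> \<le> 1" using b h by simp
    then show "\<bar>\<psi> y * chi (e n) (Hb t y)\<bar> \<le> 1" using b pr[of y] by (simp add: abs_mult mult_le_one)
    show "\<bar>\<psi> y * chi1 (e n) (Hb t y)\<bar> \<le> 1" using b pr[of y] by (simp add: abs_mult mult_le_one)
  qed
  have WM: "\<bar>W n t y\<bar> \<le> M" if t: "t \<in> {a..b}" and y: "y \<in> {L..R}" for n t y
  proof -
    have "\<bar>gt n t y * q t y x * \<rho> y\<bar> \<le> \<bar>ht t (max (F t) y)\<bar> * \<bar>q t y x\<bar> * \<bar>\<rho> y\<bar>"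
    proof -
      have "\<bar>gt n t y\<bar> = \<bar>\<psi> y * chi1 (e n) (Hb t y)\<bar> * \<bar>ht t (max (F t) y)\<bar>" by (simp add: gt_def abs_mult)
      also have "\<dots> \<le> 1 * \<bar>ht t (max (F t) y)\<bar>" using cb(2)[OF t] by (intro mult_right_mono) auto
      finally show ?thesis unfolding abs_mult by (intro mult_right_mono) auto
    qed
    moreover have "\<bar>gy n t y * (q_y t y x / deriv s y)\<bar> \<le> (\<bar>step1 (y - K)\<bar> + \<bar>hy t (max (F t) y)\<bar>) * \<bar>q_y t y x / deriv s y\<bar>"
    proof -
      have "\<bar>gy n t y\<bar> \<le> \<bar>step1 (y - K)\<bar> * \<bar>chi (e n) (Hb t y)\<bar> + \<bar>\<psi> y * chi1 (e n) (Hb t y)\<bar> * \<bar>hy t (max (F t) y)\<bar>"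
        unfolding gy_def by (rule order_trans[OF abs_triangle_ineq]) (simp add: abs_mult)
      also have "\<dots> \<le> \<bar>step1 (y - K)\<bar> * 1 + 1 * \<bar>hy t (max (F t) y)\<bar>" using cb[OF t] by (intro add_mono mult_left_mono mult_right_mono) auto
      finally have "\<bar>gy n t y\<bar> \<le> \<bar>step1 (y - K)\<bar> + \<bar>hy t (max (F t) y)\<bar>" by simp
      then show ?thesis unfolding abs_mult by (intro mult_right_mono) auto
    qed
    ultimately have "\<bar>W n t y\<bar> \<le> B t y" unfolding W_def B_def by linarith
    also have "\<dots> \<le> M" using M t y by force
    finally show ?thesis .
  qed
  have Wi: "W n t integrable_on {L..R}" if t: "t \<in> {a..b}" for n t
    using continuous_on_section[OF Wc t] by (rule integrable_continuous_interval)
  have Wlim: "(\<lambda>n. integral {L..R} (W n t)) \<longlonglongrightarrow> curve_density x t - flux K x t" if t: "t \<in> {a..b}" for t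
  proof -
    define J where "J y = (if F t < y then (1 - step (y - K)) * ht t y * q t y x * \<rho> y
      - (- step1 (y - K) * H t y + (1 - step (y - K)) * hy t y) * (q_y t y x / deriv s y) else 0)" for y
    have pw: "(\<lambda>n. W n t y) \<longlonglongrightarrow> J y" for y
    proof -
      have h: "0 \<le> Hb t y" using Hb_range(1)[OF al[OF t]] .
      note lim = chi_limit[OF h, folded e_def]
      define k where "k = (if 0 < Hb t y then 1 else 0 :: real)"
      have "(\<lambda>n. W n t y) \<longlonglongrightarrow> \<psi> y * (k * ht t (max (F t) y)) * q t y x * \<rho> y
        - (- step1 (y - K) * Hb t y + \<psi> y * (k * hy t (max (F t) y))) * (q_y t y x / deriv s y)"
        unfolding W_def gt_def gy_def k_def by (intro tendsto_intros lim)
      also have "\<psi> y * (k * ht t (max (F t) y)) * q t y x * \<rho> y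
        - (- step1 (y - K) * Hb t y + \<psi> y * (k * hy t (max (F t) y))) * (q_y t y x / deriv s y) = J y"
      proof (cases "F t < y")
        case True
        \<comment> \<open>Where \<open>H\<close> vanishes above the curve the limit factor
          \<open>k\<close> is 0 instead of 1, but both derivatives vanish there as well.\<close>
        have "k = 1 \<or> (ht t y = 0 \<and> hy t y = 0)"
        proof (cases "H t y = 0")
          case True
          then show ?thesis using zero_interior[OF al[OF t] pos[OF t] \<open>F t < y\<close>] by simp
        next
          case False
          then show ?thesis using h \<open>F t < y\<close> by (simp add: k_def Hb_def)
        qed
        then show ?thesis using True by (auto simp: J_def \<psi>_def Hb_def max_def)
      next
        case False
        then show ?thesis by (simp add: J_def k_def Hb_def)
      qed
      finally show ?thesis .
    qed
    have "(\<lambda>n. integral {L..R} (W n t)) \<longlonglongrightarrow> integral {L..R} J"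
      by (rule dominated_convergence(2)[where h = "\<lambda>_. M"]) (use Wi[OF t] WM[OF t] pw in auto)
    also have "integral {L..R} J = curve_density x t - flux K x t"
      unfolding J_def R_def by (rule curve_boundary_term[OF x al[OF t] pos[OF t] L(1) L(2)[OF t] FK[OF t]])
    finally show ?thesis .
  qed
  have IM: "norm (integral {L..R} (W n t)) \<le> M * (R - L)" if t: "t \<in> {a..b}" for n t
    using WM[OF t] continuous_on_section[OF Wc t] by (intro integral_bound LR) auto
  have Ilim: "(\<lambda>t. curve_density x t - flux K x t) integrable_on {a..b}"
    "(\<lambda>n. integral {a..b} (\<lambda>t. integral {L..R} (W n t))) \<longlonglongrightarrow> integral {a..b} (\<lambda>t. curve_density x t - flux K x t)"
    using dominated_convergence[where f = "\<lambda>n t. integral {L..R} (W n t)" and h = "\<lambda>_. M * (R - L)" and S = "{a..b}" and g = "\<lambda>t. curve_density x t - flux K x t"]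
      NI[THEN has_integral_integrable] IM Wlim by auto
  have Nlim: "(\<lambda>n. N n t) \<longlonglongrightarrow> (\<integral>\<omega>. (1 - step (\<omega> t - K)) * Hb t (\<omega> t) \<partial>P x)" if t: "t \<in> {a..b}" for t
  proof -
    have qs: "continuous_on {L..R} (\<lambda>y. q t y x)" using continuous_on_section[OF cu(8) t] by simp
    have Hs: "continuous_on {L..R} (Hb t)" using continuous_on_section[OF cu(1) t] .
    have ps: "continuous_on {L..R} (\<lambda>y. \<psi> y * Hb t y)" using pc Hs by (intro continuous_intros)
    have qb: "continuous_on {L..R} (\<lambda>y. \<bar>q t y x * \<rho> y\<bar>)" using qs ic(1) by (intro continuous_intros)
    have "(\<lambda>n. N n t) \<longlonglongrightarrow> integral {L..R} (\<lambda>y. \<psi> y * Hb t y * q t y x * \<rho> y)"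
      unfolding N_def
    proof (rule dominated_convergence(2)[where h = "\<lambda>y. \<bar>q t y x * \<rho> y\<bar>"])
      show "(\<lambda>y. g n t y * q t y x * \<rho> y) integrable_on {L..R}" for n
        using continuous_on_section[OF gc(1)[of n] t] qs ic(1) by (intro integrable_continuous_interval continuous_intros)
      show "(\<lambda>y. \<bar>q t y x * \<rho> y\<bar>) integrable_on {L..R}" using qb by (rule integrable_continuous_interval)
      show "norm (g n t y * q t y x * \<rho> y) \<le> \<bar>q t y x * \<rho> y\<bar>" for n y
      proof -
        have "\<bar>g n t y\<bar> * \<bar>q t y x * \<rho> y\<bar> \<le> 1 * \<bar>q t y x * \<rho> y\<bar>" unfolding g_def using cb(1)[OF t] by (intro mult_right_mono) auto
        then show ?thesis by (simp add: abs_mult mult.assoc)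
      qed
      show "(\<lambda>n. g n t y * q t y x * \<rho> y) \<longlonglongrightarrow> \<psi> y * Hb t y * q t y x * \<rho> y" for y
        unfolding g_def using chi_limit(1)[OF Hb_range(1)[OF al[OF t]], folded e_def] by (intro tendsto_intros)
    qed
    also have "integral {L..R} (\<lambda>y. \<psi> y * Hb t y * q t y x * \<rho> y) = (\<integral>\<omega>. \<psi> (\<omega> t) * Hb t (\<omega> t) \<partial>P x)"
    proof (rule expectation_density[OF x pos[OF t] L(1) ps, symmetric])
      fix y assume "y \<notin> {L..R}"
      then consider "y < F t" | "K + 1 \<le> y" using L(2)[OF t] by (auto simp: R_def)
      then show "\<psi> y * Hb t y = 0" by cases (auto simp: Hb_def \<psi>_def step_eq)
    qed
    finally show ?thesis unfolding \<psi>_def .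
  qed
  have "(\<lambda>n. N n b - N n a) \<longlonglongrightarrow> (\<integral>\<omega>. (1 - step (\<omega> b - K)) * Hb b (\<omega> b) \<partial>P x) - (\<integral>\<omega>. (1 - step (\<omega> a - K)) * Hb a (\<omega> a) \<partial>P x)"
    using Nlim[of b] Nlim[of a] ab by (intro tendsto_diff) auto
  moreover have "(\<lambda>n. N n b - N n a) \<longlonglongrightarrow> integral {a..b} (\<lambda>t. curve_density x t - flux K x t)"
    using Ilim(2) by (simp add: integral_unique[OF NI])
  ultimately have "(\<integral>\<omega>. (1 - step (\<omega> b - K)) * Hb b (\<omega> b) \<partial>P x) - (\<integral>\<omega>. (1 - step (\<omega> a - K)) * Hb a (\<omega> a) \<partial>P x) = integral {a..b} (\<lambda>t. curve_density x t - flux K x t)"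
    by (rule LIMSEQ_unique)
  then show ?thesis using integrable_integral[OF Ilim(1)] by simp
qed

end

section \<open>Propagation of zeros\<close>

context linear_diffusion
begin

text \<open>On a compact set \<open>s'\<close> is bounded between positive constants and
  \<open>\<rho>\<close> is bounded. The scale then gives each end of
  \<open>[y - \<eta>, y + \<eta>]\<close> an exit probability of at least \<open>c0\<close>, the
  speed gives a mean exit time \<open>O(\<eta>\<^sup>2)\<close>, and Markov's inequality makes a
  longer exit less likely than the chosen side.\<close>

lemma quick_exit:
  assumes A: "l < ereal A'" "A' < A" "A \<le> B"
  shows "\<exists>C>0. \<exists>r0>0. \<forall>\<eta> y \<sigma>. 0 < \<eta> \<longrightarrow> \<eta> \<le> r0 \<longrightarrow> y \<in> {A..B} \<longrightarrow> \<sigma> = 1 \<or> \<sigma> = - 1 \<longrightarrow>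
    0 < measure (P y) {\<omega> \<in> space (path_space E). hitting_time (y + \<sigma> * \<eta>) \<omega> < hitting_time (y - \<sigma> * \<eta>) \<omega> \<and> hitting_time (y + \<sigma> * \<eta>) \<omega> < ennreal (C * \<eta>\<^sup>2)}"
proof -
  define B' where "B' = B + 1"
  define r0 where "r0 = min 1 (A - A')"
  have r0: "0 < r0" using A by (simp add: r0_def)
  have ne: "{A'..B'} \<noteq> {}" using A by (simp add: B'_def)
  note ic = interval_continuity[OF A(1), where R = B']
  have lI: "l < ereal w" if "w \<in> {A'..B'}" for w using l_less_trans[OF A(1), of w] that by simp
  obtain w1 where w1: "w1 \<in> {A'..B'}" "\<And>w. w \<in> {A'..B'} \<Longrightarrow> deriv s w1 \<le> deriv s w"
    using continuous_attains_inf[OF compact_Icc ne ic(2)] by blast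
  obtain w2 where w2: "w2 \<in> {A'..B'}" "\<And>w. w \<in> {A'..B'} \<Longrightarrow> deriv s w \<le> deriv s w2"
    using continuous_attains_sup[OF compact_Icc ne ic(2)] by blast
  obtain w3 where w3: "w3 \<in> {A'..B'}" "\<And>w. w \<in> {A'..B'} \<Longrightarrow> \<rho> w \<le> \<rho> w3"
    using continuous_attains_sup[OF compact_Icc ne ic(1)] by blast
  define m where "m = deriv s w1"
  define M where "M = deriv s w2"
  define R where "R = \<rho> w3"
  have pos: "0 < m" "0 < M" "0 < R" using scale_deriv_pos speed_density_pos lI w1(1) w2(1) w3(1) by (auto simp: m_def M_def R_def)
  have ds: "m * (v - u) \<le> s v - s u" "s v - s u \<le> M * (v - u)" if uv: "u \<in> {A'..B'}" "v \<in> {A'..B'}" "u < v" for u v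
  proof -
    have "\<exists>z. u < z \<and> z < v \<and> s v - s u = (v - u) * deriv s z"
      using uv by (intro MVT2 scale_differentiable lI) auto
    then obtain z where z: "u < z" "z < v" "s v - s u = (v - u) * deriv s z" by blast
    then have "m \<le> deriv s z" "deriv s z \<le> M" using w1(2) w2(2) uv by (auto simp: m_def M_def)
    then show "m * (v - u) \<le> s v - s u" "s v - s u \<le> M * (v - u)" using z uv by (auto simp: mult.commute)
  qed
  define c0 where "c0 = m / (2 * M)"
  \<comment> \<open>The mean exit time is at most \<open>4 * M * R * \<eta>\<^sup>2\<close>, which
    is \<open>c0 / 4\<close> times \<open>C * \<eta>\<^sup>2\<close>; so late exits have probability
    at most \<open>c0 / 4\<close>.\<close>
  define C where "C = 16 * M * R / c0"
  have c0: "0 < c0" and C: "0 < C" using pos by (auto simp: c0_def C_def)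
  have main: "0 < measure (P y) {\<omega> \<in> space (path_space E). hitting_time (y + \<sigma> * \<eta>) \<omega> < hitting_time (y - \<sigma> * \<eta>) \<omega> \<and> hitting_time (y + \<sigma> * \<eta>) \<omega> < ennreal (C * \<eta>\<^sup>2)}"
    if h: "0 < \<eta>" "\<eta> \<le> r0" and y: "y \<in> {A..B}" and sg: "\<sigma> = 1 \<or> \<sigma> = - 1" for \<eta> y \<sigma>
  proof -
    define a where "a = y - \<eta>"
    define b where "b = y + \<eta>"
    have ab: "a \<in> {A'..B'}" "b \<in> {A'..B'}" "y \<in> {A'..B'}" "a < y" "y < b" "a < b"
      using h y A by (auto simp: a_def b_def r0_def B'_def)
    have la: "l < ereal a" "l < ereal y" using lI ab by auto
    have yE: "y \<in> E" using in_E la by auto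
    interpret prob_space "P y" by (rule P_prob_space[OF yE])
    have sab: "s b - s a \<le> 2 * M * \<eta>" "0 < s b - s a" "m * \<eta> \<le> s y - s a" "m * \<eta> \<le> s b - s y"
      using ds(2)[OF ab(1,2,6)] ds(1)[OF ab(1,3,4)] ds(1)[OF ab(3,2,5)] scale_less[OF la(1) ab(6)] by (auto simp: a_def b_def)
    have quot: "c0 \<le> d / (s b - s a)" if "m * \<eta> \<le> d" for d
    proof -
      have "c0 * (s b - s a) \<le> c0 * (2 * M * \<eta>)" using sab c0 by (intro mult_left_mono) auto
      also have "\<dots> = m * \<eta>" using pos by (simp add: c0_def)
      finally show ?thesis using that sab(2) by (simp add: pos_le_divide_eq)
    qed
    let ?S1 = "{\<omega> \<in> space (path_space E). hitting_time b \<omega> < hitting_time a \<omega>}"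
    let ?N = "{\<omega> \<in> space (path_space E). ennreal (C * \<eta>\<^sup>2) \<le> min (hitting_time a \<omega>) (hitting_time b \<omega>)}"
    have S1: "?S1 \<in> events" and N: "?N \<in> events" unfolding sets_P[OF yE] by measurable
    have p: "prob ?S1 = (s y - s a) / (s b - s a)" using scale[OF la(1) ab(4,5)] space_P[OF yE] by simp
    have p1: "c0 \<le> prob ?S1" unfolding p using quot sab by blast
    have "1 - prob ?S1 = (s b - s y) / (s b - s a)" unfolding p using sab(2) by (simp add: field_simps)
    then have p2: "c0 \<le> 1 - prob ?S1" using quot sab by simp
    have Ce: "0 < C * \<eta>\<^sup>2" using C h by simp
    have "ennreal (C * \<eta>\<^sup>2) * emeasure (P y) ?N = (\<integral>\<^sup>+\<omega>. ennreal (C * \<eta>\<^sup>2) * indicator ?N \<omega> \<partial>P y)"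
      using N by (simp add: nn_integral_cmult_indicator)
    also have "\<dots> \<le> (\<integral>\<^sup>+\<omega>. min (hitting_time a \<omega>) (hitting_time b \<omega>) \<partial>P y)"
      by (intro nn_integral_mono) (auto simp: indicator_def)
    also have "\<dots> = (\<integral>\<^sup>+w\<in>{a<..<b}. ennreal (green_function s a b y w * \<rho> w) \<partial>lborel)" by (rule speed[OF la(1) ab(4,5)])
    also have "\<dots> \<le> (\<integral>\<^sup>+w\<in>{a<..<b}. ennreal (2 * M * \<eta> * R) \<partial>lborel)"
    proof (rule nn_integral_mono)
      fix w
      have "green_function s a b y w * \<rho> w \<le> 2 * M * \<eta> * R" if w: "w \<in> {a<..<b}"
      proof (rule mult_mono)
        show "green_function s a b y w \<le> 2 * M * \<eta>" using green_bounds(2)[OF la(1) ab(6), of y w] sab(1) w ab by auto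
        show "\<rho> w \<le> R" using w3(2)[of w] w ab by (auto simp: R_def)
        show "0 \<le> 2 * M * \<eta>" using pos h by simp
        show "0 \<le> \<rho> w" using speed_density_pos[of w] l_less_trans[OF la(1), of w] w by simp
      qed
      then show "ennreal (green_function s a b y w * \<rho> w) * indicator {a<..<b} w \<le> ennreal (2 * M * \<eta> * R) * indicator {a<..<b} w"
        by (auto simp: indicator_def intro!: ennreal_leI)
    qed
    also have "\<dots> = ennreal (2 * M * \<eta> * R) * ennreal (2 * \<eta>)"
      using ab by (simp add: nn_integral_cmult_indicator a_def b_def)
    also have "\<dots> = ennreal (c0 / 4 * (C * \<eta>\<^sup>2))"
      using pos h c0 by (simp add: ennreal_mult[symmetric] C_def power2_eq_square)
    finally have "ennreal (C * \<eta>\<^sup>2 * prob ?N) \<le> ennreal (c0 / 4 * (C * \<eta>\<^sup>2))"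
      using Ce by (simp add: emeasure_eq_measure ennreal_mult)
    then have "C * \<eta>\<^sup>2 * prob ?N \<le> C * \<eta>\<^sup>2 * (c0 / 4)"
      using Ce c0 by (subst (asm) ennreal_le_iff) (auto simp: mult.commute)
    then have pN: "prob ?N \<le> c0 / 4" using Ce by (simp only: mult_le_cancel_left_pos)
    let ?W = "{\<omega> \<in> space (path_space E). hitting_time (y + \<sigma> * \<eta>) \<omega> < hitting_time (y - \<sigma> * \<eta>) \<omega> \<and> hitting_time (y + \<sigma> * \<eta>) \<omega> < ennreal (C * \<eta>\<^sup>2)}"
    have W: "?W \<in> events" unfolding sets_P[OF yE] by measurable
    show ?thesis
      using sg
    proof
      assume s1: "\<sigma> = 1"
      have "?S1 - ?N \<subseteq> ?W" unfolding s1 by (auto simp: a_def b_def min_def not_le split: if_splits)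
      then have "prob (?S1 - ?N) \<le> prob ?W" using W by (rule finite_measure_mono)
      moreover have "prob ?S1 \<le> prob ((?S1 - ?N) \<union> ?N)" using S1 N by (intro finite_measure_mono) auto
      moreover have "prob ((?S1 - ?N) \<union> ?N) \<le> prob (?S1 - ?N) + prob ?N" using S1 N by (intro measure_Un_le) auto
      ultimately show ?thesis using p1 pN c0 by linarith
    next
      assume s1: "\<sigma> = - 1"
      have "(space (P y) - ?S1) - ?N \<subseteq> ?W"
      proof
        fix \<omega> assume w: "\<omega> \<in> (space (P y) - ?S1) - ?N"
        then have wp: "\<omega> \<in> space (path_space E)" using space_P[OF yE] by simp
        have le: "hitting_time a \<omega> \<le> hitting_time b \<omega>" and lt: "min (hitting_time a \<omega>) (hitting_time b \<omega>) < ennreal (C * \<eta>\<^sup>2)"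
          using w wp by (auto simp: not_less not_le)
        then have lt': "hitting_time a \<omega> < ennreal (C * \<eta>\<^sup>2)" by (simp add: min_def)
        then have fin: "hitting_time a \<omega> < \<infinity>" unfolding infinity_ennreal_def by (rule less_trans[OF _ ennreal_less_top])
        \<comment> \<open>The complement of \<open>?S1\<close> allows equal hitting times; a finite
          tie would put the path at \<open>a\<close> and \<open>b\<close> at once.\<close>
        have "hitting_time a \<omega> \<noteq> hitting_time b \<omega>"
        proof
          assume e: "hitting_time a \<omega> = hitting_time b \<omega>"
          have "\<omega> (enn2real (hitting_time b \<omega>)) = b" using fin e by (intro hitting_time_attained(1)[OF wp]) simp
          then show False using hitting_time_attained(1)[OF wp fin] e ab by simp
        qed
        then show "\<omega> \<in> ?W" using le lt' wp unfolding s1 by (simp add: a_def b_def)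
      qed
      then have "prob ((space (P y) - ?S1) - ?N) \<le> prob ?W" using W by (rule finite_measure_mono)
      moreover have "prob (space (P y) - ?S1) \<le> prob (((space (P y) - ?S1) - ?N) \<union> ?N)" using S1 N by (intro finite_measure_mono) auto
      moreover have "prob (((space (P y) - ?S1) - ?N) \<union> ?N) \<le> prob ((space (P y) - ?S1) - ?N) + prob ?N" using S1 N by (intro measure_Un_le) auto
      moreover have "prob (space (P y) - ?S1) = 1 - prob ?S1" using S1 by (rule prob_compl)
      ultimately show ?thesis using p2 pN c0 by linarith
    qed
  qed
  then show ?thesis using C r0 by blast
qed

end

context curve_diffusion
begin

text \<open>A path from \<open>y\<close> that leaves \<open>[y - \<eta>, y + \<eta>]\<close> quickly
  on the chosen side stays above the curve until then. Shortly before the exit it is at distance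
  between \<open>\<eta> / 2\<close> and \<open>\<eta>\<close> on that side. Avoiding the curve from
  then on would mean avoiding it from \<open>t\<close> on, which has probability
  \<open>H t y = 0\<close>; so \<open>H\<close> vanishes at some such later position. The argument
  is purely probabilistic and includes \<open>t = 0\<close>, where nothing is assumed about
  derivatives of \<open>H\<close>.\<close>

lemma zero_step:
  assumes A: "l < ereal A'" "A' < A" "A \<le> B"
  shows "\<exists>C>0. \<exists>r0>0. \<forall>\<eta> t y \<sigma>. 0 < \<eta> \<longrightarrow> \<eta> \<le> r0 \<longrightarrow> y \<in> {A..B} \<longrightarrow> \<sigma> = 1 \<or> \<sigma> = - 1 \<longrightarrow>
    alive t \<longrightarrow> alive (t + C * \<eta>\<^sup>2) \<longrightarrow> (\<forall>u\<in>{t..t + C * \<eta>\<^sup>2}. F u < y - \<eta>) \<longrightarrow> H t y = 0 \<longrightarrow>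
    (\<exists>u z. 0 < u \<and> u < C * \<eta>\<^sup>2 \<and> \<eta> / 2 \<le> \<sigma> * (z - y) \<and> \<sigma> * (z - y) \<le> \<eta> \<and> H (t + u) z = 0)"
proof -
  obtain C r0 where C: "0 < C" "0 < r0" "\<And>\<eta> y \<sigma>. 0 < \<eta> \<Longrightarrow> \<eta> \<le> r0 \<Longrightarrow> y \<in> {A..B} \<Longrightarrow> \<sigma> = 1 \<or> \<sigma> = - 1 \<Longrightarrow>
    0 < measure (P y) {\<omega> \<in> space (path_space E). hitting_time (y + \<sigma> * \<eta>) \<omega> < hitting_time (y - \<sigma> * \<eta>) \<omega> \<and> hitting_time (y + \<sigma> * \<eta>) \<omega> < ennreal (C * \<eta>\<^sup>2)}"
    using quick_exit[OF A] by blast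
  have main: "\<exists>u z. 0 < u \<and> u < C * \<eta>\<^sup>2 \<and> \<eta> / 2 \<le> \<sigma> * (z - y) \<and> \<sigma> * (z - y) \<le> \<eta> \<and> H (t + u) z = 0"
    if h: "0 < \<eta>" "\<eta> \<le> r0" and y: "y \<in> {A..B}" and sg: "\<sigma> = 1 \<or> \<sigma> = - 1"
      and t: "alive t" "alive (t + C * \<eta>\<^sup>2)" and Fb: "\<forall>u\<in>{t..t + C * \<eta>\<^sup>2}. F u < y - \<eta>" and H0: "H t y = 0" for \<eta> t y \<sigma>
  proof -
    define \<epsilon> where "\<epsilon> = C * \<eta>\<^sup>2"
    have e: "0 < \<epsilon>" using C h by (simp add: \<epsilon>_def)
    have yE: "y \<in> E" using in_E l_less_trans[OF A(1), of y] y A by auto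
    interpret prob_space "P y" by (rule P_prob_space[OF yE])
    define a where "a = y - \<sigma> * \<eta>"
    define b where "b = y + \<sigma> * \<eta>"
    define W where "W = {\<omega> \<in> space (path_space E). hitting_time b \<omega> < hitting_time a \<omega> \<and> hitting_time b \<omega> < ennreal \<epsilon>}"
    have W: "0 < prob W" using C(3)[OF h y sg] by (simp add: W_def a_def b_def \<epsilon>_def)
    \<comment> \<open>The Markov property is used at fixed times, so the exit time is replaced by a
      rational time just before it. \<open>Q u\<close> collects the paths that are far enough on the
      chosen side at time \<open>u\<close> and have not met the curve.\<close>
    define Q where "Q u = {\<omega> \<in> space (path_space E). \<omega> u \<in> {w. \<eta> / 2 \<le> \<sigma> * (w - y) \<and> \<sigma> * (w - y) \<le> \<eta>}} -
      {\<omega> \<in> space (path_space E). \<exists>r\<in>{0..u}. \<omega> r = F (t + r)}" for u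
    define D where "D = {u \<in> \<rat>. 0 < u \<and> u < \<epsilon>}"
    have cD: "countable D" unfolding D_def using countable_rat by (rule countable_subset[rotated]) auto
    have QF: "Q u \<in> sets (path_filtration E u)" if u: "u \<in> D" for u
    proof -
      have "closed {w. \<eta> / 2 \<le> \<sigma> * (w - y) \<and> \<sigma> * (w - y) \<le> \<eta>}"
        by (intro closed_Collect_conj closed_Collect_le continuous_intros)
      moreover have "continuous_on {0..u} (\<lambda>r. F (t + r))"
      proof (rule continuous_on_compose2[OF F_continuous])
        show "continuous_on {0..u} (\<lambda>r. t + r)" by (intro continuous_intros)
        show "(\<lambda>r. t + r) ` {0..u} \<subseteq> {t. alive t}" using u alive_le[OF t(2)] alive_nonneg[OF t(1)] by (auto simp: D_def \<epsilon>_def)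
      qed
      ultimately show ?thesis unfolding Q_def using u
        by (intro sets.Diff coordinate_in_filtration curve_hit_in_filtration) (auto simp: D_def)
    qed
    have Qs: "Q u \<in> events" if "u \<in> D" for u using QF[OF that] path_filtration_subset sets_P[OF yE] by auto
    have sq: "\<sigma> * \<sigma> = 1" using sg by auto
    have cover: "AE \<omega> in P y. \<omega> \<in> W \<longrightarrow> \<omega> \<in> (\<Union>u\<in>D. Q u)"
      using start_AE[OF yE]
    proof (eventually_elim, intro impI)
      fix \<omega> assume w: "\<omega> \<in> space (path_space E) \<and> \<omega> 0 = y" and "\<omega> \<in> W"
      then have lt: "hitting_time b \<omega> < hitting_time a \<omega>" "hitting_time b \<omega> < ennreal \<epsilon>" by (auto simp: W_def)
      note wp = conjunct1[OF w]
      have fin: "hitting_time b \<omega> < \<infinity>" using lt(2) unfolding infinity_ennreal_def by (rule less_trans[OF _ ennreal_less_top])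
      define T where "T = enn2real (hitting_time b \<omega>)"
      note att = hitting_time_attained[OF wp fin, folded T_def]
      have T0: "0 \<le> T" by (simp add: T_def)
      have Te: "T < \<epsilon>" using lt(2) att(2) T0 by (simp add: ennreal_less_iff)
      have Tne: "T \<noteq> 0" using att(1) w h sg by (auto simp: b_def)
      have na: "\<omega> r \<noteq> a" if "0 \<le> r" "r \<le> T" for r
      proof
        assume "\<omega> r = a"
        then have "hitting_time a \<omega> \<le> ennreal r" unfolding hitting_time_def using that by (intro Inf_lower imageI) simp
        also have "\<dots> \<le> hitting_time b \<omega>" using att(2) that by (simp add: ennreal_leI)
        finally show False using lt(1) by simp
      qed
      \<comment> \<open>Leaving the interval would mean hitting one of its ends earlier:
        \<open>b\<close> is first reached at \<open>T\<close>, and \<open>a\<close> not up to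
        \<open>T\<close>.\<close>
      have range: "\<bar>\<omega> r - y\<bar> \<le> \<eta>" if r: "0 \<le> r" "r \<le> T" for r
      proof (rule ccontr)
        assume "\<not> \<bar>\<omega> r - y\<bar> \<le> \<eta>"
        then consider "\<omega> r > y + \<eta>" | "\<omega> r < y - \<eta>" by linarith
        then obtain c where c: "c = y + \<eta> \<or> c = y - \<eta>" "(\<omega> 0 \<le> c \<and> c \<le> \<omega> r) \<or> (\<omega> r \<le> c \<and> c \<le> \<omega> 0)" "\<omega> r \<noteq> c"
        proof cases
          case 1
          then show ?thesis using w h by (intro that[of "y + \<eta>"]) auto
        next
          case 2
          then show ?thesis using w h by (intro that[of "y - \<eta>"]) auto
        qed
        obtain r' where r': "0 \<le> r'" "r' \<le> r" "\<omega> r' = c" using path_ivt[OF wp order_refl r(1) c(2)] by blast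
        have "r' \<noteq> r" using r' c(3) by auto
        then have "r' < T" using r' r by simp
        then have "c \<noteq> b" "c \<noteq> a" using att(3)[OF r'(1)] na[of r'] r' by auto
        then show False using c(1) sg by (auto simp: a_def b_def)
      qed
      have "continuous_on {0..} \<omega>" using path_spaceD(1)[OF wp] .
      then obtain d where d: "0 < d" "\<And>r. 0 \<le> r \<Longrightarrow> dist r T < d \<Longrightarrow> dist (\<omega> r) (\<omega> T) < \<eta> / 2"
        unfolding continuous_on_iff using T0 h(1) by (metis atLeast_iff half_gt_zero)
      have "max 0 (T - d) < T" using T0 Tne d by auto
      then obtain u where u: "u \<in> \<rat>" "max 0 (T - d) < u" "u < T" using Rats_dense_in_real by blast
      have uD: "u \<in> D" using u Te by (auto simp: D_def)
      have "dist (\<omega> u) b < \<eta> / 2" using d(2)[of u] u att(1) by (auto simp: dist_real_def)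
      then have near: "\<bar>\<omega> u - b\<bar> < \<eta> / 2" by (simp add: dist_real_def)
      have "\<eta> / 2 \<le> \<sigma> * (\<omega> u - y) \<and> \<sigma> * (\<omega> u - y) \<le> \<eta>"
        using sg near range[of u] u by (auto simp: b_def abs_le_iff abs_less_iff)
      moreover have "\<omega> r \<noteq> F (t + r)" if "r \<in> {0..u}" for r
      proof -
        have "F (t + r) < y - \<eta>" using Fb that u Te by (auto simp: \<epsilon>_def)
        moreover have "y - \<eta> \<le> \<omega> r" using range[of r] that u by (auto simp: abs_le_iff)
        ultimately show ?thesis by simp
      qed
      ultimately have "\<omega> \<in> Q u" using wp by (auto simp: Q_def)
      then show "\<omega> \<in> (\<Union>u\<in>D. Q u)" using uD by blast
    qed
    \<comment> \<open>Countably many events cover an event of positive probability, so one rational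
      time works.\<close>
    have "\<exists>u\<in>D. emeasure (P y) (Q u) \<noteq> 0"
    proof (rule ccontr)
      assume "\<not> ?thesis"
      then have "Q u \<in> null_sets (P y)" if "u \<in> D" for u using Qs[OF that] that by auto
      then have nu: "(\<Union>u\<in>D. Q u) \<in> null_sets (P y)" using cD by (intro null_sets_UN') auto
      then have "emeasure (P y) W \<le> emeasure (P y) (\<Union>u\<in>D. Q u)" using cover by (intro emeasure_mono_AE) auto
      then have "emeasure (P y) W = 0" using nu by auto
      then show False using W by (simp add: measure_def)
    qed
    then obtain u where u: "u \<in> D" "emeasure (P y) (Q u) \<noteq> 0" by blast
    have u0: "0 < u" "u < \<epsilon>" using u by (auto simp: D_def)
    have tu: "alive (t + u)" using alive_le[OF t(2), of "t + u"] u0 alive_nonneg[OF t(1)] by (auto simp: \<epsilon>_def)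
    have "{\<omega> \<in> Q u. path_shift u \<omega> \<in> avoiding (t + u)} \<subseteq> avoiding t"
    proof
      fix \<omega> assume w: "\<omega> \<in> {\<omega> \<in> Q u. path_shift u \<omega> \<in> avoiding (t + u)}"
      then have "\<omega> \<in> space (path_space E)" by (auto simp: Q_def)
      then show "\<omega> \<in> avoiding t" using avoiding_split[OF t(1) _ tu, of \<omega>] w u0 by (auto simp: Q_def)
    qed
    then have "emeasure (P y) {\<omega> \<in> Q u. path_shift u \<omega> \<in> avoiding (t + u)} \<le> emeasure (P y) (avoiding t)"
      using avoiding_sets[OF t(1)] sets_P[OF yE] by (intro emeasure_mono) auto
    also have "\<dots> = 0" using H_eq[OF t(1) yE] H0 by (simp add: emeasure_eq_measure)
    finally have "(\<integral>\<^sup>+\<omega>\<in>Q u. ennreal (H (t + u) (\<omega> u)) \<partial>P y) = 0"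
      using expectation_H[OF yE _ tu QF[OF u(1)]] u0 by simp
    then have ae: "AE \<omega> in P y. ennreal (H (t + u) (\<omega> u)) * indicator (Q u) \<omega> = 0"
      using H_measurable[OF tu yE, of u] u0 Qs[OF u(1)] by (subst (asm) nn_integral_0_iff_AE) auto
    have "\<exists>\<omega>\<in>Q u. H (t + u) (\<omega> u) = 0"
    proof (rule ccontr)
      assume n: "\<not> ?thesis"
      have "AE \<omega> in P y. \<omega> \<notin> Q u"
        using ae
      proof eventually_elim
        fix \<omega> assume a: "ennreal (H (t + u) (\<omega> u)) * indicator (Q u) \<omega> = 0"
        show "\<omega> \<notin> Q u"
        proof
          assume q: "\<omega> \<in> Q u"
          then have "\<omega> u \<in> E" using path_spaceD(2)[of \<omega> E u] u0 by (auto simp: Q_def)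
          then have "0 \<le> H (t + u) (\<omega> u)" by (rule H_range(1)[OF tu])
          then have "H (t + u) (\<omega> u) = 0" using a q by (simp add: ennreal_eq_0_iff)
          then show False using n q by blast
        qed
      qed
      then have "emeasure (P y) (Q u) = 0" using Qs[OF u(1)] by (subst (asm) AE_iff_null_sets[symmetric]) auto
      then show False using u(2) by simp
    qed
    then obtain \<omega> where "\<omega> \<in> Q u" "H (t + u) (\<omega> u) = 0" by blast
    then show ?thesis using u0 by (intro exI[of _ u] exI[of _ "\<omega> u"]) (auto simp: Q_def \<epsilon>_def)
  qed
  then show ?thesis using C(1,2) by blast
qed

text \<open>Otherwise take, among the zeros of \<open>H\<close> in a thin space-time wedge that opens from \<open>(t, y)\<close> towards \<open>y'\<close>,
  one that is closest to \<open>y'\<close>; \<open>zero_step\<close> provides a closer one.\<close>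

lemma zero_spreads_in_space:
  assumes t: "alive t" "0 < t" and y: "F t < y" "H t y = 0" and y': "F t < y'"
  shows "H t y' = 0"
proof (rule ccontr)
  assume ne: "H t y' \<noteq> 0"
  then have yy: "y \<noteq> y'" using y by auto
  define lo where "lo = min y y'"
  define hi where "hi = max y y'"
  define \<sigma> :: real where "\<sigma> = (if y < y' then 1 else - 1)"
  have sg: "\<sigma> = 1 \<or> \<sigma> = - 1" by (simp add: \<sigma>_def)
  have lh: "lo < hi" "F t < lo" using yy y y' by (auto simp: lo_def hi_def)
  define \<kappa> where "\<kappa> = (lo - F t) / 2"
  have k: "0 < \<kappa>" "F t < lo - \<kappa>" using lh by (auto simp: \<kappa>_def field_simps)
  have lA: "l < ereal (lo - \<kappa>)" using l_less_trans[OF alive_f(2)[OF t(1)], of "lo - \<kappa>"] k by simp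
  obtain d where d: "0 < d" "alive (t + d)" "\<And>u. u \<in> {t..t + d} \<Longrightarrow> F u < lo - \<kappa>"
    using curve_below_near[OF t(1) k(2)] by blast
  have dne: "t \<le> t + d" using d by simp
  have Ak: "lo - \<kappa> < lo" using k by simp
  from zero_step[OF lA Ak less_imp_le[OF lh(1)]]
  obtain C r0 where C: "0 < C" "0 < r0" and step: "\<And>\<eta> t y \<sigma>. 0 < \<eta> \<Longrightarrow> \<eta> \<le> r0 \<Longrightarrow> y \<in> {lo..hi} \<Longrightarrow> \<sigma> = 1 \<or> \<sigma> = - 1 \<Longrightarrow>
    alive t \<Longrightarrow> alive (t + C * \<eta>\<^sup>2) \<Longrightarrow> (\<forall>u\<in>{t..t + C * \<eta>\<^sup>2}. F u < y - \<eta>) \<Longrightarrow> H t y = 0 \<Longrightarrow>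
    \<exists>u z. 0 < u \<and> u < C * \<eta>\<^sup>2 \<and> \<eta> / 2 \<le> \<sigma> * (z - y) \<and> \<sigma> * (z - y) \<le> \<eta> \<and> H (t + u) z = 0"
    by blast
  have al: "alive u" if "u \<in> {t..t + d}" for u using alive_le[OF d(2), of u] that t by auto
  have HbH: "Hb u z = H u z" if "u \<in> {t..t + d}" "z \<in> {lo..hi}" for u z
    using d(3)[OF that(1)] that k by (auto simp: Hb_def)
  have Hc: "continuous_on ({t..t + d} \<times> {lo..hi}) (\<lambda>(t, y). Hb t y)" by (rule Hb_continuous[OF t(2) d(2)])
  have y'm: "y' \<in> {lo..hi}" "y \<in> {lo..hi}" by (auto simp: lo_def hi_def)
  have "0 < Hb t y'" using ne Hb_range(1)[OF t(1), of y'] HbH[of t y'] y'm d by auto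
  moreover have "continuous_on {t..t + d} (\<lambda>u. Hb u y')"
  proof -
    have "continuous_on {t..t + d} (\<lambda>u. (u, y'))" by (intro continuous_intros)
    moreover have "(\<lambda>u. (u, y')) ` {t..t + d} \<subseteq> {t..t + d} \<times> {lo..hi}" using y'm(1) by blast
    ultimately show ?thesis using continuous_on_compose2[OF Hc] by force
  qed
  then have "((\<lambda>u. Hb u y') \<longlongrightarrow> Hb t y') (at t within {t..t + d})" unfolding continuous_on_def using dne by auto
  ultimately have "\<forall>\<^sub>F u in at t within {t..t + d}. 0 < Hb u y'" by (intro order_tendstoD(1))
  then obtain e where e: "0 < e" "\<And>u. u \<in> {t..t + d} \<Longrightarrow> u \<noteq> t \<Longrightarrow> dist u t < e \<Longrightarrow> 0 < Hb u y'"
    unfolding eventually_at by auto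
  \<comment> \<open>The wedge then stays within the time span \<open>d\<close>, on which the curve
    is low, and within time \<open>e\<close>, during which \<open>H\<close> remains positive at
    \<open>y'\<close> by continuity.\<close>
  define slope where "slope = min d (e / 2) / (hi - lo)"
  have lam: "0 < slope" "slope * (hi - lo) \<le> d" "slope * (hi - lo) < e"
    using d e lh by (auto simp: slope_def)
  define S where "S = {p \<in> {t..t + d} \<times> {lo..hi}. Hb (fst p) (snd p) = 0 \<and> fst p - t \<le> slope * (\<sigma> * (snd p - y))}"
  have "closed S"
  proof -
    have c: "closed ({t..t + d} \<times> {lo..hi})" by (intro closed_Times) auto
    have "closed ({t..t + d} \<times> {lo..hi} \<inter> (\<lambda>(t, y). Hb t y) -` {0})" by (rule continuous_closed_preimage[OF Hc c]) simp
    moreover have "closed {p :: real \<times> real. fst p - t \<le> slope * (\<sigma> * (snd p - y))}" by (intro closed_Collect_le continuous_intros)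
    ultimately have "closed (({t..t + d} \<times> {lo..hi} \<inter> (\<lambda>(t, y). Hb t y) -` {0}) \<inter> {p. fst p - t \<le> slope * (\<sigma> * (snd p - y))})" by (rule closed_Int)
    also have "(({t..t + d} \<times> {lo..hi} \<inter> (\<lambda>(t, y). Hb t y) -` {0}) \<inter> {p. fst p - t \<le> slope * (\<sigma> * (snd p - y))}) = S"
      by (auto simp: S_def case_prod_beta)
    finally show ?thesis .
  qed
  moreover have "bounded S" by (rule bounded_subset[of "{t..t + d} \<times> {lo..hi}"]) (auto simp: S_def intro: bounded_Times)
  ultimately have "compact S" by (simp add: compact_eq_bounded_closed)
  moreover have "S \<noteq> {}"
  proof -
    have "(t, y) \<in> S" using y y'm dne HbH[of t y] by (auto simp: S_def)
    then show ?thesis by auto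
  qed
  moreover have "continuous_on S (\<lambda>p. \<sigma> * snd p)" by (intro continuous_intros)
  ultimately obtain p where p: "p \<in> S" "\<And>p'. p' \<in> S \<Longrightarrow> \<sigma> * snd p' \<le> \<sigma> * snd p"
    using continuous_attains_sup by metis
  obtain T z where pT: "p = (T, z)" by (cases p)
  have T: "T \<in> {t..t + d}" "z \<in> {lo..hi}" "Hb T z = 0" "T - t \<le> slope * (\<sigma> * (z - y))" using p(1) by (auto simp: S_def pT)
  have sle: "\<sigma> * (w - y) \<le> hi - lo" if "w \<in> {lo..hi}" for w using that by (auto simp: \<sigma>_def lo_def hi_def)
  have Tb: "T - t < e" using T(4) mult_left_mono[OF sle[OF T(2)], of slope] lam by linarith
  \<comment> \<open>The extremal zero lies less than \<open>e\<close> after \<open>t\<close>, and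
    \<open>H\<close> is positive at \<open>y'\<close> during that time; so there is room left
    towards \<open>y'\<close>.\<close>
  have zne: "z \<noteq> y'"
  proof
    assume zy: "z = y'"
    show False
    proof (cases "T = t")
      case True
      then show ?thesis using T \<open>0 < Hb t y'\<close> zy by simp
    next
      case False
      then show ?thesis using e(2)[OF T(1) False] Tb T zy by (auto simp: dist_real_def)
    qed
  qed
  have gap: "0 < \<sigma> * (y' - z)" using zne T(2) by (auto simp: \<sigma>_def lo_def hi_def)
  \<comment> \<open>The step must be admissible for \<open>zero_step\<close>, stay above the curve,
    not overshoot \<open>y'\<close>, and take at most the time \<open>slope * (\<eta> / 2)\<close>
    that the wedge grants for a move by \<open>\<eta> / 2\<close>. The last condition keeps the new
    zero in the wedge.\<close>
  define \<eta> where "\<eta> = min (min r0 (\<kappa> / 2)) (min (\<sigma> * (y' - z)) (slope / (2 * C)))"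
  have h: "0 < \<eta>" "\<eta> \<le> r0" "\<eta> < \<kappa>" "\<eta> \<le> \<sigma> * (y' - z)" "\<eta> \<le> slope / (2 * C)"
    using C k gap lam by (auto simp: \<eta>_def)
  have Ch: "C * \<eta>\<^sup>2 \<le> slope * (\<eta> / 2)"
  proof -
    have "C * \<eta> \<le> C * (slope / (2 * C))" using h C by (intro mult_left_mono) auto
    also have "\<dots> = slope / 2" using C by simp
    finally have "C * \<eta> * \<eta> \<le> slope / 2 * \<eta>" using h by (intro mult_right_mono) auto
    then show ?thesis by (simp add: power2_eq_square)
  qed
  have hl: "\<sigma> * (z - y) + \<eta> \<le> hi - lo"
  proof -
    have "\<sigma> * (z - y) + \<eta> \<le> \<sigma> * (z - y) + \<sigma> * (y' - z)" using h by simp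
    also have "\<dots> = \<sigma> * (y' - y)" by (simp add: algebra_simps)
    finally show ?thesis using sle[OF y'm(1)] by simp
  qed
  have Td: "T + C * \<eta>\<^sup>2 \<le> t + d"
  proof -
    have "T - t + C * \<eta>\<^sup>2 \<le> slope * (\<sigma> * (z - y)) + slope * (\<eta> / 2)" using T(4) Ch by simp
    also have "\<dots> = slope * (\<sigma> * (z - y) + \<eta> / 2)" by (simp add: distrib_left)
    also have "\<dots> \<le> slope * (hi - lo)" using hl h lam by (intro mult_left_mono) auto
    finally show ?thesis using lam by simp
  qed
  have C0: "0 \<le> C * \<eta>\<^sup>2" using C by simp
  have "\<exists>u w. 0 < u \<and> u < C * \<eta>\<^sup>2 \<and> \<eta> / 2 \<le> \<sigma> * (w - z) \<and> \<sigma> * (w - z) \<le> \<eta> \<and> H (T + u) w = 0"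
  proof (rule step[OF h(1,2) T(2) sg al[OF T(1)]])
    show "alive (T + C * \<eta>\<^sup>2)" using T(1) Td C0 by (intro al) auto
    show "\<forall>u\<in>{T..T + C * \<eta>\<^sup>2}. F u < z - \<eta>"
    proof
      fix u assume "u \<in> {T..T + C * \<eta>\<^sup>2}"
      then have "F u < lo - \<kappa>" using T(1) Td by (intro d(3)) auto
      then show "F u < z - \<eta>" using T(2) h by auto
    qed
    show "H T z = 0" using HbH[OF T(1,2)] T(3) by simp
  qed
  then obtain u w where u: "0 < u" "u < C * \<eta>\<^sup>2" "\<eta> / 2 \<le> \<sigma> * (w - z)" "\<sigma> * (w - z) \<le> \<eta>" "H (T + u) w = 0" by blast
  have wm: "w \<in> {lo..hi}" using u h(1,4) T(2) y'm sg by (auto simp: \<sigma>_def lo_def hi_def split: if_splits)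
  have um: "T + u \<in> {t..t + d}" using u T(1) Td by auto
  have "T + u - t \<le> slope * (\<sigma> * (w - y))"
  proof -
    have "T + u - t \<le> slope * (\<sigma> * (z - y)) + slope * (\<eta> / 2)" using T(4) Ch u by simp
    also have "\<dots> = slope * (\<sigma> * (z - y) + \<eta> / 2)" by (simp add: distrib_left)
    also have "\<dots> \<le> slope * (\<sigma> * (w - y))"
    proof (rule mult_left_mono)
      have "\<sigma> * (w - y) = \<sigma> * (z - y) + \<sigma> * (w - z)" by (simp add: algebra_simps)
      then show "\<sigma> * (z - y) + \<eta> / 2 \<le> \<sigma> * (w - y)" using u by simp
    qed (use lam in simp)
    finally show ?thesis .
  qed
  then have "(T + u, w) \<in> S" using wm um u HbH[OF um wm] by (simp add: S_def)
  from p(2)[OF this] have "\<sigma> * w \<le> \<sigma> * z" by (simp add: pT)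
  moreover have "\<sigma> * (w - z) = \<sigma> * w - \<sigma> * z" by (simp add: algebra_simps)
  ultimately show False using u h by simp
qed

text \<open>One application of \<open>zero_step\<close> with a step so small that its duration is
  below \<open>d\<close> and the curve stays below the path. It also applies at time 0 and so
  carries a zero of \<open>H 0\<close> into the region where \<open>H\<close> is smooth.\<close>

lemma zero_moves_forward:
  assumes t: "alive t" and y: "F t < y" "H t y = 0" and d: "0 < d"
  shows "\<exists>u z. 0 < u \<and> u < d \<and> alive (t + u) \<and> F (t + u) < z \<and> H (t + u) z = 0"
proof -
  define \<kappa> where "\<kappa> = (y - F t) / 2"
  have k: "0 < \<kappa>" "F t < y - \<kappa>" using y by (auto simp: \<kappa>_def field_simps)
  have lA: "l < ereal (y - \<kappa>)" using l_less_trans[OF alive_f(2)[OF t], of "y - \<kappa>"] k by simp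
  obtain d1 where d1: "0 < d1" "alive (t + d1)" "\<And>u. u \<in> {t..t + d1} \<Longrightarrow> F u < y - \<kappa>"
    using curve_below_near[OF t k(2)] by blast
  have "y - \<kappa> < y" using k by simp
  from zero_step[OF lA this order_refl]
  obtain C r0 where C: "0 < C" "0 < r0" and step: "\<And>\<eta> t w \<sigma>. 0 < \<eta> \<Longrightarrow> \<eta> \<le> r0 \<Longrightarrow> w \<in> {y..y} \<Longrightarrow> \<sigma> = 1 \<or> \<sigma> = - 1 \<Longrightarrow>
    alive t \<Longrightarrow> alive (t + C * \<eta>\<^sup>2) \<Longrightarrow> (\<forall>u\<in>{t..t + C * \<eta>\<^sup>2}. F u < w - \<eta>) \<Longrightarrow> H t w = 0 \<Longrightarrow>
    \<exists>u z. 0 < u \<and> u < C * \<eta>\<^sup>2 \<and> \<eta> / 2 \<le> \<sigma> * (z - w) \<and> \<sigma> * (z - w) \<le> \<eta> \<and> H (t + u) z = 0"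
    by blast
  define \<eta> where "\<eta> = min (min r0 (\<kappa> / 2)) (min 1 (min d d1 / C))"
  have h: "0 < \<eta>" "\<eta> \<le> r0" "\<eta> < \<kappa>" "\<eta> \<le> 1" "\<eta> \<le> min d d1 / C" using C k d d1 by (auto simp: \<eta>_def)
  have Ch: "C * \<eta>\<^sup>2 \<le> min d d1"
  proof -
    have "\<eta>\<^sup>2 \<le> \<eta>" using h by (simp add: power2_eq_square mult_left_le)
    then have "C * \<eta>\<^sup>2 \<le> C * (min d d1 / C)" using h C by (intro mult_left_mono) auto
    then show ?thesis using C by simp
  qed
  have C0: "0 \<le> C * \<eta>\<^sup>2" using C by simp
  have al: "alive u" if "u \<in> {t..t + d1}" for u using alive_le[OF d1(2), of u] that alive_nonneg[OF t] by auto
  have "\<exists>u z. 0 < u \<and> u < C * \<eta>\<^sup>2 \<and> \<eta> / 2 \<le> 1 * (z - y) \<and> 1 * (z - y) \<le> \<eta> \<and> H (t + u) z = 0"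
  proof (rule step[OF h(1,2) _ _ t])
    show "alive (t + C * \<eta>\<^sup>2)" using Ch C0 by (intro al) auto
    show "\<forall>u\<in>{t..t + C * \<eta>\<^sup>2}. F u < y - \<eta>"
    proof
      fix u assume "u \<in> {t..t + C * \<eta>\<^sup>2}"
      then have "F u < y - \<kappa>" using Ch by (intro d1(3)) auto
      then show "F u < y - \<eta>" using h by simp
    qed
  qed (use y in auto)
  then obtain u z where u: "0 < u" "u < C * \<eta>\<^sup>2" "\<eta> / 2 \<le> z - y" "H (t + u) z = 0" by auto
  have "F (t + u) < z" using d1(3)[of "t + u"] u Ch h k by auto
  moreover have "alive (t + u)" using u Ch by (intro al) auto
  ultimately show ?thesis using u Ch by (intro exI[of _ u] exI[of _ z]) auto
qed

text \<open>The times in \<open>[t1, t2]\<close> at which \<open>H\<close> vanishes everywhere above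
  the curve form a closed set. Its last element cannot be before \<open>t2\<close>: a zero at a
  slightly later time exists, and zeros spread over the whole line above the curve.\<close>

lemma zero_spreads_in_time:
  assumes t: "alive t1" "0 < t1" "alive t2" "t1 \<le> t2" and y: "F t1 < y" "H t1 y = 0"
  shows "Hb t2 w = 0"
proof -
  have al: "alive u" if "u \<in> {t1..t2}" for u using alive_le[OF t(3), of u] that t by auto
  define V where "V = {u \<in> {t1..t2}. \<forall>w. Hb u w = 0}"
  have inV: "u \<in> V" if "u \<in> {t1..t2}" "F u < w" "H u w = 0" for u w
    using zero_spreads_in_space[OF al[OF that(1)] _ that(2,3)] that t by (auto simp: V_def Hb_def)
  have Veq: "V = (\<Inter>w. {t1..t2} \<inter> (\<lambda>u. Hb u w) -` {0})" by (auto simp: V_def)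
  have "closed ({t1..t2} \<inter> (\<lambda>u. Hb u w) -` {0})" for w
  proof (rule continuous_closed_preimage)
    have "continuous_on {t1..t2} (\<lambda>u. (u, w))" by (intro continuous_intros)
    from continuous_on_compose2[OF Hb_continuous[OF t(2,3), of UNIV] this]
    show "continuous_on {t1..t2} (\<lambda>u. Hb u w)" by auto
  qed auto
  then have "closed V" unfolding Veq by (intro closed_INT ballI)
  moreover have "bounded V" by (rule bounded_subset[of "{t1..t2}"]) (auto simp: V_def)
  ultimately have "compact V" by (simp add: compact_eq_bounded_closed)
  moreover have "t1 \<in> V" using inV[of t1 y] t y by auto
  ultimately obtain m where m: "m \<in> V" "\<And>u. u \<in> V \<Longrightarrow> u \<le> m" using compact_attains_sup[of V] by blast
  have mi: "m \<in> {t1..t2}" using m by (simp add: V_def)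
  have "m = t2"
  proof (rule ccontr)
    assume "m \<noteq> t2"
    then have "0 < t2 - m" using mi by auto
    moreover have "F m < F m + 1" "H m (F m + 1) = 0" using m(1) by (auto simp: V_def Hb_def dest: spec[of _ "F m + 1"])
    ultimately obtain u z where "0 < u" "u < t2 - m" "alive (m + u)" "F (m + u) < z" "H (m + u) z = 0"
      using zero_moves_forward[OF al[OF mi]] by blast
    then have "m + u \<in> V" using mi by (intro inV[of _ z]) auto
    then show False using m(2)[of "m + u"] \<open>0 < u\<close> by simp
  qed
  then show ?thesis using m(1) by (simp add: V_def)
qed

lemma no_avoidance_no_last_passage:
  assumes x: "l < ereal x" "F 0 < x" "H 0 x = 0" and t: "alive t" "0 < t"
  shows "(\<integral>\<omega>. H t (\<omega> t) \<partial>P x) = 0"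
proof -
  obtain u z where u: "0 < u" "u < t" "alive u" "F u < z" "H u z = 0"
    using zero_moves_forward[OF alive_zero x(2,3) t(2)] by auto
  have "Hb t w = 0" for w using zero_spreads_in_time[OF u(3,1) t(1) less_imp_le[OF u(2)] u(4,5)] .
  then have "AE \<omega> in P x. H t (\<omega> t) = 0" using H_below_AE[OF x(1) t] by simp
  then show ?thesis using integral_cong_AE[of "\<lambda>\<omega>. H t (\<omega> t)" "P x" "\<lambda>_. 0"] H_measurable[OF t(1) in_E[OF x(1)], of t] t by simp
qed

section \<open>The law of the last passage time\<close>

text \<open>The near and the far part add up to the full expectation, since \<open>Hb\<close> may be
  replaced by \<open>H\<close> along almost every path, and their fluxes cancel.\<close>

lemma last_passage_increment:
  assumes x: "l < ereal x" and ab: "0 < a" "a \<le> b" "alive b"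
  shows "(curve_density x has_integral (\<integral>\<omega>. H b (\<omega> b) \<partial>P x) - (\<integral>\<omega>. H a (\<omega> a) \<partial>P x)) {a..b}"
proof -
  have xE: "x \<in> E" using in_E x .
  have al: "alive r" if "r \<in> {a..b}" for r using alive_le[OF ab(3), of r] that ab by auto
  have Fc: "continuous_on {a..b} F" using al by (intro continuous_on_subset[OF F_continuous]) auto
  have ne: "{a..b} \<noteq> {}" using ab by simp
  obtain tM where tM: "tM \<in> {a..b}" "\<And>t. t \<in> {a..b} \<Longrightarrow> F t \<le> F tM"
    using continuous_attains_sup[OF compact_Icc ne Fc] by blast
  obtain tm where tm: "tm \<in> {a..b}" "\<And>t. t \<in> {a..b} \<Longrightarrow> F tm \<le> F t"
    using continuous_attains_inf[OF compact_Icc ne Fc] by blast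
  \<comment> \<open>The far part works in a box that begins at \<open>K - 1\<close>, so the curve
    must stay below \<open>K - 1\<close>.\<close>
  define K where "K = F tM + 1"
  have FK: "F t \<le> K - 1" "F t \<le> K" if "t \<in> {a..b}" for t using tM(2)[OF that] by (simp_all add: K_def)
  obtain L where L: "l < ereal L" "L < F tm" using ereal_dense2[OF alive_f(2)[OF al[OF tm(1)]]] by auto
  have LF: "L < F t" if "t \<in> {a..b}" for t using tm(2)[OF that] L by simp
  have lK: "l < ereal K" using l_less_trans[OF L(1), of K] LF[OF tM(1)] by (simp add: K_def)
  have lim: "(flux K x has_integral (\<integral>\<omega>. step (\<omega> b - K) * H b (\<omega> b) \<partial>P x) - (\<integral>\<omega>. step (\<omega> a - K) * H a (\<omega> a) \<partial>P x)) {a..b}"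
  proof -
    have "continuous_on {a..b} (flux K x)" by (rule flux_continuous[OF x ab(1,3) FK(2) lK])
    from integrable_integral[OF integrable_continuous_interval[OF this]] far_identity[OF x ab FK(1)]
    show ?thesis by simp
  qed
  have "((\<lambda>t. (curve_density x t - flux K x t) + flux K x t) has_integral
    ((\<integral>\<omega>. (1 - step (\<omega> b - K)) * Hb b (\<omega> b) \<partial>P x) - (\<integral>\<omega>. (1 - step (\<omega> a - K)) * Hb a (\<omega> a) \<partial>P x)) +
    ((\<integral>\<omega>. step (\<omega> b - K) * H b (\<omega> b) \<partial>P x) - (\<integral>\<omega>. step (\<omega> a - K) * H a (\<omega> a) \<partial>P x))) {a..b}"
    by (rule has_integral_add[OF near_identity[OF x ab FK(2) L(1) LF] lim])
  moreover have "(\<integral>\<omega>. (1 - step (\<omega> t - K)) * Hb t (\<omega> t) \<partial>P x) + (\<integral>\<omega>. step (\<omega> t - K) * H t (\<omega> t) \<partial>P x) = (\<integral>\<omega>. H t (\<omega> t) \<partial>P x)"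
    if t: "t \<in> {a..b}" for t
  proof -
    have t0: "0 < t" "0 \<le> t" using t ab by auto
    have sr: "0 \<le> step w \<and> step w \<le> 1" "0 \<le> 1 - step w \<and> 1 - step w \<le> 1" for w using step_range by auto
    have m: "(\<lambda>w. 1 - step (w - K)) \<in> borel_measurable borel" using measurable_step by simp
    note i1 = weighted_H(1)[OF xE al[OF t] t0(2) measurable_step sr(1)] and i2 = weighted_H(1)[OF xE al[OF t] t0(2) m sr(2)]
    have "AE \<omega> in P x. (1 - step (\<omega> t - K)) * H t (\<omega> t) = (1 - step (\<omega> t - K)) * Hb t (\<omega> t)"
      using H_below_AE[OF x al[OF t] t0(1)] by eventually_elim simp
    moreover have "(\<lambda>\<omega>. (1 - step (\<omega> t - K)) * Hb t (\<omega> t)) \<in> borel_measurable (P x)"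
    proof -
      have "Hb t \<in> borel_measurable borel"
        using continuous_on_section[OF Hb_continuous[OF ab(1,3), of UNIV] t] by (rule borel_measurable_continuous_onI)
      then show ?thesis using measurable_compose[OF measurable_coordinate_P[OF xE t0(2)]] m by (intro borel_measurable_times) auto
    qed
    ultimately have "(\<integral>\<omega>. (1 - step (\<omega> t - K)) * Hb t (\<omega> t) \<partial>P x) = (\<integral>\<omega>. (1 - step (\<omega> t - K)) * H t (\<omega> t) \<partial>P x)"
      using i2 by (intro integral_cong_AE) auto
    then have "(\<integral>\<omega>. (1 - step (\<omega> t - K)) * Hb t (\<omega> t) \<partial>P x) + (\<integral>\<omega>. step (\<omega> t - K) * H t (\<omega> t) \<partial>P x) =
      (\<integral>\<omega>. (1 - step (\<omega> t - K)) * H t (\<omega> t) + step (\<omega> t - K) * H t (\<omega> t) \<partial>P x)"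
      using i1 i2 by simp
    then show ?thesis by (simp add: left_diff_distrib)
  qed
  from this[of a] this[of b] ab
  have "((\<integral>\<omega>. (1 - step (\<omega> b - K)) * Hb b (\<omega> b) \<partial>P x) - (\<integral>\<omega>. (1 - step (\<omega> a - K)) * Hb a (\<omega> a) \<partial>P x)) +
    ((\<integral>\<omega>. step (\<omega> b - K) * H b (\<omega> b) \<partial>P x) - (\<integral>\<omega>. step (\<omega> a - K) * H a (\<omega> a) \<partial>P x)) = (\<integral>\<omega>. H b (\<omega> b) \<partial>P x) - (\<integral>\<omega>. H a (\<omega> a) \<partial>P x)"
    by simp
  ultimately show ?thesis by simp
qed

text \<open>\<open>H\<close> is 0 on the curve and nonnegative above it, so its difference quotients
  from above are nonnegative.\<close>

lemma curve_density_nonneg: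
  assumes x: "l < ereal x" and t: "alive t" "0 < t"
  shows "0 \<le> curve_density x t"
proof -
  have b: "{t..t} \<times> {F t..F t + 1} \<subseteq> above_curve l f" using box_above[OF t(2,1), of "F t"] by auto
  have d: "(H t has_real_derivative hy t (F t)) (at (F t) within {F t..F t + 1})"
    using box_derivs(2)[OF b, of t "F t"] by simp
  then have lim: "((\<lambda>z. (H t z - H t (F t)) / (z - F t)) \<longlongrightarrow> hy t (F t)) (at (F t) within {F t..F t + 1})"
    by (simp add: has_field_derivative_iff)
  have "\<forall>\<^sub>F z in at (F t) within {F t..F t + 1}. 0 \<le> (H t z - H t (F t)) / (z - F t)"
    unfolding eventually_at_filter
  proof (intro always_eventually allI impI)
    fix z assume "z \<noteq> F t" "z \<in> {F t..F t + 1}"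
    moreover from this have "0 \<le> H t z" using H_range(1)[OF t(1) in_E[OF l_less_trans[OF alive_f(2)[OF t(1)], of z]]] by simp
    ultimately show "0 \<le> (H t z - H t (F t)) / (z - F t)" using H_on_curve[OF t(1)] by simp
  qed
  moreover have "at (F t) within {F t..F t + 1} \<noteq> bot" by (simp add: trivial_limit_within islimpt_Icc)
  ultimately have "0 \<le> hy t (F t)" using lim by (intro tendsto_lowerbound)
  then show ?thesis unfolding curve_density_def
    using scale_deriv_pos[OF alive_f(2)[OF t(1)]] transition_density_nonneg[OF t(2) alive_f(2)[OF t(1)] x] by simp
qed

lemma last_passage_density_eq:
  assumes x: "l < ereal x" and t: "alive t" "0 < t"
  shows "last_passage_density l P s q f x t = curve_density x t"
proof -
  have i: "(t, F t) \<in> above_curve l f" using t by (simp add: above_iff)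
  have "{F t<..} \<subseteq> {z. (t, z) \<in> above_curve l f}" using t by (auto simp: above_iff)
  then have "(H t has_real_derivative hy t (F t)) (at_right (F t))"
    using H_derivs[OF i] DERIV_subset by blast
  then have "(H t has_vector_derivative hy t (F t)) (at_right (F t))"
    by (simp add: has_real_derivative_iff_has_vector_derivative)
  then have "right_deriv (H t) (F t) = hy t (F t)"
    unfolding right_deriv_def by (intro vector_derivative_within) auto
  then show ?thesis
    unfolding last_passage_density_def curve_density_def F_def[symmetric] Let_def
    using transition_density_symmetric[OF t(2) x alive_f(2)[OF t(1)]] by simp
qed

section \<open>Measurability of the last passage time\<close>

lemma last_passage_le_lifetime: "last_passage l f \<omega> \<le> \<zeta>"
  unfolding last_passage_def by (rule Sup_least) auto

lemma last_passage_event: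
  assumes "alive t" "0 < t"
  shows "{\<omega> \<in> space (path_space E). last_passage l f \<omega> < ennreal t} \<in> sets (path_space E)"
proof -
  have "{\<omega> \<in> space (path_space E). last_passage l f \<omega> < ennreal t} = {\<omega> \<in> space (path_space E). path_shift t \<omega> \<in> avoiding t}"
    using last_passage_less_iff[OF assms] by auto
  then show ?thesis using shift_avoiding_event[OF assms(1)] assms(2) by simp
qed

lemma alive_between:
  assumes "g < \<zeta>"
  shows "\<exists>t\<in>\<rat>. alive t \<and> 0 < t \<and> g < ennreal t"
proof -
  have "g < top" using assms by (rule less_le_trans) simp
  then obtain r where r: "0 \<le> r" "g = ennreal r" by (cases g) auto
  then have "alive r" using assms by (simp add: alive_def)
  then obtain d where d: "0 < d" "alive (r + d)" using alive_extend by blast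
  obtain t where t: "t \<in> \<rat>" "r < t" "t < r + d" using Rats_dense_in_real[of r "r + d"] d by auto
  have "alive t" using alive_le[OF d(2), of t] t r by auto
  then show ?thesis using t r by (intro bexI[of _ t]) (auto simp: ennreal_less_iff)
qed

text \<open>The events below an instant before the lifetime are avoidance events of the shifted
  path. The event below the lifetime is a countable union of these, and beyond the lifetime the
  event is the whole space.\<close>

lemma measurable_last_passage: "last_passage l f \<in> borel_measurable (path_space E)"
proof (rule borel_measurableI_less)
  fix c :: ennreal
  define D where "D = {t \<in> \<rat>. alive t \<and> 0 < t}"
  have cD: "countable D" unfolding D_def using countable_rat by (rule countable_subset[rotated]) auto
  show "{\<omega> \<in> space (path_space E). last_passage l f \<omega> < c} \<in> sets (path_space E)"
  proof (cases "c < \<zeta>")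
    case True
    then have "c < top" by (rule less_le_trans) simp
    then obtain r where r: "0 \<le> r" "c = ennreal r" by (cases c) auto
    then have "alive r" using True by (simp add: alive_def)
    then show ?thesis using r last_passage_event[of r] by (cases "r = 0") auto
  next
    case False
    show ?thesis
    proof (cases "c = \<zeta>")
      case True
      have "{\<omega> \<in> space (path_space E). last_passage l f \<omega> < c} = (\<Union>t\<in>D. {\<omega> \<in> space (path_space E). last_passage l f \<omega> < ennreal t})"
      proof (intro set_eqI iffI)
        fix \<omega> assume "\<omega> \<in> {\<omega> \<in> space (path_space E). last_passage l f \<omega> < c}"
        then show "\<omega> \<in> (\<Union>t\<in>D. {\<omega> \<in> space (path_space E). last_passage l f \<omega> < ennreal t})"
          using alive_between[of "last_passage l f \<omega>"] True by (auto simp: D_def)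
      next
        fix \<omega> assume "\<omega> \<in> (\<Union>t\<in>D. {\<omega> \<in> space (path_space E). last_passage l f \<omega> < ennreal t})"
        then obtain t where "alive t" "last_passage l f \<omega> < ennreal t" "\<omega> \<in> space (path_space E)" by (auto simp: D_def)
        then show "\<omega> \<in> {\<omega> \<in> space (path_space E). last_passage l f \<omega> < c}" using True by (auto simp: alive_def)
      qed
      also have "\<dots> \<in> sets (path_space E)"
        using last_passage_event by (intro sets.countable_UN' cD) (auto simp: D_def)
      finally show ?thesis .
    next
      case c: False
      then have "\<zeta> < c" using False by auto
      then have "{\<omega> \<in> space (path_space E). last_passage l f \<omega> < c} = space (path_space E)"
        using last_passage_le_lifetime by (auto intro: le_less_trans)
      then show ?thesis by simp
    qed
  qed
qed

lemma alive_exhaustion: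
  assumes "alive t0"
  shows "\<exists>b. incseq b \<and> (\<forall>n. t0 \<le> b n \<and> alive (b n)) \<and> (\<forall>t. alive t \<longrightarrow> (\<exists>n. t < b n))"
proof (cases \<zeta>)
  case (real r)
  then have r: "t0 < r" "0 \<le> t0" using assms by (auto simp: alive_def ennreal_less_iff)
  define b where "b n = r - (r - t0) / Suc n" for n :: nat
  have "incseq b" unfolding incseq_def b_def using r by (auto intro!: divide_left_mono)
  moreover have "t0 \<le> b n \<and> alive (b n)" for n
  proof -
    have "(r - t0) / Suc n \<le> (r - t0) / 1" using r by (intro divide_left_mono) auto
    moreover have "0 < (r - t0) / Suc n" using r by simp
    ultimately have "t0 \<le> b n" "b n < r" by (auto simp: b_def)
    then show ?thesis using real r by (auto simp: alive_def ennreal_less_iff)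
  qed
  moreover have "\<exists>n. t < b n" if "alive t" for t
  proof -
    have "t < r" using that real by (auto simp: alive_def ennreal_less_iff)
    then have "0 < (r - t) / (r - t0)" using r by simp
    then obtain n where "1 / Suc n < (r - t) / (r - t0)" using nat_approx_posE by blast
    then have "(r - t0) / Suc n < r - t" using r by (simp add: field_simps)
    then show ?thesis by (auto simp: b_def intro!: exI[of _ n])
  qed
  ultimately show ?thesis by blast
next
  case top
  define b where "b n = t0 + real n" for n
  have "incseq b" by (auto simp: incseq_def b_def)
  moreover have "t0 \<le> b n \<and> alive (b n)" for n using assms top by (auto simp: b_def alive_def)
  moreover have "\<exists>n. t < b n" for t
    using reals_Archimedean2[of "t - t0"] by (auto simp: b_def algebra_simps)
  ultimately show ?thesis by blast
qed

definition lifespan :: "real set" where "lifespan = {t. 0 < t \<and> ennreal t < \<zeta>}"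

lemma lifespan_iff: "t \<in> lifespan \<longleftrightarrow> alive t \<and> 0 < t"
  by (auto simp: lifespan_def alive_def)

lemma lifespan_borel [measurable]: "lifespan \<in> sets borel"
proof -

  have "open lifespan"
  proof (rule openI)
    fix t assume t: "t \<in> lifespan"
    then obtain d where d: "0 < d" "alive (t + d)" using alive_extend by (auto simp: lifespan_iff)
    have "ball t (min t d) \<subseteq> lifespan" using alive_le[OF d(2)] by (auto simp: lifespan_iff dist_real_def)
    then show "\<exists>e>0. ball t e \<subseteq> lifespan" using t d by (intro exI[of _ "min t d"]) (auto simp: lifespan_iff)
  qed
  then show ?thesis by simp
qed

section \<open>The density and its defect\<close>

lemma curve_density_continuous:
  assumes x: "l < ereal x"
  shows "continuous_on lifespan (curve_density x)"
proof -
  have Fc: "continuous_on lifespan F" by (rule continuous_on_subset[OF F_continuous]) (auto simp: lifespan_iff)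
  then have c: "continuous_on lifespan (\<lambda>t. (t, F t))" by (intro continuous_intros)
  have 1: "continuous_on lifespan (\<lambda>t. hy t (F t))"
  proof -
    have "(\<lambda>t. (t, F t)) ` lifespan \<subseteq> above_curve l f" by (auto simp: lifespan_iff above_iff)
    from continuous_on_compose2[OF H_continuous(3) c this] show ?thesis by simp
  qed
  have 2: "continuous_on lifespan (\<lambda>t. q t (F t) x)"
  proof -
    have "(\<lambda>t. (t, F t)) ` lifespan \<subseteq> {0<..} \<times> {x. l < ereal x}" using alive_f(2) by (auto simp: lifespan_iff)
    from continuous_on_compose2[OF q_continuous(1)[OF x] c this] show ?thesis by simp
  qed
  have 3: "continuous_on lifespan (\<lambda>t. deriv s (F t))"
    by (rule continuous_on_compose2[OF scale_deriv_continuous Fc]) (use alive_f(2) in \<open>auto simp: lifespan_iff\<close>)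
  have "deriv s (F t) \<noteq> 0" if "t \<in> lifespan" for t using scale_deriv_pos[OF alive_f(2), of t] that by (auto simp: lifespan_iff)
  then show ?thesis unfolding curve_density_def[abs_def] using 1 2 3 by (intro continuous_intros) auto
qed

text \<open>Both sides are Borel measures on the line. They agree on intervals \<open>[a, b)\<close>
  with \<open>0 < a\<close> and \<open>b\<close> before the lifetime, and increasing unions of these
  exhaust the part of a ray inside \<open>lifespan\<close>. The restriction to
  \<open>\<Omega>\<close> removes the values 0 and the lifetime, which no \<open>A\<close> in
  \<open>lifespan\<close> contains.\<close>

lemma last_passage_law:
  assumes x: "l < ereal x" and A: "A \<in> sets borel" "A \<subseteq> lifespan"
  shows "emeasure (P x) {\<omega> \<in> space (P x). last_passage l f \<omega> \<in> ennreal ` A} = (\<integral>\<^sup>+t\<in>A. ennreal (curve_density x t) \<partial>lborel)"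
proof -
  have xE: "x \<in> E" using in_E x .
  interpret prob_space "P x" by (rule P_prob_space[OF xE])
  let ?G = "last_passage l f"
  have Gm: "?G \<in> borel_measurable (P x)" using measurable_last_passage measurable_P_iff[OF xE] by blast
  define \<Omega> where "\<Omega> = {\<omega> \<in> space (P x). 0 < ?G \<omega> \<and> ?G \<omega> < \<zeta>}"
  have Om: "\<Omega> \<in> events" unfolding \<Omega>_def using Gm by measurable
  have Or: "\<exists>r\<in>lifespan. ?G \<omega> = ennreal r" if "\<omega> \<in> \<Omega>" for \<omega>
  proof -
    have "?G \<omega> < top" using that by (auto simp: \<Omega>_def intro: less_le_trans)
    then obtain r where "0 \<le> r" "?G \<omega> = ennreal r" by (cases "?G \<omega>") auto
    then show ?thesis using that by (intro bexI[of _ r]) (auto simp: \<Omega>_def lifespan_def)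
  qed
  define M1 where "M1 = distr (restrict_space (P x) \<Omega>) borel (\<lambda>\<omega>. enn2real (?G \<omega>))"
  define M2 where "M2 = density lborel (\<lambda>t. ennreal (curve_density x t) * indicator lifespan t)"
  have gm: "(\<lambda>\<omega>. enn2real (?G \<omega>)) \<in> borel_measurable (P x)" using Gm by measurable
  have e1: "emeasure M1 B = emeasure (P x) {\<omega> \<in> \<Omega>. enn2real (?G \<omega>) \<in> B}" if B: "B \<in> sets borel" for B
  proof -
    have "emeasure M1 B = emeasure (restrict_space (P x) \<Omega>) ((\<lambda>\<omega>. enn2real (?G \<omega>)) -` B \<inter> space (restrict_space (P x) \<Omega>))"
      unfolding M1_def using gm B by (intro emeasure_distr measurable_restrict_space1) auto
    also have "(\<lambda>\<omega>. enn2real (?G \<omega>)) -` B \<inter> space (restrict_space (P x) \<Omega>) = {\<omega> \<in> \<Omega>. enn2real (?G \<omega>) \<in> B}"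
      by (auto simp: space_restrict_space \<Omega>_def)
    also have "emeasure (restrict_space (P x) \<Omega>) {\<omega> \<in> \<Omega>. enn2real (?G \<omega>) \<in> B} = emeasure (P x) {\<omega> \<in> \<Omega>. enn2real (?G \<omega>) \<in> B}"
      using Om by (intro emeasure_restrict_space) auto
    finally show ?thesis .
  qed
  have dm: "(\<lambda>t. ennreal (curve_density x t) * indicator lifespan t) \<in> borel_measurable lborel"
  proof -
    have "(\<lambda>t. indicator lifespan t *\<^sub>R curve_density x t) \<in> borel_measurable borel"
      by (rule borel_measurable_continuous_on_indicator[OF lifespan_borel curve_density_continuous[OF x]])
    then have "(\<lambda>t. ennreal (indicator lifespan t *\<^sub>R curve_density x t)) \<in> borel_measurable borel" by simp
    also have "(\<lambda>t. ennreal (indicator lifespan t *\<^sub>R curve_density x t)) = (\<lambda>t. ennreal (curve_density x t) * indicator lifespan t)"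
      by (intro ext) (simp add: indicator_def)
    finally show ?thesis by simp
  qed
  have e2: "emeasure M2 B = (\<integral>\<^sup>+t\<in>B \<inter> lifespan. ennreal (curve_density x t) \<partial>lborel)" if B: "B \<in> sets borel" for B
    unfolding M2_def using B dm
    by (subst emeasure_density) (auto intro!: nn_integral_cong simp: indicator_def)
  have interval: "emeasure M1 {a..<b} = emeasure M2 {a..<b}" if ab: "0 < a" "a \<le> b" "alive b" for a b
  proof -
    have al: "alive a" using alive_le[OF ab(3)] ab by auto
    let ?Na = "{\<omega> \<in> space (P x). ?G \<omega> < ennreal a}" and ?Nb = "{\<omega> \<in> space (P x). ?G \<omega> < ennreal b}"
    have N: "?Na \<in> events" "?Nb \<in> events" using Gm by measurable
    have sub: "?Na \<subseteq> ?Nb" using ab(2) ennreal_leI[of a b] by (auto intro: less_le_trans)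
    have "{\<omega> \<in> \<Omega>. enn2real (?G \<omega>) \<in> {a..<b}} = ?Nb - ?Na"
    proof (intro set_eqI iffI)
      fix \<omega> assume w: "\<omega> \<in> {\<omega> \<in> \<Omega>. enn2real (?G \<omega>) \<in> {a..<b}}"
      then obtain r where r: "r \<in> lifespan" "?G \<omega> = ennreal r" using Or by auto
      then show "\<omega> \<in> ?Nb - ?Na" using w ab by (auto simp: \<Omega>_def lifespan_def ennreal_less_iff)
    next
      fix \<omega> assume w: "\<omega> \<in> ?Nb - ?Na"
      have "?G \<omega> < top" using w by (auto intro: less_trans[OF _ ennreal_less_top])
      then obtain r where r: "0 \<le> r" "?G \<omega> = ennreal r" by (cases "?G \<omega>") auto
      have rb: "a \<le> r" "r < b" using w r ab by (auto simp: ennreal_less_iff not_less)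
      have "alive r" using alive_le[OF ab(3), of r] rb r by simp
      then have "ennreal r < \<zeta>" by (simp add: alive_def)
      then show "\<omega> \<in> {\<omega> \<in> \<Omega>. enn2real (?G \<omega>) \<in> {a..<b}}" using w r rb ab by (auto simp: \<Omega>_def)
    qed
    then have "emeasure M1 {a..<b} = ennreal (prob (?Nb - ?Na))" by (simp add: e1 emeasure_eq_measure)
    also have "prob (?Nb - ?Na) = (\<integral>\<omega>. H b (\<omega> b) \<partial>P x) - (\<integral>\<omega>. H a (\<omega> a) \<partial>P x)"
      using finite_measure_Diff[OF N(2,1) sub] last_passage_distribution[OF x al ab(1)] last_passage_distribution[OF x ab(3)] ab by simp
    also have "ennreal \<dots> = (\<integral>\<^sup>+t. ennreal (curve_density x t) * indicator {a..b} t \<partial>lborel)"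
      using alive_le[OF ab(3)] ab curve_density_nonneg[OF x]
      by (intro nn_integral_has_integral_lebesgue'[symmetric] last_passage_increment[OF x ab]) auto
    \<comment> \<open>The increment formula integrates over the closed interval, the law is compared
      on the half-open one; the end point \<open>b\<close> is a null set.\<close>
    also have "\<dots> = (\<integral>\<^sup>+t\<in>{a..<b} \<inter> lifespan. ennreal (curve_density x t) \<partial>lborel)"
    proof (rule nn_integral_cong_AE)
      show "AE t in lborel. ennreal (curve_density x t) * indicator {a..b} t = ennreal (curve_density x t) * indicator ({a..<b} \<inter> lifespan) t"
        using AE_lborel_singleton[of b]
      proof eventually_elim
        fix t assume "t \<noteq> b"
        then have "t \<in> {a..b} \<longleftrightarrow> t \<in> {a..<b} \<inter> lifespan" using alive_le[OF ab(3), of t] ab by (auto simp: lifespan_iff)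
        then show "ennreal (curve_density x t) * indicator {a..b} t = ennreal (curve_density x t) * indicator ({a..<b} \<inter> lifespan) t"
          by (simp add: indicator_def)
      qed
    qed
    also have "\<dots> = emeasure M2 {a..<b}" by (simp add: e2)
    finally show ?thesis .
  qed
  have "M1 = M2"
  proof (rule measure_eqI_lessThan)
    show "sets M1 = sets borel" "sets M2 = sets borel" by (simp_all add: M1_def M2_def)
    show "emeasure M1 {c<..} < \<infinity>" for c by (simp add: e1 emeasure_eq_measure)
    fix c :: real
    define c' where "c' = max c 0"
    show "emeasure M1 {c<..} = emeasure M2 {c<..}"
    proof (cases "alive c'")
      case False
      have "t \<notin> lifespan" if "c < t" for t
      proof
        assume "t \<in> lifespan"
        then have "alive c'" using alive_le[of t c'] that by (auto simp: lifespan_iff c'_def)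
        then show False using False by simp
      qed
      then have n: "{c<..} \<inter> lifespan = {}" by auto
      have e: "{\<omega> \<in> \<Omega>. enn2real (?G \<omega>) \<in> {c<..}} = {}"
      proof (rule ccontr)
        assume "\<not> ?thesis"
        then obtain \<omega> where w: "\<omega> \<in> \<Omega>" "c < enn2real (?G \<omega>)" by auto
        obtain r where "r \<in> lifespan" "?G \<omega> = ennreal r" using Or[OF w(1)] by blast
        then show False using w n by (auto simp: lifespan_def)
      qed
      show ?thesis by (subst e1, simp, subst e2, simp) (simp only: e n, simp)
    next
      case True
      obtain d where d: "0 < d" "alive (c' + d)" using alive_extend[OF True] by blast
      obtain b where b: "incseq b" "\<And>n. c' + d \<le> b n \<and> alive (b n)" "\<And>t. alive t \<Longrightarrow> \<exists>n. t < b n"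
        using alive_exhaustion[OF d(2)] by blast
      \<comment> \<open>The left ends decrease to \<open>c'\<close> but stay above it, hence
        positive, as the comparison on intervals demands.\<close>
      define a where "a n = c' + d / Suc n" for n :: nat
      have c0: "0 \<le> c'" "c \<le> c'" by (auto simp: c'_def)
      have a: "c' < a n" "a n \<le> c' + d" for n
        using d divide_left_mono[of 1 "real (Suc n)" d] by (auto simp: a_def)
      have ad: "a n \<le> a m" if "m \<le> n" for m n using that d by (auto simp: a_def intro!: divide_left_mono)
      define I where "I n = {a n..<b n}" for n
      have inc: "incseq I"
      proof (rule incseq_SucI)
        fix n show "I n \<subseteq> I (Suc n)" using ad[of n "Suc n"] incseqD[OF b(1), of n "Suc n"] by (auto simp: I_def)
      qed
      have UI: "(\<Union>n. I n) = {c<..} \<inter> lifespan"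
      proof (intro set_eqI iffI)
        fix t assume "t \<in> (\<Union>n. I n)"
        then obtain n where "a n \<le> t" "t < b n" by (auto simp: I_def)
        then show "t \<in> {c<..} \<inter> lifespan" using a(1)[of n] c0 b(2)[of n] alive_le[of "b n" t] by (auto simp: lifespan_iff)
      next
        fix t assume t: "t \<in> {c<..} \<inter> lifespan"
        then have "c' < t" by (auto simp: c'_def lifespan_iff)
        then have "0 < (t - c') / d" using d by simp
        then obtain n where "1 / Suc n < (t - c') / d" using nat_approx_posE by blast
        then have "d / Suc n < t - c'" using d by (simp add: field_simps)
        then have n: "a n \<le> t" by (simp add: a_def)
        obtain m where m: "t < b m" using b(3)[of t] t by (auto simp: lifespan_iff)
        have "t \<in> I (max n m)" using n m ad[of n "max n m"] incseqD[OF b(1), of m "max n m"] by (auto simp: I_def)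
        then show "t \<in> (\<Union>n. I n)" by blast
      qed
      have Im: "range I \<subseteq> sets borel" by (auto simp: I_def)
      have eqn: "emeasure M1 (I n) = emeasure M2 (I n)" for n
        unfolding I_def using a[of n] c0 b(2)[of n] by (intro interval) auto
      have "emeasure M1 {c<..} = emeasure M1 (\<Union>n. I n)"
      proof -
        have "{\<omega> \<in> \<Omega>. enn2real (?G \<omega>) \<in> {c<..}} = {\<omega> \<in> \<Omega>. enn2real (?G \<omega>) \<in> (\<Union>n. I n)}"
          unfolding UI using Or by (force simp: lifespan_def)
        then show ?thesis using Im by (simp add: e1)
      qed
      also have "\<dots> = (SUP n. emeasure M1 (I n))"
        using Im inc by (intro SUP_emeasure_incseq[symmetric]) (auto simp: M1_def)
      also have "\<dots> = (SUP n. emeasure M2 (I n))" by (simp add: eqn)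
      also have "\<dots> = emeasure M2 (\<Union>n. I n)"
        using Im inc by (intro SUP_emeasure_incseq) (auto simp: M2_def)
      also have "\<dots> = emeasure M2 {c<..}"
        using Im by (simp add: e2 UI Int_assoc sets.countable_UN image_subset_iff)
      finally show ?thesis .
    qed
  qed
  moreover have "{\<omega> \<in> space (P x). ?G \<omega> \<in> ennreal ` A} = {\<omega> \<in> \<Omega>. enn2real (?G \<omega>) \<in> A}"
  proof (intro set_eqI iffI)
    fix \<omega> assume "\<omega> \<in> {\<omega> \<in> space (P x). ?G \<omega> \<in> ennreal ` A}"
    then obtain r where r: "r \<in> A" "?G \<omega> = ennreal r" "\<omega> \<in> space (P x)" by auto
    then have "r \<in> lifespan" using A by auto
    then show "\<omega> \<in> {\<omega> \<in> \<Omega>. enn2real (?G \<omega>) \<in> A}" using r by (auto simp: \<Omega>_def lifespan_def)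
  next
    fix \<omega> assume w: "\<omega> \<in> {\<omega> \<in> \<Omega>. enn2real (?G \<omega>) \<in> A}"
    then obtain r where "r \<in> lifespan" "?G \<omega> = ennreal r" using Or by auto
    then show "\<omega> \<in> {\<omega> \<in> space (P x). ?G \<omega> \<in> ennreal ` A}" using w by (auto simp: \<Omega>_def lifespan_def)
  qed
  moreover have "A \<inter> lifespan = A" using A by auto
  ultimately show ?thesis using e1[OF A(1)] e2[OF A(1)] by simp
qed

lemma last_passage_defective:
  assumes x: "l < ereal x" "F 0 < x"
  shows "(\<integral>\<^sup>+t\<in>lifespan. ennreal (curve_density x t) \<partial>lborel) < 1"
proof (rule ccontr)
  have xE: "x \<in> E" using in_E x by blast
  interpret prob_space "P x" by (rule P_prob_space[OF xE])
  let ?G = "last_passage l f"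
  define \<Omega> where "\<Omega> = {\<omega> \<in> space (P x). ?G \<omega> \<in> ennreal ` lifespan}"
  have Gm: "?G \<in> borel_measurable (P x)" using measurable_last_passage measurable_P_iff[OF xE] by blast
  have "\<Omega> = {\<omega> \<in> space (P x). 0 < ?G \<omega> \<and> ?G \<omega> < \<zeta>}"
  proof (intro set_eqI iffI)
    fix \<omega> assume w: "\<omega> \<in> {\<omega> \<in> space (P x). 0 < ?G \<omega> \<and> ?G \<omega> < \<zeta>}"
    then have "?G \<omega> < top" by (auto intro: less_le_trans)
    then obtain r where "0 \<le> r" "?G \<omega> = ennreal r" by (cases "?G \<omega>") auto
    then show "\<omega> \<in> \<Omega>" using w by (auto simp: \<Omega>_def lifespan_def)
  qed (auto simp: \<Omega>_def lifespan_def)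
  then have Om: "\<Omega> \<in> events" using Gm by simp
  assume "\<not> ?thesis"
  then have "1 \<le> emeasure (P x) \<Omega>"
    using last_passage_law[OF x(1) lifespan_borel order_refl] by (simp add: \<Omega>_def)
  then have O1: "prob \<Omega> = 1" using prob_le_1[of \<Omega>] by (simp add: emeasure_eq_measure)
  have N0: "avoiding 0 \<in> events" using avoiding_sets[OF alive_zero] sets_P[OF xE] by simp
  have "avoiding 0 \<inter> \<Omega> = {}"
  proof (rule ccontr)
    assume "\<not> ?thesis"
    then obtain \<omega> where w: "\<omega> \<in> avoiding 0" "\<omega> \<in> \<Omega>" by blast
    then have e: "{t. 0 \<le> t \<and> ennreal t \<le> \<zeta> \<and> ereal (\<omega> t) = f t} = {}" by (auto simp: avoiding_def)
    \<comment> \<open>A path that never meets the curve has no meeting times, and the supremum of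
      the empty set is 0 in \<open>ennreal\<close>.\<close>
    have "?G \<omega> = 0" unfolding last_passage_def e by (simp add: bot_ennreal)
    then show False using w(2) by (auto simp: \<Omega>_def lifespan_def ennreal_eq_0_iff)
  qed
  then have "avoiding 0 \<subseteq> space (P x) - \<Omega>" using sets.sets_into_space[OF N0] by auto
  then have "prob (avoiding 0) \<le> prob (space (P x) - \<Omega>)" using Om by (intro finite_measure_mono) auto
  then have "H 0 x = 0" using prob_compl[OF Om] O1 H_eq[OF alive_zero xE] measure_nonneg[of "P x" "avoiding 0"] by simp
  note zero = no_avoidance_no_last_passage[OF x(1,2) this]
  define D where "D = {t \<in> \<rat>. alive t \<and> 0 < t}"
  have cD: "countable D" unfolding D_def using countable_rat by (rule countable_subset[rotated]) auto
  have "{\<omega> \<in> space (P x). ?G \<omega> < ennreal t} \<in> null_sets (P x)" if "t \<in> D" for t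
  proof -
    have "prob {\<omega> \<in> space (P x). ?G \<omega> < ennreal t} = 0" using last_passage_distribution[OF x(1), of t] zero[of t] that by (simp add: D_def)
    then show ?thesis using Gm by (intro null_setsI) (simp_all add: emeasure_eq_measure)
  qed
  then have "(\<Union>t\<in>D. {\<omega> \<in> space (P x). ?G \<omega> < ennreal t}) \<in> null_sets (P x)" using cD by (intro null_sets_UN') auto
  \<comment> \<open>On \<open>\<Omega>\<close> the last passage comes before the lifetime, so a
    rational instant fits in between; each of these countably many events is null, although
    \<open>\<Omega>\<close> has probability 1.\<close>
  moreover have "\<Omega> \<subseteq> (\<Union>t\<in>D. {\<omega> \<in> space (P x). ?G \<omega> < ennreal t})"
  proof
    fix \<omega> assume w: "\<omega> \<in> \<Omega>"
    then have "?G \<omega> < \<zeta>" by (auto simp: \<Omega>_def lifespan_def)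
    from alive_between[OF this] show "\<omega> \<in> (\<Union>t\<in>D. {\<omega> \<in> space (P x). ?G \<omega> < ennreal t})"
      using w by (auto simp: D_def \<Omega>_def)
  qed
  ultimately have "\<Omega> \<in> null_sets (P x)" using Om null_sets_subset by blast
  then have "emeasure (P x) \<Omega> = 0" by (rule null_setsD1)
  then show False using O1 by (simp add: measure_def)
qed

end

theorem theorem1:
  fixes l :: ereal
    and E :: "real set"
    and P :: "real \<Rightarrow> (real \<Rightarrow> real) measure"
    and s \<rho> :: "real \<Rightarrow> real"
    and q :: "real \<Rightarrow> real \<Rightarrow> real \<Rightarrow> real"
    and f :: "real \<Rightarrow> ereal"
    and x :: real
  assumes diffusion: "linear_diffusion l E P s \<rho> q"
    and f_range: "\<And>t. 0 \<le> t \<Longrightarrow> l \<le> f t \<and> f t < \<infinity>"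
    and f_cont: "continuous_on {0..} f"
    and f_C1: "C1_on {t. 0 < t \<and> ennreal t < curve_lifetime l f} (\<lambda>t. real_of_ereal (f t))"
    and lifetime_pos: "0 < curve_lifetime l f"
    and eventually_above:
      "\<And>z. curve_lifetime l f = \<infinity> \<Longrightarrow> l < ereal z \<Longrightarrow>
        AE \<omega> in P z. \<exists>L>0. ((\<lambda>t. ereal (\<omega> t) - f t) \<longlongrightarrow> L) at_top"
    and H_C12: "C12_on (above_curve l f) (no_hit_prob l P f)"
    and H_limit:
      "\<And>z t. l < ereal z \<Longrightarrow> 0 < t \<Longrightarrow> ennreal t < curve_lifetime l f \<Longrightarrow>
        ((\<lambda>y. 1 / deriv s y * deriv (no_hit_prob l P f t) y * q t z y) \<longlongrightarrow> 0) at_top"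
    and x: "l < ereal x"
  shows "last_passage l f \<in> borel_measurable (P x)
    \<and> (\<forall>t>0. ennreal t < curve_lifetime l f \<longrightarrow> 0 \<le> last_passage_density l P s q f x t)
    \<and> (\<forall>A\<in>sets borel. A \<subseteq> {t. 0 < t \<and> ennreal t < curve_lifetime l f} \<longrightarrow>
         emeasure (P x) {\<omega> \<in> space (P x). last_passage l f \<omega> \<in> ennreal ` A} =
         (\<integral>\<^sup>+t\<in>A. ennreal (last_passage_density l P s q f x t) \<partial>lborel))
    \<and> (f 0 < ereal x \<longrightarrow>
         (\<integral>\<^sup>+t\<in>{t. 0 < t \<and> ennreal t < curve_lifetime l f}.
            ennreal (last_passage_density l P s q f x t) \<partial>lborel) < 1)"
proof -
  from H_C12 obtain ht hy hyy where
    c: "continuous_on (above_curve l f) (\<lambda>(t, y). no_hit_prob l P f t y)" "continuous_on (above_curve l f) (\<lambda>(t, y). ht t y)"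
      "continuous_on (above_curve l f) (\<lambda>(t, y). hy t y)" "continuous_on (above_curve l f) (\<lambda>(t, y). hyy t y)"
    and d: "\<forall>(t, y)\<in>above_curve l f.
        ((\<lambda>r. no_hit_prob l P f r y) has_real_derivative ht t y) (at t within {r. (r, y) \<in> above_curve l f}) \<and>
        ((\<lambda>z. no_hit_prob l P f t z) has_real_derivative hy t y) (at y within {z. (t, z) \<in> above_curve l f}) \<and>
        ((\<lambda>z. hy t z) has_real_derivative hyy t y) (at y within {z. (t, z) \<in> above_curve l f})"
    unfolding C12_on_def by blast
  interpret linear_diffusion l E P s \<rho> q by (rule diffusion)
  interpret curve_diffusion l E P s \<rho> q f ht hy hyy
    by unfold_locales (use f_range f_cont lifetime_pos eventually_above c d in auto)
  have xE: "x \<in> E" using in_E x .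
  have dens: "last_passage_density l P s q f x t = curve_density x t" if "t \<in> lifespan" for t
    using last_passage_density_eq[OF x] that by (simp add: lifespan_iff)
  have int: "(\<integral>\<^sup>+t\<in>A. ennreal (last_passage_density l P s q f x t) \<partial>lborel) = (\<integral>\<^sup>+t\<in>A. ennreal (curve_density x t) \<partial>lborel)"
    if "A \<subseteq> lifespan" for A
    using that dens by (intro nn_integral_cong) (auto simp: indicator_def)
  have 1: "last_passage l f \<in> borel_measurable (P x)" using measurable_last_passage measurable_P_iff[OF xE] by blast
  have 2: "0 \<le> last_passage_density l P s q f x t" if "t \<in> lifespan" for t
    using dens[OF that] curve_density_nonneg[OF x] that by (simp add: lifespan_iff)
  have 3: "(\<integral>\<^sup>+t\<in>lifespan. ennreal (last_passage_density l P s q f x t) \<partial>lborel) < 1" if "f 0 < ereal x"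
    using last_passage_defective[OF x] alive_f(1)[OF alive_zero] that int[OF order_refl] by simp
  show ?thesis
    unfolding lifespan_def[symmetric]
    using 1 2 3 last_passage_law[OF x] int by (auto simp: lifespan_def)
qed

end
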